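(* Let $(X_1,\dots,X_n)$ be a smooth integrable system of type $(n,0)$ on an $n$-dimensional manifold $M^n$, and let $p\in M^n$ be a nondegenerate singular point of it. Denote by $$m=n-\dim \mathrm{Span}_{\mathbb{R}}(X_1(p),\dots,X_n(p))$$ the corank of the system at $p$. Then there exist a smooth local coordinate system $(x_1,\dots,x_n)$ in a neighborhood of $p$, non-negative integers $h,e\ge 0$ with $h+2e=m$, and a basis $(v_1,\dots,v_n)$ of $\mathbb{R}^n$, such that the vector fields $Y_i=X_{v_i}=\sum_{j=1}^n v_i^jX_j$ ($i=1,\dots,n$), where $v_i=(v_i^1,\dots,v_i^n)$, have the following form: $$\begin{cases} Y_i = x_i\dfrac{\partial}{\partial x_i}, & i=1,\dots,h,\\[4pt] Y_{h+2j-1}=x_{h+2j-1}\dfrac{\partial}{\partial x_{h+2j-1}}+x_{h+2j}\dfrac{\partial}{\partial x_{h+2j}}, & j=1,\dots,e,\\[4pt] Y_{h+2j}=x_{h+2j-1}\dfrac{\partial}{\partial x_{h+2j}}-x_{h+2j}\dfrac{\partial}{\partial x_{h+2j-1}}, & j=1,\dots,e,\\[4pt] Y_k=\dfrac{\partial}{\partial x_k}, & k=m+1,\dots,n.\end{cases}$$ Moreover, the numbers $(h,e)$ do not depend on the choice of local coordinates.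
   Context: "Smooth" means $C^\infty$, and manifolds are real. **Integrable system of type $(n,0)$.** This is an $n$-tuple $(X_1,\dots,X_n)$ of smooth pairwise commuting vector fields on an $n$-dimensional manifold $M^n$ with $X_1\wedge\dots\wedge X_n\ne0$ almost everywhere. For $v=(v^1,\dots,v^n)\in\mathbb{R}^n$ put $X_v=\sum_i v^iX_i$ (the generator, associated to $v$, of the local $\mathbb{R}^n$-action generated by $X_1,\dots,X_n$). **Nondegenerate fixed point.** A point $p$ is a fixed point if $X_1(p)=\dots=X_n(p)=0$. A fixed point is nondegenerate if the linear parts $X_1^{(1)},\dots,X_n^{(1)}$ of $X_1,\dots,X_n$ at $p$ (linear vector fields in local coordinates centered at $p$) are all semisimple (diagonalizable over $\mathbb{C}$) and satisfy $X_1^{(1)}\wedge\dots\wedge X_n^{(1)}\neq0$ almost everywhere. **Nondegenerate singular point.** A point $p$ is singular if $\dim\mathrm{Span}_{\mathbb{R}}(X_1(p),\dots,X_n(p))<n$ (it need not be a fixed point). If this dimension is $k$, then after renumbering $X_{n-k+1}\wedge\dots\wedge X_n(p)\ne0$; projecting $X_1,\dots,X_{n-k}$ to the local quotient of a neighborhood of $p$ by the free local $\mathbb{R}^k$-action generated by $X_{n-k+1},\dots,X_n$ gives a reduced integrable system of type $(n-k,0)$, for which the image of $p$ is a fixed point. The point $p$ is called nondegenerate if this is a nondegenerate fixed point of the reduced system. *)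

theory Defs
  imports "HOL-Analysis.Analysis"
begin

text \<open>Meant for open \<open>S\<close> only: the derivatives are taken at the points of \<open>S\<close>, not within \<open>S\<close>.\<close>

primrec times_cont_diff_on ::
    "nat \<Rightarrow> 'a::real_normed_vector set \<Rightarrow> ('a \<Rightarrow> 'b::real_normed_vector) \<Rightarrow> bool" where
  "times_cont_diff_on 0 S f \<longleftrightarrow> continuous_on S f"
| "times_cont_diff_on (Suc k) S f \<longleftrightarrow>
     (\<forall>x\<in>S. f differentiable (at x)) \<and>
     (\<forall>u. times_cont_diff_on k S (\<lambda>x. frechet_derivative f (at x) u))"

definition smooth_on :: "'a::real_normed_vector set \<Rightarrow> ('a \<Rightarrow> 'b::real_normed_vector) \<Rightarrow> bool" where
  "smooth_on S f \<longleftrightarrow> (\<forall>k. times_cont_diff_on k S f)"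

text \<open>A chart is a domain together with a coordinate map; the values of the map outside the
  domain are irrelevant. The dimension of the manifold is \<open>CARD('n)\<close>.\<close>

type_synonym ('p, 'n) chart = "'p set \<times> ('p \<Rightarrow> real ^ 'n)"

abbreviation chart_dom :: "('p, 'n) chart \<Rightarrow> 'p set" where "chart_dom \<equiv> fst"
abbreviation coord :: "('p, 'n) chart \<Rightarrow> 'p \<Rightarrow> real ^ 'n" where "coord \<equiv> snd"

definition in_coords :: "('p, 'n) chart \<Rightarrow> ('p \<Rightarrow> 'b) \<Rightarrow> real ^ 'n \<Rightarrow> 'b" where
  "in_coords c f = f \<circ> inv_into (chart_dom c) (coord c)"

definition is_chart :: "'p topology \<Rightarrow> ('p, 'n::finite) chart \<Rightarrow> bool" where
  "is_chart M c \<longleftrightarrow>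
     openin M (chart_dom c) \<and> open (coord c ` chart_dom c) \<and>
     homeomorphic_map (subtopology M (chart_dom c)) (top_of_set (coord c ` chart_dom c)) (coord c)"

definition smoothly_compatible :: "('p, 'n::finite) chart \<Rightarrow> ('p, 'n) chart \<Rightarrow> bool" where
  "smoothly_compatible c d \<longleftrightarrow>
     smooth_on (coord c ` (chart_dom c \<inter> chart_dom d)) (in_coords c (coord d)) \<and>
     smooth_on (coord d ` (chart_dom c \<inter> chart_dom d)) (in_coords d (coord c))"

text \<open>The atlas is maximal, so its members are exactly the smooth local coordinate systems.\<close>

definition smooth_manifold :: "'p topology \<Rightarrow> ('p, 'n::finite) chart set \<Rightarrow> bool" where
  "smooth_manifold M A \<longleftrightarrow>
     Hausdorff_space M \<and> second_countable M \<and>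
     (\<Union>c\<in>A. chart_dom c) = topspace M \<and>
     (\<forall>c\<in>A. is_chart M c) \<and>
     (\<forall>c\<in>A. \<forall>d\<in>A. smoothly_compatible c d) \<and>
     (\<forall>c. is_chart M c \<and> (\<forall>d\<in>A. smoothly_compatible c d) \<longrightarrow> c \<in> A)"

text \<open>A tangent vector at \<open>q\<close> is the family of its component vectors in the charts around \<open>q\<close>,
  related by the Jacobians of the coordinate changes. Accordingly \<open>X c q\<close> is the
  component vector at \<open>q\<close> of the vector field \<open>X\<close> with respect to the chart \<open>c\<close>, that is,
  \<open>X = (\<Sum>i. X c q $ i \<partial>/\<partial>x_i)\<close> at \<open>q\<close> where \<open>x_i = coord c _ $ i\<close>.\<close>

type_synonym ('p, 'n) vfield = "('p, 'n) chart \<Rightarrow> 'p \<Rightarrow> real ^ 'n"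

definition smooth_vector_field :: "('p, 'n::finite) chart set \<Rightarrow> ('p, 'n) vfield \<Rightarrow> bool" where
  "smooth_vector_field A X \<longleftrightarrow>
     (\<forall>c\<in>A. \<forall>d\<in>A. \<forall>q \<in> chart_dom c \<inter> chart_dom d.
        X d q = frechet_derivative (in_coords c (coord d)) (at (coord c q)) (X c q)) \<and>
     (\<forall>c\<in>A. smooth_on (coord c ` chart_dom c) (in_coords c (X c)))"

definition lie_bracket :: "('p, 'n::finite) vfield \<Rightarrow> ('p, 'n) vfield \<Rightarrow> ('p, 'n) vfield" where
  "lie_bracket X Y = (\<lambda>c q.
     frechet_derivative (in_coords c (Y c)) (at (coord c q)) (X c q) -
     frechet_derivative (in_coords c (X c)) (at (coord c q)) (Y c q))"

definition commuting_fields ::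
    "('p, 'n::finite) chart set \<Rightarrow> ('p, 'n) vfield \<Rightarrow> ('p, 'n) vfield \<Rightarrow> bool" where
  "commuting_fields A X Y \<longleftrightarrow> (\<forall>c\<in>A. \<forall>q\<in>chart_dom c. lie_bracket X Y c q = 0)"

text \<open>The coefficient of \<open>w_1 \<and> \<dots> \<and> w_n\<close> with respect to the standard \<open>n\<close>-vector.\<close>

definition wedge :: "('n::finite \<Rightarrow> real ^ 'n) \<Rightarrow> real" where
  "wedge w = det (\<chi> i j. w j $ i)"

text \<open>``Almost everywhere'' on a manifold means: up to a set that is Lebesgue null in every chart.
  The \<open>n\<close>-tuple of vector fields is indexed by the type \<open>'n\<close> that also indexes the
  coordinates.\<close>

definition integrable_system ::
    "('p, 'n::finite) chart set \<Rightarrow> ('n \<Rightarrow> ('p, 'n) vfield) \<Rightarrow> bool" where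
  "integrable_system A X \<longleftrightarrow>
     (\<forall>i. smooth_vector_field A (X i)) \<and>
     (\<forall>i j. commuting_fields A (X i) (X j)) \<and>
     (\<forall>c\<in>A. negligible (coord c ` {q \<in> chart_dom c. wedge (\<lambda>i. X i c q) = 0}))"

definition generator ::
    "('n::finite \<Rightarrow> ('p, 'n) vfield) \<Rightarrow> real ^ 'n \<Rightarrow> ('p, 'n) vfield" where
  "generator X v = (\<lambda>c q. \<Sum>i\<in>UNIV. v $ i *\<^sub>R X i c q)"

text \<open>The dimension does not depend on the chosen chart around \<open>q\<close>.\<close>

definition rank_at ::
    "('p, 'n::finite) chart set \<Rightarrow> ('n \<Rightarrow> ('p, 'n) vfield) \<Rightarrow> 'p \<Rightarrow> nat" where
  "rank_at A X q =
     (let c = (SOME c. c \<in> A \<and> q \<in> chart_dom c) in dim (span (range (\<lambda>i. X i c q))))"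

definition singular_point ::
    "'p topology \<Rightarrow> ('p, 'n::finite) chart set \<Rightarrow> ('n \<Rightarrow> ('p, 'n) vfield) \<Rightarrow> 'p \<Rightarrow> bool" where
  "singular_point M A X p \<longleftrightarrow> p \<in> topspace M \<and> rank_at A X p < CARD('n)"

definition independent_at ::
    "('p, 'n::finite) chart set \<Rightarrow> ('n \<Rightarrow> ('p, 'n) vfield) \<Rightarrow> 'n set \<Rightarrow> 'p \<Rightarrow> bool" where
  "independent_at A X K q \<longleftrightarrow>
     (\<forall>c\<in>A. q \<in> chart_dom c \<longrightarrow>
        inj_on (\<lambda>i. X i c q) K \<and> independent ((\<lambda>i. X i c q) ` K))"

definition diagonalizable_over_C :: "real ^ 'm ^ 'm \<Rightarrow> bool" where
  "diagonalizable_over_C B \<longleftrightarrow>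
     (\<exists>(P :: complex ^ 'm ^ 'm) (D :: complex ^ 'm ^ 'm).
        invertible P \<and> (\<forall>i j. i \<noteq> j \<longrightarrow> D $ i $ j = 0) \<and>
        (\<chi> i j. complex_of_real (B $ i $ j)) = P ** D ** matrix_inv P)"

definition linear_part :: "(real ^ 'm \<Rightarrow> real ^ 'm) \<Rightarrow> real ^ 'm \<Rightarrow> real ^ 'm ^ 'm" where
  "linear_part Z y = matrix (frechet_derivative Z (at y))"

definition nondegenerate_fixed_point ::
    "('m::finite \<Rightarrow> real ^ 'm \<Rightarrow> real ^ 'm) \<Rightarrow> real ^ 'm \<Rightarrow> bool" where
  "nondegenerate_fixed_point Z y \<longleftrightarrow>
     (\<forall>a. Z a y = 0) \<and>
     (\<forall>a. diagonalizable_over_C (linear_part (Z a) y)) \<and>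
     negligible {x. wedge (\<lambda>a. linear_part (Z a) y *v x) = 0}"

definition integral_curve ::
    "'p topology \<Rightarrow> ('p, 'n::finite) chart set \<Rightarrow> ('p, 'n) vfield \<Rightarrow> (real \<Rightarrow> 'p) \<Rightarrow> bool" where
  "integral_curve M A Y \<gamma> \<longleftrightarrow>
     continuous_map (top_of_set {0..1}) M \<gamma> \<and>
     (\<forall>t\<in>{0..1}. \<forall>c\<in>A. \<gamma> t \<in> chart_dom c \<longrightarrow>
        ((\<lambda>s. coord c (\<gamma> s)) has_vector_derivative Y c (\<gamma> t)) (at t within {0..1}))"

text \<open>The orbits, inside \<open>V\<close>, of the local action generated by the fields \<open>X i\<close> with \<open>i \<in> K\<close>.\<close>

definition same_local_orbit ::
    "'p topology \<Rightarrow> ('p, 'n::finite) chart set \<Rightarrow> ('n \<Rightarrow> ('p, 'n) vfield) \<Rightarrow> 'n set \<Rightarrow> 'p set \<Rightarrow>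
     'p \<Rightarrow> 'p \<Rightarrow> bool" where
  "same_local_orbit M A X K V =
     (\<lambda>q r. \<exists>w \<gamma>. (\<forall>i. i \<notin> K \<longrightarrow> w $ i = 0) \<and> integral_curve M A (generator X w) \<gamma> \<and>
        \<gamma> ` {0..1} \<subseteq> V \<and> \<gamma> 0 = q \<and> \<gamma> 1 = r)\<^sup>*\<^sup>*"

text \<open>The orbit space of \<open>V\<close> is identified, through the surjective submersion \<open>\<pi>\<close> whose fibres are
  the orbits, with the open subset \<open>\<pi> ` V\<close> of \<open>real ^ 'm\<close>.\<close>

definition local_quotient ::
    "'p topology \<Rightarrow> ('p, 'n::finite) chart set \<Rightarrow> ('n \<Rightarrow> ('p, 'n) vfield) \<Rightarrow> 'n set \<Rightarrow> 'p set \<Rightarrow>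
     ('p \<Rightarrow> real ^ 'm::finite) \<Rightarrow> bool" where
  "local_quotient M A X K V \<pi> \<longleftrightarrow>
     openin M V \<and>
     (\<forall>q\<in>V. independent_at A X K q) \<and>
     (\<forall>c\<in>A. smooth_on (coord c ` (chart_dom c \<inter> V)) (in_coords c \<pi>)) \<and>
     (\<forall>c\<in>A. \<forall>q \<in> chart_dom c \<inter> V. surj (frechet_derivative (in_coords c \<pi>) (at (coord c q)))) \<and>
     (\<forall>q\<in>V. \<forall>r\<in>V. \<pi> q = \<pi> r \<longleftrightarrow> same_local_orbit M A X K V q r)"

text \<open>\<open>Y\<close> is the projection along \<open>\<pi>\<close> of the vector field \<open>X\<close> on \<open>V\<close>; it matters on \<open>\<pi> ` V\<close> only.\<close>

definition projects_to ::
    "('p, 'n::finite) chart set \<Rightarrow> 'p set \<Rightarrow> ('p \<Rightarrow> real ^ 'm::finite) \<Rightarrow> ('p, 'n) vfield \<Rightarrow>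
     (real ^ 'm \<Rightarrow> real ^ 'm) \<Rightarrow> bool" where
  "projects_to A V \<pi> X Y \<longleftrightarrow>
     (\<forall>c\<in>A. \<forall>q \<in> chart_dom c \<inter> V.
        Y (\<pi> q) = frechet_derivative (in_coords c \<pi>) (at (coord c q)) (X c q))"

text \<open>The type \<open>'m\<close> supplies the model space \<open>real ^ 'm\<close> of the reduced system. The definition
  forces \<open>CARD('m)\<close> to be the corank at \<open>p\<close>; since the corank at a singular point is positive,
  such a type always exists. Renumbering amounts to choosing the set \<open>K\<close> of those
  indices whose fields are independent at \<open>p\<close> and span, and an enumeration \<open>\<sigma>\<close> of the others.\<close>

definition nondegenerate_singular_point ::
    "'m::finite itself \<Rightarrow> 'p topology \<Rightarrow> ('p, 'n::finite) chart set \<Rightarrow> ('n \<Rightarrow> ('p, 'n) vfield) \<Rightarrow>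
     'p \<Rightarrow> bool" where
  "nondegenerate_singular_point T M A X p \<longleftrightarrow>
     singular_point M A X p \<and>
     (\<exists>K (\<sigma> :: 'm \<Rightarrow> 'n) V (\<pi> :: 'p \<Rightarrow> real ^ 'm) Z.
        card K = rank_at A X p \<and> independent_at A X K p \<and> bij_betw \<sigma> UNIV (- K) \<and>
        p \<in> V \<and> local_quotient M A X K V \<pi> \<and>
        (\<forall>a. projects_to A V \<pi> (X (\<sigma> a)) (Z a)) \<and>
        nondegenerate_fixed_point Z (\<pi> p))"

definition basis_of_Rn :: "(nat \<Rightarrow> real ^ 'n::finite) \<Rightarrow> bool" where
  "basis_of_Rn v \<longleftrightarrow>
     inj_on v {1..CARD('n)} \<and> independent (v ` {1..CARD('n)}) \<and> span (v ` {1..CARD('n)}) = UNIV"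

text \<open>The bijection \<open>\<iota>\<close> from \<open>{1..CARD('n)}\<close> to \<open>'n\<close> numbers the coordinates.\<close>

definition normal_form ::
    "(nat \<Rightarrow> 'n::finite) \<Rightarrow> ('n \<Rightarrow> ('p, 'n) vfield) \<Rightarrow> ('p, 'n) chart \<Rightarrow> (nat \<Rightarrow> real ^ 'n) \<Rightarrow>
     nat \<Rightarrow> nat \<Rightarrow> bool" where
  "normal_form \<iota> X c v h e \<longleftrightarrow>
     (\<forall>q\<in>chart_dom c.
        let x = (\<lambda>i. coord c q $ \<iota> i);
            ddx = (\<lambda>i. axis (\<iota> i) (1::real));
            Y = (\<lambda>i. generator X (v i) c q)
        in (\<forall>i\<in>{1..h}. Y i = x i *\<^sub>R ddx i) \<and>
           (\<forall>j\<in>{1..e}. Y (h + 2*j - 1) =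
              x (h + 2*j - 1) *\<^sub>R ddx (h + 2*j - 1) + x (h + 2*j) *\<^sub>R ddx (h + 2*j)) \<and>
           (\<forall>j\<in>{1..e}. Y (h + 2*j) =
              x (h + 2*j - 1) *\<^sub>R ddx (h + 2*j) - x (h + 2*j) *\<^sub>R ddx (h + 2*j - 1)) \<and>
           (\<forall>k\<in>{h + 2*e + 1..CARD('n)}. Y k = ddx k))"

end

theory Submission
  imports Defs
begin

text \<open>The semisimple commuting linear parts of the reduced system span a Cartan subalgebra, hence some
  constant combination \<open>W\<close> of the reduced fields has the identity as its linear part. The map \<open>\<psi>\<close>
  with \<open>D\<psi>(x) x = W (\<psi> x)\<close> that linearises \<open>W\<close> is the time-one solution of a Volterra equation: along
  the ray \<open>s x\<close> one puts \<open>\<psi> (s x) = s w\<close>, which turns the singular equation into one with a smooth right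
  hand side. Then the fields acting freely are straightened to \<open>\<partial>/\<partial>x\<^sub>k\<close>, and the lift of \<open>W\<close> is made a
  radial field in the transverse directions, up to a constant. A smooth field commuting with
  such a radial field is homogeneous, hence linear in the transverse directions with
  constant components along the free ones, so that a simultaneous real normal form of the
  commuting semisimple matrices gives the coordinates. For the uniqueness, the vectors \<open>v\<close> such that
  \<open>X\<^sub>v\<close> vanishes at \<open>p\<close> and has only real eigenvalues there form a space, independent of the
  coordinates, which in a normal form has dimension \<open>h + e\<close>.\<close>

text \<open>A smooth field is in general not smoothly conjugate to its linear part, because of
  resonances between its eigenvalues. The choice of \<open>W\<close> removes this obstacle: all its
  eigenvalues are 1, and no sum of two or more ones equals 1. Concretely, the linear term cancels in
  \<open>\<psi> (s x) = s w\<close>, and \<open>w' = (E (s w) - s w) / s\<^sup>2\<close> remains,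
  whose right hand side is regular at \<open>s = 0\<close>. Such a \<open>W\<close> exists because
  at a point \<open>x0\<close> with nonzero wedge the vectors \<open>L b x0\<close> form a basis: a
  combination of the \<open>L a\<close> fixing \<open>x0\<close> fixes every \<open>L b x0\<close>
  by commutativity, hence everything. The Volterra equations are kept at Lipschitz constant 1/2 on
  the unit time interval. The Picard operator then contracts in the sup norm, and the linearised
  equation, which the derivative of the solution satisfies, has the same constant; so existence,
  continuity and differentiability of every order follow from one estimate. The corank already gives
  \<open>h + 2 * e\<close>, so for the uniqueness a single further invariant, \<open>h + e\<close>,
  is enough.\<close>

section \<open>Smooth maps depending on a parameter\<close>

text \<open>Only the differentiability in \<open>x\<close> is counted; the parameter enters through
  joint continuity alone. So \<open>I\<close> may be a closed interval of times, or a single point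
  when there is no parameter, and no derivative at an end point of \<open>I\<close> is ever
  involved.\<close>

primrec pdiff ::
    "nat \<Rightarrow> 'p::topological_space set \<Rightarrow> 'a::real_normed_vector set \<Rightarrow>
      ('p \<Rightarrow> 'a \<Rightarrow> 'b::real_normed_vector) \<Rightarrow> bool" where
  "pdiff 0 I U f \<longleftrightarrow> continuous_on (I \<times> U) (\<lambda>(s, x). f s x)"
| "pdiff (Suc k) I U f \<longleftrightarrow>
     continuous_on (I \<times> U) (\<lambda>(s, x). f s x) \<and>
     (\<forall>s\<in>I. \<forall>x\<in>U. f s differentiable (at x)) \<and>
     (\<forall>u. pdiff k I U (\<lambda>s x. frechet_derivative (f s) (at x) u))"

lemma frechet_derivative_eq:
  "(f has_derivative f') (at x) \<Longrightarrow> frechet_derivative f (at x) u = f' u"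
  using frechet_derivative_at by metis

lemma pdiff_continuous: "pdiff k I U f \<Longrightarrow> continuous_on (I \<times> U) (\<lambda>(s, x). f s x)"
  by (cases k) auto

lemma pdiff_differentiable:
  "pdiff (Suc k) I U f \<Longrightarrow> s \<in> I \<Longrightarrow> x \<in> U \<Longrightarrow>
    (f s has_derivative frechet_derivative (f s) (at x)) (at x)"
  by (auto simp: frechet_derivative_works)

lemma pdiff_derivative:
  "pdiff (Suc k) I U f \<Longrightarrow> pdiff k I U (\<lambda>s x. frechet_derivative (f s) (at x) u)"
  by auto

lemma pdiff_cong:
  assumes "open U" "pdiff k I U f" "\<And>s x. s \<in> I \<Longrightarrow> x \<in> U \<Longrightarrow> g s x = f s x"
  shows "pdiff k I U g"
  using assms(2,3)
proof (induction k arbitrary: f g)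
  case 0
  then show ?case by (auto cong: continuous_on_cong_simp simp: case_prod_unfold mem_Times_iff
        elim!: continuous_on_eq)
next
  case (Suc k)
  have der: "(g s has_derivative frechet_derivative (f s) (at x)) (at x)" if "s \<in> I" "x \<in> U" for s x
    using has_derivative_transform_within_open[OF pdiff_differentiable[OF Suc.prems(1) that] assms(1) that(2)]
      Suc.prems(2) that(1) by metis
  have "continuous_on (I \<times> U) (\<lambda>(s, x). g s x)"
    using pdiff_continuous[OF Suc.prems(1)]
    by (rule continuous_on_eq) (use Suc.prems(2) in auto)
  moreover have "pdiff k I U (\<lambda>s x. frechet_derivative (g s) (at x) u)" for u
    by (rule Suc.IH[OF pdiff_derivative[OF Suc.prems(1)]]) (use der frechet_derivative_eq in blast)
  moreover have "\<forall>s\<in>I. \<forall>x\<in>U. g s differentiable at x"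
    using der differentiableI by blast
  ultimately show ?case by simp
qed

lemma pdiff_SucI:
  assumes "open U" "continuous_on (I \<times> U) (\<lambda>(s, x). f s x)"
    "\<And>s x. s \<in> I \<Longrightarrow> x \<in> U \<Longrightarrow> (f s has_derivative f' s x) (at x)"
    "\<And>u. pdiff k I U (\<lambda>s x. f' s x u)"
  shows "pdiff (Suc k) I U f"
proof -
  have "pdiff k I U (\<lambda>s x. frechet_derivative (f s) (at x) u)" for u
    by (rule pdiff_cong[OF assms(1) assms(4)[of u]]) (use assms(3) frechet_derivative_eq in blast)
  with assms show ?thesis by (auto simp: differentiable_def)
qed

lemma pdiff_SucD: "pdiff (Suc k) I U f \<Longrightarrow> pdiff k I U f"
  by (induction k arbitrary: f) auto

lemma pdiff_subset: "pdiff k I U f \<Longrightarrow> J \<subseteq> I \<Longrightarrow> W \<subseteq> U \<Longrightarrow> pdiff k J W f"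
proof (induction k arbitrary: f)
  case 0
  then show ?case by (auto elim!: continuous_on_subset)
next
  case (Suc k)
  have "continuous_on (J \<times> W) (\<lambda>(s, x). f s x)"
    using pdiff_continuous[OF Suc.prems(1)] Suc.prems(2,3) by (auto elim!: continuous_on_subset)
  with Suc show ?case by (auto simp: subset_eq)
qed

lemma pdiff_const:
  fixes a :: "'p::topological_space \<Rightarrow> 'b::real_normed_vector"
    and U :: "'a::real_normed_vector set"
  shows "continuous_on I a \<Longrightarrow> pdiff k I U (\<lambda>s x. a s)"
proof (induction k arbitrary: a)
  case 0
  then show ?case
    by (auto simp: case_prod_unfold intro!: continuous_on_compose2[of I a _ fst] continuous_intros)
next
  case (Suc k)
  have "pdiff k I U (\<lambda>s x. 0 :: 'b)" by (rule Suc.IH[of "\<lambda>_. 0"]) simp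
  moreover have "continuous_on (I \<times> U) (\<lambda>(s, x). a s)"
    using Suc.prems
    by (auto simp: case_prod_unfold intro!: continuous_on_compose2[of I a _ fst] continuous_intros)
  ultimately show ?case by simp
qed

lemma pdiff_linear:
  assumes "bounded_linear h"
  shows "pdiff k I U (\<lambda>s x. h x)"
proof -
  have 1: "continuous_on (I \<times> U) (\<lambda>(s, x). h x)"
    unfolding case_prod_unfold
    by (intro bounded_linear.continuous_on[OF assms] continuous_intros)
  have 2: "frechet_derivative h (at x) = h" for x
    using frechet_derivative_at[OF bounded_linear_imp_has_derivative[OF assms]] by metis
  show ?thesis
    by (cases k) (auto simp: 1 2 bounded_linear_imp_differentiable[OF assms] intro!: pdiff_const)
qed

lemma pdiff_id: "pdiff k I U (\<lambda>s x. x)"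
  by (rule pdiff_linear) (rule bounded_linear_ident)

lemma pdiff_bounded_linear:
  assumes h: "bounded_linear h" and U: "open U" and f: "pdiff k I U f"
  shows "pdiff k I U (\<lambda>s x. h (f s x))"
  using f
proof (induction k arbitrary: f)
  case 0
  then show ?case by (auto simp: case_prod_unfold intro: bounded_linear.continuous_on[OF h])
next
  case (Suc k)
  show ?case
  proof (rule pdiff_SucI[OF U])
    show "continuous_on (I \<times> U) (\<lambda>(s, x). h (f s x))"
      using pdiff_continuous[OF Suc.prems]
      by (auto simp: case_prod_unfold intro: bounded_linear.continuous_on[OF h])
    show "((\<lambda>x. h (f s x)) has_derivative (\<lambda>u. h (frechet_derivative (f s) (at x) u))) (at x)"
      if "s \<in> I" "x \<in> U" for s x
      by (rule bounded_linear.has_derivative[OF h pdiff_differentiable[OF Suc.prems that]])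
    show "pdiff k I U (\<lambda>s x. h (frechet_derivative (f s) (at x) u))" for u
      by (rule Suc.IH[OF pdiff_derivative[OF Suc.prems]])
  qed
qed

lemma pdiff_add:
  assumes U: "open U" and f: "pdiff k I U f" "pdiff k I U g"
  shows "pdiff k I U (\<lambda>s x. f s x + g s x)"
  using f
proof (induction k arbitrary: f g)
  case 0
  then show ?case by (auto simp: case_prod_unfold intro: continuous_intros)
next
  case (Suc k)
  show ?case
  proof (rule pdiff_SucI[OF U])
    show "continuous_on (I \<times> U) (\<lambda>(s, x). f s x + g s x)"
      using Suc.prems[THEN pdiff_continuous]
      by (auto simp: case_prod_unfold intro: continuous_intros)
    show "((\<lambda>x. f s x + g s x) has_derivative
        (\<lambda>u. frechet_derivative (f s) (at x) u + frechet_derivative (g s) (at x) u)) (at x)"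
      if "s \<in> I" "x \<in> U" for s x
      by (intro has_derivative_add pdiff_differentiable[OF Suc.prems(1) that]
          pdiff_differentiable[OF Suc.prems(2) that])
    show "pdiff k I U (\<lambda>s x. frechet_derivative (f s) (at x) u + frechet_derivative (g s) (at x) u)" for u
      by (rule Suc.IH[OF Suc.prems[THEN pdiff_derivative]])
  qed
qed

lemma pdiff_bounded_bilinear:
  assumes h: "bounded_bilinear h" and U: "open U" and f: "pdiff k I U f" "pdiff k I U g"
  shows "pdiff k I U (\<lambda>s x. h (f s x) (g s x))"
  using f
proof (induction k arbitrary: f g)
  case 0
  then show ?case by (auto simp: case_prod_unfold intro: bounded_bilinear.continuous_on[OF h])
next
  case (Suc k)
  show ?case
  proof (rule pdiff_SucI[OF U])
    show "continuous_on (I \<times> U) (\<lambda>(s, x). h (f s x) (g s x))"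
      using Suc.prems[THEN pdiff_continuous]
      by (auto simp: case_prod_unfold intro: bounded_bilinear.continuous_on[OF h])
    show "((\<lambda>x. h (f s x) (g s x)) has_derivative
        (\<lambda>u. h (f s x) (frechet_derivative (g s) (at x) u) + h (frechet_derivative (f s) (at x) u) (g s x))) (at x)"
      if "s \<in> I" "x \<in> U" for s x
      by (intro bounded_bilinear.FDERIV[OF h] pdiff_differentiable[OF Suc.prems(1) that]
          pdiff_differentiable[OF Suc.prems(2) that])
    show "pdiff k I U (\<lambda>s x. h (f s x) (frechet_derivative (g s) (at x) u) +
             h (frechet_derivative (f s) (at x) u) (g s x))" for u
      by (intro pdiff_add[OF U] Suc.IH Suc.prems[THEN pdiff_derivative] Suc.prems[THEN pdiff_SucD])
  qed
qed

lemmas pdiff_scaleR = pdiff_bounded_bilinear[OF bounded_bilinear_scaleR]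
lemmas pdiff_mult = pdiff_bounded_bilinear[OF bounded_bilinear_mult]
lemmas pdiff_minus = pdiff_bounded_linear[OF bounded_linear_minus[OF bounded_linear_ident]]

lemma pdiff_diff:
  assumes "open U" "pdiff k I U f" "pdiff k I U g"
  shows "pdiff k I U (\<lambda>s x. f s x - g s x)"
  using pdiff_add[OF assms(1,2) pdiff_minus[OF assms(1,3)]] by simp

lemma pdiff_sum:
  assumes "open U" "\<And>i. i \<in> S \<Longrightarrow> pdiff k I U (f i)"
  shows "pdiff k I U (\<lambda>s x. \<Sum>i\<in>S. f i s x)"
  using assms(2)
  by (induction S rule: infinite_finite_induct) (auto intro!: pdiff_add[OF assms(1)] pdiff_const)

lemma pdiff_prod:
  fixes f :: "'i \<Rightarrow> 'p::topological_space \<Rightarrow> 'a::real_normed_vector \<Rightarrow> real"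
  assumes "open U" "\<And>i. i \<in> S \<Longrightarrow> pdiff k I U (f i)"
  shows "pdiff k I U (\<lambda>s x. \<Prod>i\<in>S. f i s x)"
  using assms(2)
  by (induction S rule: infinite_finite_induct) (auto intro!: pdiff_mult[OF assms(1)] pdiff_const)

lemma pdiff_Pair:
  fixes f :: "'p::topological_space \<Rightarrow> 'a::real_normed_vector \<Rightarrow> 'b::real_normed_vector"
    and g :: "'p \<Rightarrow> 'a \<Rightarrow> 'd::real_normed_vector"
  assumes "open U" "pdiff k I U f" "pdiff k I U g"
  shows "pdiff k I U (\<lambda>s x. (f s x, g s x))"
proof -
  have "bounded_linear (\<lambda>a::'b. (a, 0::'d))" "bounded_linear (\<lambda>a::'d. (0::'b, a))"
    by (auto intro: bounded_linear_Pair bounded_linear_ident bounded_linear_zero)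
  from pdiff_add[OF assms(1) pdiff_bounded_linear[OF this(1) assms(1,2)]
      pdiff_bounded_linear[OF this(2) assms(1,3)]]
  show ?thesis by simp
qed

lemma pdiff_vec:
  fixes f :: "'n::finite \<Rightarrow> 'p::topological_space \<Rightarrow> 'a::real_normed_vector \<Rightarrow> real"
  assumes "open U" "\<And>i. pdiff k I U (f i)"
  shows "pdiff k I U (\<lambda>s x. \<chi> i. f i s x)"
proof -
  have "pdiff k I U (\<lambda>s x. \<Sum>i\<in>UNIV. f i s x *\<^sub>R axis i (1::real))"
    by (intro pdiff_sum[OF assms(1)] pdiff_scaleR[OF assms(1)] assms(2) pdiff_const) auto
  moreover have "(\<Sum>i\<in>UNIV. f i s x *\<^sub>R axis i (1::real)) = (\<chi> i. f i s x)" for s x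
    by (simp add: vec_eq_iff axis_def if_distrib cong: if_cong)
  ultimately show ?thesis by simp
qed

lemma pdiff_nth: "open U \<Longrightarrow> pdiff k I U f \<Longrightarrow> pdiff k I U (\<lambda>s x. f s x $ i)"
  by (rule pdiff_bounded_linear[OF bounded_linear_vec_nth])

text \<open>Continuity is all that is asked of the parameter, so any continuous substitution is
  allowed. This produces integrands evaluated at times such as \<open>r * t\<close>.\<close>

lemma pdiff_reparam:
  assumes h: "continuous_on J h" "h ` J \<subseteq> I" and f: "pdiff k I U f"
  shows "pdiff k J U (\<lambda>t. f (h t))"
proof -
  have c: "continuous_on (J \<times> U) (\<lambda>(t, x). f (h t) x)" if "pdiff k I U f" for k f
  proof -
    have "continuous_on (J \<times> U) (\<lambda>z. (h (fst z), snd z))"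
      by (auto intro!: continuous_intros continuous_on_compose2[OF h(1), of _ fst])
    from continuous_on_compose2[OF pdiff_continuous[OF that] this] h(2)
    show ?thesis by (auto simp: case_prod_unfold image_subset_iff)
  qed
  show ?thesis
    using f
  proof (induction k arbitrary: f)
    case 0
    from c[OF this] show ?case by simp
  next
    case (Suc k)
    from c[OF Suc.prems] Suc.prems Suc.IH[OF pdiff_derivative[OF Suc.prems]] h(2)
    show ?case by (auto simp: image_subset_iff)
  qed
qed

lemma pdiff_compose:
  fixes G :: "'p::topological_space \<Rightarrow> 'b::euclidean_space \<Rightarrow> 'c::real_normed_vector"
  assumes U: "open U" and V: "open V" and G: "pdiff k I V G" and g: "pdiff k I U g"
    and gV: "\<And>s x. s \<in> I \<Longrightarrow> x \<in> U \<Longrightarrow> g s x \<in> V"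
  shows "pdiff k I U (\<lambda>s x. G s (g s x))"
proof -
  have c: "continuous_on (I \<times> U) (\<lambda>(s, x). G s (g s x))"
    if "pdiff k I V G" "pdiff k I U g" for k G
  proof -
    have "continuous_on (I \<times> U) (\<lambda>z. (fst z, g (fst z) (snd z)))"
      using pdiff_continuous[OF that(2)] by (auto simp: case_prod_unfold intro!: continuous_intros)
    from continuous_on_compose2[OF pdiff_continuous[OF that(1)] this] gV
    show ?thesis by (auto simp: case_prod_unfold image_subset_iff)
  qed
  show ?thesis
    using G g
  proof (induction k arbitrary: G)
    case 0
    from c[OF this] show ?case by simp
  next
    case (Suc k)
    \<comment> \<open>The chain rule takes the derivative of \<open>G s\<close> in a moving
      direction, whereas \<open>pdiff\<close> speaks of fixed directions. Expanding in a basis gives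
      fixed directions with moving coefficients, to which the induction hypothesis applies.\<close>
    have exp: "frechet_derivative (G s) (at y) v =
        (\<Sum>i\<in>Basis. (v \<bullet> i) *\<^sub>R frechet_derivative (G s) (at y) i)" if "s \<in> I" "y \<in> V" for s y v
    proof -
      have "linear (frechet_derivative (G s) (at y))"
        using pdiff_differentiable[OF Suc.prems(1) that] has_derivative_linear by blast
      then show ?thesis
        by (subst (1) euclidean_representation[of v, symmetric]) (simp add: linear_sum linear_cmul)
    qed
    show ?case
    proof (rule pdiff_SucI[OF U])
      show "continuous_on (I \<times> U) (\<lambda>(s, x). G s (g s x))"
        by (rule c[OF Suc.prems])
      show "((\<lambda>x. G s (g s x)) has_derivative (\<lambda>u. \<Sum>i\<in>Basis.
          (frechet_derivative (g s) (at x) u \<bullet> i) *\<^sub>R frechet_derivative (G s) (at (g s x)) i)) (at x)"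
        if "s \<in> I" "x \<in> U" for s x
        unfolding exp[OF that(1) gV[OF that], symmetric]
        by (rule has_derivative_compose[OF pdiff_differentiable[OF Suc.prems(2) that]
            pdiff_differentiable[OF Suc.prems(1) that(1) gV[OF that]]])
      show "pdiff k I U (\<lambda>s x. \<Sum>i\<in>Basis.
          (frechet_derivative (g s) (at x) u \<bullet> i) *\<^sub>R frechet_derivative (G s) (at (g s x)) i)" for u
        by (intro pdiff_sum[OF U] pdiff_scaleR[OF U] Suc.IH pdiff_SucD[OF Suc.prems(2)]
            pdiff_derivative[OF Suc.prems(1)] pdiff_derivative[OF Suc.prems(2)]
            pdiff_bounded_linear[OF bounded_linear_inner_left U])
    qed
  qed
qed

lemma pdiff_inverse:
  fixes f :: "'p::topological_space \<Rightarrow> 'a::real_normed_vector \<Rightarrow> real"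
  assumes U: "open U" and f: "pdiff k I U f" and nz: "\<And>s x. s \<in> I \<Longrightarrow> x \<in> U \<Longrightarrow> f s x \<noteq> 0"
  shows "pdiff k I U (\<lambda>s x. inverse (f s x))"
  using f
proof (induction k)
  case 0
  then show ?case using nz by (auto simp: case_prod_unfold intro!: continuous_intros)
next
  case (Suc k)
  show ?case
  proof (rule pdiff_SucI[OF U])
    show "continuous_on (I \<times> U) (\<lambda>(s, x). inverse (f s x))"
      using Suc.prems[THEN pdiff_continuous] nz
      by (auto simp: case_prod_unfold intro!: continuous_intros)
    show "((\<lambda>x. inverse (f s x)) has_derivative
        (\<lambda>u. - (inverse (f s x) * frechet_derivative (f s) (at x) u * inverse (f s x)))) (at x)"
      if "s \<in> I" "x \<in> U" for s x
      using Deriv.has_derivative_inverse[OF nz[OF that] pdiff_differentiable[OF Suc.prems that]] .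
    show "pdiff k I U (\<lambda>s x. - (inverse (f s x) * frechet_derivative (f s) (at x) u * inverse (f s x)))" for u
      by (intro pdiff_minus[OF U] pdiff_mult[OF U] Suc.IH pdiff_derivative[OF Suc.prems] pdiff_SucD[OF Suc.prems])
  qed
qed

lemma invertible_matrix_inv:
  assumes "invertible A"
  shows "A ** matrix_inv A = mat 1" "matrix_inv A ** A = mat 1"
  using someI_ex[OF assms[unfolded invertible_def]] by (simp_all add: matrix_inv_def)

text \<open>By Cramer's rule the components are quotients of determinants, that is, of polynomials
  in the entries. It serves both the inverse function theorem and the coframe dual to the free
  fields.\<close>

lemma pdiff_matrix_inv:
  fixes F :: "'p::topological_space \<Rightarrow> 'a::real_normed_vector \<Rightarrow> real ^ 'n ^ 'n"
  assumes U: "open U" and F: "\<And>i j. pdiff k I U (\<lambda>s x. F s x $ i $ j)" and b: "pdiff k I U b"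
    and nz: "\<And>s x. s \<in> I \<Longrightarrow> x \<in> U \<Longrightarrow> det (F s x) \<noteq> 0"
  shows "pdiff k I U (\<lambda>s x. matrix_inv (F s x) *v b s x)"
proof -
  have det: "pdiff k I U (\<lambda>s x. det (B s x))" if "\<And>i j. pdiff k I U (\<lambda>s x. B s x $ i $ j)"
    for B :: "'p \<Rightarrow> 'a \<Rightarrow> real ^ 'n ^ 'n"
    unfolding det_def
    by (intro pdiff_sum[OF U] pdiff_mult[OF U] pdiff_prod[OF U] that pdiff_const continuous_intros)
  have Fb: "pdiff k I U (\<lambda>s x. if j = l then b s x $ i else F s x $ i $ j)" for i j l
    using F[of i j] pdiff_nth[OF U b, of i] by (cases "j = l") auto
  have "pdiff k I U (\<lambda>s x. \<chi> l. det (\<chi> i j. if j = l then b s x $ i else F s x $ i $ j) * inverse (det (F s x)))"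
  proof (intro pdiff_vec[OF U] pdiff_mult[OF U] pdiff_inverse[OF U])
    show "pdiff k I U (\<lambda>s x. det (\<chi> i j. if j = l then b s x $ i else F s x $ i $ j))" for l
      using det[of "\<lambda>s x. \<chi> i j. if j = l then b s x $ i else F s x $ i $ j"] Fb by simp
  qed (use det F nz in auto)
  then show ?thesis
  proof (rule pdiff_cong[OF U])
    fix s x assume sx: "s \<in> I" "x \<in> U"
    have "F s x *v (matrix_inv (F s x) *v b s x) = b s x"
      using nz[OF sx] by (simp add: matrix_vector_mul_assoc invertible_det_nz invertible_matrix_inv)
    then show "matrix_inv (F s x) *v b s x =
        (\<chi> l. det (\<chi> i j. if j = l then b s x $ i else F s x $ i $ j) * inverse (det (F s x)))"
      using cramer[OF nz[OF sx]] by (simp add: divide_inverse)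
  qed
qed

section \<open>Passage between parametrised and plain smoothness\<close>

lemma pdiff_imp_times_cont_diff_on:
  assumes "pdiff k I U f" and s: "s \<in> I"
  shows "times_cont_diff_on k U (f s)"
  using assms(1)
proof (induction k arbitrary: f)
  case 0
  have "continuous_on U (Pair s)" by (intro continuous_intros)
  from continuous_on_compose2[OF pdiff_continuous[OF 0] this] s show ?case by auto
next
  case (Suc k)
  have "times_cont_diff_on k U (\<lambda>x. frechet_derivative (f s) (at x) u)" for u
    by (rule Suc.IH[OF pdiff_derivative[OF Suc.prems]])
  then show ?case using Suc.prems s by simp
qed

lemma times_cont_diff_on_imp_pdiff:
  assumes "times_cont_diff_on k U f" shows "pdiff k I U (\<lambda>_. f)"
  using assms
proof (induction k arbitrary: f)
  case 0
  then have "continuous_on U f" by simp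
  then show ?case
    by (auto simp: case_prod_unfold intro!: continuous_on_compose2[of U f _ snd] continuous_intros)
next
  case (Suc k)
  then have "continuous_on U f"
    by (auto simp: continuous_on_eq_continuous_within intro!: differentiable_imp_continuous_within
        intro: differentiable_at_withinI)
  then have "continuous_on (I \<times> U) (\<lambda>(s, x). f x)"
    by (auto simp: case_prod_unfold intro!: continuous_on_compose2[of U f _ snd] continuous_intros)
  moreover have "pdiff k I U (\<lambda>_ x. frechet_derivative f (at x) u)" for u
    by (rule Suc.IH) (use Suc.prems in simp)
  ultimately show ?case
    unfolding pdiff.simps using Suc.prems[unfolded times_cont_diff_on.simps] by blast
qed

lemma smooth_on_pdiff: "smooth_on U f \<Longrightarrow> pdiff k I U (\<lambda>_. f)"
  by (rule times_cont_diff_on_imp_pdiff) (simp add: smooth_on_def)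

text \<open>With a one-point parameter set \<open>pdiff\<close> becomes the plain notion, so the
  closure properties of \<open>smooth_on\<close> below are inherited from the parametrised
  ones.\<close>

lemma smooth_onI:
  assumes "\<And>k. pdiff k {0::real} U (\<lambda>_. f)"
  shows "smooth_on U f"
  unfolding smooth_on_def
proof
  fix k
  show "times_cont_diff_on k U f"
    using pdiff_imp_times_cont_diff_on[OF assms singletonI] .
qed

lemma smooth_on_differentiable:
  assumes "smooth_on U f" "x \<in> U"
  shows "(f has_derivative frechet_derivative f (at x)) (at x)"
  using pdiff_differentiable[OF smooth_on_pdiff[OF assms(1)] singletonI[of "0::real"] assms(2)] .

lemma smooth_on_derivative:
  assumes "smooth_on U f"
  shows "smooth_on U (\<lambda>x. frechet_derivative f (at x) u)"
  by (rule smooth_onI, rule pdiff_derivative[OF smooth_on_pdiff[OF assms]])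

lemma smooth_on_continuous:
  assumes "smooth_on U f"
  shows "continuous_on U f"
  using assms[unfolded smooth_on_def, rule_format, of 0] by simp

lemma smooth_on_subset: "smooth_on U f \<Longrightarrow> W \<subseteq> U \<Longrightarrow> smooth_on W f"
  by (rule smooth_onI, rule pdiff_subset[where U = U and I = "{0}"], erule smooth_on_pdiff, simp)

lemma smooth_on_cong:
  assumes "open U" "smooth_on U f" "\<And>x. x \<in> U \<Longrightarrow> g x = f x"
  shows "smooth_on U g"
  by (rule smooth_onI, rule pdiff_cong[OF assms(1) smooth_on_pdiff[OF assms(2)]]) (rule assms(3))

lemma smooth_on_compose:
  fixes G :: "'b::euclidean_space \<Rightarrow> 'c::real_normed_vector"
  assumes "open U" "open V" "smooth_on V G" "smooth_on U g" "\<And>x. x \<in> U \<Longrightarrow> g x \<in> V"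
  shows "smooth_on U (\<lambda>x. G (g x))"
  by (rule smooth_onI, rule pdiff_compose[OF assms(1,2) smooth_on_pdiff[OF assms(3)]
      smooth_on_pdiff[OF assms(4)]]) (rule assms(5))

lemma smooth_on_bounded_linear_compose:
  "bounded_linear h \<Longrightarrow> open U \<Longrightarrow> smooth_on U f \<Longrightarrow> smooth_on U (\<lambda>x. h (f x))"
  by (rule smooth_onI, rule pdiff_bounded_linear, assumption+, erule smooth_on_pdiff)

lemma smooth_on_bounded_linear: "bounded_linear h \<Longrightarrow> smooth_on U h"
  by (rule smooth_onI) (rule pdiff_linear)

lemma smooth_on_const: "smooth_on U (\<lambda>x. c)"
  by (rule smooth_onI, rule pdiff_const, rule continuous_on_const)

lemma smooth_on_add: "open U \<Longrightarrow> smooth_on U f \<Longrightarrow> smooth_on U g \<Longrightarrow> smooth_on U (\<lambda>x. f x + g x)"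
  by (rule smooth_onI, rule pdiff_add, assumption, (erule smooth_on_pdiff)+)

lemma smooth_on_diff: "open U \<Longrightarrow> smooth_on U f \<Longrightarrow> smooth_on U g \<Longrightarrow> smooth_on U (\<lambda>x. f x - g x)"
  by (rule smooth_onI, rule pdiff_diff, assumption, (erule smooth_on_pdiff)+)

lemma smooth_on_scaleR: "open U \<Longrightarrow> smooth_on U f \<Longrightarrow> smooth_on U g \<Longrightarrow> smooth_on U (\<lambda>x. f x *\<^sub>R g x)"
  by (rule smooth_onI, rule pdiff_scaleR, assumption, (erule smooth_on_pdiff)+)

lemma smooth_on_sum:
  "open U \<Longrightarrow> (\<And>i. i \<in> S \<Longrightarrow> smooth_on U (f i)) \<Longrightarrow> smooth_on U (\<lambda>x. \<Sum>i\<in>S. f i x)"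
  by (rule smooth_onI, rule pdiff_sum, assumption, rule smooth_on_pdiff)

section \<open>Volterra equations\<close>

text \<open>As an element of a normed space the derivative can be compared in operator norm, which
  the compactness arguments below need; in finite dimension continuity in each basis direction
  suffices.\<close>

lemma pdiff_blinfun:
  fixes f :: "'p::t2_space \<Rightarrow> 'a::euclidean_space \<Rightarrow> 'b::real_normed_vector"
  assumes "pdiff (Suc k) I U f"
  shows "continuous_on (I \<times> U) (\<lambda>z. Blinfun (frechet_derivative (f (fst z)) (at (snd z))))"
    and "\<And>s x. s \<in> I \<Longrightarrow> x \<in> U \<Longrightarrow>
      blinfun_apply (Blinfun (frechet_derivative (f s) (at x))) = frechet_derivative (f s) (at x)"
proof -
  show ap: "blinfun_apply (Blinfun (frechet_derivative (f s) (at x))) = frechet_derivative (f s) (at x)"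
    if "s \<in> I" "x \<in> U" for s x
    using pdiff_differentiable[OF assms that] has_derivative_bounded_linear bounded_linear_Blinfun_apply
    by blast
  show "continuous_on (I \<times> U) (\<lambda>z. Blinfun (frechet_derivative (f (fst z)) (at (snd z))))"
  proof (rule continuous_on_blinfun_componentwise)
    fix i :: 'a
    show "continuous_on (I \<times> U) (\<lambda>z. blinfun_apply (Blinfun (frechet_derivative (f (fst z)) (at (snd z)))) i)"
      using pdiff_continuous[OF pdiff_derivative[OF assms, of i]]
      by (rule continuous_on_eq) (auto simp: ap)
  qed
qed

lemma has_derivative_param_integral:
  fixes f :: "'p::t2_space \<times> real \<Rightarrow> 'a::euclidean_space \<Rightarrow> 'b::euclidean_space"
  assumes U: "open U" and f: "pdiff (Suc k) (I \<times> {0..1}) U f" and sx: "s \<in> I" "x \<in> U"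
  shows "((\<lambda>x. integral {0..1} (\<lambda>t. f (s, t) x)) has_derivative
    (\<lambda>u. integral {0..1} (\<lambda>t. frechet_derivative (f (s, t)) (at x) u))) (at x)"
proof -
  obtain r where r: "r > 0" "ball x r \<subseteq> U" using U sx(2) openE by blast
  let ?D = "\<lambda>x t. Blinfun (frechet_derivative (f (s, t)) (at x))"
  have contD: "continuous_on (ball x r \<times> cbox 0 1) (\<lambda>(x, t). ?D x t)"
  proof -
    have "continuous_on (ball x r \<times> cbox 0 1) (\<lambda>z. ((s, snd z), fst z))"
      by (intro continuous_intros)
    from continuous_on_compose2[OF pdiff_blinfun(1)[OF f] this] sx r
    show ?thesis by (auto simp: case_prod_unfold image_subset_iff)
  qed
  have apD: "blinfun_apply (?D y t) = frechet_derivative (f (s, t)) (at y)"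
    if "y \<in> U" "t \<in> cbox 0 1" for y t
    using pdiff_blinfun(2)[OF f, of "(s, t)" y] that sx by auto
  have cont_t: "continuous_on (cbox 0 1) (\<lambda>t. f (s, t) y)" if "y \<in> U" for y
  proof -
    have "continuous_on (cbox 0 1) (\<lambda>t. ((s, t), y))" by (intro continuous_intros)
    from continuous_on_compose2[OF pdiff_continuous[OF f] this] sx that
    show ?thesis by (auto simp: image_subset_iff)
  qed
  have "((\<lambda>x. integral (cbox 0 1) (\<lambda>t. f (s, t) x)) has_derivative
      blinfun_apply (integral (cbox 0 1) (?D x))) (at x within ball x r)"
  proof (rule leibniz_rule[OF _ _ contD])
    fix y t assume yt: "y \<in> ball x r" "t \<in> cbox (0::real) 1"
    then have "(f (s, t) has_derivative frechet_derivative (f (s, t)) (at y)) (at y)"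
      using sx r by (intro pdiff_differentiable[OF f]) auto
    with yt r show "((\<lambda>x. f (s, t) x) has_derivative blinfun_apply (?D y t)) (at y within ball x r)"
      by (subst apD) (auto intro: has_derivative_at_withinI)
  next
    fix y assume "y \<in> ball x r"
    then show "(\<lambda>t. f (s, t) y) integrable_on cbox 0 1"
      using cont_t r by (intro integrable_continuous) auto
  qed (use r in auto)
  moreover have "at x within ball x r = at x"
    using r by (intro at_within_open) auto
  moreover have "blinfun_apply (integral (cbox 0 1) (?D x)) u =
      integral {0..1} (\<lambda>t. frechet_derivative (f (s, t)) (at x) u)" for u
  proof -
    have "continuous_on (cbox 0 1) (Pair x)" by (intro continuous_intros)
    from continuous_on_compose2[OF contD this] r
    have "continuous_on (cbox 0 1) (\<lambda>t. ?D x t)" by (auto simp: image_subset_iff)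
    then have "blinfun_apply (integral (cbox 0 1) (?D x)) u = integral (cbox 0 1) (\<lambda>t. blinfun_apply (?D x t) u)"
      by (intro blinfun_apply_integral integrable_continuous)
    also have "\<dots> = integral {0..1} (\<lambda>t. frechet_derivative (f (s, t)) (at x) u)"
      unfolding cbox_interval by (intro integral_cong) (use apD[OF sx(2)] in auto)
    finally show ?thesis .
  qed
  then have "blinfun_apply (integral (cbox 0 1) (?D x)) =
      (\<lambda>u. integral {0..1} (\<lambda>t. frechet_derivative (f (s, t)) (at x) u))" by blast
  ultimately show ?thesis
    unfolding cbox_interval by argo
qed

text \<open>Differentiation under the integral sign at every order. The integration variable is kept
  as a second component of the parameter, so that the induction stays inside
  \<open>pdiff\<close>.\<close>

lemma pdiff_integral:
  fixes f :: "'p::t2_space \<times> real \<Rightarrow> 'a::euclidean_space \<Rightarrow> 'b::euclidean_space"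
  assumes U: "open U" and f: "pdiff k (I \<times> {0..1}) U f"
  shows "pdiff k I U (\<lambda>s x. integral {0..1} (\<lambda>t. f (s, t) x))"
  using f
proof (induction k arbitrary: f)
  case 0
  have "continuous_on ((I \<times> U) \<times> cbox 0 1) (\<lambda>(z, t). f (fst z, t) (snd z))"
  proof -
    have "continuous_on ((I \<times> U) \<times> cbox 0 1) (\<lambda>z. ((fst (fst z), snd z), snd (fst z)))"
      by (intro continuous_intros)
    from continuous_on_compose2[OF pdiff_continuous[OF 0] this]
    show ?thesis by (auto simp: case_prod_unfold image_subset_iff)
  qed
  from integral_continuous_on_param[OF this]
  show ?case by (simp add: case_prod_unfold)
next
  case (Suc k)
  show ?case
  proof (rule pdiff_SucI[OF U pdiff_continuous[OF Suc.IH[OF pdiff_SucD[OF Suc.prems]]]])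
    show "((\<lambda>x. integral {0..1} (\<lambda>t. f (s, t) x)) has_derivative
        (\<lambda>u. integral {0..1} (\<lambda>t. frechet_derivative (f (s, t)) (at x) u))) (at x)"
      if "s \<in> I" "x \<in> U" for s x
      by (rule has_derivative_param_integral[OF U Suc.prems that])
    show "pdiff k I U (\<lambda>s x. integral {0..1} (\<lambda>t. frechet_derivative (f (s, t)) (at x) u))" for u
      by (rule Suc.IH[OF pdiff_derivative[OF Suc.prems]])
  qed
qed

section \<open>Contractive Volterra equations: existence, continuity and derivatives of
  solutions\<close>

lemma integral_rescale:
  fixes g :: "real \<Rightarrow> 'b::euclidean_space"
  assumes "0 \<le> s"
  shows "integral {0..s} g = s *\<^sub>R integral {0..1} (\<lambda>t. g (s * t))"
proof (cases "s = 0")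
  case False
  with assms have s: "s > 0" by simp
  then have "integral {0..1} (\<lambda>t. g (s * t)) = (1 / s) *\<^sub>R integral {0..s} g"
    using integral_stretch_real[of s 0 s g] by (simp add: image_divide_atLeastAtMost)
  with s show ?thesis by simp
qed simp

text \<open>At a point where the norm is largest the hypothesis bounds this maximum by
  \<open>e\<close> plus \<open>c\<close> times itself. This takes the place of a Gronwall inequality
  in all comparisons of solutions.\<close>

lemma sup_contraction_bound:
  fixes \<Delta> :: "real \<Rightarrow> 'b::real_normed_vector"
  assumes "continuous_on {0..1} \<Delta>" "c < 1"
    and "\<And>s M. s \<in> {0..1} \<Longrightarrow> (\<And>r. r \<in> {0..1} \<Longrightarrow> norm (\<Delta> r) \<le> M) \<Longrightarrow> norm (\<Delta> s) \<le> e + c * M"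
    and "s \<in> {0..1}"
  shows "norm (\<Delta> s) \<le> e / (1 - c)"
proof -
  have "continuous_on {0..1} (\<lambda>s. norm (\<Delta> s))" by (intro continuous_intros assms)
  then obtain m where m: "m \<in> {0..1}" "\<And>r. r \<in> {0..1} \<Longrightarrow> norm (\<Delta> r) \<le> norm (\<Delta> m)"
    using continuous_attains_sup[of "{0..1::real}" "\<lambda>s. norm (\<Delta> s)"] by auto
  have "norm (\<Delta> m) \<le> e + c * norm (\<Delta> m)" by (rule assms(3)[OF m])
  then have "norm (\<Delta> m) \<le> e / (1 - c)" using assms(2) by (simp add: field_simps)
  with m(2)[OF assms(4)] show ?thesis by simp
qed

lemma integral_norm_le:
  fixes f :: "real \<Rightarrow> 'b::euclidean_space"
  assumes "s \<in> {0..1}" "continuous_on {0..1} f" "\<And>r. r \<in> {0..1} \<Longrightarrow> norm (f r) \<le> B"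
  shows "norm (integral {0..s} f) \<le> B"
proof -
  have "B \<ge> 0" using assms(3)[of 0] norm_ge_zero[of "f 0"] by (simp del: norm_ge_zero)
  have "norm (integral {0..s} f) \<le> B * (s - 0)"
    using assms by (intro integral_bound) (auto elim!: continuous_on_subset)
  also have "\<dots> \<le> B * 1" using assms(1) \<open>B \<ge> 0\<close> by (intro mult_left_mono) auto
  finally show ?thesis by simp
qed

text \<open>The integral runs over a length at most 1, so Lipschitz constant 1/2 makes the Picard
  operator a contraction in the sup norm.\<close>

lemma volterra_exists:
  fixes H :: "real \<Rightarrow> 'b::euclidean_space \<Rightarrow> 'b"
  assumes H: "continuous_on ({0..1} \<times> UNIV) (\<lambda>(r, y). H r y)" and b: "continuous_on {0..1} b"
    and lip: "\<And>r y y'. r \<in> {0..1} \<Longrightarrow> norm (H r y - H r y') \<le> 1 / 2 * norm (y - y')"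
  shows "\<exists>w. continuous_on {0..1} w \<and> (\<forall>s\<in>{0..1}. w s = b s + integral {0..s} (\<lambda>r. H r (w r)))"
proof -
  \<comment> \<open>The complete space at hand consists of bounded continuous functions on the whole
    line; clamping the time to \<open>{0..1}\<close> moves the problem there.\<close>
  define c where "c = (\<lambda>s::real. max 0 (min 1 s))"
  have c: "c s \<in> {0..1}" "continuous_on UNIV c" for s
    by (auto simp: c_def intro!: continuous_intros)
  have cid: "s \<in> {0..1} \<Longrightarrow> c s = s" for s by (auto simp: c_def)
  have Hw: "continuous_on {0..1} (\<lambda>r. H r (w r))" if "continuous_on {0..1} w" for w
  proof -
    have "continuous_on {0..1} (\<lambda>r. (r, w r))" by (intro continuous_intros that)
    from continuous_on_compose2[OF H this] show ?thesis by auto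
  qed
  define T where "T = (\<lambda>w::real \<Rightarrow>\<^sub>C 'b. Bcontfun (\<lambda>s. b (c s) + integral {0..c s} (\<lambda>r. H r (w r))))"
  have T: "apply_bcontfun (T w) s = b (c s) + integral {0..c s} (\<lambda>r. H r (w r))" for w s
  proof -
    let ?g = "\<lambda>s. b s + integral {0..s} (\<lambda>r. H r (w r))"
    have g: "continuous_on {0..1} ?g"
      by (intro continuous_intros b indefinite_integral_continuous_1 integrable_continuous_real Hw
          continuous_on_apply_bcontfun)
    have "continuous_on UNIV (\<lambda>s. ?g (c s))"
      by (rule continuous_on_compose2[OF g c(2)]) (use c in auto)
    moreover have "range (\<lambda>s. ?g (c s)) \<subseteq> ?g ` {0..1}" using c by auto
    then have "bounded (range (\<lambda>s. ?g (c s)))"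
      using compact_imp_bounded[OF compact_continuous_image[OF g]] bounded_subset by blast
    ultimately show ?thesis unfolding T_def by (subst Bcontfun_inverse) (auto simp: bcontfun_def)
  qed
  have "\<exists>!w. T w = w"
  proof (rule banach_fix_type[of "1 / 2"], safe)
    fix w w' :: "real \<Rightarrow>\<^sub>C 'b"
    show "dist (T w) (T w') \<le> 1 / 2 * dist w w'"
    proof (rule dist_bound)
      fix s
      have "apply_bcontfun (T w) s - T w' s = integral {0..c s} (\<lambda>r. H r (w r) - H r (w' r))"
        unfolding T using c(1)[of s]
        by (subst integral_diff)
          (auto intro!: integrable_continuous_real continuous_on_subset[OF Hw] continuous_on_apply_bcontfun)
      also have "norm \<dots> \<le> 1 / 2 * dist w w'"
      proof (rule integral_norm_le[OF c(1)])
        show "continuous_on {0..1} (\<lambda>r. H r (w r) - H r (w' r))"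
          by (intro continuous_intros Hw continuous_on_apply_bcontfun)
        fix r :: real assume "r \<in> {0..1}"
        from lip[OF this, of "w r" "w' r"] dist_bounded[of w r w']
        show "norm (H r (w r) - H r (w' r)) \<le> 1 / 2 * dist w w'" by (simp add: dist_norm)
      qed
      finally show "dist (apply_bcontfun (T w) s) (T w' s) \<le> 1 / 2 * dist w w'"
        by (simp add: dist_norm)
    qed
  qed auto
  then obtain w where w: "T w = w" by blast
  show ?thesis
  proof (intro exI[of _ "apply_bcontfun w"] conjI ballI)
    fix s :: real assume "s \<in> {0..1}"
    with T[of w s] w cid show "w s = b s + integral {0..s} (\<lambda>r. H r (w r))" by simp
  qed simp
qed

text \<open>Two solutions are compared through the mixed term \<open>H r (x, w r x0)\<close>: one
  difference is small by continuity of the data, the other is contracted.\<close>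

lemma volterra_continuous:
  fixes H :: "real \<Rightarrow> 'a::euclidean_space \<times> 'b::euclidean_space \<Rightarrow> 'b"
  assumes H: "continuous_on ({0..1} \<times> (U \<times> UNIV)) (\<lambda>(r, z). H r z)"
    and b: "continuous_on ({0..1} \<times> U) (\<lambda>(s, x). b s x)"
    and lip: "\<And>r x y y'. r \<in> {0..1} \<Longrightarrow> x \<in> U \<Longrightarrow>
      norm (H r (x, y) - H r (x, y')) \<le> 1 / 2 * norm (y - y')"
    and w: "\<And>x. x \<in> U \<Longrightarrow> continuous_on {0..1} (\<lambda>s. w s x)"
    and eq: "\<And>s x. s \<in> {0..1} \<Longrightarrow> x \<in> U \<Longrightarrow> w s x = b s x + integral {0..s} (\<lambda>r. H r (x, w r x))"
  shows "continuous_on ({0..1} \<times> U) (\<lambda>(s, x). w s x)"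
  unfolding continuous_on_iff
proof clarsimp
  fix s0 :: real and x0 and e :: real
  assume s0: "0 \<le> s0" "s0 \<le> 1" and x0: "x0 \<in> U" and e: "e > 0"
  have Hw: "continuous_on {0..1} (\<lambda>r. H r (x, w r y))" if "x \<in> U" "y \<in> U" for x y
  proof -
    have "continuous_on {0..1} (\<lambda>r. (r, (x, w r y)))" by (intro continuous_intros w that)
    from continuous_on_compose2[OF H this] that show ?thesis by auto
  qed
  \<comment> \<open>The solution is frozen at \<open>x0\<close>, so only data known to be continuous
    vary with \<open>x\<close>, and compactness of the time interval makes the bound uniform. Twice
    \<open>e / 8\<close>, divided by \<open>1 - 1 / 2\<close>, gives \<open>e / 2\<close>; the other
    half is kept for the variation of \<open>s\<close>.\<close>
  let ?g = "\<lambda>(x, s). (b s x, H s (x, w s x0))"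
  have "continuous_on (U \<times> {0..1}) ?g"
  proof -
    have 1: "continuous_on (U \<times> {0..1}) (\<lambda>z. (snd z, fst z))" by (intro continuous_intros)
    have "continuous_on (U \<times> {0..1}) (\<lambda>z. (snd z, (fst z, w (snd z) x0)))"
      by (intro continuous_intros continuous_on_compose2[OF w[OF x0], of _ snd]) auto
    from continuous_on_compose2[OF H this] continuous_on_compose2[OF b 1]
    show ?thesis by (auto simp: case_prod_unfold image_subset_iff intro!: continuous_intros)
  qed
  then obtain X0 where X0: "x0 \<in> X0" "open X0"
    "\<And>x t. x \<in> X0 \<inter> U \<Longrightarrow> t \<in> {0..1} \<Longrightarrow> dist (?g (x, t)) (?g (x0, t)) \<le> e / 8"
    by (rule continuous_on_prod_compactE[OF _ compact_Icc x0, where e = "e / 8"]) (use e in auto)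
  have close: "norm (w s x - w s x0) \<le> e / 2" if x: "x \<in> X0 \<inter> U" and s: "s \<in> {0..1}" for x s
  proof -
    have "norm (w s x - w s x0) \<le> (e / 4) / (1 - 1 / 2)"
    proof (rule sup_contraction_bound[of "\<lambda>s. w s x - w s x0", OF _ _ _ s])
      show "continuous_on {0..1} (\<lambda>s. w s x - w s x0)"
        using w x x0 by (intro continuous_intros) auto
      fix s :: real and M assume s: "s \<in> {0..1}" and M: "\<And>r. r \<in> {0..1} \<Longrightarrow> norm (w r x - w r x0) \<le> M"
      have bb: "norm (b r x - b r x0) \<le> e / 8" "norm (H r (x, w r x0) - H r (x0, w r x0)) \<le> e / 8"
        if "r \<in> {0..1}" for r
        using X0(3)[OF x that] dist_fst_le[of "?g (x, r)" "?g (x0, r)"] dist_snd_le[of "?g (x, r)" "?g (x0, r)"]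
        by (auto simp: dist_norm)
      have "w s x - w s x0 = (b s x - b s x0) + integral {0..s} (\<lambda>r. H r (x, w r x) - H r (x0, w r x0))"
        using x x0 s by (subst integral_diff) (auto simp: eq intro!: integrable_continuous_real
            continuous_on_subset[OF Hw])
      also have "norm \<dots> \<le> e / 8 + (e / 8 + 1 / 2 * M)"
      proof (intro norm_triangle_mono bb[OF s] integral_norm_le[OF s])
        show "continuous_on {0..1} (\<lambda>r. H r (x, w r x) - H r (x0, w r x0))"
          using x x0 by (intro continuous_intros Hw) auto
        fix r :: real assume r: "r \<in> {0..1}"
        have "H r (x, w r x) - H r (x0, w r x0) =
            (H r (x, w r x0) - H r (x0, w r x0)) + (H r (x, w r x) - H r (x, w r x0))" by simp
        also have "norm \<dots> \<le> e / 8 + 1 / 2 * M"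
          using lip[OF r, of x "w r x" "w r x0"] x M[OF r] by (intro norm_triangle_mono bb[OF r]) auto
        finally show "norm (H r (x, w r x) - H r (x0, w r x0)) \<le> e / 8 + 1 / 2 * M" .
      qed
      finally show "norm (w s x - w s x0) \<le> e / 4 + 1 / 2 * M" by simp
    qed simp
    then show ?thesis by simp
  qed
  obtain d1 where d1: "d1 > 0" "\<And>s. s \<in> {0..1} \<Longrightarrow> dist s s0 < d1 \<Longrightarrow> dist (w s x0) (w s0 x0) < e / 2"
    using w[OF x0, unfolded continuous_on_iff, rule_format, of s0 "e / 2"] s0 e by auto
  obtain d2 where d2: "d2 > 0" "ball x0 d2 \<subseteq> X0" using X0(1,2) openE by blast
  show "\<exists>d>0. \<forall>s\<in>{0..1}. \<forall>x\<in>U. dist (s, x) (s0, x0) < d \<longrightarrow> dist (w s x) (w s0 x0) < e"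
  proof (intro exI[of _ "min d1 d2"] conjI ballI impI)
    fix s x assume sx: "s \<in> {0..1}" "x \<in> U" "dist (s, x) (s0, x0) < min d1 d2"
    then have "dist s s0 < d1" "dist x x0 < d2"
      using dist_fst_le[of "(s, x)" "(s0, x0)"] dist_snd_le[of "(s, x)" "(s0, x0)"] by auto
    with sx d2 have "dist (w s x) (w s x0) \<le> e / 2"
      unfolding dist_norm[of "w s x"] by (intro close) (auto simp: dist_commute subset_eq)
    with d1(2)[OF sx(1) \<open>dist s s0 < d1\<close>] show "dist (w s x) (w s0 x0) < e"
      using dist_triangle[of "w s x" "w s0 x0" "w s x0"] by simp
  qed (use d1 d2 in auto)
qed

text \<open>The compact curve \<open>p\<close> has a tube inside \<open>W\<close> on which the
  derivatives differ little from those on the curve. The mean value inequality then bounds the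
  first-order remainder uniformly in \<open>r\<close>.\<close>

lemma uniformly_differentiable:
  fixes H :: "real \<Rightarrow> 'c::euclidean_space \<Rightarrow> 'b::real_normed_vector"
  assumes W: "open W" and H: "pdiff (Suc k) {0..1} W H" and p: "continuous_on {0..1} p"
    and pW: "\<And>r. r \<in> {0..1} \<Longrightarrow> p r \<in> W" and e: "e > 0"
  shows "\<exists>d>0. \<forall>r\<in>{0..1}. \<forall>h. norm h < d \<longrightarrow> p r + h \<in> W \<and>
    norm (H r (p r + h) - H r (p r) - frechet_derivative (H r) (at (p r)) h) \<le> e * norm h"
proof -
  have "compact (p ` {0..1})" by (intro compact_continuous_image p) simp
  moreover have "p ` {0..1} \<subseteq> W" using pW by auto
  ultimately obtain d1 where d1: "d1 > 0" "(\<Union>x\<in>p ` {0..1}. cball x d1) \<subseteq> W"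
    using compact_subset_open_imp_cball_epsilon_subset[OF _ W] by blast
  have inW: "p r + h \<in> W" if "r \<in> {0..1}" "norm h \<le> d1" for r h
  proof -
    have "p r + h \<in> cball (p r) d1" using that by (simp add: dist_norm)
    then show ?thesis using d1(2) that by blast
  qed
  let ?B = "\<lambda>z. Blinfun (frechet_derivative (H (snd z)) (at (p (snd z) + fst z)))"
  have "continuous_on (cball 0 d1 \<times> {0..1}) (\<lambda>z. (snd z, p (snd z) + fst z))"
    by (intro continuous_intros continuous_on_compose2[OF p, of _ snd]) auto
  then have "continuous_on (cball 0 d1 \<times> {0..1}) ?B"
    using continuous_on_compose2[OF pdiff_blinfun(1)[OF H], of "cball 0 d1 \<times> {0..1}" "\<lambda>z. (snd z, p (snd z) + fst z)"]
      inW by (auto simp: image_subset_iff)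
  then obtain X0 where X0: "0 \<in> X0" "open X0"
    "\<And>h r. h \<in> X0 \<inter> cball 0 d1 \<Longrightarrow> r \<in> {0..1} \<Longrightarrow> dist (?B (h, r)) (?B (0, r)) \<le> e"
    by (rule continuous_on_prod_compactE[OF _ compact_Icc, of "cball 0 d1" 0 1 ?B 0 e]) (use e d1 in auto)
  obtain d2 where d2: "d2 > 0" "ball 0 d2 \<subseteq> X0" using X0(1,2) openE by blast
  show ?thesis
  proof (intro exI[of _ "min d1 d2"] conjI ballI allI impI)
    show "min d1 d2 > 0" using d1 d2 by simp
    fix r :: real and h :: 'c assume r: "r \<in> {0..1}" and h: "norm h < min d1 d2"
    show "p r + h \<in> W" using inW[OF r, of h] h by simp
    let ?S = "ball (p r) (min d1 d2)"
    have S: "y \<in> W" "y - p r \<in> X0 \<inter> cball 0 d1" if "y \<in> ?S" for y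
    proof -
      have "norm (y - p r) < min d1 d2" using that by (simp add: dist_norm norm_minus_commute)
      then show "y \<in> W" "y - p r \<in> X0 \<inter> cball 0 d1"
        using inW[OF r, of "y - p r"] d2 by (auto simp: subset_eq)
    qed
    have "norm (H r (p r + h) - H r (p r) - frechet_derivative (H r) (at (p r)) (p r + h - p r)) \<le> norm (p r + h - p r) * e"
    proof (rule differentiable_bound_linearization)
      show "p r + t *\<^sub>R (p r + h - p r) \<in> ?S" if "t \<in> {0..1}" for t
      proof -
        have "norm (t *\<^sub>R h) \<le> norm h" using that by (auto intro: mult_left_le_one_le)
        then show ?thesis using h by (simp add: dist_norm)
      qed
      show "p r \<in> ?S" using d1 d2 by simp
      fix y assume y: "y \<in> ?S"
      show "(H r has_derivative frechet_derivative (H r) (at y)) (at y within ?S)"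
        by (rule has_derivative_at_withinI[OF pdiff_differentiable[OF H r S(1)[OF y]]])
      have "norm (?B (y - p r, r) - ?B (0, r)) \<le> e"
        using X0(3)[OF S(2)[OF y] r] by (simp add: dist_norm)
      moreover have "blinfun_apply (?B (y - p r, r) - ?B (0, r)) =
          frechet_derivative (H r) (at y) - frechet_derivative (H r) (at (p r))"
        using pdiff_blinfun(2)[OF H r S(1)[OF y]] pdiff_blinfun(2)[OF H r pW[OF r]]
        by (auto simp: blinfun.diff_left)
      ultimately show "onorm (frechet_derivative (H r) (at y) - frechet_derivative (H r) (at (p r))) \<le> e"
        by (metis norm_blinfun.rep_eq)
    qed
    then show "norm (H r (p r + h) - H r (p r) - frechet_derivative (H r) (at (p r)) h) \<le> e * norm h"
      by (simp add: mult.commute)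
  qed
qed

text \<open>Difference quotients in the second variable obey the Lipschitz bound, hence so does
  their limit. Thus the linearised Volterra equation inherits the contraction factor of the original
  one.\<close>

lemma lipschitz_derivative_bound:
  fixes F :: "'a::real_normed_vector \<times> 'b::real_normed_vector \<Rightarrow> 'c::real_normed_vector"
  assumes F: "(F has_derivative F') (at (x, y))" and V: "open V" "y \<in> V"
    and lip: "\<And>y'. y' \<in> V \<Longrightarrow> norm (F (x, y') - F (x, y)) \<le> c * norm (y' - y)"
  shows "norm (F' (0, v)) \<le> c * norm v"
proof -
  have "((\<lambda>t. (x, y + t *\<^sub>R v)) has_derivative (\<lambda>t. (0, t *\<^sub>R v))) (at 0)"
    by (auto intro!: derivative_eq_intros)
  from has_derivative_compose[OF this, of F F'] F
  have "((\<lambda>t. F (x, y + t *\<^sub>R v)) has_derivative (\<lambda>t. F' (0, t *\<^sub>R v))) (at 0)" by simp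
  then have lim: "((\<lambda>t. norm (F (x, y + t *\<^sub>R v) - F (x, y) - F' (0, t *\<^sub>R v)) / norm t) \<longlongrightarrow> 0) (at (0::real))"
    by (simp add: has_derivative_at)
  interpret F': bounded_linear F' using F by (rule has_derivative_bounded_linear)
  have sc: "F' (0, t *\<^sub>R v) = t *\<^sub>R F' (0, v)" for t
    using F'.scaleR[of t "(0, v)"] by simp
  have "((\<lambda>t. y + t *\<^sub>R v) \<longlongrightarrow> y + 0 *\<^sub>R v) (at (0::real))" by (intro tendsto_intros)
  then have "eventually (\<lambda>t. y + t *\<^sub>R v \<in> V) (at (0::real))"
    using topological_tendstoD[of _ y "at (0::real)" V] V by simp
  moreover have "eventually (\<lambda>t. t \<noteq> 0) (at (0::real))" by (simp add: eventually_at_filter)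
  ultimately have "eventually (\<lambda>t. norm (F' (0, v)) - c * norm v \<le>
      norm (F (x, y + t *\<^sub>R v) - F (x, y) - F' (0, t *\<^sub>R v)) / norm t) (at (0::real))"
  proof eventually_elim
    case (elim t)
    have "\<bar>t\<bar> * norm (F' (0, v)) = norm (F' (0, t *\<^sub>R v))" by (simp add: sc)
    also have "\<dots> \<le> norm (F (x, y + t *\<^sub>R v) - F (x, y)) + norm (F (x, y + t *\<^sub>R v) - F (x, y) - F' (0, t *\<^sub>R v))"
      using norm_triangle_ineq4[of "F (x, y + t *\<^sub>R v) - F (x, y)" "F (x, y + t *\<^sub>R v) - F (x, y) - F' (0, t *\<^sub>R v)"]
      by simp
    also have "norm (F (x, y + t *\<^sub>R v) - F (x, y)) \<le> \<bar>t\<bar> * (c * norm v)"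
      using lip[OF elim(1)] by (simp add: algebra_simps)
    finally have "\<bar>t\<bar> * (norm (F' (0, v)) - c * norm v) \<le> norm (F (x, y + t *\<^sub>R v) - F (x, y) - F' (0, t *\<^sub>R v))"
      by (simp add: algebra_simps)
    with elim(2) show ?case by (simp add: pos_le_divide_eq mult.commute)
  qed
  from tendsto_lowerbound[OF lim this] show ?thesis by simp
qed

lemma volterra_pdiff:
  fixes H :: "real \<Rightarrow> 'a::euclidean_space \<times> 'b::euclidean_space \<Rightarrow> 'b"
  assumes U: "open U" and V: "open V"
    and H: "pdiff k {0..1} (U \<times> V) H" and b: "pdiff k {0..1} U b"
    and w: "continuous_on ({0..1} \<times> U) (\<lambda>(s, x). w s x)"
    and wV: "\<And>s x. s \<in> {0..1} \<Longrightarrow> x \<in> U \<Longrightarrow> w s x \<in> V"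
    and eq: "\<And>s x. s \<in> {0..1} \<Longrightarrow> x \<in> U \<Longrightarrow> w s x = b s x + integral {0..s} (\<lambda>r. H r (x, w r x))"
    and lip: "\<And>r x y y'. r \<in> {0..1} \<Longrightarrow> x \<in> U \<Longrightarrow> y \<in> V \<Longrightarrow> y' \<in> V \<Longrightarrow>
      norm (H r (x, y) - H r (x, y')) \<le> 1 / 2 * norm (y - y')"
  shows "pdiff k {0..1} U w"
  using V H b w wV eq lip
proof (induction k arbitrary: V H b w)
  case 0
  then show ?case by simp
next
  case (Suc k)
  note V = Suc.prems(1) and H = Suc.prems(2) and b = Suc.prems(3) and w = Suc.prems(4)
    and wV = Suc.prems(5) and eq = Suc.prems(6) and lip = Suc.prems(7)
  have UV: "open (U \<times> V)" "open (U \<times> (UNIV :: 'b set))" using U V by (auto intro: open_Times)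
  define DH where "DH = (\<lambda>r x. frechet_derivative (H r) (at (x, w r x)))"
  have DHder: "(H r has_derivative DH r x) (at (x, w r x))" if "r \<in> {0..1}" "x \<in> U" for r x
    unfolding DH_def by (rule pdiff_differentiable[OF H that(1)]) (use wV[OF that] that in auto)
  have DHlin: "bounded_linear (DH r x)" if "r \<in> {0..1}" "x \<in> U" for r x
    using DHder[OF that] by (rule has_derivative_bounded_linear)
  have DHb: "norm (DH r x (0, v)) \<le> 1 / 2 * norm v" if "r \<in> {0..1}" "x \<in> U" for r x v
    by (rule lipschitz_derivative_bound[OF DHder[OF that] V wV[OF that]])
      (rule lip[OF that _ wV[OF that]])
  \<comment> \<open>The induction hypothesis is used twice: here for \<open>w\<close> itself, so
    that the coefficients of the linearised equation, derivatives of \<open>H\<close> taken along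
    \<open>w\<close>, have order \<open>k\<close>, and below for the solution of that
    equation.\<close>
  have wk: "pdiff k {0..1} U w"
    by (rule Suc.IH[OF V pdiff_SucD[OF H] pdiff_SucD[OF b] w wV eq lip])
  have wc: "continuous_on {0..1} (\<lambda>s. w s x)" if "x \<in> U" for x
  proof -
    have "continuous_on {0..1} (\<lambda>s. (s, x))" by (intro continuous_intros)
    from continuous_on_compose2[OF w this] that show ?thesis by auto
  qed
  have DHk: "pdiff k {0..1} U (\<lambda>r x. DH r x e)" for e
    unfolding DH_def
    by (rule pdiff_compose[OF U UV(1) pdiff_derivative[OF H] pdiff_Pair[OF U pdiff_id wk]])
      (use wV in auto)
  \<comment> \<open>The derivative of the solution solves the linearised equation, whose kernel is \<open>K\<close>; this is
    an equation of the same kind, so that the induction hypothesis applies to it.\<close>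
  define K where "K = (\<lambda>u r z. DH r (fst z) (u, 0) + (\<Sum>j\<in>Basis. (snd z \<bullet> j) *\<^sub>R DH r (fst z) (0, j)))"
  have Kk: "pdiff k {0..1} (U \<times> UNIV) (K u)" for u
  proof -
    have D: "pdiff k {0..1} (U \<times> UNIV) (\<lambda>r z :: 'a \<times> 'b. DH r (fst z) v)" for v
      by (rule pdiff_compose[OF UV(2) U DHk pdiff_linear[OF bounded_linear_fst]]) auto
    show ?thesis
      unfolding K_def
      by (intro pdiff_add[OF UV(2)] pdiff_sum[OF UV(2)] pdiff_scaleR[OF UV(2)] D pdiff_linear
          bounded_linear_compose[OF bounded_linear_inner_left bounded_linear_snd])
  qed
  have K: "K u r (x, y) = DH r x (u, y)" if "r \<in> {0..1}" "x \<in> U" for u r x y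
  proof -
    interpret bounded_linear "DH r x" by (rule DHlin[OF that])
    have "DH r x (u, y) = DH r x (u, 0) + DH r x (0, y)" by (simp flip: add)
    also have "DH r x (0, y) = DH r x (\<Sum>j\<in>Basis. (y \<bullet> j) *\<^sub>R (0, j))"
      by (simp add: euclidean_representation scaleR_prod_def sum_prod)
    also have "\<dots> = (\<Sum>j\<in>Basis. (y \<bullet> j) *\<^sub>R DH r x (0, j))" by (simp only: sum scaleR)
    finally show ?thesis by (simp add: K_def)
  qed
  have Klip: "norm (K u r (x, y) - K u r (x, y')) \<le> 1 / 2 * norm (y - y')"
    if "r \<in> {0..1}" "x \<in> U" for u r x y y'
  proof -
    interpret bounded_linear "DH r x" by (rule DHlin[OF that])
    have "K u r (x, y) - K u r (x, y') = DH r x (0, y - y')" using that by (simp add: K flip: diff)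
    with DHb[OF that] show ?thesis by simp
  qed
  define Db where "Db = (\<lambda>u s x. frechet_derivative (b s) (at x) u)"
  have Dbk: "pdiff k {0..1} U (Db u)" for u unfolding Db_def by (rule pdiff_derivative[OF b])
  have sec: "continuous_on {0..1} (\<lambda>s. f s x)" if "pdiff j {0..1} U f" "x \<in> U" for f :: "real \<Rightarrow> 'a \<Rightarrow> 'b" and j x
  proof -
    have "continuous_on {0..1} (\<lambda>s. (s, x))" by (intro continuous_intros)
    from continuous_on_compose2[OF pdiff_continuous[OF that(1)] this] that(2) show ?thesis by auto
  qed
  have ex: "\<exists>v. continuous_on {0..1} v \<and> (\<forall>s\<in>{0..1}. v s = Db u s x + integral {0..s} (\<lambda>r. K u r (x, v r)))"
    if x: "x \<in> U" for u x
  proof (rule volterra_exists)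
    have "continuous_on ({0..1} \<times> UNIV) (\<lambda>z. (fst z, (x, snd z)))" by (intro continuous_intros)
    from continuous_on_compose2[OF pdiff_continuous[OF Kk] this] x
    show "continuous_on ({0..1} \<times> UNIV) (\<lambda>(r, y). K u r (x, y))" by (auto simp: case_prod_unfold image_subset_iff)
    show "continuous_on {0..1} (\<lambda>s. Db u s x)" by (rule sec[OF Dbk x])
  qed (use Klip x in auto)
  define \<eta>0 where "\<eta>0 = (\<lambda>u x. SOME v. continuous_on {0..1} v \<and>
    (\<forall>s\<in>{0..1}. v s = Db u s x + integral {0..s} (\<lambda>r. K u r (x, v r))))"
  have \<eta>0c: "continuous_on {0..1} (\<eta>0 u x)"
    and \<eta>0: "s \<in> {0..1} \<Longrightarrow> \<eta>0 u x s = Db u s x + integral {0..s} (\<lambda>r. K u r (x, \<eta>0 u x r))"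
    if "x \<in> U" for u x s
    using someI_ex[OF ex[OF that, of u]] unfolding \<eta>0_def by auto
  have \<eta>0k: "pdiff k {0..1} U (\<lambda>s x. \<eta>0 u x s)" for u
  proof (rule Suc.IH[OF open_UNIV Kk Dbk])
    show "continuous_on ({0..1} \<times> U) (\<lambda>(s, x). \<eta>0 u x s)"
      by (rule volterra_continuous[OF pdiff_continuous[OF Kk] pdiff_continuous[OF Dbk]])
        (use Klip \<eta>0c \<eta>0 in auto)
  qed (use Klip \<eta>0 in auto)
  \<comment> \<open>The solutions \<open>\<eta>0\<close> are chosen for each \<open>u\<close>
    separately, which says nothing about linearity. Combining those of the basis vectors makes the
    candidate derivative linear by construction.\<close>
  define \<eta> where "\<eta> = (\<lambda>u s x. \<Sum>i\<in>Basis. (u \<bullet> i) *\<^sub>R \<eta>0 i x s)"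
  have \<eta>k: "pdiff k {0..1} U (\<eta> u)" for u
    unfolding \<eta>_def by (intro pdiff_sum[OF U] pdiff_scaleR[OF U] pdiff_const continuous_intros \<eta>0k)
  have \<eta>lin: "linear (\<lambda>u. \<eta> u s x)" for s x
    unfolding \<eta>_def
    by (intro linearI) (simp_all add: inner_add_left scaleR_add_left sum.distrib scaleR_sum_right)
  have DHc: "continuous_on {0..1} (\<lambda>r. DH r x (f r))" if "continuous_on {0..1} f" "x \<in> U" for f x
  proof -
    have "continuous_on {0..1} (\<lambda>r. \<Sum>j\<in>Basis. (f r \<bullet> j) *\<^sub>R DH r x j)"
      by (intro continuous_intros that sec[OF DHk])
    then show ?thesis
    proof (rule continuous_on_eq)
      fix r :: real assume "r \<in> {0..1}"
      then interpret bounded_linear "DH r x" using DHlin that by blast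
      have "DH r x (f r) = DH r x (\<Sum>j\<in>Basis. (f r \<bullet> j) *\<^sub>R j)" by (simp add: euclidean_representation)
      then show "(\<Sum>j\<in>Basis. (f r \<bullet> j) *\<^sub>R DH r x j) = DH r x (f r)" by (simp add: sum scaleR)
    qed
  qed
  have \<eta>: "\<eta> u s x = Db u s x + integral {0..s} (\<lambda>r. DH r x (u, \<eta> u r x))"
    if s: "s \<in> {0..1}" and x: "x \<in> U" for u s x
  proof -
    have int: "(\<lambda>r. (u \<bullet> i) *\<^sub>R DH r x (i, \<eta>0 i x r)) integrable_on {0..s}" for i
      using s by (intro integrable_continuous_real continuous_intros continuous_on_subset[OF DHc] \<eta>0c x) auto
    have "linear (frechet_derivative (b s) (at x))"
      using pdiff_differentiable[OF b s x] by (rule has_derivative_linear)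
    then have Db: "Db u s x = (\<Sum>i\<in>Basis. (u \<bullet> i) *\<^sub>R Db i s x)"
      unfolding Db_def
      by (subst (1) euclidean_representation[of u, symmetric]) (simp only: linear_sum linear_cmul)
    have "\<eta> u s x = (\<Sum>i\<in>Basis. (u \<bullet> i) *\<^sub>R Db i s x + integral {0..s} (\<lambda>r. (u \<bullet> i) *\<^sub>R DH r x (i, \<eta>0 i x r)))"
      unfolding \<eta>_def
    proof (intro sum.cong refl)
      fix i :: 'a
      have "integral {0..s} (\<lambda>r. K i r (x, \<eta>0 i x r)) = integral {0..s} (\<lambda>r. DH r x (i, \<eta>0 i x r))"
        using s x by (intro integral_cong) (auto simp: K)
      then show "(u \<bullet> i) *\<^sub>R \<eta>0 i x s =
          (u \<bullet> i) *\<^sub>R Db i s x + integral {0..s} (\<lambda>r. (u \<bullet> i) *\<^sub>R DH r x (i, \<eta>0 i x r))"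
        by (subst \<eta>0[OF x s]) (simp add: scaleR_add_right)
    qed
    also have "\<dots> = Db u s x + integral {0..s} (\<lambda>r. \<Sum>i\<in>Basis. (u \<bullet> i) *\<^sub>R DH r x (i, \<eta>0 i x r))"
      by (simp add: sum.distrib Db integral_sum[OF finite_Basis int])
    also have "integral {0..s} (\<lambda>r. \<Sum>i\<in>Basis. (u \<bullet> i) *\<^sub>R DH r x (i, \<eta>0 i x r)) =
        integral {0..s} (\<lambda>r. DH r x (u, \<eta> u r x))"
    proof (rule integral_cong)
      fix r assume "r \<in> {0..s}"
      then interpret bounded_linear "DH r x" using s x by (intro DHlin) auto
      have "(\<Sum>i\<in>Basis. (u \<bullet> i) *\<^sub>R DH r x (i, \<eta>0 i x r)) = DH r x (\<Sum>i\<in>Basis. (u \<bullet> i) *\<^sub>R (i, \<eta>0 i x r))"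
        by (simp only: sum scaleR)
      also have "(\<Sum>i\<in>Basis. (u \<bullet> i) *\<^sub>R (i, \<eta>0 i x r)) = (u, \<eta> u r x)"
        by (simp add: euclidean_representation scaleR_prod_def sum_prod \<eta>_def)
      finally show "(\<Sum>i\<in>Basis. (u \<bullet> i) *\<^sub>R DH r x (i, \<eta>0 i x r)) = DH r x (u, \<eta> u r x)" .
    qed
    finally show ?thesis .
  qed
  have der: "(w s has_derivative (\<lambda>u. \<eta> u s x)) (at x)" if s: "s \<in> {0..1}" and x: "x \<in> U" for s x
    unfolding has_derivative_at_alt
  proof (intro conjI allI impI)
    show "bounded_linear (\<lambda>u. \<eta> u s x)" using \<eta>lin linear_conv_bounded_linear by blast
    fix e :: real assume e: "e > 0"
    have "\<exists>C. \<forall>r\<in>{0..1}. norm (\<eta>0 i x r) \<le> C" for i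
      using compact_imp_bounded[OF compact_continuous_image[OF \<eta>0c[OF x, of i] compact_Icc]]
      unfolding bounded_iff by auto
    then obtain C where C: "\<And>i r. r \<in> {0..1} \<Longrightarrow> norm (\<eta>0 i x r) \<le> C i" by metis
    define C1 where "C1 = (\<Sum>i\<in>Basis. \<bar>C i\<bar>)"
    have C1: "C1 \<ge> 0" "norm (\<eta> u r x) \<le> C1 * norm u" if "r \<in> {0..1}" for u r
    proof -
      show "C1 \<ge> 0" unfolding C1_def by (intro sum_nonneg) auto
      have "norm (\<eta> u r x) \<le> (\<Sum>i\<in>Basis. norm u * \<bar>C i\<bar>)"
        unfolding \<eta>_def
      proof (rule sum_norm_le)
        fix i :: 'a assume "i \<in> Basis"
        then have "\<bar>u \<bullet> i\<bar> \<le> norm u" by (rule Basis_le_norm)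
        moreover have "norm (\<eta>0 i x r) \<le> \<bar>C i\<bar>" using C[OF that, of i] by linarith
        ultimately show "norm ((u \<bullet> i) *\<^sub>R \<eta>0 i x r) \<le> norm u * \<bar>C i\<bar>"
          by (simp add: mult_mono)
      qed
      then show "norm (\<eta> u r x) \<le> C1 * norm u" by (simp add: C1_def sum_distrib_left mult.commute)
    qed
    \<comment> \<open>The bound 1/4 keeps the contraction factor \<open>e' + 1 / 2\<close> at most
      3/4. Dividing by \<open>1 - 3 / 4\<close> then costs a factor 4, which the second bound
      absorbs.\<close>
    define e' where "e' = min (1 / 4) (e / (4 * (C1 + 2)))"
    have e': "e' > 0" "e' \<le> 1 / 4" "4 * (e' * (C1 + 2)) \<le> e"
    proof -
      have "C1 + 2 > 0" using C1(1)[of 0] by simp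
      then show "e' > 0" using e by (auto simp: e'_def)
      show "e' \<le> 1 / 4" unfolding e'_def by (rule min.cobounded1)
      have "e' \<le> e / (4 * (C1 + 2))" by (simp add: e'_def)
      with \<open>C1 + 2 > 0\<close> show "4 * (e' * (C1 + 2)) \<le> e" by (simp add: field_simps)
    qed
    have "continuous_on {0..1} (\<lambda>r. (x, w r x))" by (intro continuous_intros wc x)
    then obtain d1 where d1: "d1 > 0" "\<And>r h. r \<in> {0..1} \<Longrightarrow> norm h < d1 \<Longrightarrow>
        norm (H r ((x, w r x) + h) - H r (x, w r x) - DH r x h) \<le> e' * norm h"
      using uniformly_differentiable[OF UV(1) H, of "\<lambda>r. (x, w r x)" e'] wV x e'(1) unfolding DH_def by force
    obtain d2 where d2: "d2 > 0" "\<And>r h. r \<in> {0..1} \<Longrightarrow> norm h < d2 \<Longrightarrow>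
        norm (b r (x + h) - b r x - Db h r x) \<le> e' * norm h"
      using uniformly_differentiable[OF U b, of "\<lambda>r. x" e'] x e'(1) unfolding Db_def by force
    have "continuous_on (U \<times> {0..1}) (\<lambda>(x, s). w s x)"
    proof -
      have "continuous_on (U \<times> {0..1}) (\<lambda>z. (snd z, fst z))" by (intro continuous_intros)
      from continuous_on_compose2[OF w this] show ?thesis by (auto simp: case_prod_unfold image_subset_iff)
    qed
    then obtain X0 where X0: "x \<in> X0" "open X0"
      "\<And>y r. y \<in> X0 \<inter> U \<Longrightarrow> r \<in> {0..1} \<Longrightarrow> dist (w r y) (w r x) \<le> d1 / 4"
      by (rule continuous_on_prod_compactE[OF _ compact_Icc x, where e = "d1 / 4"]) (use d1 in auto)
    obtain d3 where d3: "d3 > 0" "ball x d3 \<subseteq> X0 \<inter> U"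
      using X0(1,2) U x openE[of "X0 \<inter> U" x] by blast
    show "\<exists>d>0. \<forall>y. norm (y - x) < d \<longrightarrow> norm (w s y - w s x - \<eta> (y - x) s x) \<le> e * norm (y - x)"
    proof (intro exI[of _ "min (d1 / 4) (min d2 d3)"] conjI allI impI)
      show "min (d1 / 4) (min d2 d3) > 0" using d1 d2 d3 by simp
      fix y assume y: "norm (y - x) < min (d1 / 4) (min d2 d3)"
      then have yX: "y \<in> X0 \<inter> U" using d3 by (auto simp: dist_norm norm_minus_commute subset_eq)
      then have yU: "y \<in> U" by simp
      define u where "u = y - x"
      define \<Delta> where "\<Delta> = (\<lambda>r. w r y - w r x)"
      define err where "err = (\<lambda>r. \<Delta> r - \<eta> u r x)"
      have \<eta>c: "continuous_on {0..1} (\<lambda>r. \<eta> u r x)" by (rule sec[OF \<eta>k x])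
      have \<Delta>c: "continuous_on {0..1} \<Delta>" unfolding \<Delta>_def by (intro continuous_intros wc x yU)
      have Hc: "continuous_on {0..1} (\<lambda>r. H r (z, w r z))" if "z \<in> U" for z
      proof -
        have "continuous_on {0..1} (\<lambda>r. (r, (z, w r z)))" by (intro continuous_intros wc that)
        from continuous_on_compose2[OF pdiff_continuous[OF H] this] that wV show ?thesis by (auto simp: image_subset_iff)
      qed
      have "norm (err s) \<le> (e' * (C1 + 2) * norm u) / (1 - 3 / 4)"
      proof (rule sup_contraction_bound[OF _ _ _ s])
        show "continuous_on {0..1} err" unfolding err_def by (intro continuous_intros \<Delta>c \<eta>c)
        fix s :: real and m assume s: "s \<in> {0..1}" and m: "\<And>r. r \<in> {0..1} \<Longrightarrow> norm (err r) \<le> m"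
        \<comment> \<open>The first-order remainder of \<open>H r\<close> for the true increment
          \<open>(u, \<Delta> r)\<close>. Passing from \<open>\<Delta> r\<close> to the predicted
          increment \<open>\<eta> u r x\<close> adds a term in \<open>err r\<close>, which
          \<open>DHb\<close> contracts.\<close>
        define rest where "rest = (\<lambda>r. H r (y, w r y) - H r (x, w r x) - DH r x (u, \<Delta> r))"
        have rest: "norm (rest r) \<le> e' * (norm u + (m + C1 * norm u))" if r: "r \<in> {0..1}" for r
        proof -
          have "norm (u, \<Delta> r) \<le> norm u + norm (\<Delta> r)" by (simp add: norm_Pair sqrt_sum_squares_le_sum)
          also have "norm (\<Delta> r) \<le> d1 / 4" using X0(3)[OF yX r] by (simp add: \<Delta>_def dist_norm)
          finally have "norm (u, \<Delta> r) < d1" using y d1(1) by (simp add: u_def)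
          from d1(2)[OF r this] have "norm (rest r) \<le> e' * norm (u, \<Delta> r)"
            by (simp add: rest_def u_def \<Delta>_def)
          also have "norm (u, \<Delta> r) \<le> norm u + norm (\<Delta> r)" by (simp add: norm_Pair sqrt_sum_squares_le_sum)
          also have "norm (\<Delta> r) \<le> norm (err r) + norm (\<eta> u r x)"
            using norm_triangle_ineq[of "err r" "\<eta> u r x"] by (simp add: err_def)
          also have "\<dots> \<le> m + C1 * norm u" using m[OF r] C1(2)[OF r] by (rule add_mono)
          finally show ?thesis using e'(1) by simp
        qed
        have restc: "continuous_on {0..1} rest"
          unfolding rest_def by (intro continuous_intros Hc DHc \<Delta>c x yU)
        have errc: "continuous_on {0..1} (\<lambda>r. DH r x (0, err r))"
          unfolding err_def by (intro DHc continuous_intros \<Delta>c \<eta>c x)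
        have sub: "{0..s} \<subseteq> {0..1}" using s by auto
        note ints = integrable_continuous_real[OF continuous_on_subset[OF _ sub]]
        have "err s = (b s y - b s x - Db u s x) + (integral {0..s} (\<lambda>r. H r (y, w r y))
            - integral {0..s} (\<lambda>r. H r (x, w r x)) - integral {0..s} (\<lambda>r. DH r x (u, \<eta> u r x)))"
          unfolding err_def \<Delta>_def using eq[OF s yU] eq[OF s x] \<eta>[OF s x, of u] by simp
        also have "integral {0..s} (\<lambda>r. H r (y, w r y)) - integral {0..s} (\<lambda>r. H r (x, w r x))
            - integral {0..s} (\<lambda>r. DH r x (u, \<eta> u r x)) =
            integral {0..s} (\<lambda>r. H r (y, w r y) - H r (x, w r x) - DH r x (u, \<eta> u r x))"
          by (simp add: integral_diff ints integrable_diff Hc DHc x yU \<eta>c continuous_intros)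
        also have "\<dots> = integral {0..s} (\<lambda>r. rest r + DH r x (0, err r))"
        proof (rule integral_cong)
          fix r assume "r \<in> {0..s}"
          then interpret bounded_linear "DH r x" using s x by (intro DHlin) auto
          have "DH r x (u, \<eta> u r x) = DH r x (u, \<Delta> r) - DH r x (0, err r)"
            by (simp add: err_def flip: diff)
          then show "H r (y, w r y) - H r (x, w r x) - DH r x (u, \<eta> u r x) = rest r + DH r x (0, err r)"
            by (simp add: rest_def)
        qed
        also have "norm ((b s y - b s x - Db u s x) + \<dots>) \<le>
            e' * norm u + (e' * (norm u + (m + C1 * norm u)) + 1 / 2 * m)"
        proof (intro norm_triangle_mono integral_norm_le[OF s])
          show "norm (b s y - b s x - Db u s x) \<le> e' * norm u"
            using d2(2)[OF s, of u] y by (simp add: u_def)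
          show "continuous_on {0..1} (\<lambda>r. rest r + DH r x (0, err r))"
            by (intro continuous_intros restc errc)
          fix r :: real assume r: "r \<in> {0..1}"
          show "norm (rest r) \<le> e' * (norm u + (m + C1 * norm u))" by (rule rest[OF r])
          show "norm (DH r x (0, err r)) \<le> 1 / 2 * m"
            using DHb[OF r x, of "err r"] m[OF r] by simp
        qed
        also have "\<dots> = e' * (C1 + 2) * norm u + (e' + 1 / 2) * m" by (simp add: algebra_simps)
        also have "\<dots> \<le> e' * (C1 + 2) * norm u + 3 / 4 * m"
          using e'(2) m[OF s] order_trans[OF norm_ge_zero m[OF s]] by (intro add_left_mono mult_right_mono) auto
        finally show "norm (err s) \<le> e' * (C1 + 2) * norm u + 3 / 4 * m" .
      qed simp
      also have "\<dots> = (4 * (e' * (C1 + 2))) * norm u" by simp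
      also have "\<dots> \<le> e * norm u" by (intro mult_right_mono e') simp
      finally show "norm (w s y - w s x - \<eta> (y - x) s x) \<le> e * norm (y - x)"
        by (simp add: err_def \<Delta>_def u_def)
    qed
  qed
  show ?case by (rule pdiff_SucI[OF U w der \<eta>k])
qed

section \<open>Linearisation of Euler fields\<close>

text \<open>For \<open>P 0 = 0\<close> this is the Hadamard quotient
  \<open>P (r *\<^sub>R w) / r\<close>, in the integral form that remains meaningful at
  \<open>r = 0\<close>.\<close>

definition hadamard :: "('a::euclidean_space \<Rightarrow> 'b::euclidean_space) \<Rightarrow> real \<Rightarrow> 'a \<Rightarrow> 'b" where
  "hadamard P r w = integral {0..1} (\<lambda>t. frechet_derivative P (at ((r * t) *\<^sub>R w)) w)"

lemma scaleR_in_ball: "\<bar>s\<bar> \<le> 1 \<Longrightarrow> w \<in> ball 0 R \<Longrightarrow> s *\<^sub>R w \<in> ball (0::'a::real_normed_vector) R"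
  using mult_right_mono[of "\<bar>s\<bar>" 1 "norm w"] by simp

lemma frechet_derivative_euclidean:
  fixes f :: "'a::euclidean_space \<Rightarrow> 'b::real_normed_vector"
  assumes "f differentiable (at x)"
  shows "frechet_derivative f (at x) u = (\<Sum>i\<in>Basis. (u \<bullet> i) *\<^sub>R frechet_derivative f (at x) i)"
proof -
  have "linear (frechet_derivative f (at x))"
    using assms by (simp add: linear_frechet_derivative)
  then show ?thesis
    by (subst (1) euclidean_representation[of u, symmetric]) (simp add: linear_sum linear_cmul)
qed

lemma pdiff_hadamard:
  assumes P: "smooth_on (ball 0 R) P"
  shows "pdiff k {0..1} (ball 0 R) (hadamard P)"
proof -
  let ?U = "ball (0::'a) R"
  have g: "pdiff k ({0..1} \<times> {0..1}) ?U (\<lambda>z w. (fst z * snd z) *\<^sub>R w)"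
    by (intro pdiff_scaleR pdiff_const pdiff_id continuous_intros) auto
  have gU: "(fst z * snd z) *\<^sub>R w \<in> ?U" if "z \<in> {0..1} \<times> {0..1}" "w \<in> ?U" for z w
    by (rule scaleR_in_ball[OF _ that(2)]) (use that(1) in \<open>auto simp: mult_le_one\<close>)
  have D: "pdiff k ({0..1} \<times> {0..1}) ?U (\<lambda>z w. frechet_derivative P (at ((fst z * snd z) *\<^sub>R w)) i)" for i
    by (rule pdiff_compose[OF open_ball open_ball smooth_on_pdiff[OF smooth_on_derivative[OF P]] g gU])
  have "pdiff k ({0..1} \<times> {0..1}) ?U (\<lambda>z w. \<Sum>i\<in>Basis. (w \<bullet> i) *\<^sub>R frechet_derivative P (at ((fst z * snd z) *\<^sub>R w)) i)"
    by (intro pdiff_sum pdiff_scaleR D pdiff_linear bounded_linear_inner_left) auto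
  then have "pdiff k ({0..1} \<times> {0..1}) ?U (\<lambda>z w. frechet_derivative P (at ((fst z * snd z) *\<^sub>R w)) w)"
  proof (rule pdiff_cong[OF open_ball])
    fix z :: "real \<times> real" and w assume "z \<in> {0..1} \<times> {0..1}" "w \<in> ?U"
    then have "P differentiable (at ((fst z * snd z) *\<^sub>R w))"
      using smooth_on_differentiable[OF P gU] differentiableI by blast
    then show "frechet_derivative P (at ((fst z * snd z) *\<^sub>R w)) w =
        (\<Sum>i\<in>Basis. (w \<bullet> i) *\<^sub>R frechet_derivative P (at ((fst z * snd z) *\<^sub>R w)) i)"
      by (rule frechet_derivative_euclidean)
  qed
  from pdiff_integral[OF open_ball this] show ?thesis by (simp add: hadamard_def[abs_def])
qed

lemma smooth_on_ray:
  assumes P: "smooth_on (ball 0 R) P" and w: "w \<in> ball 0 R" and t: "t \<in> {0..1}"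
  shows "((\<lambda>t. P (t *\<^sub>R w)) has_vector_derivative frechet_derivative P (at (t *\<^sub>R w)) w) (at t within T)"
proof -
  have in_ball: "t *\<^sub>R w \<in> ball 0 R" using t w by (intro scaleR_in_ball) auto
  have "((\<lambda>t. P (t *\<^sub>R w)) has_derivative (\<lambda>h. frechet_derivative P (at (t *\<^sub>R w)) (h *\<^sub>R w))) (at t)"
    by (rule has_derivative_compose[where g = P and f = "\<lambda>t. t *\<^sub>R w" and s = UNIV, OF _ smooth_on_differentiable[OF P in_ball]])
      (auto intro!: derivative_eq_intros)
  moreover have "linear (frechet_derivative P (at (t *\<^sub>R w)))"
    using smooth_on_differentiable[OF P in_ball] by (rule has_derivative_linear)
  ultimately have "((\<lambda>t. P (t *\<^sub>R w)) has_vector_derivative frechet_derivative P (at (t *\<^sub>R w)) w) (at t)"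
    by (simp add: has_vector_derivative_def linear_cmul)
  then show ?thesis by (rule has_vector_derivative_at_within)
qed

lemma hadamard_eq:
  assumes P: "smooth_on (ball 0 R) P" "P 0 = 0" and w: "w \<in> ball 0 R" and r: "r \<in> {0..1}"
  shows "P (r *\<^sub>R w) = r *\<^sub>R hadamard P r w"
proof -
  have rw: "r *\<^sub>R w \<in> ball 0 R" using r w by (intro scaleR_in_ball) auto
  have "((\<lambda>t. frechet_derivative P (at (t *\<^sub>R r *\<^sub>R w)) (r *\<^sub>R w)) has_integral P (1 *\<^sub>R r *\<^sub>R w) - P (0 *\<^sub>R r *\<^sub>R w)) {0..1}"
    by (rule fundamental_theorem_of_calculus, simp, rule smooth_on_ray[OF P(1) rw])
  then have "P (r *\<^sub>R w) = integral {0..1} (\<lambda>t. frechet_derivative P (at (t *\<^sub>R r *\<^sub>R w)) (r *\<^sub>R w))"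
    using P(2) by (simp add: integral_unique)
  also have "\<dots> = integral {0..1} (\<lambda>t. r *\<^sub>R frechet_derivative P (at ((r * t) *\<^sub>R w)) w)"
  proof (rule integral_cong)
    fix t :: real assume "t \<in> {0..1}"
    then have "t *\<^sub>R r *\<^sub>R w \<in> ball 0 R" by (intro scaleR_in_ball[OF _ rw]) auto
    from has_derivative_linear[OF smooth_on_differentiable[OF P(1) this]]
    show "frechet_derivative P (at (t *\<^sub>R r *\<^sub>R w)) (r *\<^sub>R w) = r *\<^sub>R frechet_derivative P (at ((r * t) *\<^sub>R w)) w"
      by (simp add: linear_cmul mult.commute)
  qed
  finally show ?thesis by (simp add: hadamard_def)
qed

lemma hadamard_scaleR:
  assumes P: "smooth_on (ball 0 R) P" and w: "w \<in> ball 0 R" and r: "r \<in> {0..1}" "s \<in> {0..1}"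
  shows "hadamard P r (s *\<^sub>R w) = s *\<^sub>R hadamard P (r * s) w"
proof -
  have "hadamard P r (s *\<^sub>R w) = integral {0..1} (\<lambda>t. s *\<^sub>R frechet_derivative P (at ((r * s * t) *\<^sub>R w)) w)"
    unfolding hadamard_def
  proof (rule integral_cong)
    fix t :: real assume "t \<in> {0..1}"
    then have "(r * t) *\<^sub>R s *\<^sub>R w \<in> ball 0 R"
      using w r by (intro scaleR_in_ball) (auto simp: mult_le_one)
    from has_derivative_linear[OF smooth_on_differentiable[OF P this]]
    show "frechet_derivative P (at ((r * t) *\<^sub>R s *\<^sub>R w)) (s *\<^sub>R w) = s *\<^sub>R frechet_derivative P (at ((r * s * t) *\<^sub>R w)) w"
      by (simp add: linear_cmul mult_ac)
  qed
  then show ?thesis by (simp add: hadamard_def)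
qed

lemma onorm_Lipschitz_ball:
  fixes f :: "'a::euclidean_space \<Rightarrow> 'b::real_normed_vector"
  assumes "\<And>x. x \<in> S \<Longrightarrow> (f has_derivative f' x) (at x)" "convex S"
    "\<And>x. x \<in> S \<Longrightarrow> onorm (f' x) \<le> B" "x \<in> S" "y \<in> S"
  shows "norm (f x - f y) \<le> B * norm (x - y)"
  by (rule differentiable_bound[OF assms(2) _ assms(3-5)]) (use assms(1) has_derivative_at_withinI in blast)+

lemma euler_linearization:
  fixes E :: "'a::euclidean_space \<Rightarrow> 'a"
  assumes R: "R > 0" and E: "smooth_on (ball 0 R) E" and E0: "E 0 = 0"
    and DE0: "\<And>u. frechet_derivative E (at 0) u = u"
  obtains \<rho> \<psi> where "\<rho> > 0" "smooth_on (ball 0 \<rho>) \<psi>" "\<psi> 0 = 0" "(\<psi> has_derivative (\<lambda>u. u)) (at 0)"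
    "\<And>x. x \<in> ball 0 \<rho> \<Longrightarrow> \<psi> x \<in> ball 0 R"
    "\<And>x. x \<in> ball 0 \<rho> \<Longrightarrow> frechet_derivative \<psi> (at x) x = E (\<psi> x)"
proof -
  \<comment> \<open>The columns of the derivative of \<open>E\<close> minus the identity. They
    vanish at the origin, so that a second Hadamard quotient can be taken.\<close>
  define P where "P = (\<lambda>j y. frechet_derivative E (at y) j - j)"
  have P: "smooth_on (ball 0 R) (P j)" "P j 0 = 0" for j
    unfolding P_def by (auto intro!: smooth_on_diff smooth_on_derivative E smooth_on_const simp: DE0)
  define N where "N = (\<lambda>j r w. integral {0..1} (\<lambda>t. t *\<^sub>R hadamard (P j) (r * t) w))"
  \<comment> \<open>For \<open>r > 0\<close> this is
    \<open>(E (r *\<^sub>R w) - r *\<^sub>R w) / r\<^sup>2\<close>: one factor \<open>r\<close>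
    comes from integrating along the ray, the other from the vanishing of \<open>P j\<close> at the
    origin.\<close>
  define G where "G = (\<lambda>r w. \<Sum>j\<in>Basis. (w \<bullet> j) *\<^sub>R N j r w)"
  have N: "pdiff k {0..1} (ball 0 R) (N j)" for k j
  proof -
    have "pdiff k ({0..1} \<times> {0..1}) (ball 0 R) (\<lambda>z. hadamard (P j) (fst z * snd z))"
      by (rule pdiff_reparam[OF _ _ pdiff_hadamard[OF P(1)]])
        (auto intro!: continuous_intros simp: mult_le_one)
    then have "pdiff k ({0..1} \<times> {0..1}) (ball 0 R) (\<lambda>z w. snd z *\<^sub>R hadamard (P j) (fst z * snd z) w)"
      by (intro pdiff_scaleR pdiff_const continuous_intros) auto
    from pdiff_integral[OF open_ball this] show ?thesis by (simp add: N_def[abs_def])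
  qed
  have G: "pdiff k {0..1} (ball 0 R) G" for k
    unfolding G_def
    by (intro pdiff_sum pdiff_scaleR N pdiff_linear bounded_linear_inner_left) auto
  have Nscale: "N j r (s *\<^sub>R w) = s *\<^sub>R N j (r * s) w" if "w \<in> ball 0 R" "r \<in> {0..1}" "s \<in> {0..1}" for j r s w
  proof -
    have "N j r (s *\<^sub>R w) = integral {0..1} (\<lambda>t. s *\<^sub>R (t *\<^sub>R hadamard (P j) (r * s * t) w))"
      unfolding N_def
    proof (rule integral_cong)
      fix t :: real assume "t \<in> {0..1}"
      then have "r * t \<in> {0..1}" using that by (auto simp: mult_le_one)
      from hadamard_scaleR[OF P(1) that(1) this that(3)]
      show "t *\<^sub>R hadamard (P j) (r * t) (s *\<^sub>R w) = s *\<^sub>R (t *\<^sub>R hadamard (P j) (r * s * t) w)"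
        by (simp add: mult_ac)
    qed
    then show ?thesis unfolding N_def integral_cmul .
  qed
  have Gscale: "G r (s *\<^sub>R w) = s\<^sup>2 *\<^sub>R G (r * s) w" if "w \<in> ball 0 R" "r \<in> {0..1}" "s \<in> {0..1}" for r s w
    unfolding G_def by (simp add: Nscale[OF that] scaleR_sum_right power2_eq_square mult_ac)
  have N0: "N j r 0 = 0" if "r \<in> {0..1}" for j r
    using Nscale[of 0 r 0 j] R that by simp
  have G0: "G r 0 = 0" for r by (simp add: G_def)
  have GE: "E w = w + G 1 w" if w: "w \<in> ball 0 R" for w
  proof -
    have "((\<lambda>t. frechet_derivative E (at (t *\<^sub>R w)) w - w) has_integral
        (E (1 *\<^sub>R w) - 1 *\<^sub>R w) - (E (0 *\<^sub>R w) - 0 *\<^sub>R w)) {0..1}"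
      by (rule fundamental_theorem_of_calculus)
        (auto intro!: derivative_eq_intros smooth_on_ray[OF E w])
    then have "E w - w = integral {0..1} (\<lambda>t. frechet_derivative E (at (t *\<^sub>R w)) w - w)"
      using E0 by (simp add: integral_unique)
    also have "\<dots> = integral {0..1} (\<lambda>t. \<Sum>j\<in>Basis. (w \<bullet> j) *\<^sub>R (t *\<^sub>R hadamard (P j) t w))"
    proof (rule integral_cong)
      fix t :: real assume t: "t \<in> {0..1}"
      then have "t *\<^sub>R w \<in> ball 0 R" using w by (intro scaleR_in_ball) auto
      then have "E differentiable (at (t *\<^sub>R w))" using smooth_on_differentiable[OF E] differentiableI by blast
      then have "frechet_derivative E (at (t *\<^sub>R w)) w - w =
          (\<Sum>j\<in>Basis. (w \<bullet> j) *\<^sub>R frechet_derivative E (at (t *\<^sub>R w)) j) - (\<Sum>j\<in>Basis. (w \<bullet> j) *\<^sub>R j)"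
        using frechet_derivative_euclidean[of E _ w] by (simp only: euclidean_representation)
      also have "\<dots> = (\<Sum>j\<in>Basis. (w \<bullet> j) *\<^sub>R P j (t *\<^sub>R w))"
        by (simp add: P_def scaleR_diff_right sum_subtractf)
      finally show "frechet_derivative E (at (t *\<^sub>R w)) w - w = (\<Sum>j\<in>Basis. (w \<bullet> j) *\<^sub>R (t *\<^sub>R hadamard (P j) t w))"
        by (simp add: hadamard_eq[OF P w t])
    qed
    also have "\<dots> = G 1 w"
    proof -
      have "continuous_on {0..1} (\<lambda>t. hadamard (P j) t w)" for j
      proof -
        have "continuous_on {0..1} (\<lambda>t. (t::real, w))" by (intro continuous_intros)
        from continuous_on_compose2[OF pdiff_continuous[OF pdiff_hadamard[OF P(1)]] this] w
        show ?thesis by (auto simp: image_subset_iff)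
      qed
      then have "(\<lambda>t. (w \<bullet> j) *\<^sub>R (t *\<^sub>R hadamard (P j) t w)) integrable_on {0..1}" for j
        by (intro integrable_continuous_real continuous_intros)
      then have "integral {0..1} (\<lambda>t. \<Sum>j\<in>Basis. (w \<bullet> j) *\<^sub>R (t *\<^sub>R hadamard (P j) t w)) =
          (\<Sum>j\<in>Basis. (w \<bullet> j) *\<^sub>R integral {0..1} (\<lambda>t. t *\<^sub>R hadamard (P j) t w))"
        by (subst integral_sum) (simp_all only: finite_Basis integral_cmul)
      then show ?thesis by (simp add: G_def N_def)
    qed
    finally show ?thesis by (simp add: algebra_simps)
  qed
  have DG0: "frechet_derivative (G r) (at 0) u = 0" if r: "r \<in> {0..1}" for r u
  proof -
    have Nd: "(N j r has_derivative frechet_derivative (N j r) (at 0)) (at 0)" for j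
      using pdiff_differentiable[OF N r] R by simp
    have "(G r has_derivative (\<lambda>u. \<Sum>j\<in>Basis. (0 \<bullet> j) *\<^sub>R frechet_derivative (N j r) (at 0) u + (u \<bullet> j) *\<^sub>R N j r 0)) (at 0)"
      unfolding G_def
      by (intro has_derivative_sum has_derivative_scaleR Nd
          bounded_linear_imp_has_derivative bounded_linear_inner_left)
    then show ?thesis using frechet_derivative_eq[of "G r"] N0[OF r] by simp
  qed
  let ?B = "\<lambda>z. Blinfun (frechet_derivative (G (snd z)) (at (fst z)))"
  have "continuous_on (ball 0 R \<times> {0..1}) (\<lambda>z. (snd z, fst z))" by (intro continuous_intros)
  from continuous_on_compose2[OF pdiff_blinfun(1)[OF G] this]
  have "continuous_on (ball 0 R \<times> {0..1}) ?B" by (auto simp: image_subset_iff)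
  then obtain X0 where X0: "0 \<in> X0" "open X0"
    "\<And>h r. h \<in> X0 \<inter> ball 0 R \<Longrightarrow> r \<in> {0..1} \<Longrightarrow> dist (?B (h, r)) (?B (0, r)) \<le> 1 / 2"
    by (rule continuous_on_prod_compactE[OF _ compact_Icc, where ?x0.0 = 0 and e = "1 / 2"]) (use R in auto)
  \<comment> \<open>Every \<open>G r\<close> has derivative zero at the origin, so a small ball
    gives Lipschitz constant 1/2 for all \<open>r\<close> at once.\<close>
  obtain \<rho> where \<rho>: "\<rho> > 0" "ball 0 \<rho> \<subseteq> X0 \<inter> ball 0 R"
    using X0(1,2) R openE[of "X0 \<inter> ball 0 R" 0] by auto
  have Glip: "norm (G r y - G r y') \<le> 1 / 2 * norm (y - y')"
    if "r \<in> {0..1}" "y \<in> ball 0 \<rho>" "y' \<in> ball 0 \<rho>" for r y y'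
  proof (rule onorm_Lipschitz_ball[OF _ convex_ball _ that(2,3)])
    fix x :: 'a assume x: "x \<in> ball 0 \<rho>"
    then have x': "x \<in> X0 \<inter> ball 0 R" using \<rho> by blast
    show "(G r has_derivative frechet_derivative (G r) (at x)) (at x)"
      by (rule pdiff_differentiable[OF G that(1)]) (use x' in blast)
    have "?B (0, r) = 0"
      by (rule blinfun_eqI) (use pdiff_blinfun(2)[OF G that(1), of 0] DG0[OF that(1)] R in simp)
    then have "norm (?B (x, r)) \<le> 1 / 2" using X0(3)[OF x' that(1)] by (simp add: dist_norm)
    then show "onorm (frechet_derivative (G r) (at x)) \<le> 1 / 2"
      using pdiff_blinfun(2)[OF G that(1), of x] x' by (simp add: norm_blinfun.rep_eq)
  qed
  \<comment> \<open>A nonexpansive retraction onto a ball extends \<open>G r\<close> to the whole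
    space without losing the Lipschitz constant, as \<open>volterra_exists\<close> requires. It is
    not smooth and is removed again below.\<close>
  define q where "q = closest_point (cball (0::'a) (\<rho> / 2))"
  have q: "q y \<in> cball 0 (\<rho> / 2)" "norm (q y - q y') \<le> norm (y - y')" "y \<in> cball 0 (\<rho> / 2) \<Longrightarrow> q y = y" for y y'
    using closest_point_in_set[of "cball (0::'a) (\<rho> / 2)" y]
      closest_point_lipschitz[of "cball (0::'a) (\<rho> / 2)" y y'] \<rho>
    by (auto simp: q_def dist_norm closest_point_self)
  have qb: "q y \<in> ball 0 \<rho>" for y using q(1)[of y] \<rho>(1) by auto
  have qR: "q y \<in> ball 0 R" for y using qb \<rho>(2) by blast
  have qc: "continuous_on UNIV q" unfolding q_def using \<rho> by (intro continuous_on_closest_point) auto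
  define H where "H = (\<lambda>r (z::'a \<times> 'a). G r (q (snd z)))"
  have Hlip: "norm (H r (x, y) - H r (x, y')) \<le> 1 / 2 * norm (y - y')" if "r \<in> {0..1}" for r x y y'
    using Glip[OF that qb qb, of y y'] q(2)[of y y'] by (simp add: H_def)
  have Hc: "continuous_on ({0..1} \<times> UNIV) (\<lambda>(r, z). H r z)"
  proof -
    have "continuous_on ({0..1} \<times> UNIV) (\<lambda>z :: real \<times> 'a \<times> 'a. (fst z, q (snd (snd z))))"
      by (intro continuous_intros continuous_on_compose2[OF qc]) auto
    from continuous_on_compose2[OF pdiff_continuous[OF G] this] qR
    show ?thesis by (auto simp: H_def case_prod_unfold image_subset_iff)
  qed
  have ex: "\<exists>v. continuous_on {0..1} v \<and> (\<forall>s\<in>{0..1}. v s = x + integral {0..s} (\<lambda>r. H r (x, v r)))" for x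
  proof (rule volterra_exists)
    have "continuous_on ({0..1} \<times> UNIV) (\<lambda>z :: real \<times> 'a. (fst z, (x, snd z)))" by (intro continuous_intros)
    from continuous_on_compose2[OF Hc this]
    show "continuous_on ({0..1} \<times> UNIV) (\<lambda>(r, y). H r (x, y))" by (auto simp: case_prod_unfold image_subset_iff)
  qed (use Hlip in auto)
  define w where "w = (\<lambda>s x. (SOME v. continuous_on {0..1} v \<and> (\<forall>s\<in>{0..1}. v s = x + integral {0..s} (\<lambda>r. H r (x, v r)))) s)"
  have wc: "continuous_on {0..1} (\<lambda>s. w s x)"
    and weq: "s \<in> {0..1} \<Longrightarrow> w s x = x + integral {0..s} (\<lambda>r. H r (x, w r x))" for x s
    using someI_ex[OF ex[of x]] unfolding w_def by auto
  have Hc': "continuous_on ({0..1} \<times> (UNIV \<times> UNIV)) (\<lambda>(r, z). H r z)" using Hc by simp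
  have bc: "continuous_on ({0..1::real} \<times> (UNIV :: 'a set)) (\<lambda>(s, x). x)"
    unfolding case_prod_unfold by (intro continuous_intros)
  have wc2: "continuous_on ({0..1} \<times> UNIV) (\<lambda>(s, x). w s x)"
    by (rule volterra_continuous[where b = "\<lambda>s x. x", OF Hc' bc Hlip wc weq])
  have Hwc: "continuous_on {0..1} (\<lambda>r. H r (x, w r x))" for x
  proof -
    have "continuous_on {0..1} (\<lambda>r. (r, (x, w r x)))" by (intro continuous_intros wc)
    from continuous_on_compose2[OF Hc this] show ?thesis by auto
  qed
  have wbound: "norm (w s x) \<le> 2 * norm x" if s: "s \<in> {0..1}" for s x
  proof -
    have "norm (w s x) \<le> norm x / (1 - 1 / 2)"
    proof (rule sup_contraction_bound[OF wc _ _ s])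
      fix s :: real and m assume s: "s \<in> {0..1}" and m: "\<And>r. r \<in> {0..1} \<Longrightarrow> norm (w r x) \<le> m"
      have "norm (H r (x, w r x)) \<le> 1 / 2 * m" if "r \<in> {0..1}" for r
        using Hlip[OF that, of x "w r x" 0] m[OF that] q(3)[of 0] \<rho>(1) by (simp add: H_def G0)
      then have "norm (x + integral {0..s} (\<lambda>r. H r (x, w r x))) \<le> norm x + 1 / 2 * m"
        by (intro norm_triangle_mono integral_norm_le[OF s Hwc]) auto
      then show "norm (w s x) \<le> norm x + 1 / 2 * m" by (simp flip: weq[OF s])
    qed simp
    then show ?thesis by simp
  qed
  \<comment> \<open>Since \<open>w s x\<close> has norm at most twice that of \<open>x\<close>,
    starting within \<open>\<rho> / 4\<close> keeps it within \<open>\<rho> / 2\<close>, where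
    \<open>q\<close> is the identity. There \<open>w\<close> solves the equation with the smooth
    kernel \<open>G\<close>.\<close>
  define U where "U = ball (0::'a) (\<rho> / 4)"
  have wU: "w s x \<in> ball 0 (\<rho> / 2)" if "s \<in> {0..1}" "x \<in> U" for s x
    using wbound[OF that(1), of x] that(2) by (simp add: U_def)
  have wR: "w s x \<in> ball 0 \<rho>" "w s x \<in> ball 0 R" if "s \<in> {0..1}" "x \<in> U" for s x
    using wU[OF that] \<rho> by (auto simp: subset_eq)
  have HG: "H r (x, w r x) = G r (w r x)" if "r \<in> {0..1}" "x \<in> U" for r x
    using wU[OF that] q(3)[of "w r x"] by (simp add: H_def)
  have weqG: "w s x = x + integral {0..s} (\<lambda>r. G r (w r x))" if "s \<in> {0..1}" "x \<in> U" for s x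
    unfolding weq[OF that(1)] by (intro arg_cong2[of _ _ _ _ "(+)"] integral_cong refl HG) (use that in auto)
  have Uo: "open U" by (simp add: U_def)
  have wk: "pdiff k {0..1} U w" for k
  proof (rule volterra_pdiff[OF Uo open_ball[of 0 \<rho>]])
    show "pdiff k {0..1} (U \<times> ball 0 \<rho>) (\<lambda>r z. G r (snd z))"
      by (rule pdiff_compose[OF _ open_ball G pdiff_linear[OF bounded_linear_snd]])
        (use \<rho> Uo in \<open>auto intro: open_Times\<close>)
    show "pdiff k {0..1} U (\<lambda>s x. x)" by (rule pdiff_id)
    show "continuous_on ({0..1} \<times> U) (\<lambda>(s, x). w s x)" by (rule continuous_on_subset[OF wc2]) auto
  qed (use wR weqG Glip in auto)
  define \<psi> where "\<psi> = w 1"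
  have \<psi>: "smooth_on U \<psi>"
    unfolding smooth_on_def \<psi>_def by (auto intro!: pdiff_imp_times_cont_diff_on[OF wk])
  have Gc: "continuous_on {0..1} (\<lambda>r. G r (w r x))" if "x \<in> U" for x
    by (rule continuous_on_eq[OF Hwc]) (use HG that in auto)
  have wder: "((\<lambda>s. w s x) has_vector_derivative G s (w s x)) (at s within {0..1})"
    if s: "s \<in> {0..1}" and x: "x \<in> U" for s x
  proof -
    have "((\<lambda>s. x + integral {0..s} (\<lambda>r. G r (w r x))) has_vector_derivative G s (w s x)) (at s within {0..1})"
      using integral_has_vector_derivative[OF Gc[OF x] s] by (auto intro!: derivative_eq_intros)
    then show ?thesis
      by (rule has_vector_derivative_transform[OF s, rotated]) (use weqG x in auto)
  qed
  have scale: "\<psi> (s *\<^sub>R x) = s *\<^sub>R w s x" if s: "s \<in> {0..1}" and x: "x \<in> U" for s x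
  proof -
    have sx: "s *\<^sub>R x \<in> U" unfolding U_def using s x by (intro scaleR_in_ball) (auto simp: U_def)
    have sr: "s * r \<in> {0..1}" "r * s \<in> {0..1}" if "r \<in> {0..1}" for r using s that by (auto simp: mult_le_one)
    \<comment> \<open>By the homogeneity \<open>Gscale\<close>, the solution for \<open>x\<close>
      with time slowed down by \<open>s\<close> and values multiplied by \<open>s\<close> solves the
      equation for \<open>s *\<^sub>R x\<close>. The contraction estimate with zero error identifies
      the two.\<close>
    define v where "v = (\<lambda>r. s *\<^sub>R w (s * r) x)"
    have "continuous_on {0..1} ((*) s)" by (intro continuous_intros)
    moreover have "(*) s ` {0..1} \<subseteq> {0..1}" by (rule image_subsetI, rule sr(1))
    ultimately have vc: "continuous_on {0..1} v"
      unfolding v_def by (intro continuous_on_scaleR continuous_on_const continuous_on_compose2[OF wc, where f = "(*) s"])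
    have vG: "G r (v r) = s\<^sup>2 *\<^sub>R G (s * r) (w (s * r) x)" if "r \<in> {0..1}" for r
      using Gscale[OF wR(2)[OF sr(1)[OF that] x] that s] by (simp add: v_def mult.commute)
    have vb: "v r \<in> ball 0 \<rho>" if "r \<in> {0..1}" for r
      unfolding v_def using s wR(1)[OF sr(1)[OF that] x] by (intro scaleR_in_ball) auto
    have veq: "v r = s *\<^sub>R x + integral {0..r} (\<lambda>r. G r (v r))" if r: "r \<in> {0..1}" for r
    proof -
      have "integral {0..s * r} (\<lambda>r. G r (w r x)) = s *\<^sub>R integral {0..r} (\<lambda>t. G (s * t) (w (s * t) x))"
      proof (cases "r = 0")
        case False
        have "integral {0..s * r} (\<lambda>r. G r (w r x)) = (s * r) *\<^sub>R integral {0..1} (\<lambda>t. G (s * r * t) (w (s * r * t) x))"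
          using sr r by (intro integral_rescale) auto
        moreover have "integral {0..r} (\<lambda>t. G (s * t) (w (s * t) x)) = r *\<^sub>R integral {0..1} (\<lambda>t. G (s * (r * t)) (w (s * (r * t)) x))"
          using r by (intro integral_rescale) auto
        ultimately show ?thesis by (simp add: mult_ac)
      qed simp
      then have "v r = s *\<^sub>R x + s\<^sup>2 *\<^sub>R integral {0..r} (\<lambda>t. G (s * t) (w (s * t) x))"
        using weqG[OF sr(1)[OF r] x] by (simp add: v_def scaleR_add_right power2_eq_square)
      also have "s\<^sup>2 *\<^sub>R integral {0..r} (\<lambda>t. G (s * t) (w (s * t) x)) = integral {0..r} (\<lambda>r. G r (v r))"
        unfolding integral_cmul[symmetric] by (rule integral_cong) (use r vG in auto)
      finally show ?thesis .
    qed
    have vGc: "continuous_on {0..1} (\<lambda>r. G r (v r))"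
    proof -
      have "continuous_on {0..1} (\<lambda>r. (r, v r))" by (intro continuous_intros vc)
      from continuous_on_compose2[OF pdiff_continuous[OF G] this] vb \<rho>(2)
      show ?thesis by (auto simp: image_subset_iff subset_eq)
    qed
    have "norm (w 1 (s *\<^sub>R x) - v 1) \<le> 0 / (1 - 1 / 2)"
    proof (rule sup_contraction_bound[of "\<lambda>r. w r (s *\<^sub>R x) - v r"])
      show "continuous_on {0..1} (\<lambda>r. w r (s *\<^sub>R x) - v r)" by (intro continuous_intros wc vc)
      fix r :: real and m assume r: "r \<in> {0..1}" and m: "\<And>r. r \<in> {0..1} \<Longrightarrow> norm (w r (s *\<^sub>R x) - v r) \<le> m"
      have "w r (s *\<^sub>R x) - v r = integral {0..r} (\<lambda>r. G r (w r (s *\<^sub>R x)) - G r (v r))"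
        unfolding weqG[OF r sx] veq[OF r]
        using r by (subst integral_diff) (auto intro!: integrable_continuous_real
            continuous_on_subset[OF Gc[OF sx]] continuous_on_subset[OF vGc])
      also have "norm \<dots> \<le> 1 / 2 * m"
      proof (rule integral_norm_le[OF r])
        show "continuous_on {0..1} (\<lambda>r. G r (w r (s *\<^sub>R x)) - G r (v r))" by (intro continuous_intros Gc[OF sx] vGc)
        fix r :: real assume r: "r \<in> {0..1}"
        show "norm (G r (w r (s *\<^sub>R x)) - G r (v r)) \<le> 1 / 2 * m"
          using Glip[OF r wR(1)[OF r sx] vb[OF r]] m[OF r] by simp
      qed
      finally show "norm (w r (s *\<^sub>R x) - v r) \<le> 0 + 1 / 2 * m" by simp
    qed auto
    then show ?thesis by (simp add: \<psi>_def v_def)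
  qed
  \<comment> \<open>Both sides of \<open>scale\<close> are differentiated in \<open>s\<close>. At
    \<open>s = 1\<close> this is the equation for \<open>E\<close>, because
    \<open>\<psi> x + G 1 (\<psi> x) = E (\<psi> x)\<close>; at \<open>s = 0\<close> it gives the
    derivative of \<open>\<psi>\<close> at the origin.\<close>
  have ray: "frechet_derivative \<psi> (at (s *\<^sub>R x)) x = w s x + s *\<^sub>R G s (w s x)"
    if s: "s \<in> {0..1}" and x: "x \<in> U" for s x
  proof -
    have "((\<lambda>s. s *\<^sub>R w s x) has_vector_derivative w s x + s *\<^sub>R G s (w s x)) (at s within {0..1})"
      using wder[OF s x] by (auto intro!: derivative_eq_intros simp: add.commute)
    then have "((\<lambda>s. \<psi> (s *\<^sub>R x)) has_vector_derivative w s x + s *\<^sub>R G s (w s x)) (at s within {0..1})"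
      by (rule has_vector_derivative_transform[OF s, rotated]) (use scale x in auto)
    moreover have "((\<lambda>s. \<psi> (s *\<^sub>R x)) has_vector_derivative frechet_derivative \<psi> (at (s *\<^sub>R x)) x) (at s within {0..1})"
      using smooth_on_ray[of "\<rho> / 4" \<psi> x s] \<psi> x s unfolding U_def by blast
    ultimately show ?thesis
      using vector_derivative_unique_within_closed_interval[of 0 1 s] s by (auto simp: cbox_interval)
  qed
  show thesis
  proof
    show "\<rho> / 4 > 0" using \<rho> by simp
    show "smooth_on (ball 0 (\<rho> / 4)) \<psi>" using \<psi> by (simp add: U_def)
    have U0: "0 \<in> U" using \<rho> by (simp add: U_def)
    show "\<psi> 0 = 0" using scale[of 0 0] U0 by simp
    have D: "(\<psi> has_derivative frechet_derivative \<psi> (at 0)) (at 0)"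
      using smooth_on_differentiable[OF \<psi> U0] .
    have id: "frechet_derivative \<psi> (at 0) u = u" if "u \<in> U" for u
      using ray[of 0 u] weq[of 0 u] that by simp
    have "frechet_derivative \<psi> (at 0) u = u" for u
    proof -
      \<comment> \<open>The formula at \<open>s = 0\<close> is available for vectors in
        \<open>U\<close> only; \<open>c\<close> shrinks \<open>u\<close> into \<open>U\<close>, and
        linearity undoes the scaling.\<close>
      define d where "d = norm u + 1"
      have d: "d > 0" "norm u \<le> d" by (auto simp: d_def add_nonneg_pos)
      define c where "c = \<rho> / (8 * d)"
      have c: "c > 0" unfolding c_def using \<rho> d by simp
      have "c * norm u \<le> c * d" using c d by (intro mult_left_mono) auto
      also have "\<dots> = \<rho> / 8" using d by (simp add: c_def)
      also have "\<dots> < \<rho> / 4" using \<rho> by simp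
      finally have "c * norm u < \<rho> / 4" .
      then have "c *\<^sub>R u \<in> U" using c by (simp add: U_def)
      from id[OF this] have "c *\<^sub>R frechet_derivative \<psi> (at 0) u = c *\<^sub>R u"
        using has_derivative_linear[OF D] by (simp add: linear_cmul)
      with c show ?thesis by simp
    qed
    then have "frechet_derivative \<psi> (at 0) = (\<lambda>u. u)" by auto
    with D show "(\<psi> has_derivative (\<lambda>u. u)) (at 0)" by simp
    fix x :: 'a assume "x \<in> ball 0 (\<rho> / 4)"
    then have x: "x \<in> U" by (simp add: U_def)
    show "\<psi> x \<in> ball 0 R" using wR(2)[of 1 x] x by (simp add: \<psi>_def)
    then show "frechet_derivative \<psi> (at x) x = E (\<psi> x)"
      using ray[of 1 x] x GE[of "\<psi> x"] by (simp add: \<psi>_def)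
  qed
qed

section \<open>Integral curves and inverse functions\<close>

text \<open>Slowing the field down by \<open>\<epsilon>\<close> lets the whole unit interval serve
  as time, which is the form of the Volterra equation and of \<open>integral_curve\<close>.\<close>

lemma local_integral_curve:
  fixes F :: "'a::euclidean_space \<Rightarrow> 'a"
  assumes S: "open S" "x \<in> S" and F: "smooth_on S F"
  obtains \<epsilon> and w :: "real \<Rightarrow> 'a" where "\<epsilon> > 0" "w 0 = x" "\<And>s. s \<in> {0..1} \<Longrightarrow> w s \<in> S"
    "\<And>s. s \<in> {0..1} \<Longrightarrow> (w has_vector_derivative \<epsilon> *\<^sub>R F (w s)) (at s within {0..1})"
proof -
  obtain \<rho> where \<rho>: "\<rho> > 0" "cball x \<rho> \<subseteq> S" using S open_contains_cball by blast
  have Fd: "(F has_derivative frechet_derivative F (at y)) (at y)" if "y \<in> S" for y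
    by (rule smooth_on_differentiable[OF F that])
  have "continuous_on S (\<lambda>z. (0::real, z))" by (intro continuous_intros)
  from continuous_on_compose2[OF pdiff_blinfun(1)[OF smooth_on_pdiff[OF F, where I = "{0}"]] this]
  have Bc: "continuous_on S (\<lambda>y. Blinfun (frechet_derivative F (at y)))" by (auto simp: image_subset_iff)
  then have "bounded ((\<lambda>y. Blinfun (frechet_derivative F (at y))) ` cball x \<rho>)"
    using \<rho> by (intro compact_imp_bounded compact_continuous_image) (auto elim: continuous_on_subset)
  then obtain L where L: "\<And>y. y \<in> cball x \<rho> \<Longrightarrow> norm (Blinfun (frechet_derivative F (at y))) \<le> L"
    unfolding bounded_iff by blast
  have "bounded (F ` cball x \<rho>)"
    using \<rho> smooth_on_continuous[OF F]
    by (intro compact_imp_bounded compact_continuous_image) (auto elim: continuous_on_subset)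
  then obtain B where B: "\<And>y. y \<in> cball x \<rho> \<Longrightarrow> norm (F y) \<le> B"
    unfolding bounded_iff by blast
  \<comment> \<open>The first bound brings the Lipschitz constant of the slowed field to 1/2, the
    second keeps the curve within distance \<open>\<rho>\<close> of \<open>x\<close>; adding 1 keeps
    the denominators positive.\<close>
  define \<epsilon> where "\<epsilon> = min (1 / (2 * (\<bar>L\<bar> + 1))) (\<rho> / (\<bar>B\<bar> + 1))"
  have \<epsilon>: "\<epsilon> > 0" "\<epsilon> * \<bar>L\<bar> \<le> 1 / 2" "\<epsilon> * \<bar>B\<bar> \<le> \<rho>"
  proof -
    show e0: "\<epsilon> > 0" unfolding \<epsilon>_def using \<rho> by auto
    have "\<epsilon> * (\<bar>L\<bar> + 1) \<le> 1 / (2 * (\<bar>L\<bar> + 1)) * (\<bar>L\<bar> + 1)"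
      unfolding \<epsilon>_def by (intro mult_right_mono) auto
    also have "\<dots> = 1 / 2" by (simp add: field_simps add_nonneg_eq_0_iff)
    finally show "\<epsilon> * \<bar>L\<bar> \<le> 1 / 2" using e0 by (simp add: distrib_left)
    have "\<epsilon> * (\<bar>B\<bar> + 1) \<le> \<rho> / (\<bar>B\<bar> + 1) * (\<bar>B\<bar> + 1)"
      unfolding \<epsilon>_def by (intro mult_right_mono) auto
    also have "\<dots> = \<rho>" by (simp add: field_simps add_nonneg_eq_0_iff)
    finally show "\<epsilon> * \<bar>B\<bar> \<le> \<rho>" using e0 by (simp add: distrib_left)
  qed
  have Flip: "norm (F y - F y') \<le> \<bar>L\<bar> * norm (y - y')" if "y \<in> cball x \<rho>" "y' \<in> cball x \<rho>" for y y'
  proof (rule onorm_Lipschitz_ball[OF Fd convex_cball _ that])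
    fix z assume z: "z \<in> cball x \<rho>"
    then show "z \<in> S" using \<rho> by blast
    then have "blinfun_apply (Blinfun (frechet_derivative F (at z))) = frechet_derivative F (at z)"
      by (intro bounded_linear_Blinfun_apply has_derivative_bounded_linear[OF Fd])
    with L[OF z] show "onorm (frechet_derivative F (at z)) \<le> \<bar>L\<bar>" by (simp add: norm_blinfun.rep_eq)
  qed
  define q where "q = closest_point (cball x \<rho>)"
  have q: "q y \<in> cball x \<rho>" "norm (q y - q y') \<le> norm (y - y')" "y \<in> cball x \<rho> \<Longrightarrow> q y = y" for y y'
    using closest_point_in_set[of "cball x \<rho>" y] closest_point_lipschitz[of "cball x \<rho>" y y'] \<rho>
    by (auto simp: q_def dist_norm closest_point_self)
  have qc: "continuous_on UNIV q" unfolding q_def using \<rho> by (intro continuous_on_closest_point) auto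
  have Fq: "continuous_on T (\<lambda>t. F (q (f t)))" if "continuous_on T f" for T and f :: "'t::topological_space \<Rightarrow> 'a"
    by (rule continuous_on_compose2[OF smooth_on_continuous[OF F]], rule continuous_on_compose2[OF qc that])
      (use q \<rho> in auto)
  have "\<exists>w :: real \<Rightarrow> 'a. continuous_on {0..1} w \<and> (\<forall>s\<in>{0..1}. w s = x + integral {0..s} (\<lambda>r. \<epsilon> *\<^sub>R F (q (w r))))"
  proof (rule volterra_exists)
    show "continuous_on ({0..1} \<times> UNIV) (\<lambda>(r::real, y). \<epsilon> *\<^sub>R F (q y))"
      unfolding case_prod_unfold by (intro continuous_intros Fq)
    fix y y'
    have "norm (\<epsilon> *\<^sub>R F (q y) - \<epsilon> *\<^sub>R F (q y')) = \<epsilon> * norm (F (q y) - F (q y'))"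
      using \<epsilon>(1) by (simp flip: scaleR_diff_right)
    also have "\<dots> \<le> \<epsilon> * (\<bar>L\<bar> * norm (q y - q y'))"
      using \<epsilon>(1) Flip[OF q(1) q(1)] by (intro mult_left_mono) auto
    also have "\<dots> \<le> \<epsilon> * (\<bar>L\<bar> * norm (y - y'))"
      using \<epsilon>(1) q(2) by (intro mult_left_mono) auto
    also have "\<dots> \<le> 1 / 2 * norm (y - y')"
      using mult_right_mono[OF \<epsilon>(2), of "norm (y - y')"] by (simp add: mult.assoc)
    finally show "norm (\<epsilon> *\<^sub>R F (q y) - \<epsilon> *\<^sub>R F (q y')) \<le> 1 / 2 * norm (y - y')" .
  qed (intro continuous_intros)
  then obtain w :: "real \<Rightarrow> 'a" where wc: "continuous_on {0..1} w"
    and w: "\<And>s. s \<in> {0..1} \<Longrightarrow> w s = x + integral {0..s} (\<lambda>r. \<epsilon> *\<^sub>R F (q (w r)))" by blast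
  have ic: "continuous_on {0..1} (\<lambda>r. \<epsilon> *\<^sub>R F (q (w r)))" by (intro continuous_intros Fq wc)
  have wb: "w s \<in> cball x \<rho>" if s: "s \<in> {0..1}" for s
  proof -
    have "norm (integral {0..s} (\<lambda>r. \<epsilon> *\<^sub>R F (q (w r)))) \<le> \<rho>"
    proof (rule integral_norm_le[OF s ic])
      fix r :: real assume "r \<in> {0..1}"
      have "norm (\<epsilon> *\<^sub>R F (q (w r))) \<le> \<epsilon> * \<bar>B\<bar>"
        using \<epsilon>(1) B[OF q(1), of "w r"] by (auto intro!: mult_left_mono)
      with \<epsilon>(3) show "norm (\<epsilon> *\<^sub>R F (q (w r))) \<le> \<rho>" by simp
    qed
    then show ?thesis by (simp add: w[OF s] dist_norm)
  qed
  show thesis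
  proof
    show "\<epsilon> > 0" by fact
    show "w 0 = x" using w[of 0] by simp
    fix s :: real assume s: "s \<in> {0..1}"
    show "w s \<in> S" using wb[OF s] \<rho> by blast
    have "((\<lambda>s. x + integral {0..s} (\<lambda>r. \<epsilon> *\<^sub>R F (q (w r)))) has_vector_derivative \<epsilon> *\<^sub>R F (q (w s))) (at s within {0..1})"
      using has_vector_derivative_add[OF has_vector_derivative_const[of x] integral_has_vector_derivative[OF ic s]]
      by (simp only: add_0_left)
    then show "(w has_vector_derivative \<epsilon> *\<^sub>R F (w s)) (at s within {0..1})"
      unfolding q(3)[OF wb[OF s]]
      by (rule has_vector_derivative_transform[OF s, rotated]) (use w in auto)
  qed
qed

lemma inv_matrix_inv:
  fixes f :: "real ^ 'n \<Rightarrow> real ^ 'n"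
  assumes "linear f" "inj f"
  shows "det (matrix f) \<noteq> 0" "inv f u = matrix_inv (matrix f) *v u"
proof -
  show d: "det (matrix f) \<noteq> 0" using assms by (simp add: det_nz_iff_inj)
  have "f (matrix_inv (matrix f) *v u) = matrix f *v (matrix_inv (matrix f) *v u)"
    using assms(1) by (simp add: matrix_works)
  also have "\<dots> = u"
    using d by (simp add: matrix_vector_mul_assoc invertible_matrix_inv invertible_det_nz)
  finally show "inv f u = matrix_inv (matrix f) *v u" using assms(2) by (metis inv_f_f)
qed

text \<open>The derivative of \<open>g\<close> is the inverse of the matrix of \<open>Df\<close>
  taken along \<open>g\<close>, hence as often differentiable as \<open>g\<close> itself; so each
  order of differentiability of \<open>g\<close> yields the next.\<close>

lemma smooth_inverse_function:
  fixes f :: "real ^ 'n \<Rightarrow> real ^ 'n"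
  assumes S: "open S" "x0 \<in> S" and f: "smooth_on S f" and inj: "inj (frechet_derivative f (at x0))"
  obtains S' V g where "open S'" "x0 \<in> S'" "S' \<subseteq> S" "open V" "homeomorphism S' V f g" "smooth_on V g"
    "\<And>x. x \<in> S' \<Longrightarrow> inj (frechet_derivative f (at x))"
    "\<And>y. y \<in> V \<Longrightarrow> (g has_derivative inv (frechet_derivative f (at (g y)))) (at y)"
proof -
  define f' where "f' = (\<lambda>x. Blinfun (frechet_derivative f (at x)))"
  have fd: "(f has_derivative frechet_derivative f (at x)) (at x)" if "x \<in> S" for x
    by (rule smooth_on_differentiable[OF f that])
  have f': "blinfun_apply (f' x) = frechet_derivative f (at x)" if "x \<in> S" for x
    unfolding f'_def using has_derivative_bounded_linear[OF fd[OF that]] by (rule bounded_linear_Blinfun_apply)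
  have "continuous_on S (\<lambda>z. (0::real, z))" by (intro continuous_intros)
  from continuous_on_compose2[OF pdiff_blinfun(1)[OF smooth_on_pdiff[OF f, where I = "{0}"]] this]
  have f'c: "continuous_on S f'" by (auto simp: image_subset_iff f'_def)
  have lin0: "linear (frechet_derivative f (at x0))" using fd[OF S(2)] by (rule has_derivative_linear)
  obtain h where h: "linear h" "h \<circ> frechet_derivative f (at x0) = id"
    using linear_injective_left_inverse[OF lin0 inj] by blast
  have "Blinfun h o\<^sub>L f' x0 = id_blinfun"
    by (rule blinfun_eqI)
      (use h f'[OF S(2)] in \<open>simp add: bounded_linear_Blinfun_apply linear_conv_bounded_linear o_def fun_eq_iff\<close>)
  then obtain U' V g g' where *: "open U'" "U' \<subseteq> S" "x0 \<in> U'" "open V" "f x0 \<in> V" "homeomorphism U' V f g"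
    "\<And>y. y \<in> V \<Longrightarrow> (g has_derivative (g' y)) (at y)"
    "\<And>y. y \<in> V \<Longrightarrow> g' y = inv (blinfun_apply (f' (g y)))"
    "\<And>y. y \<in> V \<Longrightarrow> bij (blinfun_apply (f' (g y)))"
    using inverse_function_theorem[OF S(1) _ f'c S(2), of f "Blinfun h"] fd f' by metis
  have gU: "g y \<in> U'" if "y \<in> V" for y using *(6) that by (auto simp: homeomorphism_def)
  have inj': "inj (frechet_derivative f (at x))" if "x \<in> U'" for x
  proof -
    have "f x \<in> V" "g (f x) = x" using *(6) that by (auto simp: homeomorphism_def)
    with *(9)[of "f x"] f'[of x] that *(2) show ?thesis by (auto simp: bij_def)
  qed
  have gd: "(g has_derivative inv (frechet_derivative f (at (g y)))) (at y)" if "y \<in> V" for y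
    using *(7,8)[OF that] f'[of "g y"] gU[OF that] *(2) by auto
  have gk: "pdiff k {0::real} V (\<lambda>_. g)" for k
  proof (induction k)
    case 0
    have "continuous_on V g" using *(6) by (simp add: homeomorphism_def)
    then show ?case by (auto simp: case_prod_unfold intro!: continuous_on_compose2[of V g _ snd] continuous_intros)
  next
    case (Suc k)
    have Dfg: "pdiff k {0::real} V (\<lambda>_ y. frechet_derivative f (at (g y)) v)" for v
      using pdiff_compose[OF *(4) S(1) smooth_on_pdiff[OF smooth_on_derivative[OF f]] Suc] gU *(2) by blast
    have lin: "linear (frechet_derivative f (at (g y)))" if "y \<in> V" for y
      using fd[of "g y"] gU[OF that] *(2) has_derivative_linear by blast
    have M: "pdiff k {0::real} V (\<lambda>_ y. matrix (frechet_derivative f (at (g y))) $ i $ j)" for i j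
    proof -
      have entry: "matrix (frechet_derivative f (at (g y))) $ i $ j = frechet_derivative f (at (g y)) (axis j 1) $ i" for y
        by (simp add: matrix_def)
      show ?thesis unfolding entry by (intro pdiff_nth[OF *(4)] Dfg)
    qed
    show ?case
    proof (rule pdiff_SucI[OF *(4)])
      show "continuous_on ({0} \<times> V) (\<lambda>(s::real, x). g x)" using pdiff_continuous[OF Suc] .
      show "(g has_derivative inv (frechet_derivative f (at (g y)))) (at y)" if "y \<in> V" for y
        by (rule gd[OF that])
      show "pdiff k {0::real} V (\<lambda>s y. inv (frechet_derivative f (at (g y))) u)" for u
        by (rule pdiff_cong[OF *(4) pdiff_matrix_inv[OF *(4) M, of "\<lambda>_ _. u"]])
          (use inv_matrix_inv[OF lin inj'[OF gU]] in \<open>auto intro!: pdiff_const\<close>)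
    qed
  qed
  show thesis
    by (rule that[OF *(1,3,2,4,6) _ inj' gd]) (auto intro: smooth_onI gk)
qed

section \<open>Simultaneous normal form of commuting semisimple matrices\<close>

definition of_real_vec :: "real ^ 'm \<Rightarrow> complex ^ 'm" where
  "of_real_vec x = (\<chi> i. complex_of_real (x $ i))"

definition cmat :: "real ^ 'm ^ 'm \<Rightarrow> complex ^ 'm ^ 'm" where
  "cmat B = (\<chi> i j. complex_of_real (B $ i $ j))"

text \<open>Bilinear, without conjugation: the first argument represents a complex linear form, and
  transposition is the adjoint. Eigenvectors of a transposed matrix are thus forms which the matrix
  itself multiplies by a scalar.\<close>

definition cdot :: "complex ^ 'm \<Rightarrow> complex ^ 'm \<Rightarrow> complex" where
  "cdot x y = (\<Sum>i\<in>UNIV. x $ i * y $ i)"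

definition cnj_vec :: "complex ^ 'm \<Rightarrow> complex ^ 'm" where
  "cnj_vec x = (\<chi> i. cnj (x $ i))"

lemma cdot_linear:
  "cdot (x + y) z = cdot x z + cdot y z" "cdot (c *s x) z = c * cdot x z" "cdot 0 z = 0"
  "cdot (x - y) z = cdot x z - cdot y z"
  "cdot z (x + y) = cdot z x + cdot z y" "cdot z (c *s x) = c * cdot z x"
  by (simp_all add: cdot_def algebra_simps sum.distrib sum_distrib_left sum_subtractf)

lemma cdot_transpose: "cdot (transpose A *v x) y = cdot x (A *v y)"
  by (simp add: cdot_def matrix_vector_mult_def transpose_def sum_distrib_left sum_distrib_right)
    (subst sum.swap, simp add: mult_ac)

lemma cmat_mult_of_real_vec: "cmat B *v of_real_vec x = of_real_vec (B *v x)"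
  by (simp add: cmat_def of_real_vec_def matrix_vector_mult_def vec_eq_iff)

lemma cmat_mult: "cmat (A ** B) = cmat A ** cmat B"
  by (simp add: cmat_def matrix_matrix_mult_def vec_eq_iff)

lemma matrix_vector_mult_sum:
  fixes A :: "'a::comm_semiring_1 ^ 'n ^ 'm"
  shows "A *v (\<Sum>i\<in>S. f i) = (\<Sum>i\<in>S. A *v f i)"
  by (induction S rule: infinite_finite_induct) (auto simp: matrix_vector_right_distrib)

text \<open>\<open>Q l\<close> is the spectral projection for \<open>l\<close>, and zero if
  \<open>l\<close> is no eigenvalue. In the eigenbasis a matrix commuting with the given one has
  nonzero entries only between equal eigenvalues, hence it commutes with every such
  projection.\<close>

lemma diagonal_projections:
  fixes P D R :: "complex ^ 'm ^ 'm"
  assumes PR: "P ** R = mat 1" "R ** P = mat 1" and D: "\<And>i j. i \<noteq> j \<Longrightarrow> D $ i $ j = 0"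
  shows "\<exists>(\<Lambda> :: complex set) Q. finite \<Lambda> \<and> (\<forall>x. (\<Sum>l\<in>\<Lambda>. Q l *v x) = x) \<and>
    (\<forall>l x. (P ** D ** R) *v (Q l *v x) = l *s (Q l *v x)) \<and>
    (\<forall>l C. C ** (P ** D ** R) = (P ** D ** R) ** C \<longrightarrow> C ** Q l = Q l ** C)"
proof -
  define E :: "complex \<Rightarrow> complex ^ 'm ^ 'm" where
    "E = (\<lambda>l. \<chi> i j. if i = j \<and> D $ i $ i = l then 1 else 0)"
  define Q where "Q = (\<lambda>l. P ** E l ** R)"
  define \<Lambda> where "\<Lambda> = range (\<lambda>i. D $ i $ i)"
  have Ev: "(E l *v y) $ i = (if D $ i $ i = l then y $ i else 0)" for l y i
  proof -
    have "(E l *v y) $ i = (\<Sum>j\<in>UNIV. if j = i then (if D $ i $ i = l then y $ i else 0) else 0)"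
      unfolding E_def matrix_vector_mult_def by (simp only: vec_lambda_beta, intro sum.cong) auto
    then show ?thesis by simp
  qed
  have Dv: "(D *v y) $ i = D $ i $ i * y $ i" for y i
  proof -
    have "(D *v y) $ i = (\<Sum>j\<in>UNIV. if j = i then D $ i $ i * y $ i else 0)"
      unfolding matrix_vector_mult_def by (simp only: vec_lambda_beta, intro sum.cong) (auto simp: D)
    then show ?thesis by simp
  qed
  have RP: "R *v (P *v x) = x" "P *v (R *v x) = x" for x
    by (simp_all add: matrix_vector_mul_assoc PR)
  show ?thesis
  proof (intro exI[of _ \<Lambda>] exI[of _ Q] conjI allI impI)
    show "finite \<Lambda>" by (simp add: \<Lambda>_def)
  next
    fix x
    have "(\<Sum>l\<in>\<Lambda>. E l *v y) = y" for y
      by (simp add: vec_eq_iff Ev \<Lambda>_def)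
    then have "P *v (\<Sum>l\<in>\<Lambda>. E l *v (R *v x)) = x" by (simp add: RP)
    then show "(\<Sum>l\<in>\<Lambda>. Q l *v x) = x"
      by (simp add: Q_def matrix_vector_mult_sum flip: matrix_vector_mul_assoc)
  next
    fix l x
    have "D *v (E l *v y) = l *s (E l *v y)" for y by (simp add: vec_eq_iff Dv Ev)
    then show "(P ** D ** R) *v (Q l *v x) = l *s (Q l *v x)"
      by (simp add: Q_def RP vec.scale flip: matrix_vector_mul_assoc)
  next
    fix l C assume C: "C ** (P ** D ** R) = (P ** D ** R) ** C"
    define C' where "C' = R ** C ** P"
    have CR: "R ** C = C' ** R" "C ** P = P ** C'"
      by (simp_all add: C'_def matrix_mul_assoc PR flip: matrix_mul_assoc)
        (simp_all add: matrix_mul_assoc PR)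
    have "R ** (C ** (P ** D ** R)) ** P = R ** ((P ** D ** R) ** C) ** P" by (simp add: C)
    moreover have "R ** (C ** (P ** D ** R)) ** P = C' ** D"
    proof -
      have "R ** (C ** (P ** D ** R)) ** P = C' ** D ** (R ** P)" by (simp add: C'_def matrix_mul_assoc)
      then show ?thesis by (simp add: PR)
    qed
    moreover have "R ** ((P ** D ** R) ** C) ** P = D ** C'"
    proof -
      have "R ** ((P ** D ** R) ** C) ** P = (R ** P) ** D ** C'" by (simp add: C'_def matrix_mul_assoc)
      then show ?thesis by (simp add: PR)
    qed
    ultimately have comm: "C' ** D = D ** C'" by simp
    have entry: "C' $ i $ j * D $ j $ j = D $ i $ i * C' $ i $ j" for i j
    proof -
      have "(C' ** D) $ i $ j = (\<Sum>k\<in>UNIV. if k = j then C' $ i $ j * D $ j $ j else 0)"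
        unfolding matrix_matrix_mult_def by (simp only: vec_lambda_beta, intro sum.cong) (auto simp: D)
      moreover have "(D ** C') $ i $ j = (\<Sum>k\<in>UNIV. if k = i then D $ i $ i * C' $ i $ j else 0)"
        unfolding matrix_matrix_mult_def by (simp only: vec_lambda_beta, intro sum.cong) (auto simp: D)
      ultimately show ?thesis using comm by (simp only: sum.delta finite UNIV_I if_True)
    qed
    have "C' ** E l = E l ** C'"
    proof -
      have "(C' ** E l) $ i $ j = (E l ** C') $ i $ j" for i j
      proof -
        have "(C' ** E l) $ i $ j = (\<Sum>k\<in>UNIV. if k = j then (if D $ j $ j = l then C' $ i $ j else 0) else 0)"
          unfolding matrix_matrix_mult_def E_def by (simp only: vec_lambda_beta, intro sum.cong) auto
        moreover have "(E l ** C') $ i $ j = (\<Sum>k\<in>UNIV. if k = i then (if D $ i $ i = l then C' $ i $ j else 0) else 0)"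
          unfolding matrix_matrix_mult_def E_def by (simp only: vec_lambda_beta, intro sum.cong) auto
        moreover have "C' $ i $ j = 0 \<or> D $ j $ j = D $ i $ i" using entry[of i j] by auto
        ultimately show ?thesis by auto
      qed
      then show ?thesis by (simp add: vec_eq_iff)
    qed
    then have "P ** (C' ** E l) ** R = P ** (E l ** C') ** R" by simp
    then show "C ** Q l = Q l ** C"
      unfolding Q_def matrix_mul_assoc CR(2) by (simp add: CR(1) flip: matrix_mul_assoc)
  qed
qed

section \<open>Common eigenforms of a commuting diagonalizable family\<close>

lemma diagonalizable_over_C_projections:
  fixes B :: "real ^ 'm ^ 'm"
  assumes "diagonalizable_over_C B"
  shows "\<exists>(\<Lambda> :: complex set) Q. finite \<Lambda> \<and> (\<forall>x. (\<Sum>l\<in>\<Lambda>. Q l *v x) = x) \<and>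
    (\<forall>l x. transpose (cmat B) *v (Q l *v x) = l *s (Q l *v x)) \<and>
    (\<forall>l C. C ** transpose (cmat B) = transpose (cmat B) ** C \<longrightarrow> C ** Q l = Q l ** C)"
proof -
  obtain P D :: "complex ^ 'm ^ 'm" where P: "invertible P" and D: "\<And>i j. i \<noteq> j \<Longrightarrow> D $ i $ j = 0" and B: "cmat B = P ** D ** matrix_inv P"
    using assms unfolding diagonalizable_over_C_def cmat_def by blast
  have tD: "transpose D = D"
  proof -
    have "D $ j $ i = D $ i $ j" for i j using D[of i j] D[of j i] by (cases "i = j") auto
    then show ?thesis by (simp add: transpose_def vec_eq_iff)
  qed
  have tB: "transpose (cmat B) = transpose (matrix_inv P) ** D ** transpose P"
    by (simp add: B matrix_transpose_mul tD matrix_mul_assoc)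
  have h: "transpose (matrix_inv P) ** transpose P = mat 1" "transpose P ** transpose (matrix_inv P) = mat 1"
    by (simp_all add: invertible_matrix_inv[OF P] transpose_mat flip: matrix_transpose_mul)
  show ?thesis
    unfolding tB by (rule diagonal_projections[OF h]) (rule D)
qed

text \<open>It will select one member out of each pair of complex conjugate nonreal eigenforms.
  Removing one orbit \<open>{x, f x}\<close> at a time gives the induction.\<close>

lemma involution_transversal:
  assumes "finite X" "\<And>x. x \<in> X \<Longrightarrow> f x \<in> X" "\<And>x. x \<in> X \<Longrightarrow> f (f x) = x" "\<And>x. x \<in> X \<Longrightarrow> f x \<noteq> x"
  shows "\<exists>T. T \<subseteq> X \<and> X = T \<union> f ` T \<and> T \<inter> f ` T = {}"
  using assms
proof (induction "card X" arbitrary: X rule: less_induct)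
  case less
  show ?case
  proof (cases "X = {}")
    case False
    then obtain x where x: "x \<in> X" by blast
    let ?Y = "X - {x, f x}"
    have fY: "f y \<in> ?Y" if "y \<in> ?Y" for y
      using that less.prems(2,3) x by (metis Diff_iff insert_iff singletonD)
    have "card ?Y < card X" using x less.prems(1) by (intro psubset_card_mono) auto
    then obtain T where T: "T \<subseteq> ?Y" "?Y = T \<union> f ` T" "T \<inter> f ` T = {}"
      using less.hyps[of ?Y] less.prems fY by (metis (no_types, lifting) Diff_iff finite_Diff)
    have "f x \<in> X" "f (f x) = x" "f x \<noteq> x" using less.prems x by auto
    have "X = insert x T \<union> f ` insert x T" using T(2) x \<open>f x \<in> X\<close> by auto
    moreover have "insert x T \<inter> f ` insert x T = {}"
    proof -
      have "f x \<notin> T" "x \<notin> f ` T" using T(1,2) by auto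
      with T(3) \<open>f x \<noteq> x\<close> show ?thesis by auto
    qed
    ultimately show ?thesis using T(1) x by (intro exI[of _ "insert x T"]) auto
  qed auto
qed

text \<open>The projections of a further matrix \<open>M a\<close> split a common eigenvector into
  eigenvectors of \<open>M a\<close>. They commute with the earlier matrices, so the pieces remain
  common eigenvectors of those.\<close>

lemma common_eigenvectors_span:
  fixes M :: "'i \<Rightarrow> complex ^ 'm ^ 'm"
  assumes "finite S" and comm: "\<And>a b. M a ** M b = M b ** M a"
    and proj: "\<And>a. \<exists>(\<Lambda> :: complex set) Q. finite \<Lambda> \<and> (\<forall>x. (\<Sum>l\<in>\<Lambda>. Q l *v x) = x) \<and>
      (\<forall>l x. M a *v (Q l *v x) = l *s (Q l *v x)) \<and> (\<forall>l C. C ** M a = M a ** C \<longrightarrow> C ** Q l = Q l ** C)"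
  shows "vec.span {x. \<forall>a\<in>S. \<exists>c. M a *v x = c *s x} = UNIV"
  using assms(1)
proof (induction S rule: finite_induct)
  case empty
  then show ?case by simp
next
  case (insert a S)
  let ?E = "\<lambda>S. {x. \<forall>a\<in>S. \<exists>c. M a *v x = c *s x}"
  obtain \<Lambda> :: "complex set" and Q where Q: "finite \<Lambda>" "\<And>x. (\<Sum>l\<in>\<Lambda>. Q l *v x) = x"
    "\<And>l x. M a *v (Q l *v x) = l *s (Q l *v x)" "\<And>l C. C ** M a = M a ** C \<Longrightarrow> C ** Q l = Q l ** C"
    using proj[of a] by blast
  have "?E S \<subseteq> vec.span (?E (insert a S))"
  proof
    fix x assume x: "x \<in> ?E S"
    have "Q l *v x \<in> ?E (insert a S)" for l
    proof -
      have "\<exists>c. M b *v (Q l *v x) = c *s (Q l *v x)" if "b \<in> S" for b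
      proof -
        have "\<exists>c. M b *v x = c *s x" using x that by simp
        then obtain c where c: "M b *v x = c *s x" by blast
        have "M b *v (Q l *v x) = (M b ** Q l) *v x" by (rule matrix_vector_mul_assoc)
        also have "M b ** Q l = Q l ** M b" by (rule Q(4)) (rule comm)
        also have "(Q l ** M b) *v x = Q l *v (M b *v x)" by (rule matrix_vector_mul_assoc[symmetric])
        also have "\<dots> = c *s (Q l *v x)" unfolding c by (rule vec.scale)
        finally show ?thesis by blast
      qed
      then show ?thesis using Q(3)[of l x] by auto
    qed
    then have "(\<Sum>l\<in>\<Lambda>. Q l *v x) \<in> vec.span (?E (insert a S))"
      by (intro vec.span_sum vec.span_base)
    then show "x \<in> vec.span (?E (insert a S))" by (simp add: Q(2))
  qed
  then have "vec.span (?E S) \<subseteq> vec.span (?E (insert a S))"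
    by (intro vec.span_minimal vec.subspace_span)
  with insert.IH show ?case by auto
qed

lemma of_real_vec_linear:
  "of_real_vec (x + y) = of_real_vec x + of_real_vec y" "of_real_vec (c *\<^sub>R x) = complex_of_real c *s of_real_vec x"
  by (simp_all add: of_real_vec_def vec_eq_iff)

lemma cnj_cdot: "cnj (cdot x (of_real_vec y)) = cdot (cnj_vec x) (of_real_vec y)"
  by (simp add: cdot_def cnj_vec_def of_real_vec_def)

text \<open>The nonzero wedge says that the vectors \<open>L a *v x0\<close> form a basis, and a
  form vanishing on a basis is zero; its real and imaginary parts are treated apart.\<close>

lemma cdot_cyclic_eq_0:
  fixes L :: "'m \<Rightarrow> real ^ 'm ^ 'm"
  assumes W: "wedge (\<lambda>a. L a *v x0) \<noteq> 0"
    and zero: "\<And>a. cdot x (of_real_vec (L a *v x0)) = 0"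
  shows "x = 0"
proof -
  define A where "A = (\<chi> i j. (L j *v x0) $ i)"
  have A: "invertible (transpose A)"
    using W by (simp add: A_def wedge_def invertible_det_nz)
  have z: "y = 0" if "\<And>a. (\<Sum>i\<in>UNIV. y $ i * (L a *v x0) $ i) = 0" for y :: "real ^ 'm"
  proof -
    have "transpose A *v y = 0"
      using that by (simp del: transpose_matrix_vector add: vec_eq_iff matrix_vector_mult_def transpose_def A_def mult.commute)
    then have "matrix_inv (transpose A) *v (transpose A *v y) = 0" by (simp del: transpose_matrix_vector)
    then show ?thesis
      by (simp del: transpose_matrix_vector add: matrix_vector_mul_assoc invertible_matrix_inv[OF A])
  qed
  have "Re (cdot x (of_real_vec (L a *v x0))) = 0" "Im (cdot x (of_real_vec (L a *v x0))) = 0" for a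
    by (simp_all add: zero)
  then have "(\<chi> i. Re (x $ i)) = 0" "(\<chi> i. Im (x $ i)) = 0"
    by (auto intro!: z simp: cdot_def of_real_vec_def)
  then show ?thesis by (simp add: vec_eq_iff complex_eq_iff)
qed

text \<open>The normalised common eigenvectors of the transposed matrices: linear forms on which every
  \<open>L a\<close> acts by a scalar. A nonzero one cannot vanish at the cyclic vector \<open>x0\<close>, and distinct ones
  belong to distinct characters.\<close>

lemma common_eigenforms:
  fixes L :: "'m \<Rightarrow> real ^ 'm ^ 'm"
  assumes comm: "\<And>a b. L a ** L b = L b ** L a"
    and diag: "\<And>a. diagonalizable_over_C (L a)"
    and W: "wedge (\<lambda>a. L a *v x0) \<noteq> 0"
  obtains X :: "(complex ^ 'm) set" where "finite X" "card X = CARD('m)" "vec.span X = UNIV"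
    "\<And>x. x \<in> X \<Longrightarrow> cnj_vec x \<in> X"
    "\<And>x a y. x \<in> X \<Longrightarrow> cdot x (of_real_vec (L a *v y)) =
      cdot x (of_real_vec (L a *v x0)) * cdot x (of_real_vec y)"
proof -
  define M where "M = (\<lambda>a. transpose (cmat (L a)))"
  have Mcomm: "M a ** M b = M b ** M a" for a b
    by (simp add: M_def comm flip: matrix_transpose_mul cmat_mult)
  have Mdot: "cdot (M a *v x) (of_real_vec y) = cdot x (of_real_vec (L a *v y))" for a x y
    by (simp del: transpose_matrix_vector add: M_def cdot_transpose cmat_mult_of_real_vec)
  let ?E = "{x. \<forall>a\<in>UNIV. \<exists>c. M a *v x = c *s x}"
  \<comment> \<open>The value 1 at \<open>x0\<close> fixes the scaling of an eigenform and makes its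
    eigenvalue for \<open>L a\<close> simply its value at \<open>L a *v x0\<close>.\<close>
  define X where "X = {x \<in> ?E. cdot x (of_real_vec x0) = 1}"
  have char: "M a *v x = cdot x (of_real_vec (L a *v x0)) *s x" if "x \<in> X" for x a
  proof -
    obtain c where c: "M a *v x = c *s x" using \<open>x \<in> X\<close> by (auto simp: X_def)
    have "cdot (M a *v x) (of_real_vec x0) = c" using that by (simp add: c cdot_linear X_def)
    then have "cdot x (of_real_vec (L a *v x0)) = c" by (simp only: Mdot)
    with c show ?thesis by simp
  qed
  have "vec.span ?E = UNIV"
    by (rule common_eigenvectors_span[OF finite Mcomm])
      (unfold M_def, rule diagonalizable_over_C_projections[OF diag])
  moreover have "?E \<subseteq> vec.span X"
  proof
    fix x assume x: "x \<in> ?E"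
    define d where "d = cdot x (of_real_vec x0)"
    show "x \<in> vec.span X"
    proof (cases "d = 0")
      case True
      have "cdot x (of_real_vec (L a *v x0)) = 0" for a
      proof -
        obtain c where "M a *v x = c *s x" using x by blast
        then show ?thesis using Mdot[of a x x0] True by (simp add: cdot_linear d_def)
      qed
      then have "x = 0" by (rule cdot_cyclic_eq_0[OF W])
      then show ?thesis by (simp add: vec.span_zero)
    next
      case False
      have "inverse d *s x \<in> X"
      proof -
        have "\<exists>c. M a *v (inverse d *s x) = c *s (inverse d *s x)" for a
        proof -
          obtain c where c: "M a *v x = c *s x" using x by blast
          have "M a *v (inverse d *s x) = c *s (inverse d *s x)"
            by (simp add: vec.scale c mult.commute)
          then show ?thesis by blast
        qed
        moreover have "cdot (inverse d *s x) (of_real_vec x0) = 1"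
          using False by (simp add: cdot_linear d_def)
        ultimately show ?thesis by (simp add: X_def)
      qed
      then have "d *s (inverse d *s x) \<in> vec.span X" by (intro vec.span_scale vec.span_base)
      with False show ?thesis by simp
    qed
  qed
  ultimately have span: "vec.span X = UNIV"
    using vec.span_minimal[OF _ vec.subspace_span, of ?E X] by auto
  obtain B where B1: "B \<subseteq> X" "vec.independent B" "X \<subseteq> vec.span B"
    by (rule vec.maximal_independent_subset)
  have "vec.span B = UNIV" using vec.span_minimal[OF B1(3) vec.subspace_span] span by auto
  note B = B1(1,2) this
  have finB: "finite B" using B(2) by (rule vec.finiteI_independent)
  \<comment> \<open>So \<open>X\<close> itself is a basis, which counts its elements. If
    \<open>x\<close> is expanded in \<open>B\<close>, independence forces every \<open>b\<close>
    with nonzero coefficient to have the character of \<open>x\<close>; then \<open>b - x\<close>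
    vanishes on all \<open>L a *v x0\<close>, whence \<open>b = x\<close>.\<close>
  have "X \<subseteq> B"
  proof
    fix x assume x: "x \<in> X"
    have "x \<in> vec.span B" by (simp add: B(3))
    then obtain c where c: "x = (\<Sum>b\<in>B. c b *s b)"
      unfolding vec.span_finite[OF finB] by blast
    have "x \<noteq> 0" using x by (auto simp: X_def cdot_linear)
    have "\<exists>b\<in>B. c b \<noteq> 0"
    proof (rule ccontr)
      assume "\<not> ?thesis"
      then have "(\<Sum>b\<in>B. c b *s b) = 0" by (intro sum.neutral) auto
      with c \<open>x \<noteq> 0\<close> show False by simp
    qed
    then obtain b where b: "b \<in> B" "c b \<noteq> 0" by blast
    let ?\<chi> = "\<lambda>x a. cdot x (of_real_vec (L a *v x0))"
    have "?\<chi> b a = ?\<chi> x a" for a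
    proof -
      have "(\<Sum>b\<in>B. (c b * (?\<chi> b a - ?\<chi> x a)) *s b) = (\<Sum>b\<in>B. c b *s (M a *v b)) - ?\<chi> x a *s (\<Sum>b\<in>B. c b *s b)"
        unfolding vec.scale_sum_right sum_subtractf[symmetric]
      proof (intro sum.cong refl)
        fix b assume "b \<in> B"
        then have "b \<in> X" using B(1) by blast
        then show "(c b * (?\<chi> b a - ?\<chi> x a)) *s b = c b *s (M a *v b) - ?\<chi> x a *s (c b *s b)"
          unfolding char[OF \<open>b \<in> X\<close>] by (simp add: vec_eq_iff algebra_simps)
      qed
      also have "(\<Sum>b\<in>B. c b *s (M a *v b)) = M a *v x"
        unfolding c by (simp add: matrix_vector_mult_sum vec.scale)
      also have "M a *v x - ?\<chi> x a *s (\<Sum>b\<in>B. c b *s b) = 0"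
        using char[OF x, of a] by (simp flip: c)
      finally have "c b * (?\<chi> b a - ?\<chi> x a) = 0"
        using vec.independentD[OF B(2) finB subset_refl, of "\<lambda>b. c b * (?\<chi> b a - ?\<chi> x a)" b] b(1) by simp
      with b(2) show ?thesis by simp
    qed
    then have "b - x = 0" by (intro cdot_cyclic_eq_0[OF W]) (simp add: cdot_linear)
    with b show "x \<in> B" by simp
  qed
  with B(1) have XB: "X = B" by blast
  show thesis
  proof
    show "finite X" using finB XB by simp
    show "card X = CARD('m)"
      using vec.dim_span_eq_card_independent[OF B(2)] B(3) XB by (simp add: vec.dim_UNIV card_cart_basis)
    show "vec.span X = UNIV" by (rule span)
    show "cnj_vec x \<in> X" if "x \<in> X" for x
    proof -
      have "M a *v cnj_vec x = cnj_vec (M a *v x)" for a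
        by (simp add: M_def matrix_vector_mult_def cnj_vec_def transpose_def cmat_def vec_eq_iff)
      then have "M a *v cnj_vec x = cnj (cdot x (of_real_vec (L a *v x0))) *s cnj_vec x" if "x \<in> X" for a
        using char[OF that, of a] by (simp add: cnj_vec_def vec_eq_iff)
      then show ?thesis
        using that by (auto simp: X_def simp flip: cnj_cdot)
    qed
    show "cdot x (of_real_vec (L a *v y)) = cdot x (of_real_vec (L a *v x0)) * cdot x (of_real_vec y)"
      if "x \<in> X" for x a y
      using Mdot[of a x y] char[OF that, of a] by (simp add: cdot_linear)
  qed
qed

text \<open>A combination of the \<open>L a\<close> multiplies each eigenform by a complex number,
  its value at \<open>x0\<close>. These numbers can be prescribed: 1 at one real form gives a line,
  1 or \<open>\<i>\<close> at one form out of a conjugate pair gives a dilation or a rotation of a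
  plane, with real and imaginary part as coordinates.\<close>

lemma simultaneous_normal_form:
  fixes L :: "'m::finite \<Rightarrow> real ^ 'm ^ 'm"
  assumes comm: "\<And>a b. L a ** L b = L b ** L a"
    and diag: "\<And>a. diagonalizable_over_C (L a)"
    and W: "wedge (\<lambda>a. L a *v x0) \<noteq> 0"
  obtains h e \<Theta> u where "h + 2 * e = CARD('m)" "\<And>k. linear (\<Theta> k :: real ^ 'm \<Rightarrow> real)"
    "\<And>y. (\<And>k. k \<in> {1..CARD('m)} \<Longrightarrow> \<Theta> k y = 0) \<Longrightarrow> y = 0"
    "\<And>i k y. i \<in> {1..h} \<Longrightarrow> k \<in> {1..CARD('m)} \<Longrightarrow>
      \<Theta> k (\<Sum>a\<in>UNIV. u i $ a *\<^sub>R (L a *v y)) = (if k = i then \<Theta> i y else 0)"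
    "\<And>j k y. j \<in> {1..e} \<Longrightarrow> k \<in> {1..CARD('m)} \<Longrightarrow>
      \<Theta> k (\<Sum>a\<in>UNIV. u (h + 2 * j - 1) $ a *\<^sub>R (L a *v y)) =
      (if k = h + 2 * j - 1 \<or> k = h + 2 * j then \<Theta> k y else 0)"
    "\<And>j k y. j \<in> {1..e} \<Longrightarrow> k \<in> {1..CARD('m)} \<Longrightarrow>
      \<Theta> k (\<Sum>a\<in>UNIV. u (h + 2 * j) $ a *\<^sub>R (L a *v y)) =
      (if k = h + 2 * j - 1 then - \<Theta> (h + 2 * j) y
       else if k = h + 2 * j then \<Theta> (h + 2 * j - 1) y else 0)"
    "\<And>c. (\<Sum>i\<in>{1..CARD('m)}. c i *\<^sub>R u i) = (0 :: real ^ 'm) \<Longrightarrow> \<forall>i\<in>{1..CARD('m)}. c i = 0"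
proof -
  obtain X :: "(complex ^ 'm) set" where X: "finite X" "card X = CARD('m)" "vec.span X = UNIV"
    "\<And>x. x \<in> X \<Longrightarrow> cnj_vec x \<in> X"
    "\<And>x a y. x \<in> X \<Longrightarrow> cdot x (of_real_vec (L a *v y)) =
      cdot x (of_real_vec (L a *v x0)) * cdot x (of_real_vec y)"
    using common_eigenforms[OF comm diag W] by blast
  define p where "p = (\<lambda>(x :: complex ^ 'm) y. cdot x (of_real_vec y) :: complex)"
  have plin: "p x (y + z) = p x y + p x z" "p x (c *\<^sub>R y) = complex_of_real c * p x y" for x y z c
    by (simp_all add: p_def of_real_vec_linear cdot_linear)
  have p0: "p x 0 = 0" for x using plin(2)[of x 0 0] by simp
  have psum: "p x (\<Sum>i\<in>S. f i) = (\<Sum>i\<in>S. p x (f i))" for x S and f :: "'z \<Rightarrow> real ^ 'm"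
    by (induction S rule: infinite_finite_induct) (auto simp: plin p0)
  define LL where "LL = (\<lambda>u y. \<Sum>a\<in>UNIV. u $ a *\<^sub>R (L a *v y))"
  have pLL: "p x (LL u y) = p x (LL u x0) * p x y" if "x \<in> X" for x u y
    unfolding LL_def psum plin sum_distrib_right
    by (intro sum.cong refl) (simp only: p_def X(5)[OF that, of _ y] mult.assoc)
  define Xr where "Xr = {x \<in> X. cnj_vec x = x}"
  have cc: "cnj_vec (cnj_vec x) = x" for x :: "complex ^ 'm" by (simp add: cnj_vec_def vec_eq_iff)
  have "\<exists>T. T \<subseteq> X - Xr \<and> X - Xr = T \<union> cnj_vec ` T \<and> T \<inter> cnj_vec ` T = {}"
    by (rule involution_transversal) (use X(1,4) cc in \<open>auto simp: Xr_def\<close>)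
  then obtain T where T: "T \<subseteq> X - Xr" "X - Xr = T \<union> cnj_vec ` T" "T \<inter> cnj_vec ` T = {}" by blast
  have finT: "finite T" using T(1) X(1) finite_subset by blast
  have finXr: "finite Xr" using X(1) by (simp add: Xr_def)
  define h where "h = card Xr"
  define e where "e = card T"
  have he: "h + 2 * e = CARD('m)"
  proof -
    have "inj (cnj_vec :: complex ^ 'm \<Rightarrow> _)" by (rule inj_on_inverseI[of _ cnj_vec]) (simp add: cc)
    then have "card (cnj_vec ` T) = e" unfolding e_def by (intro card_image) (auto intro: inj_on_subset)
    then have "card (X - Xr) = 2 * e" using T(2,3) finT by (simp add: card_Un_disjoint e_def)
    moreover have "card X = card Xr + card (X - Xr)"
      using X(1) by (subst card_Un_disjoint[symmetric]) (auto simp: Xr_def intro!: arg_cong[of _ _ card])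
    ultimately show ?thesis using X(2) by (simp add: h_def)
  qed
  obtain \<xi> where \<xi>: "bij_betw \<xi> {1..h} Xr" using ex_bij_betw_nat_finite_1[OF finXr] h_def by blast
  obtain \<kappa> where \<kappa>: "bij_betw \<kappa> {1..e} T" using ex_bij_betw_nat_finite_1[OF finT] e_def by blast
  have img: "\<xi> ` {1..h} = Xr" "\<kappa> ` {1..e} = T"
    using \<xi> \<kappa> by (simp_all add: bij_betw_imp_surj_on)
  \<comment> \<open>The real forms come first. Beyond \<open>h\<close> an odd offset
    \<open>h + 2 * j - 1\<close> carries the real part of \<open>\<kappa> j\<close> and the
    following even offset \<open>h + 2 * j\<close> its imaginary part.\<close>
  define \<Theta> where "\<Theta> = (\<lambda>k y. if k \<le> h then Re (p (\<xi> k) y)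
    else if odd (k - h) then Re (p (\<kappa> ((k - h + 1) div 2)) y) else Im (p (\<kappa> ((k - h) div 2)) y))"
  have \<Theta>1: "\<Theta> k y = Re (p (\<xi> k) y)" if "k \<in> {1..h}" for k y using that by (simp add: \<Theta>_def)
  have \<Theta>2: "\<Theta> (h + 2 * j - 1) y = Re (p (\<kappa> j) y)" "\<Theta> (h + 2 * j) y = Im (p (\<kappa> j) y)" if j: "j \<in> {1..e}" for j y
  proof -
    obtain i where "j = Suc i" using j by (cases j) auto
    then show "\<Theta> (h + 2 * j - 1) y = Re (p (\<kappa> j) y)" "\<Theta> (h + 2 * j) y = Im (p (\<kappa> j) y)"
      by (simp_all add: \<Theta>_def)
  qed
  have kcases: "k \<in> {1..h} \<or> (\<exists>j\<in>{1..e}. k = h + 2 * j - 1 \<or> k = h + 2 * j)" if "k \<in> {1..CARD('m)}" for k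
  proof (cases "k \<le> h")
    case False
    define d where "d = k - h"
    have d: "k = h + d" "1 \<le> d" "d \<le> 2 * e" using False that he by (auto simp: d_def)
    show ?thesis
    proof (cases "even d")
      case True
      then obtain j where "d = 2 * j" by blast
      with d show ?thesis by (intro disjI2 bexI[of _ j]) auto
    next
      case odd: False
      then obtain j where "d = 2 * j + 1" using oddE by blast
      with d have "Suc j \<in> {1..e}" "k = h + 2 * Suc j - 1" by auto
      then show ?thesis by blast
    qed
  qed (use that in auto)
  have lin: "linear (\<Theta> k)" for k
    unfolding \<Theta>_def by (intro linearI) (simp_all add: plin)
  have inj: "y = 0" if z: "\<And>k. k \<in> {1..CARD('m)} \<Longrightarrow> \<Theta> k y = 0" for y
  proof -
    \<comment> \<open>A self-conjugate form is real on real vectors, so its real part, which alone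
      is recorded in \<open>\<Theta>\<close>, determines it.\<close>
    have rl: "Im (p x y) = 0" if "x \<in> Xr" for x
      using cnj_cdot[of x y] that by (simp add: Xr_def p_def complex_eq_iff)
    have "p x y = 0" if x: "x \<in> X" for x
    proof -
      have T0: "p x y = 0" if "x \<in> T" for x
      proof -
        have "x \<in> \<kappa> ` {1..e}" using that by (simp only: img)
        then obtain j where j: "j \<in> {1..e}" "x = \<kappa> j" by blast
        then have "h + 2 * j - 1 \<in> {1..CARD('m)}" "h + 2 * j \<in> {1..CARD('m)}" using he by auto
        from z[OF this(1), unfolded \<Theta>2[OF j(1)]] z[OF this(2), unfolded \<Theta>2[OF j(1)]]
        show ?thesis using j by (simp add: complex_eq_iff)
      qed
      consider "x \<in> Xr" | "x \<in> T" | x' where "x' \<in> T" "x = cnj_vec x'" using T(2) x by blast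
      then show ?thesis
      proof cases
        case 1
        then have "x \<in> \<xi> ` {1..h}" by (simp only: img)
        then obtain k where k: "k \<in> {1..h}" "x = \<xi> k" by blast
        then have "k \<in> {1..CARD('m)}" using he by auto
        from z[OF this] k rl[OF 1] show ?thesis by (simp add: \<Theta>1 complex_eq_iff)
      next
        case 3
        then show ?thesis using T0[OF 3(1)] cnj_cdot[of x' y] by (simp add: p_def)
      qed (use T0 in auto)
    qed
    then have "X \<subseteq> {x. cdot x (of_real_vec y) = 0}" by (auto simp: p_def)
    moreover have "vec.subspace {x. cdot x (of_real_vec y) = 0}"
      by (auto simp: vec.subspace_def cdot_linear)
    ultimately have "vec.span X \<subseteq> {x. cdot x (of_real_vec y) = 0}" by (rule vec.span_minimal)
    then have "cdot (axis i 1) (of_real_vec y) = 0" for i using X(3) by blast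
    then have "of_real_vec y $ i = 0" for i
      by (simp add: cdot_def axis_def if_distrib[of "\<lambda>x. x * _"] cong: if_cong)
    then show ?thesis by (simp add: of_real_vec_def vec_eq_iff)
  qed
  have LLlin: "linear (\<lambda>u. LL u x0)"
    unfolding LL_def by (intro linearI) (simp_all add: scaleR_add_left sum.distrib scaleR_sum_right)
  have "\<exists>\<beta>. bij_betw \<beta> (UNIV :: 'm set) {1..CARD('m)}" by (rule finite_same_card_bij) auto
  then obtain \<beta> where \<beta>: "bij_betw \<beta> (UNIV :: 'm set) {1..CARD('m)}" by blast
  \<comment> \<open>The numbers by which \<open>LL u\<close> acts, read off at the cyclic vector.
    They determine \<open>LL u x0\<close> and hence \<open>u\<close>, so \<open>\<Phi>\<close> is
    bijective and the \<open>u i\<close> can be taken as preimages of the standard vectors.\<close>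
  define \<Phi> where "\<Phi> = (\<lambda>u. \<chi> i. \<Theta> (\<beta> i) (LL u x0))"
  have \<Phi>lin: "linear \<Phi>"
    unfolding \<Phi>_def
    by (intro linearI) (simp_all add: vec_eq_iff linear_add[OF LLlin] linear_cmul[OF LLlin] linear_add[OF lin] linear_cmul[OF lin])
  define A where "A = (\<chi> i j. (L j *v x0) $ i)"
  have A: "invertible A" using W by (simp add: A_def wedge_def invertible_det_nz)
  have "inj \<Phi>"
    unfolding linear_injective_0[OF \<Phi>lin]
  proof (intro allI impI)
    fix u assume "\<Phi> u = 0"
    have "\<Theta> k (LL u x0) = 0" if k: "k \<in> {1..CARD('m)}" for k
    proof -
      have "k \<in> range \<beta>" using k by (simp add: bij_betw_imp_surj_on[OF \<beta>])
      then obtain a where "k = \<beta> a" by blast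
      moreover have "\<Phi> u $ a = 0" using \<open>\<Phi> u = 0\<close> by simp
      ultimately show ?thesis by (simp add: \<Phi>_def)
    qed
    then have "LL u x0 = 0" by (rule inj)
    moreover have "LL u x0 = A *v u"
    proof (simp add: vec_eq_iff, intro allI)
      fix i
      have "(A *v u) $ i = (\<Sum>j\<in>UNIV. A $ i $ j * u $ j)" by (simp add: matrix_vector_mult_def)
      then show "LL u x0 $ i = (A *v u) $ i" by (simp add: LL_def A_def mult.commute)
    qed
    ultimately have "matrix_inv A *v (A *v u) = 0" by simp
    then show "u = 0" by (simp add: matrix_vector_mul_assoc invertible_matrix_inv[OF A])
  qed
  then have "surj \<Phi>" by (rule linear_injective_imp_surjective[OF \<Phi>lin _ refl])
  then have "\<forall>i. \<exists>u. \<Phi> u = (\<chi> a. if \<beta> a = i then 1 else 0)" by (metis surjD)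
  then obtain u where u: "\<And>i. \<Phi> (u i) = (\<chi> a. if \<beta> a = i then 1 else 0)" by metis
  have \<Theta>u: "\<Theta> k (LL (u i) x0) = (if k = i then 1 else 0)" if "k \<in> {1..CARD('m)}" for i k
  proof -
    have "k \<in> range \<beta>" using that by (simp add: bij_betw_imp_surj_on[OF \<beta>])
    then obtain a where "k = \<beta> a" by blast
    moreover have "\<Phi> (u i) $ a = (if \<beta> a = i then 1 else 0)" by (simp add: u)
    ultimately show ?thesis by (simp add: \<Phi>_def)
  qed
  have X\<kappa>: "\<kappa> j \<in> X" if "j \<in> {1..e}" for j using img(2) T(1) imageI[OF that, of \<kappa>] by auto
  have X\<xi>: "\<xi> j \<in> Xr" "\<xi> j \<in> X" if "j \<in> {1..h}" for j
    using img(1) imageI[OF that, of \<xi>] by (auto simp: Xr_def)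
  have ev1: "\<Theta> k (LL (u i) y) = (if k = i then \<Theta> k y else 0)" if k: "k \<in> {1..h}" for i k y
  proof -
    have "Im (p (\<xi> k) z) = 0" for z
      using cnj_cdot[of "\<xi> k" z] X\<xi>(1)[OF k] by (simp add: Xr_def p_def complex_eq_iff)
    then have "Re (p (\<xi> k) (LL (u i) y)) = Re (p (\<xi> k) (LL (u i) x0)) * Re (p (\<xi> k) y)"
      by (subst pLL[OF X\<xi>(2)[OF k]]) simp
    then have "\<Theta> k (LL (u i) y) = \<Theta> k (LL (u i) x0) * \<Theta> k y" by (simp add: \<Theta>1[OF k])
    then show ?thesis using \<Theta>u[of k i] k he by simp
  qed
  \<comment> \<open>Multiplication of the complex coordinate \<open>p (\<kappa> j) y\<close> by a
    complex number, written out in real and imaginary parts.\<close>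
  have ev2: "\<Theta> (h + 2 * j - 1) (LL (u i) y) = (if h + 2 * j - 1 = i then 1 else 0) * \<Theta> (h + 2 * j - 1) y
        - (if h + 2 * j = i then 1 else 0) * \<Theta> (h + 2 * j) y"
      "\<Theta> (h + 2 * j) (LL (u i) y) = (if h + 2 * j - 1 = i then 1 else 0) * \<Theta> (h + 2 * j) y
        + (if h + 2 * j = i then 1 else 0) * \<Theta> (h + 2 * j - 1) y" if j: "j \<in> {1..e}" for i j y
  proof -
    have "h + 2 * j - 1 \<in> {1..CARD('m)}" "h + 2 * j \<in> {1..CARD('m)}" using he j by auto
    from \<Theta>u[OF this(1), of i] \<Theta>u[OF this(2), of i]
    have "Re (p (\<kappa> j) (LL (u i) x0)) = (if h + 2 * j - 1 = i then 1 else 0)"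
      "Im (p (\<kappa> j) (LL (u i) x0)) = (if h + 2 * j = i then 1 else 0)" by (simp_all only: \<Theta>2[OF j])
    then show "\<Theta> (h + 2 * j - 1) (LL (u i) y) = (if h + 2 * j - 1 = i then 1 else 0) * \<Theta> (h + 2 * j - 1) y
        - (if h + 2 * j = i then 1 else 0) * \<Theta> (h + 2 * j) y"
      "\<Theta> (h + 2 * j) (LL (u i) y) = (if h + 2 * j - 1 = i then 1 else 0) * \<Theta> (h + 2 * j) y
        + (if h + 2 * j = i then 1 else 0) * \<Theta> (h + 2 * j - 1) y"
      by (simp_all only: \<Theta>2[OF j] pLL[OF X\<kappa>[OF j], of "u i" y] times_complex.sel)
  qed
  have g1: "\<Theta> k (LL (u i) y) = (if k = i then \<Theta> i y else 0)"
    if i: "i \<in> {1..h}" and k: "k \<in> {1..CARD('m)}" for i k y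
    using kcases[OF k]
  proof (elim disjE bexE)
    assume "k \<in> {1..h}" then show ?thesis using ev1 by simp
  next
    fix j assume j: "j \<in> {1..e}" "k = h + 2 * j - 1"
    then have "h + 2 * j - 1 \<noteq> i" "h + 2 * j \<noteq> i" using i by auto
    with j show ?thesis using ev2(1)[of j i y] by simp
  next
    fix j assume j: "j \<in> {1..e}" "k = h + 2 * j"
    then have "h + 2 * j - 1 \<noteq> i" "h + 2 * j \<noteq> i" using i by auto
    with j show ?thesis using ev2(2)[of j i y] by simp
  qed
  have g23: "\<Theta> k (LL (u (h + 2 * j - 1)) y) = (if k = h + 2 * j - 1 \<or> k = h + 2 * j then \<Theta> k y else 0)"
      "\<Theta> k (LL (u (h + 2 * j)) y) = (if k = h + 2 * j - 1 then - \<Theta> (h + 2 * j) y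
       else if k = h + 2 * j then \<Theta> (h + 2 * j - 1) y else 0)"
    if j: "j \<in> {1..e}" and k: "k \<in> {1..CARD('m)}" for j k y
  proof -
    have ne: "k \<noteq> h + 2 * j - 1" "k \<noteq> h + 2 * j" if "k \<in> {1..h}" using that j by auto
    have eqs: "h + 2 * j' - 1 = h + 2 * j - 1 \<longleftrightarrow> j' = j" "h + 2 * j' - 1 \<noteq> h + 2 * j"
      "h + 2 * j' \<noteq> h + 2 * j - 1" "h + 2 * j' = h + 2 * j \<longleftrightarrow> j' = j" if "j' \<in> {1..e}" for j'
    proof -
      have "j \<ge> 1" "j' \<ge> 1" using j that by auto
      then show "h + 2 * j' - 1 = h + 2 * j - 1 \<longleftrightarrow> j' = j" "h + 2 * j' - 1 \<noteq> h + 2 * j"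
        "h + 2 * j' \<noteq> h + 2 * j - 1" "h + 2 * j' = h + 2 * j \<longleftrightarrow> j' = j" by presburger+
    qed
    show "\<Theta> k (LL (u (h + 2 * j - 1)) y) = (if k = h + 2 * j - 1 \<or> k = h + 2 * j then \<Theta> k y else 0)"
      using kcases[OF k]
    proof (elim disjE bexE)
      assume "k \<in> {1..h}" then show ?thesis using ev1 ne by simp
    next
      fix j' assume "j' \<in> {1..e}" "k = h + 2 * j' - 1"
      then show ?thesis using ev2(1)[of j' "h + 2 * j - 1" y] eqs[of j'] by simp
    next
      fix j' assume "j' \<in> {1..e}" "k = h + 2 * j'"
      then show ?thesis using ev2(2)[of j' "h + 2 * j - 1" y] eqs[of j'] by simp
    qed
    show "\<Theta> k (LL (u (h + 2 * j)) y) = (if k = h + 2 * j - 1 then - \<Theta> (h + 2 * j) y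
       else if k = h + 2 * j then \<Theta> (h + 2 * j - 1) y else 0)"
      using kcases[OF k]
    proof (elim disjE bexE)
      assume "k \<in> {1..h}" then show ?thesis using ev1 ne by simp
    next
      fix j' assume "j' \<in> {1..e}" "k = h + 2 * j' - 1"
      then show ?thesis using ev2(1)[of j' "h + 2 * j" y] eqs[of j'] by simp
    next
      fix j' assume "j' \<in> {1..e}" "k = h + 2 * j'"
      then show ?thesis using ev2(2)[of j' "h + 2 * j" y] eqs[of j'] by simp
    qed
  qed
  have g4: "\<forall>i\<in>{1..CARD('m)}. c i = 0" if c: "(\<Sum>i\<in>{1..CARD('m)}. c i *\<^sub>R u i) = 0" for c
  proof
    fix k assume k: "k \<in> {1..CARD('m)}"
    have "0 = \<Theta> k (LL (\<Sum>i\<in>{1..CARD('m)}. c i *\<^sub>R u i) x0)"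
      unfolding c using linear_0[OF LLlin] linear_0[OF lin] by simp
    also have "\<dots> = (\<Sum>i\<in>{1..CARD('m)}. c i * \<Theta> k (LL (u i) x0))"
      by (simp add: linear_sum[OF LLlin] linear_cmul[OF LLlin] linear_sum[OF lin] linear_cmul[OF lin])
    also have "\<dots> = c k" using k by (simp add: \<Theta>u[OF k] if_distrib[of "\<lambda>x. _ * x"] cong: if_cong)
    finally show "c k = 0" by simp
  qed
  show thesis
    by (rule that[of h e \<Theta> u]; fact he lin inj g1[unfolded LL_def] g23[unfolded LL_def] g4)
qed

section \<open>Charts\<close>

lemma is_chart_inj: 
  assumes "is_chart M c"
  shows "inj_on (coord c) (chart_dom c)"
  using assms openin_subset[of M "chart_dom c"]
  by (auto simp: is_chart_def homeomorphic_eq_everything_map topspace_subtopology Int_absorb1)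

lemma in_coords_coord:
  assumes "is_chart M c" "q \<in> chart_dom c"
  shows "in_coords c f (coord c q) = f q"
  using is_chart_inj[OF assms(1)] assms(2) by (simp add: in_coords_def)

lemma chart_continuous_inv:
  assumes "is_chart M c"
  shows "continuous_map (top_of_set (coord c ` chart_dom c)) (subtopology M (chart_dom c))
    (inv_into (chart_dom c) (coord c))"
proof -
  have top: "topspace (subtopology M (chart_dom c)) = chart_dom c"
    using assms openin_subset[of M "chart_dom c"] by (auto simp: is_chart_def)
  obtain g where g: "homeomorphic_maps (subtopology M (chart_dom c)) (top_of_set (coord c ` chart_dom c)) (coord c) g"
    using assms unfolding is_chart_def homeomorphic_map_maps by blast
  then have cont: "continuous_map (top_of_set (coord c ` chart_dom c)) (subtopology M (chart_dom c)) g"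
    and gi: "\<And>q. q \<in> chart_dom c \<Longrightarrow> g (coord c q) = q"
    using top by (auto simp: homeomorphic_maps_def)
  from cont show ?thesis
  proof (rule continuous_map_eq)
    fix x assume "x \<in> topspace (top_of_set (coord c ` chart_dom c))"
    then obtain q where "q \<in> chart_dom c" "x = coord c q" by auto
    then show "g x = inv_into (chart_dom c) (coord c) x"
      using gi is_chart_inj[OF assms] by simp
  qed
qed

lemma chart_open_image:
  assumes c: "is_chart M c" and W: "openin M W"
  shows "open (coord c ` (chart_dom c \<inter> W))"
proof -
  have sub: "chart_dom c \<subseteq> topspace M" using c openin_subset by (auto simp: is_chart_def)
  have "openin (top_of_set (coord c ` chart_dom c)) (coord c ` (chart_dom c \<inter> W))"
    using homeomorphic_map_openness[of "subtopology M (chart_dom c)" "top_of_set (coord c ` chart_dom c)" "coord c" "chart_dom c \<inter> W"]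
      c W sub by (auto simp: is_chart_def openin_subtopology Int_absorb1)
  moreover have "open (coord c ` chart_dom c)" using c by (simp add: is_chart_def)
  ultimately show ?thesis using openin_open_trans by blast
qed

lemma chart_open_preimage:
  assumes c: "is_chart M c" and S: "open S"
  shows "openin M {q \<in> chart_dom c. coord c q \<in> S}"
proof -
  have sub: "chart_dom c \<subseteq> topspace M" using c openin_subset by (auto simp: is_chart_def)
  have "continuous_map (subtopology M (chart_dom c)) (top_of_set (coord c ` chart_dom c)) (coord c)"
    using c by (auto simp: is_chart_def homeomorphic_imp_continuous_map)
  then have "continuous_map (subtopology M (chart_dom c)) euclidean (coord c)"
    by (simp add: continuous_map_in_subtopology)
  then have "openin (subtopology M (chart_dom c)) {q \<in> topspace (subtopology M (chart_dom c)). coord c q \<in> S}"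
    using S by (intro openin_continuous_map_preimage[of _ euclidean]) auto
  moreover have "{q \<in> topspace (subtopology M (chart_dom c)). coord c q \<in> S} = {q \<in> chart_dom c. coord c q \<in> S}"
    using sub by auto
  ultimately show ?thesis using c by (simp add: is_chart_def openin_open_subtopology)
qed

lemma manifold_chart: "smooth_manifold M A \<Longrightarrow> c \<in> A \<Longrightarrow> is_chart M c"
  by (simp add: smooth_manifold_def)

lemma manifold_compatible:
  "smooth_manifold M A \<Longrightarrow> c \<in> A \<Longrightarrow> d \<in> A \<Longrightarrow>
    smooth_on (coord c ` (chart_dom c \<inter> chart_dom d)) (in_coords c (coord d))"
  by (simp add: smooth_manifold_def smoothly_compatible_def)

text \<open>The inverse function theorem makes \<open>f\<close> a coordinate change, and maximality
  of the atlas puts the result into \<open>A\<close>. The image is cut down to a ball because later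
  constructions integrate along rays and along fibres.\<close>

lemma new_chart:
  fixes M :: "'p topology" and A :: "('p, 'n::finite) chart set"
  assumes man: "smooth_manifold M A" and c: "c \<in> A" "p \<in> chart_dom c"
    and S: "open S" "S \<subseteq> coord c ` chart_dom c" "coord c p \<in> S"
    and f: "smooth_on S f" and inj: "inj (frechet_derivative f (at (coord c p)))"
  obtains d r g where "d \<in> A" "p \<in> chart_dom d" "r > 0" "chart_dom d \<subseteq> chart_dom c"
    "\<And>q. coord d q = f (coord c q)"
    "coord d ` chart_dom d = ball (f (coord c p)) r"
    "smooth_on (ball (f (coord c p)) r) g"
    "\<And>y. y \<in> ball (f (coord c p)) r \<Longrightarrow> g y \<in> S \<and> f (g y) = y"
    "\<And>q. q \<in> chart_dom d \<Longrightarrow> coord c q = g (coord d q)"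
    "\<And>Y q. smooth_vector_field A Y \<Longrightarrow> q \<in> chart_dom d \<Longrightarrow>
      Y d q = frechet_derivative f (at (coord c q)) (Y c q)"
proof -
  have chc: "is_chart M c" by (rule manifold_chart[OF man c(1)])
  obtain S1 V g where *: "open S1" "coord c p \<in> S1" "S1 \<subseteq> S" "open V" "homeomorphism S1 V f g" "smooth_on V g"
    using smooth_inverse_function[OF S(1,3) f inj] by metis
  have hom: "\<And>x. x \<in> S1 \<Longrightarrow> f x \<in> V \<and> g (f x) = x" "\<And>y. y \<in> V \<Longrightarrow> g y \<in> S1 \<and> f (g y) = y"
    and contf: "continuous_on S1 f" and contg: "continuous_on V g"
    using *(5) by (auto simp: homeomorphism_def)
  obtain r where r: "r > 0" "ball (f (coord c p)) r \<subseteq> V" using *(2,4) hom openE by metis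
  define B where "B = ball (f (coord c p)) r"
  define S' where "S' = S1 \<inter> f -` B"
  have S'o: "open S'"
    unfolding S'_def using continuous_open_preimage[OF contf *(1), of B] by (simp add: B_def)
  have pS': "coord c p \<in> S'" using *(2) r by (simp add: S'_def B_def)
  have S'S: "S' \<subseteq> S1" by (auto simp: S'_def)
  have B: "B \<subseteq> V" using r by (simp add: B_def)
  have gB: "g y \<in> S'" "f (g y) = y" if "y \<in> B" for y using hom(2)[of y] B that by (auto simp: S'_def)
  have fS': "f x \<in> B" "g (f x) = x" if "x \<in> S'" for x using hom(1)[of x] that by (auto simp: S'_def)
  define dd where "dd = {q \<in> chart_dom c. coord c q \<in> S'}"
  define d where "d = (dd, \<lambda>q. f (coord c q))"
  have d: "chart_dom d = dd" "\<And>q. coord d q = f (coord c q)" by (simp_all add: d_def)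
  have ddo: "openin M dd" unfolding dd_def by (rule chart_open_preimage[OF chc S'o])
  have S'S2: "S' \<subseteq> S" "S' \<subseteq> coord c ` chart_dom c" using S'S *(3) S(2) by blast+
  have cdd: "coord c ` dd = S'"
  proof
    show "S' \<subseteq> coord c ` dd"
    proof
      fix x assume x: "x \<in> S'"
      then obtain q where "q \<in> chart_dom c" "x = coord c q" using S'S2 by blast
      with x show "x \<in> coord c ` dd" by (auto simp: dd_def)
    qed
  qed (auto simp: dd_def)
  have ddim: "coord d ` dd = B"
  proof -
    have "coord d ` dd = f ` S'" by (simp add: d(2) image_image flip: cdd)
    also have "\<dots> = B" using fS' gB by (metis image_eqI subset_antisym subsetI image_subsetI)
    finally show ?thesis .
  qed
  have chd: "is_chart M d"
    unfolding is_chart_def d(1) ddim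
  proof (intro conjI ddo)
    show "open B" by (simp add: B_def)
    have "homeomorphic_map (subtopology (subtopology M (chart_dom c)) dd)
        (subtopology (top_of_set (coord c ` chart_dom c)) S') (coord c)"
    proof (rule homeomorphic_map_subtopologies)
      show "homeomorphic_map (subtopology M (chart_dom c)) (top_of_set (coord c ` chart_dom c)) (coord c)"
        using chc by (simp add: is_chart_def)
      have "chart_dom c \<subseteq> topspace M" using chc openin_subset by (auto simp: is_chart_def)
      then show "coord c ` (topspace (subtopology M (chart_dom c)) \<inter> dd) =
          topspace (top_of_set (coord c ` chart_dom c)) \<inter> S'"
        using S'S *(3) S(2) by (auto simp: dd_def)
    qed
    moreover have "subtopology (subtopology M (chart_dom c)) dd = subtopology M dd"
      by (simp add: subtopology_subtopology dd_def Int_absorb1 subset_eq)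
    moreover have "subtopology (top_of_set (coord c ` chart_dom c)) S' = top_of_set S'"
      using S'S *(3) S(2) by (simp add: subtopology_subtopology Int_absorb1)
    moreover have "homeomorphic_map (top_of_set S') (top_of_set B) f"
      unfolding homeomorphic_map_maps homeomorphic_maps_def
      by (rule exI[of _ g])
        (use gB fS' continuous_on_subset[OF contf S'S] continuous_on_subset[OF contg B]
          in \<open>auto simp: continuous_map_in_subtopology\<close>)
    ultimately have "homeomorphic_map (subtopology M dd) (top_of_set B) (f \<circ> coord c)"
      using homeomorphic_map_compose by metis
    then show "homeomorphic_map (subtopology M dd) (top_of_set B) (coord d)"
      by (simp add: d_def o_def)
  qed
  have cq: "coord c q \<in> S'" "q \<in> chart_dom c" "g (coord d q) = coord c q" if "q \<in> dd" for q
    using that fS' by (auto simp: dd_def d(2))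
  have dA: "d \<in> A"
  proof -
    have "smoothly_compatible d e" if e: "e \<in> A" for e
      unfolding smoothly_compatible_def
    proof
      have che: "is_chart M e" by (rule manifold_chart[OF man e])
      have eo: "openin M (chart_dom e)" "openin M (chart_dom c)" using che chc by (auto simp: is_chart_def)
      have W: "open (coord d ` (chart_dom d \<inter> chart_dom e))" by (rule chart_open_image[OF chd eo(1)])
      show "smooth_on (coord d ` (chart_dom d \<inter> chart_dom e)) (in_coords d (coord e))"
      proof (rule smooth_on_cong[OF W])
        show "smooth_on (coord d ` (chart_dom d \<inter> chart_dom e)) (\<lambda>y. in_coords c (coord e) (g y))"
        proof (rule smooth_on_compose[OF W chart_open_image[OF chc eo(1)] manifold_compatible[OF man c(1) e]])
          show "smooth_on (coord d ` (chart_dom d \<inter> chart_dom e)) g"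
            by (rule smooth_on_subset[OF *(6)]) (use ddim B d(1) in auto)
        qed (use cq d(1) in auto)
        show "in_coords d (coord e) y = in_coords c (coord e) (g y)"
          if "y \<in> coord d ` (chart_dom d \<inter> chart_dom e)" for y
          using that cq d(1) by (auto simp: in_coords_coord[OF chd] in_coords_coord[OF chc])
      qed
      have W': "open (coord e ` (chart_dom e \<inter> dd))" by (rule chart_open_image[OF che ddo])
      have "smooth_on (coord e ` (chart_dom e \<inter> dd)) (in_coords e (coord d))"
      proof (rule smooth_on_cong[OF W'])
        show "smooth_on (coord e ` (chart_dom e \<inter> dd)) (\<lambda>x. f (in_coords e (coord c) x))"
        proof (rule smooth_on_compose[OF W' S(1) f])
          show "smooth_on (coord e ` (chart_dom e \<inter> dd)) (in_coords e (coord c))"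
            by (rule smooth_on_subset[OF manifold_compatible[OF man e c(1)]]) (use cq in auto)
        qed (use subsetD[OF S'S2(1) cq(1)] in \<open>auto simp: in_coords_coord[OF che]\<close>)
        show "in_coords e (coord d) x = f (in_coords e (coord c) x)" if "x \<in> coord e ` (chart_dom e \<inter> dd)" for x
          using that by (auto simp: in_coords_coord[OF che] d(2))
      qed
      then show "smooth_on (coord e ` (chart_dom d \<inter> chart_dom e)) (in_coords e (coord d))"
        by (simp add: d(1) Int_commute)
    qed
    moreover have "\<forall>c. is_chart M c \<and> (\<forall>d\<in>A. smoothly_compatible c d) \<longrightarrow> c \<in> A"
      using man unfolding smooth_manifold_def by (elim conjE)
    ultimately show ?thesis using chd by blast
  qed
  show thesis
  proof (rule that[of d r g])
    show "d \<in> A" by fact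
    show "p \<in> chart_dom d" using c pS' by (simp add: d(1) dd_def)
    show "r > 0" by fact
    show "chart_dom d \<subseteq> chart_dom c" by (auto simp: d(1) dd_def)
    show "coord d q = f (coord c q)" for q by (rule d(2))
    show "coord d ` chart_dom d = ball (f (coord c p)) r" by (simp add: d(1) ddim B_def)
    show "smooth_on (ball (f (coord c p)) r) g" by (rule smooth_on_subset[OF *(6) r(2)])
    show "g y \<in> S \<and> f (g y) = y" if "y \<in> ball (f (coord c p)) r" for y
      using gB[of y] S'S *(3) that by (auto simp: B_def)
    show "coord c q = g (coord d q)" if "q \<in> chart_dom d" for q using cq that d(1) by simp
    fix Y q assume Y: "smooth_vector_field A Y" and q: "q \<in> chart_dom d"
    have qd: "q \<in> dd" using q d(1) by simp
    have Yd: "Y d q = frechet_derivative (in_coords c (coord d)) (at (coord c q)) (Y c q)"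
      using Y c(1) dA q cq(2)[OF qd] unfolding smooth_vector_field_def by blast
    have "(f has_derivative frechet_derivative f (at (coord c q))) (at (coord c q))"
      using smooth_on_differentiable[OF f] cq(1)[OF qd] S'S *(3) by blast
    then have "(in_coords c (coord d) has_derivative frechet_derivative f (at (coord c q))) (at (coord c q))"
    proof (rule has_derivative_transform_within_open[OF _ S'o cq(1)[OF qd]])
      fix x assume "x \<in> S'"
      then obtain q' where "q' \<in> dd" "x = coord c q'" using cdd by blast
      then show "f x = in_coords c (coord d) x"
        using cq(2) by (simp add: in_coords_coord[OF chc] d(2))
    qed
    then show "Y d q = frechet_derivative f (at (coord c q)) (Y c q)"
      using Yd frechet_derivative_eq by metis
  qed
qed

section \<open>Fields tangent to the fibres of the quotient map\<close>

lemma generator_axis: "generator X (axis j a) c q = a *\<^sub>R X j c q"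
  unfolding generator_def axis_def
  by (simp add: if_distrib[of "\<lambda>x. x *\<^sub>R _"] cong: if_cong)

text \<open>An integral curve of \<open>X j\<close> stays in one local orbit, where
  \<open>\<pi>\<close> is constant. Differentiating \<open>\<pi>\<close> along it at its start gives
  the claim up to the speed \<open>\<epsilon>\<close>.\<close>

lemma quotient_derivative_zero:
  fixes M :: "'p topology" and A :: "('p, 'n::finite) chart set" and \<pi> :: "'p \<Rightarrow> real ^ 'm::finite"
  assumes man: "smooth_manifold M A" and sys: "integrable_system A X"
    and quot: "local_quotient M A X K V \<pi>"
    and c: "c \<in> A" and q: "q \<in> chart_dom c" "q \<in> V" and j: "j \<in> K"
  shows "frechet_derivative (in_coords c \<pi>) (at (coord c q)) (X j c q) = 0"
proof -
  have chc: "is_chart M c" by (rule manifold_chart[OF man c])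
  have Xj: "smooth_vector_field A (X j)" using sys by (simp add: integrable_system_def)
  have Vo: "openin M V" using quot by (simp add: local_quotient_def)
  define S where "S = coord c ` (chart_dom c \<inter> V)"
  have S: "open S" "S \<subseteq> coord c ` chart_dom c" "coord c q \<in> S"
    using chart_open_image[OF chc Vo] q by (auto simp: S_def)
  define F where "F = in_coords c (X j c)"
  have F: "smooth_on S F"
    using Xj c S(2) by (auto simp: smooth_vector_field_def F_def intro: smooth_on_subset)
  obtain \<epsilon> w where w: "\<epsilon> > 0" "w 0 = coord c q" "\<And>s. s \<in> {0..1} \<Longrightarrow> w s \<in> S"
    "\<And>s. s \<in> {0..1} \<Longrightarrow> (w has_vector_derivative \<epsilon> *\<^sub>R F (w s)) (at s within {0..1})"
    using local_integral_curve[OF S(1,3) F] by metis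
  define ic where "ic = inv_into (chart_dom c) (coord c)"
  have ic: "ic x \<in> chart_dom c" "coord c (ic x) = x" "ic x \<in> V" if xS: "x \<in> S" for x
  proof -
    obtain q' where q': "q' \<in> chart_dom c" "q' \<in> V" "x = coord c q'"
      using xS unfolding S_def by blast
    then have "ic x = q'" using is_chart_inj[OF chc] by (simp add: ic_def)
    with q' show "ic x \<in> chart_dom c" "coord c (ic x) = x" "ic x \<in> V" by auto
  qed
  have icq: "ic (coord c q) = q" using is_chart_inj[OF chc] q by (simp add: ic_def)
  have wc: "continuous_on {0..1} w"
    unfolding continuous_on_eq_continuous_within using has_vector_derivative_continuous[OF w(4)] by blast
  have const: "\<pi> (ic (w \<tau>)) = \<pi> q" if \<tau>: "\<tau> \<in> {0..1}" for \<tau>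
  proof -
    have \<tau>s: "\<tau> * s \<in> {0..1}" if "s \<in> {0..1}" for s using \<tau> that by (auto simp: mult_le_one)
    \<comment> \<open>Orbits are defined through curves over the unit interval. The point
      \<open>w \<tau>\<close> is reached at time 1 by running the same curve at speed
      \<open>\<tau>\<close>, which is an integral curve of \<open>\<tau> * \<epsilon>\<close> times
      \<open>X j\<close>.\<close>
    define \<gamma> where "\<gamma> = (\<lambda>s. ic (w (\<tau> * s)))"
    have "integral_curve M A (generator X (axis j (\<tau> * \<epsilon>))) \<gamma>"
      unfolding integral_curve_def
    proof (intro conjI ballI impI)
      have "continuous_map (top_of_set {0..1}) (top_of_set (coord c ` chart_dom c)) (\<lambda>s. w (\<tau> * s))"
        unfolding continuous_map_in_subtopology
        using \<tau>s w(3) S(2) by (auto intro!: continuous_on_compose2[OF wc] continuous_intros)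
      from continuous_map_compose[OF this chart_continuous_inv[OF chc]]
      show "continuous_map (top_of_set {0..1}) M \<gamma>"
        by (simp add: \<gamma>_def ic_def o_def continuous_map_in_subtopology)
    next
      fix s :: real and d assume s: "s \<in> {0..1}" and d: "d \<in> A" and sd: "\<gamma> s \<in> chart_dom d"
      have wS: "w (\<tau> * s) \<in> S" by (rule w(3)[OF \<tau>s[OF s]])
      have \<gamma>c: "\<gamma> s \<in> chart_dom c" "coord c (\<gamma> s) = w (\<tau> * s)" using ic[OF wS] by (simp_all add: \<gamma>_def)
      have "((\<lambda>s. w (\<tau> * s)) has_vector_derivative \<tau> *\<^sub>R (\<epsilon> *\<^sub>R F (w (\<tau> * s)))) (at s within {0..1})"
      proof -
        have a: "((\<lambda>s. \<tau> * s) has_vector_derivative \<tau>) (at s within {0..1})"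
          by (auto intro!: derivative_eq_intros)
        have b: "(w has_vector_derivative \<epsilon> *\<^sub>R F (w (\<tau> * s))) (at (\<tau> * s) within (\<lambda>s. \<tau> * s) ` {0..1})"
          by (rule has_vector_derivative_within_subset[OF w(4)[OF \<tau>s[OF s]]], rule image_subsetI, rule \<tau>s)
        show ?thesis by (rule vector_diff_chain_within[OF a b, unfolded o_def])
      qed
      moreover have der: "(in_coords c (coord d) has_derivative frechet_derivative (in_coords c (coord d)) (at (w (\<tau> * s)))) (at (w (\<tau> * s)))"
        by (rule smooth_on_differentiable[OF manifold_compatible[OF man c d]]) (use \<gamma>c sd in \<open>auto intro!: image_eqI[of _ _ "\<gamma> s"]\<close>)
      ultimately have "((\<lambda>s. in_coords c (coord d) (w (\<tau> * s))) has_derivative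
          (\<lambda>h. frechet_derivative (in_coords c (coord d)) (at (w (\<tau> * s))) (h *\<^sub>R \<tau> *\<^sub>R \<epsilon> *\<^sub>R F (w (\<tau> * s))))) (at s within {0..1})"
        unfolding has_vector_derivative_def by (rule has_derivative_compose)
      moreover have "frechet_derivative (in_coords c (coord d)) (at (w (\<tau> * s))) (h *\<^sub>R \<tau> *\<^sub>R \<epsilon> *\<^sub>R F (w (\<tau> * s))) =
          h *\<^sub>R generator X (axis j (\<tau> * \<epsilon>)) d (\<gamma> s)" for h
      proof -
        have "F (w (\<tau> * s)) = X j c (\<gamma> s)" using \<gamma>c in_coords_coord[OF chc \<gamma>c(1)] by (simp add: F_def)
        moreover have "X j d (\<gamma> s) = frechet_derivative (in_coords c (coord d)) (at (coord c (\<gamma> s))) (X j c (\<gamma> s))"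
          using Xj c d sd \<gamma>c(1) unfolding smooth_vector_field_def by blast
        ultimately show ?thesis
          using has_derivative_linear[OF der] by (simp add: linear_cmul generator_axis \<gamma>c(2))
      qed
      ultimately show "((\<lambda>s. coord d (\<gamma> s)) has_vector_derivative generator X (axis j (\<tau> * \<epsilon>)) d (\<gamma> s)) (at s within {0..1})"
        by (simp add: has_vector_derivative_def \<gamma>_def in_coords_def ic_def)
    qed
    moreover have "\<gamma> ` {0..1} \<subseteq> V" using ic(3) w(3) \<tau>s by (auto simp: \<gamma>_def)
    moreover have "\<gamma> 0 = q" "\<gamma> 1 = ic (w \<tau>)" using icq w(2) by (simp_all add: \<gamma>_def)
    moreover have "\<forall>i. i \<notin> K \<longrightarrow> axis j (\<tau> * \<epsilon>) $ i = 0" using j by (auto simp: axis_def)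
    ultimately have "same_local_orbit M A X K V q (ic (w \<tau>))"
      unfolding same_local_orbit_def by (intro r_into_rtranclp) blast
    then have "\<pi> q = \<pi> (ic (w \<tau>))"
      using quot q(2) ic(3)[OF w(3)[OF \<tau>]] unfolding local_quotient_def by blast
    then show ?thesis by simp
  qed
  have der: "(in_coords c \<pi> has_derivative frechet_derivative (in_coords c \<pi>) (at (coord c q))) (at (coord c q))"
    by (rule smooth_on_differentiable[OF _ S(3)]) (use quot c in \<open>auto simp: local_quotient_def S_def\<close>)
  have "((\<lambda>\<tau>. in_coords c \<pi> (w \<tau>)) has_derivative
      (\<lambda>h. frechet_derivative (in_coords c \<pi>) (at (coord c q)) (h *\<^sub>R \<epsilon> *\<^sub>R F (coord c q)))) (at 0 within {0..1})"
    using has_derivative_compose[OF w(4)[of 0, unfolded has_vector_derivative_def], of "in_coords c \<pi>"] der w(2) by simp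
  moreover have "F (coord c q) = X j c q" by (simp add: F_def in_coords_coord[OF chc q(1)])
  ultimately have a: "((\<lambda>\<tau>. in_coords c \<pi> (w \<tau>)) has_vector_derivative
      \<epsilon> *\<^sub>R frechet_derivative (in_coords c \<pi>) (at (coord c q)) (X j c q)) (at 0 within {0..1})"
    using has_derivative_linear[OF der] by (simp add: has_vector_derivative_def linear_cmul)
  have b: "((\<lambda>\<tau>. in_coords c \<pi> (w \<tau>)) has_vector_derivative 0) (at 0 within {0..1})"
    by (rule has_vector_derivative_transform[of 0 "{0..1}" _ "\<lambda>_. \<pi> q"])
      (use const in \<open>auto simp: in_coords_def ic_def\<close>)
  have "\<epsilon> *\<^sub>R frechet_derivative (in_coords c \<pi>) (at (coord c q)) (X j c q) = 0"
    by (rule vector_derivative_unique_within_closed_interval[of 0 1 0, unfolded cbox_interval, OF _ _ a b]) auto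
  with w(1) show ?thesis by simp
qed

section \<open>Charts adapted to the free directions\<close>

text \<open>The term with the second derivative of \<open>f\<close> contains the factor
  \<open>B x = 0\<close>. Hence at a zero of a field a coordinate change acts on the linear part
  through its Jacobian only.\<close>

lemma has_derivative_apply_at_zero:
  fixes f :: "'a::euclidean_space \<Rightarrow> 'b::euclidean_space"
  assumes S: "open S" "x \<in> S" and f: "smooth_on S f"
    and B: "(B has_derivative B') (at x)" "B x = 0"
  shows "((\<lambda>z. frechet_derivative f (at z) (B z)) has_derivative (\<lambda>u. frechet_derivative f (at x) (B' u))) (at x)"
proof -
  have lin: "frechet_derivative f (at z) v = (\<Sum>i\<in>Basis. (v \<bullet> i) *\<^sub>R frechet_derivative f (at z) i)" if "z \<in> S" for z v
    using smooth_on_differentiable[OF f that] by (intro frechet_derivative_euclidean) (rule differentiableI)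
  have "((\<lambda>z. \<Sum>i\<in>Basis. (B z \<bullet> i) *\<^sub>R frechet_derivative f (at z) i) has_derivative
      (\<lambda>u. \<Sum>i\<in>Basis. (B x \<bullet> i) *\<^sub>R frechet_derivative (\<lambda>z. frechet_derivative f (at z) i) (at x) u
        + (B' u \<bullet> i) *\<^sub>R frechet_derivative f (at x) i)) (at x)"
    by (intro has_derivative_sum has_derivative_scaleR has_derivative_inner_left B(1)
        smooth_on_differentiable[OF smooth_on_derivative[OF f] S(2)])
  then have "((\<lambda>z. \<Sum>i\<in>Basis. (B z \<bullet> i) *\<^sub>R frechet_derivative f (at z) i) has_derivative
      (\<lambda>u. frechet_derivative f (at x) (B' u))) (at x)"
    by (simp add: B(2) flip: lin[OF S(2)])
  then show ?thesis
    by (rule has_derivative_transform_within_open[OF _ S]) (rule lin[symmetric])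
qed

lemma linear_cart_expand:
  fixes f :: "real ^ 'n \<Rightarrow> 'b::real_vector"
  assumes "linear f"
  shows "f w = (\<Sum>l\<in>UNIV. w $ l *\<^sub>R f (axis l 1))"
proof -
  have "w = (\<Sum>l\<in>UNIV. w $ l *\<^sub>R axis l 1)"
    by (simp add: vec_eq_iff axis_def if_distrib[of "\<lambda>y. _ * y"] cong: if_cong)
  then have "f w = f (\<Sum>l\<in>UNIV. w $ l *\<^sub>R axis l 1)" by (rule arg_cong)
  also have "\<dots> = (\<Sum>l\<in>UNIV. w $ l *\<^sub>R f (axis l 1))"
    by (simp only: linear_sum[OF assms] linear_cmul[OF assms])
  finally show ?thesis .
qed

text \<open>The directions in \<open>K\<close> will be those of the free fields, the others are
  transverse. The transverse space is identified with the model \<open>real ^ 'm\<close> of the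
  reduced system, with \<open>\<rho>\<close> as projection and \<open>\<eta>\<close> as its section;
  the fibres of \<open>\<rho>\<close> are the orbits to be straightened.\<close>

locale index_split =
  fixes K :: "'n::finite set" and \<sigma> :: "'m::finite \<Rightarrow> 'n"
  assumes \<sigma>: "bij_betw \<sigma> UNIV (- K)"
begin

definition \<rho> :: "real ^ 'n \<Rightarrow> real ^ 'm" where "\<rho> x = (\<chi> b. x $ \<sigma> b)"
definition \<eta> :: "real ^ 'm \<Rightarrow> real ^ 'n" where "\<eta> z = (\<chi> i. if i \<in> K then 0 else z $ inv_into UNIV \<sigma> i)"
definition Q :: "real ^ 'n \<Rightarrow> real ^ 'n" where "Q x = (\<chi> i. if i \<in> K then x $ i else 0)"

lemma \<sigma>_notin [simp]: "\<sigma> b \<notin> K"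
  using \<sigma> by (auto simp: bij_betw_def)

lemma \<sigma>_inv [simp]: "inv_into UNIV \<sigma> (\<sigma> b) = b" "i \<notin> K \<Longrightarrow> \<sigma> (inv_into UNIV \<sigma> i) = i"
proof -
  show "inv_into UNIV \<sigma> (\<sigma> b) = b" using \<sigma> by (simp add: bij_betw_def)
  assume "i \<notin> K"
  then have "i \<in> range \<sigma>" using \<sigma> by (simp add: bij_betw_def)
  then show "\<sigma> (inv_into UNIV \<sigma> i) = i" by (rule f_inv_into_f)
qed

lemma bounded_linear_split: "bounded_linear \<rho>" "bounded_linear \<eta>" "bounded_linear Q"
  by (auto simp: \<rho>_def \<eta>_def Q_def vec_eq_iff intro!: linearI linear_conv_bounded_linear[THEN iffD1])

lemmas \<rho>_simps = linear_add[OF bounded_linear.linear[OF bounded_linear_split(1)]]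
  linear_diff[OF bounded_linear.linear[OF bounded_linear_split(1)]]
  linear_cmul[OF bounded_linear.linear[OF bounded_linear_split(1)]]
  linear_sum[OF bounded_linear.linear[OF bounded_linear_split(1)]]
  linear_0[OF bounded_linear.linear[OF bounded_linear_split(1)]]
lemmas \<eta>_simps = linear_add[OF bounded_linear.linear[OF bounded_linear_split(2)]]
  linear_diff[OF bounded_linear.linear[OF bounded_linear_split(2)]]
  linear_cmul[OF bounded_linear.linear[OF bounded_linear_split(2)]]
  linear_sum[OF bounded_linear.linear[OF bounded_linear_split(2)]]
  linear_0[OF bounded_linear.linear[OF bounded_linear_split(2)]]
lemmas Q_simps = linear_add[OF bounded_linear.linear[OF bounded_linear_split(3)]]
  linear_diff[OF bounded_linear.linear[OF bounded_linear_split(3)]]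
  linear_cmul[OF bounded_linear.linear[OF bounded_linear_split(3)]]
  linear_sum[OF bounded_linear.linear[OF bounded_linear_split(3)]]
  linear_0[OF bounded_linear.linear[OF bounded_linear_split(3)]]

lemma split_simps [simp]:
  "\<rho> (\<eta> z) = z" "\<rho> (Q x) = 0" "Q (\<eta> z) = 0" "Q (Q x) = Q x" "j \<in> K \<Longrightarrow> \<rho> (axis j a) = 0"
  "j \<in> K \<Longrightarrow> Q (axis j a) = axis j a"
  by (auto simp: \<rho>_def \<eta>_def Q_def vec_eq_iff axis_def)

lemma split_sum: "\<eta> (\<rho> x) + Q x = x"
  by (simp add: \<rho>_def \<eta>_def Q_def vec_eq_iff)

lemma Q_expand: "Q x = (\<Sum>j\<in>K. x $ j *\<^sub>R axis j 1)"
  by (simp add: Q_def vec_eq_iff axis_def if_distrib[of "\<lambda>y. _ * y"] cong: if_cong)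

lemma norm_split: "norm (\<rho> x) \<le> norm x" "norm (\<eta> z) = norm z" "norm (Q x) \<le> norm x"
proof -
  have re: "(\<Sum>b\<in>UNIV. f (\<sigma> b)) = (\<Sum>i\<in>-K. f i)" for f :: "'n \<Rightarrow> real"
    using sum.reindex_bij_betw[OF \<sigma>] by simp
  have "(\<Sum>b\<in>UNIV. (x $ \<sigma> b)\<^sup>2) \<le> (\<Sum>i\<in>UNIV. (x $ i)\<^sup>2)"
    unfolding re[of "\<lambda>i. (x $ i)\<^sup>2"] by (intro sum_mono2) auto
  then show "norm (\<rho> x) \<le> norm x" by (simp add: norm_vec_def L2_set_def \<rho>_def)
  have "(\<Sum>i\<in>UNIV. (\<eta> z $ i)\<^sup>2) = (\<Sum>i\<in>-K. (\<eta> z $ i)\<^sup>2)"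
    by (intro sum.mono_neutral_right) (auto simp: \<eta>_def)
  also have "\<dots> = (\<Sum>b\<in>UNIV. (z $ b)\<^sup>2)" by (subst re[symmetric]) (simp add: \<eta>_def)
  finally show "norm (\<eta> z) = norm z" by (simp add: norm_vec_def L2_set_def)
  have "(\<Sum>i\<in>UNIV. (Q x $ i)\<^sup>2) \<le> (\<Sum>i\<in>UNIV. (x $ i)\<^sup>2)"
    by (intro sum_mono) (auto simp: Q_def)
  then show "norm (Q x) \<le> norm x" by (simp add: norm_vec_def L2_set_def)
qed

text \<open>Shrinking the components in \<open>K\<close> enlarges no component. So a ball contains
  the segment in the fibre from each of its points to the transverse representative, along which the
  integrals below are taken.\<close>

lemma fibre_in_ball:
  assumes "x \<in> ball 0 q" "t \<in> {0..1}"
  shows "\<eta> (\<rho> x) + t *\<^sub>R Q x \<in> ball 0 q"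
proof -
  have "norm (\<eta> (\<rho> x) + t *\<^sub>R Q x) \<le> norm x"
    by (rule norm_le_componentwise_cart)
      (use assms(2) in \<open>auto simp: \<eta>_def \<rho>_def Q_def abs_mult intro: mult_left_le_one_le\<close>)
  then show ?thesis using assms(1) by simp
qed

lemma ball_split: "x \<in> ball 0 r \<Longrightarrow> \<rho> x \<in> ball 0 r" "z \<in> ball 0 r \<Longrightarrow> \<eta> z \<in> ball 0 r" "x \<in> ball 0 r \<Longrightarrow> Q x \<in> ball 0 r"
  using norm_split(1)[of x] norm_split(2)[of z] norm_split(3)[of x] by auto

end

section \<open>The system in charts centred at the singular point\<close>

locale local_system = index_split K \<sigma>
  for K :: "'n::finite set" and \<sigma> :: "'m::finite \<Rightarrow> 'n" +
  fixes M :: "'p topology" and A :: "('p, 'n) chart set" and X :: "'n \<Rightarrow> ('p, 'n) vfield" and p :: 'p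
  assumes man: "smooth_manifold M A" and sys: "integrable_system A X"
begin

text \<open>The image is a whole ball around the image of \<open>p\<close>, so that rays to the
  origin and segments in the fibres stay inside it.\<close>

definition centered :: "('p, 'n) chart \<Rightarrow> real \<Rightarrow> bool" where
  "centered c r \<longleftrightarrow> c \<in> A \<and> p \<in> chart_dom c \<and> coord c p = 0 \<and> r > 0 \<and> coord c ` chart_dom c = ball 0 r"

definition R :: "('p, 'n) chart \<Rightarrow> 'n \<Rightarrow> real ^ 'n \<Rightarrow> real ^ 'n" where
  "R c i = in_coords c (X i c)"

lemma field: "smooth_vector_field A (X i)"
  using sys by (simp add: integrable_system_def)

lemma R_coord: "c \<in> A \<Longrightarrow> q \<in> chart_dom c \<Longrightarrow> R c i (coord c q) = X i c q"
  unfolding R_def by (rule in_coords_coord[OF manifold_chart[OF man]])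

lemma R_smooth: "centered c r \<Longrightarrow> smooth_on (ball 0 r) (R c i)"
  using field[of i] unfolding centered_def smooth_vector_field_def R_def by metis

lemma R_derivative:
  "centered c r \<Longrightarrow> x \<in> ball 0 r \<Longrightarrow> (R c i has_derivative frechet_derivative (R c i) (at x)) (at x)"
  by (rule smooth_on_differentiable[OF R_smooth])

lemma R_commute:
  assumes c: "centered c r" and x: "x \<in> ball 0 r"
  shows "frechet_derivative (R c j) (at x) (R c i x) = frechet_derivative (R c i) (at x) (R c j x)"
proof -
  obtain q where q: "q \<in> chart_dom c" "x = coord c q" using c x unfolding centered_def by blast
  have "lie_bracket (X i) (X j) c q = 0"
    using sys c q unfolding integrable_system_def commuting_fields_def centered_def by blast
  then show ?thesis
    using c q R_coord[of c q] unfolding centered_def lie_bracket_def R_def by simp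
qed

lemma change_chart:
  assumes c: "centered c r" and s: "0 < s" "s \<le> r" and f: "smooth_on (ball 0 s) f" "f 0 = 0"
    and inj: "inj (frechet_derivative f (at 0))"
  obtains d r' g where "centered d r'" "chart_dom d \<subseteq> chart_dom c" "smooth_on (ball 0 r') g" "g 0 = 0"
    "\<And>y. y \<in> ball 0 r' \<Longrightarrow> g y \<in> ball 0 s" "\<And>y. y \<in> ball 0 r' \<Longrightarrow> f (g y) = y"
    "\<And>y i. y \<in> ball 0 r' \<Longrightarrow> R d i y = frechet_derivative f (at (g y)) (R c i (g y))"
proof -
  have c': "c \<in> A" "p \<in> chart_dom c" "coord c p = 0" "coord c ` chart_dom c = ball 0 r" using c by (auto simp: centered_def)
  have "ball 0 s \<subseteq> coord c ` chart_dom c" "coord c p \<in> ball 0 s" "inj (frechet_derivative f (at (coord c p)))"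
    using s inj by (simp_all add: c'(3,4) subset_ball)
  note nc = new_chart[OF man c'(1,2) open_ball[of 0 s] this(1,2) f(1) this(3)]
  show thesis
  proof (rule nc)
    fix d r' g assume d: "d \<in> A" "p \<in> chart_dom d" "r' > 0" "chart_dom d \<subseteq> chart_dom c"
      "\<And>q. coord d q = f (coord c q)"
      "coord d ` chart_dom d = ball (f (coord c p)) r'"
      "smooth_on (ball (f (coord c p)) r') g"
      "\<And>y. y \<in> ball (f (coord c p)) r' \<Longrightarrow> g y \<in> ball 0 s \<and> f (g y) = y"
      "\<And>q. q \<in> chart_dom d \<Longrightarrow> coord c q = g (coord d q)"
      "\<And>Y q. smooth_vector_field A Y \<Longrightarrow> q \<in> chart_dom d \<Longrightarrow>
        Y d q = frechet_derivative f (at (coord c q)) (Y c q)"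
    have fp: "f (coord c p) = 0" by (simp add: c' f)
    show thesis
    proof (rule that[of d r' g])
      show "centered d r'" using d(1,2,3,6) d(5)[of p] fp by (simp add: centered_def)
      show "chart_dom d \<subseteq> chart_dom c" by (rule d(4))
      show "smooth_on (ball 0 r') g" using d(7) by (simp add: fp)
      show "g 0 = 0" using d(9)[OF d(2)] d(5)[of p] by (simp add: c' f)
      fix y :: "real ^ 'n" and i assume y: "y \<in> ball 0 r'"
      show "g y \<in> ball 0 s" "f (g y) = y" using d(8)[of y] y by (simp_all add: fp)
      have "y \<in> coord d ` chart_dom d" using d(6) y by (simp only: fp)
      then obtain q where q: "q \<in> chart_dom d" "y = coord d q" by blast
      have "q \<in> chart_dom c" using q(1) d(4) by blast
      with q show "R d i y = frechet_derivative f (at (g y)) (R c i (g y))"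
        using d(10)[OF field q(1)] d(9)[OF q(1)] R_coord[OF d(1) q(1)] R_coord[OF c'(1), of q] by simp
    qed
  qed
qed

text \<open>With the quotient map as transverse coordinates, the fields of \<open>K\<close> become
  vertical and the others show their reduced fields. The coordinates in \<open>K\<close> have to be
  right to first order at \<open>p\<close> only, so a linear map supplies them.\<close>

lemma first_chart:
  fixes \<pi> :: "'p \<Rightarrow> real ^ 'm"
  assumes p: "p \<in> topspace M" and V: "p \<in> V" and quot: "local_quotient M A X K V \<pi>"
    and proj: "\<And>a. projects_to A V \<pi> (X (\<sigma> a)) (Z a)"
  obtains c r where "centered c r" "\<And>j. j \<in> K \<Longrightarrow> R c j 0 = axis j 1"
    "\<And>x j. x \<in> ball 0 r \<Longrightarrow> j \<in> K \<Longrightarrow> \<rho> (R c j x) = 0"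
    "\<And>x a. x \<in> ball 0 r \<Longrightarrow> \<rho> (R c (\<sigma> a) x) = Z a (\<pi> p + \<rho> x)"
proof -
  obtain c0 where c0: "c0 \<in> A" "p \<in> chart_dom c0"
    using man p unfolding smooth_manifold_def by blast
  have ch0: "is_chart M c0" by (rule manifold_chart[OF man c0(1)])
  have Vo: "openin M V" using quot by (simp add: local_quotient_def)
  define S where "S = coord c0 ` (chart_dom c0 \<inter> V)"
  have S: "open S" "S \<subseteq> coord c0 ` chart_dom c0" "coord c0 p \<in> S"
    using chart_open_image[OF ch0 Vo] c0 V by (auto simp: S_def)
  define f0 where "f0 = (\<lambda>x. x - coord c0 p)"
  have f0: "smooth_on S f0"
    unfolding f0_def by (intro smooth_on_diff S smooth_on_const smooth_on_bounded_linear bounded_linear_ident)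
  have "(f0 has_derivative (\<lambda>u. u)) (at (coord c0 p))"
    unfolding f0_def by (auto intro!: derivative_eq_intros)
  from frechet_derivative_eq[OF this] have "inj (frechet_derivative f0 (at (coord c0 p)))"
    by (simp add: inj_def)
  note nc = new_chart[OF man c0 S f0 this]
  show thesis
  proof (rule nc)
    fix c1 r1 g1 assume c1: "c1 \<in> A" "p \<in> chart_dom c1" "r1 > 0" "chart_dom c1 \<subseteq> chart_dom c0"
      "\<And>q. coord c1 q = f0 (coord c0 q)"
      "coord c1 ` chart_dom c1 = ball (f0 (coord c0 p)) r1"
      "smooth_on (ball (f0 (coord c0 p)) r1) g1"
      "\<And>y. y \<in> ball (f0 (coord c0 p)) r1 \<Longrightarrow> g1 y \<in> S \<and> f0 (g1 y) = y"
      "\<And>q. q \<in> chart_dom c1 \<Longrightarrow> coord c0 q = g1 (coord c1 q)"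
      "\<And>Y q. smooth_vector_field A Y \<Longrightarrow> q \<in> chart_dom c1 \<Longrightarrow>
        Y c1 q = frechet_derivative f0 (at (coord c0 q)) (Y c0 q)"
    have im1: "coord c1 ` chart_dom c1 = ball 0 r1" "coord c1 p = 0"
      using c1(6) c1(5)[of p] by (simp_all add: f0_def)
    then have cen1: "centered c1 r1" using c1(1,2,3) by (simp add: centered_def)
    have dom1: "chart_dom c1 \<subseteq> V"
    proof
      fix q assume q: "q \<in> chart_dom c1"
      then have "coord c1 q \<in> ball (f0 (coord c0 p)) r1" using c1(6) by blast
      then have "coord c0 q \<in> S" using c1(8)[of "coord c1 q"] c1(9)[OF q] by simp
      then obtain q' where "q' \<in> chart_dom c0" "q' \<in> V" "coord c0 q = coord c0 q'" unfolding S_def by blast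
      moreover have "q \<in> chart_dom c0" using q c1(4) by blast
      ultimately have "q = q'" using inj_onD[OF is_chart_inj[OF ch0]] by blast
      with \<open>q' \<in> V\<close> show "q \<in> V" by simp
    qed
    define h where "h = in_coords c1 \<pi>"
    have h: "smooth_on (ball 0 r1) h"
    proof -
      have "smooth_on (coord c1 ` (chart_dom c1 \<inter> V)) h"
        using quot c1(1) unfolding local_quotient_def h_def by blast
      moreover have "chart_dom c1 \<inter> V = chart_dom c1" using dom1 by blast
      ultimately show ?thesis by (simp only: im1)
    qed
    have hq: "h (coord c1 q) = \<pi> q" if "q \<in> chart_dom c1" for q
      unfolding h_def by (rule in_coords_coord[OF manifold_chart[OF man c1(1)] that])
    have hp: "h 0 = \<pi> p" using hq[OF c1(2)] im1 by simp
    have hd: "(h has_derivative frechet_derivative h (at x)) (at x)" if "x \<in> ball 0 r1" for x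
      by (rule smooth_on_differentiable[OF h that])
    have hK: "frechet_derivative h (at x) (R c1 j x) = 0" if "x \<in> ball 0 r1" "j \<in> K" for x j
    proof -
      have "x \<in> coord c1 ` chart_dom c1" using that(1) by (simp only: im1)
      then obtain q where q: "q \<in> chart_dom c1" "x = coord c1 q" by blast
      then have "q \<in> V" using dom1 by blast
      from quotient_derivative_zero[OF man sys quot c1(1) q(1) this that(2)] show ?thesis
        by (simp add: h_def q(2) R_coord[OF c1(1) q(1)])
    qed
    have hZ: "frechet_derivative h (at x) (R c1 (\<sigma> a) x) = Z a (h x)" if "x \<in> ball 0 r1" for x a
    proof -
      have "x \<in> coord c1 ` chart_dom c1" using that by (simp only: im1)
      then obtain q where q: "q \<in> chart_dom c1" "x = coord c1 q" by blast
      then have "q \<in> chart_dom c1 \<inter> V" using dom1 by blast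
      then have "Z a (\<pi> q) = frechet_derivative (in_coords c1 \<pi>) (at (coord c1 q)) (X (\<sigma> a) c1 q)"
        using proj[of a] c1(1) unfolding projects_to_def by blast
      then show ?thesis by (simp only: q(2) R_coord[OF c1(1) q(1)] hq[OF q(1)]) (simp only: h_def)
    qed
    have h0: "surj (frechet_derivative h (at 0))"
    proof -
      have "p \<in> chart_dom c1 \<inter> V" using c1(2) V by blast
      then have "surj (frechet_derivative (in_coords c1 \<pi>) (at (coord c1 p)))"
        using quot c1(1) unfolding local_quotient_def by blast
      then show ?thesis by (simp only: im1 h_def)
    qed
    have "independent_at A X K p" using quot V unfolding local_quotient_def by blast
    then have ind: "inj_on (\<lambda>i. X i c1 p) K" "independent ((\<lambda>i. X i c1 p) ` K)"
      using c1(1,2) unfolding independent_at_def by blast+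
    \<comment> \<open>Extends the frame dual to the independent vectors \<open>X j c1 p\<close> to a
      linear map; its \<open>K\<close>-components will be the new
      \<open>K\<close>-coordinates.\<close>
    obtain T where T': "linear T" "\<forall>v\<in>(\<lambda>i. X i c1 p) ` K. T v = axis (inv_into K (\<lambda>i. X i c1 p) v) (1::real)"
      using linear_independent_extend[OF ind(2), of "\<lambda>v. axis (inv_into K (\<lambda>i. X i c1 p) v) (1::real)"] by blast
    note T = T'(1) bspec[OF T'(2)]
    have R0: "R c1 j 0 = X j c1 p" for j using R_coord[OF c1(1,2), of j] by (simp only: im1(2))
    have TR: "T (R c1 j 0) = axis j 1" if "j \<in> K" for j
    proof -
      have inv: "inv_into K (\<lambda>i. X i c1 p) (X j c1 p) = j" using inv_into_f_f[OF ind(1) that] .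
      have "T (X j c1 p) = axis (inv_into K (\<lambda>i. X i c1 p) (X j c1 p)) 1"
        by (rule T(2)) (rule imageI[OF that])
      then show ?thesis by (simp only: R0 inv)
    qed
    have Tb: "bounded_linear T" using T(1) linear_conv_bounded_linear by blast
    define f where "f = (\<lambda>x. \<eta> (h x - \<pi> p) + Q (T x))"
    have fs: "smooth_on (ball 0 r1) f"
      unfolding f_def
      by (intro smooth_on_add smooth_on_bounded_linear_compose[OF bounded_linear_split(2)] smooth_on_diff h smooth_on_const
          smooth_on_bounded_linear bounded_linear_compose[OF bounded_linear_split(3) Tb] open_ball)
    have fd: "frechet_derivative f (at x) u = \<eta> (frechet_derivative h (at x) u) + Q (T u)" if "x \<in> ball 0 r1" for x u
    proof (rule frechet_derivative_eq)
      show "(f has_derivative (\<lambda>u. \<eta> (frechet_derivative h (at x) u) + Q (T u))) (at x)"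
        unfolding f_def
        by (rule derivative_eq_intros bounded_linear.has_derivative[OF bounded_linear_split(2)]
            bounded_linear.has_derivative[OF bounded_linear_split(3)] bounded_linear.has_derivative[OF Tb] hd[OF that] refl | simp)+
    qed
    have in0: "0 \<in> ball (0::real^'n) r1" using c1(3) by simp
    have fd0: "frechet_derivative f (at 0) = (\<lambda>u. \<eta> (frechet_derivative h (at 0) u) + Q (T u))"
      using fd[OF in0] by blast
    have lin0: "linear (frechet_derivative f (at 0))"
      using smooth_on_differentiable[OF fs in0] by (rule has_derivative_linear)
    have linh: "linear (frechet_derivative h (at 0))" using hd[OF in0] by (rule has_derivative_linear)
    \<comment> \<open>The submersion reaches every transverse component. The components in
      \<open>K\<close> are then corrected by the fields of \<open>K\<close>, which the derivative of
      \<open>h\<close> annihilates.\<close>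
    have "surj (frechet_derivative f (at 0))"
      unfolding surj_def
    proof
      fix y
      obtain u0 where u0: "frechet_derivative h (at 0) u0 = \<rho> y" using h0 by (metis surjD)
      define w where "w = y - T u0"
      define u where "u = u0 + (\<Sum>j\<in>K. w $ j *\<^sub>R R c1 j 0)"
      have "frechet_derivative h (at 0) u = \<rho> y"
        using hK[OF in0] by (simp add: u_def linear_add[OF linh] linear_sum[OF linh] linear_cmul[OF linh] u0)
      moreover have "T u = T u0 + Q w"
        using TR by (simp add: u_def linear_add[OF T(1)] linear_sum[OF T(1)] linear_cmul[OF T(1)] Q_expand)
      then have "Q (T u) = Q y" by (simp add: Q_simps w_def)
      ultimately have "frechet_derivative f (at 0) u = y" by (simp add: fd0 split_sum)
      then show "\<exists>u. y = frechet_derivative f (at 0) u" by metis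
    qed
    then have "inj (frechet_derivative f (at 0))"
      using linear_surjective_imp_injective[OF lin0 _ refl] by blast
    moreover have "f 0 = 0" by (simp add: f_def hp \<eta>_simps linear_0[OF T(1)] Q_simps)
    ultimately obtain c r g where c': "centered c r" "chart_dom c \<subseteq> chart_dom c1" "smooth_on (ball 0 r) g" "g 0 = 0"
      "\<And>y. y \<in> ball 0 r \<Longrightarrow> g y \<in> ball 0 r1" "\<And>y. y \<in> ball 0 r \<Longrightarrow> f (g y) = y"
      "\<And>y i. y \<in> ball 0 r \<Longrightarrow> R c i y = frechet_derivative f (at (g y)) (R c1 i (g y))"
      using change_chart[OF cen1 c1(3) order_refl fs] by blast
    note c = c'(1,4-7)
    show thesis
    proof (rule that[OF c(1)])
      have "r > 0" using c(1) by (simp add: centered_def)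
      fix j assume j: "j \<in> K"
      show "R c j 0 = axis j 1"
        using c(5)[of 0 j] \<open>r > 0\<close> j hK[OF in0] TR by (simp add: c(2) fd0 \<eta>_simps)
      show "\<rho> (R c j x) = 0" if "x \<in> ball 0 r" for x
        using c(5)[OF that] hK[OF c(3)[OF that] j] by (simp add: fd[OF c(3)[OF that]] \<rho>_simps)
    next
      fix x :: "real ^ 'n" and a assume x: "x \<in> ball 0 r"
      have "\<rho> x = h (g x) - \<pi> p" using arg_cong[OF c(4)[OF x], of \<rho>] by (simp add: f_def \<rho>_simps)
      then show "\<rho> (R c (\<sigma> a) x) = Z a (\<pi> p + \<rho> x)"
        using c(5)[OF x] hZ[OF c(3)[OF x]] by (simp add: fd[OF c(3)[OF x]] \<rho>_simps)
    qed
  qed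
qed

end

lemma constant_of_zero_interior_derivative:
  fixes y :: "real \<Rightarrow> 'b::euclidean_space"
  assumes "continuous_on {0..1} y" "\<And>t. 0 < t \<Longrightarrow> t < 1 \<Longrightarrow> (y has_vector_derivative 0) (at t)"
  shows "y 1 = y 0"
proof -
  have "((\<lambda>_. 0) has_integral y 1 - y 0) {0..1::real}"
    using assms by (intro fundamental_theorem_of_calculus_interior[where f = y]) auto
  then show ?thesis using has_integral_unique[OF has_integral_0] by fastforce
qed

section \<open>Coordinate changes that linearise the system\<close>

context local_system
begin

lemma frechet_\<rho>_R:
  assumes "centered c r" "x \<in> ball 0 r"
  shows "((\<lambda>x. \<rho> (R c i x)) has_derivative (\<lambda>u. \<rho> (frechet_derivative (R c i) (at x) u))) (at x)"
  by (rule bounded_linear.has_derivative[OF bounded_linear_split(1) R_derivative[OF assms]])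

text \<open>Linearises the reduced Euler field \<open>\<Sum>a v a Z' a\<close>; the reduced fields \<open>Z' a\<close> become the \<open>Y a\<close>.\<close>

lemma euler_chart:
  assumes c: "centered c r" and K0: "\<And>j. j \<in> K \<Longrightarrow> R c j 0 = axis j 1"
    and K: "\<And>x j. x \<in> ball 0 r \<Longrightarrow> j \<in> K \<Longrightarrow> \<rho> (R c j x) = 0"
    and Z: "\<And>x a. x \<in> ball 0 r \<Longrightarrow> \<rho> (R c (\<sigma> a) x) = Z' a (\<rho> x)"
    and Z0: "\<And>a. Z' a 0 = 0" and Zd: "\<And>a. (Z' a has_derivative L a) (at 0)"
    and v: "\<And>u. (\<Sum>a\<in>UNIV. v a *\<^sub>R L a u) = u"
  obtains c' r' Y where "centered c' r'" "\<And>j. j \<in> K \<Longrightarrow> R c' j 0 = axis j 1"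
    "\<And>x j. x \<in> ball 0 r' \<Longrightarrow> j \<in> K \<Longrightarrow> \<rho> (R c' j x) = 0"
    "\<And>x a. x \<in> ball 0 r' \<Longrightarrow> \<rho> (R c' (\<sigma> a) x) = Y a (\<rho> x)"
    "\<And>a. (Y a has_derivative L a) (at 0)"
    "\<And>x. x \<in> ball 0 r' \<Longrightarrow> (\<Sum>a\<in>UNIV. v a *\<^sub>R Y a (\<rho> x)) = \<rho> x"
proof -
  have r: "r > 0" using c by (simp add: centered_def)
  have Zs: "smooth_on (ball 0 r) (Z' a)" for a
  proof (rule smooth_on_cong[OF open_ball])
    show "smooth_on (ball 0 r) (\<lambda>z. \<rho> (R c (\<sigma> a) (\<eta> z)))"
      by (rule smooth_on_bounded_linear_compose[OF bounded_linear_split(1) open_ball],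
          rule smooth_on_compose[OF open_ball open_ball R_smooth[OF c] smooth_on_bounded_linear[OF bounded_linear_split(2)]],
          rule ball_split(2))
    show "Z' a z = \<rho> (R c (\<sigma> a) (\<eta> z))" if "z \<in> ball 0 r" for z
      using Z[OF ball_split(2)[OF that]] by simp
  qed
  define E where "E = (\<lambda>z. \<Sum>a\<in>UNIV. v a *\<^sub>R Z' a z)"
  have E: "smooth_on (ball 0 r) E"
    unfolding E_def by (intro smooth_on_sum smooth_on_scaleR smooth_on_const Zs open_ball)
  have E0: "E 0 = 0" by (simp add: E_def Z0)
  have Ed: "(E has_derivative (\<lambda>u. \<Sum>a\<in>UNIV. v a *\<^sub>R L a u)) (at 0)"
    unfolding E_def by (intro has_derivative_sum has_derivative_scaleR_right Zd)
  have DE: "frechet_derivative E (at 0) u = u" for u using frechet_derivative_eq[OF Ed, of u] v[of u] by simp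
  obtain s0 \<psi> where \<psi>: "s0 > 0" "smooth_on (ball 0 s0) \<psi>" "\<psi> 0 = 0" "(\<psi> has_derivative (\<lambda>u. u)) (at 0)"
    "\<And>x. x \<in> ball 0 s0 \<Longrightarrow> \<psi> x \<in> ball 0 r"
    "\<And>x. x \<in> ball 0 s0 \<Longrightarrow> frechet_derivative \<psi> (at x) x = E (\<psi> x)"
    using euler_linearization[OF r E E0 DE] by blast
  have D\<psi>0: "frechet_derivative \<psi> (at 0) = (\<lambda>u. u)" using frechet_derivative_at[OF \<psi>(4)] by simp
  have "0 \<in> ball (0 :: real ^ 'm) s0" "inj (frechet_derivative \<psi> (at 0))" using \<psi>(1) by (simp_all add: D\<psi>0 inj_def)
  note sif = smooth_inverse_function[OF open_ball this(1) \<psi>(2) this(2)]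
  show thesis
  proof (rule sif)
    fix S' V' \<phi> assume inv: "open S'" "0 \<in> S'" "S' \<subseteq> ball 0 s0" "open V'" "homeomorphism S' V' \<psi> \<phi>" "smooth_on V' \<phi>"
      "\<And>x. x \<in> S' \<Longrightarrow> inj (frechet_derivative \<psi> (at x))"
      "\<And>y. y \<in> V' \<Longrightarrow> (\<phi> has_derivative inv (frechet_derivative \<psi> (at (\<phi> y)))) (at y)"
    have hom: "\<And>x. x \<in> S' \<Longrightarrow> \<psi> x \<in> V' \<and> \<phi> (\<psi> x) = x" "\<And>y. y \<in> V' \<Longrightarrow> \<phi> y \<in> S' \<and> \<psi> (\<phi> y) = y"
      using inv(5) by (auto simp: homeomorphism_def)
    have V0: "0 \<in> V'" "\<phi> 0 = 0" using hom(1)[OF inv(2)] \<psi>(3) by auto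
    obtain s1 where s1: "s1 > 0" "ball 0 s1 \<subseteq> V'" using openE[OF inv(4) V0(1)] by blast
    define s where "s = min s1 r"
    have s: "0 < s" "s \<le> r" "ball 0 s \<subseteq> V'" using s1 r by (auto simp: s_def)
    have \<phi>d: "(\<phi> has_derivative frechet_derivative \<phi> (at z)) (at z)" if "z \<in> V'" for z
      by (rule smooth_on_differentiable[OF inv(6) that])
    have D\<phi>0: "frechet_derivative \<phi> (at 0) u = u" for u
      using frechet_derivative_eq[OF inv(8)[OF V0(1)]] by (simp add: V0 D\<psi>0 inv_id[unfolded id_def])
    \<comment> \<open>Only the transverse coordinates change, by the inverse \<open>\<phi>\<close>
      of the linearising map. So the fields of \<open>K\<close> stay vertical and keep their values
      at the origin.\<close>
    define f where "f = (\<lambda>x. \<eta> (\<phi> (\<rho> x)) + Q x)"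
    have fs: "smooth_on (ball 0 s) f"
      unfolding f_def
    proof (rule smooth_on_add[OF open_ball smooth_on_bounded_linear_compose[OF bounded_linear_split(2) open_ball]
          smooth_on_bounded_linear[OF bounded_linear_split(3)]])
      show "smooth_on (ball 0 s) (\<lambda>x. \<phi> (\<rho> x))"
        by (rule smooth_on_compose[OF open_ball inv(4,6) smooth_on_bounded_linear[OF bounded_linear_split(1)]])
          (use s(3) ball_split(1) in blast)
    qed
    have \<rho>V: "\<rho> x \<in> V'" if "x \<in> ball 0 s" for x using s(3) ball_split(1)[OF that] by blast
    have fd: "frechet_derivative f (at x) u = \<eta> (frechet_derivative \<phi> (at (\<rho> x)) (\<rho> u)) + Q u" if "x \<in> ball 0 s" for x u
    proof (rule frechet_derivative_eq)
      have "((\<lambda>x. \<phi> (\<rho> x)) has_derivative (\<lambda>u. frechet_derivative \<phi> (at (\<rho> x)) (\<rho> u))) (at x)"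
        by (rule has_derivative_compose[OF bounded_linear_imp_has_derivative[OF bounded_linear_split(1)] \<phi>d[OF \<rho>V[OF that]]])
      then show "(f has_derivative (\<lambda>u. \<eta> (frechet_derivative \<phi> (at (\<rho> x)) (\<rho> u)) + Q u)) (at x)"
        unfolding f_def
        by (intro has_derivative_add bounded_linear.has_derivative[OF bounded_linear_split(2)]
            bounded_linear_imp_has_derivative[OF bounded_linear_split(3)])
    qed
    have in0: "0 \<in> ball (0 :: real ^ 'n) s" using s by simp
    have "frechet_derivative f (at 0) u = u" for u
      using fd[OF in0, of u] by (simp add: \<rho>_simps D\<phi>0 split_sum)
    then have inj: "inj (frechet_derivative f (at 0))" by (simp add: inj_def)
    have f0: "f 0 = 0" by (simp add: f_def \<rho>_simps \<eta>_simps Q_simps V0)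
    obtain d r' g where d: "centered d r'" "chart_dom d \<subseteq> chart_dom c" "smooth_on (ball 0 r') g" "g 0 = 0"
      "\<And>y. y \<in> ball 0 r' \<Longrightarrow> g y \<in> ball 0 s" "\<And>y. y \<in> ball 0 r' \<Longrightarrow> f (g y) = y"
      "\<And>y i. y \<in> ball 0 r' \<Longrightarrow> R d i y = frechet_derivative f (at (g y)) (R c i (g y))"
      using change_chart[OF c s(1,2) fs f0 inj] by blast
    \<comment> \<open>The reduced field transported by \<open>\<phi>\<close>; the new point
      \<open>w\<close> has the old position \<open>\<psi> w\<close>. Its linear part is still
      \<open>L a\<close>, because \<open>\<psi>\<close> is tangent to the identity.\<close>
    define Y where "Y = (\<lambda>a w. frechet_derivative \<phi> (at (\<psi> w)) (Z' a (\<psi> w)))"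
    have gr: "g y \<in> ball 0 r" if "y \<in> ball 0 r'" for y using d(5)[OF that] s(2) by auto
    have \<rho>y: "\<rho> y = \<phi> (\<rho> (g y))" "\<rho> (g y) = \<psi> (\<rho> y)" "\<rho> y \<in> S'" if "y \<in> ball 0 r'" for y
    proof -
      show 1: "\<rho> y = \<phi> (\<rho> (g y))" using arg_cong[OF d(6)[OF that], of \<rho>] by (simp add: f_def \<rho>_simps)
      show "\<rho> (g y) = \<psi> (\<rho> y)" "\<rho> y \<in> S'" unfolding 1 using hom(2)[OF \<rho>V[OF d(5)[OF that]]] by simp_all
    qed
    have \<rho>R: "\<rho> (R d i y) = frechet_derivative \<phi> (at (\<psi> (\<rho> y))) (\<rho> (R c i (g y)))" if "y \<in> ball 0 r'" for i y
      unfolding d(7)[OF that] fd[OF d(5)[OF that]] by (simp add: \<rho>_simps \<rho>y(2)[OF that])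
    show thesis
    proof (rule that[OF d(1), of Y])
      have r': "r' > 0" using d(1) by (simp add: centered_def)
      fix j assume j: "j \<in> K"
      show "R d j 0 = axis j 1"
        using d(7)[of 0 j] r' by (simp add: d(4) fd[OF in0] K0[OF j] \<rho>_simps D\<phi>0 j \<eta>_simps)
    next
      fix x :: "real ^ 'n" and j assume x: "x \<in> ball 0 r'" and j: "j \<in> K"
      have "\<psi> (\<rho> x) \<in> V'" using hom(1)[OF \<rho>y(3)[OF x]] by simp
      from has_derivative_linear[OF \<phi>d[OF this]]
      show "\<rho> (R d j x) = 0" by (simp add: \<rho>R[OF x] K[OF gr[OF x] j] linear_0)
    next
      fix x :: "real ^ 'n" and a assume x: "x \<in> ball 0 r'"
      show "\<rho> (R d (\<sigma> a) x) = Y a (\<rho> x)"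
        by (simp add: \<rho>R[OF x] Z[OF gr[OF x]] \<rho>y(2)[OF x] Y_def)
    next
      fix a
      have "((\<lambda>z. frechet_derivative \<phi> (at z) (Z' a z)) has_derivative (\<lambda>u. frechet_derivative \<phi> (at 0) (L a u))) (at 0)"
        by (rule has_derivative_apply_at_zero[OF inv(4) V0(1) inv(6) Zd Z0])
      then have "((\<lambda>z. frechet_derivative \<phi> (at z) (Z' a z)) has_derivative L a) (at (\<psi> 0))"
        by (simp add: D\<phi>0 \<psi>(3))
      from has_derivative_compose[OF \<psi>(4) this] show "(Y a has_derivative L a) (at 0)" by (simp add: Y_def)
    next
      fix x :: "real ^ 'n" assume x: "x \<in> ball 0 r'"
      let ?w = "\<rho> x"
      have w: "?w \<in> S'" "?w \<in> ball 0 s0" "\<psi> ?w \<in> V'" using \<rho>y(3)[OF x] hom(1) inv(3) by auto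
      have "linear (frechet_derivative \<phi> (at (\<psi> ?w)))" using \<phi>d[OF w(3)] by (rule has_derivative_linear)
      then have "(\<Sum>a\<in>UNIV. v a *\<^sub>R Y a ?w) = frechet_derivative \<phi> (at (\<psi> ?w)) (E (\<psi> ?w))"
        by (simp add: Y_def E_def linear_sum linear_cmul)
      also have "\<dots> = inv (frechet_derivative \<psi> (at ?w)) (frechet_derivative \<psi> (at ?w) ?w)"
        using frechet_derivative_eq[OF inv(8)[OF w(3)]] hom(1)[OF w(1)] \<psi>(6)[OF w(2)] by simp
      also have "\<dots> = ?w" using inv(7)[OF w(1)] by (simp add: inv_f_f)
      finally show "(\<Sum>a\<in>UNIV. v a *\<^sub>R Y a ?w) = ?w" .
    qed
  qed
qed

text \<open>Straightens the free action: the new \<open>K\<close>-coordinates are primitives, along the fibres of \<open>\<rho>\<close>, of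
  the coframe dual to the commuting fields indexed by \<open>K\<close>; these forms are closed because the
  fields commute.\<close>

lemma straighten:
  assumes c: "centered c r" and K0: "\<And>j. j \<in> K \<Longrightarrow> R c j 0 = axis j 1"
    and K: "\<And>x j. x \<in> ball 0 r \<Longrightarrow> j \<in> K \<Longrightarrow> \<rho> (R c j x) = 0"
  obtains c' r' g where "centered c' r'" "\<And>x j. x \<in> ball 0 r' \<Longrightarrow> j \<in> K \<Longrightarrow> R c' j x = axis j 1"
    "\<And>x. x \<in> ball 0 r' \<Longrightarrow> g x \<in> ball 0 r" "\<And>x. x \<in> ball 0 r' \<Longrightarrow> \<rho> (g x) = \<rho> x"
    "\<And>x i. x \<in> ball 0 r' \<Longrightarrow> \<rho> (R c' i x) = \<rho> (R c i (g x))"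
proof -
  have r: "r > 0" using c by (simp add: centered_def)
  have in0: "0 \<in> ball (0 :: real ^ 'n) r" using r by simp
  \<comment> \<open>The fields of \<open>K\<close>, completed to a frame by constant vectors. The
    rows of its inverse \<open>T\<close> with index in \<open>K\<close> are the dual
    coframe.\<close>
  define F where "F = (\<lambda>x. (\<chi> i j. if j \<in> K then R c j x $ i else if i = j then 1 else 0) :: real ^ 'n ^ 'n)"
  have Fent: "pdiff k I (ball 0 r) (\<lambda>_ x. F x $ i $ j)" for k i j and I :: "real set"
  proof (cases "j \<in> K")
    case True
    then show ?thesis
      using pdiff_nth[OF open_ball smooth_on_pdiff[OF R_smooth[OF c, of j]], of k I i] by (simp add: F_def)
  next
    case False
    then show ?thesis by (simp add: F_def pdiff_const)
  qed
  have Fcol: "F x *v w = (\<Sum>j\<in>K. w $ j *\<^sub>R R c j x) + \<eta> (\<rho> w)" for x w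
  proof -
    have "(F x *v w) $ i = (\<Sum>j\<in>K. w $ j *\<^sub>R R c j x) $ i + \<eta> (\<rho> w) $ i" for i
    proof -
      have "(F x *v w) $ i = (\<Sum>j\<in>UNIV. F x $ i $ j * w $ j)" by (simp add: matrix_vector_mult_def)
      also have "\<dots> = (\<Sum>j\<in>K. F x $ i $ j * w $ j) + (\<Sum>j\<in>-K. F x $ i $ j * w $ j)"
        by (subst sum.union_disjoint[symmetric]) auto
      also have "(\<Sum>j\<in>-K. F x $ i $ j * w $ j) = (\<Sum>j\<in>-K. if j = i then w $ i else 0)"
        by (intro sum.cong) (auto simp: F_def)
      also have "\<dots> = \<eta> (\<rho> w) $ i" by (simp add: \<eta>_def \<rho>_def)
      finally show ?thesis by (simp add: F_def mult.commute)
    qed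
    then show ?thesis by (simp add: vec_eq_iff)
  qed
  have F0: "F 0 *v w = w" for w
    using split_sum[of w] by (simp add: Fcol K0 Q_expand add.commute)
  then have "F 0 = mat 1" by (simp add: matrix_eq)
  then have det0: "det (F 0) = 1" by simp
  have "continuous_on (ball 0 r) (\<lambda>x. det (F x))"
  proof -
    have ent: "continuous_on (ball 0 r) (\<lambda>x. F x $ i $ j)" for i j
    proof -
      have "continuous_on (ball 0 r) (\<lambda>x. (0::real, x))" by (intro continuous_intros)
      from continuous_on_compose2[OF pdiff_continuous[OF Fent[of 0 "{0}"]] this]
      show ?thesis by (auto simp: image_subset_iff)
    qed
    show ?thesis unfolding det_def by (intro ent continuous_intros)
  qed
  then have "open (ball 0 r \<inter> (\<lambda>x. det (F x)) -` (- {0}))"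
    by (intro continuous_open_preimage) auto
  moreover have "0 \<in> ball 0 r \<inter> (\<lambda>x. det (F x)) -` (- {0})" using in0 det0 by simp
  ultimately obtain s where s: "s > 0" "ball 0 s \<subseteq> ball 0 r \<inter> (\<lambda>x. det (F x)) -` (- {0})"
    using openE by blast
  have sr: "ball (0 :: real ^ 'n) s \<subseteq> ball 0 r" and det: "\<And>x. x \<in> ball 0 s \<Longrightarrow> det (F x) \<noteq> 0" using s by auto
  define s' where "s' = min s r"
  have s': "0 < s'" "s' \<le> r" using s r by (auto simp: s'_def)
  have s's: "ball (0 :: real ^ 'n) s' \<subseteq> ball 0 s" by (auto simp: s'_def)
  define T where "T = (\<lambda>x w. matrix_inv (F x) *v w)"
  have T: "smooth_on (ball 0 s) (\<lambda>x. T x w)" for w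
    unfolding T_def
    by (rule smooth_onI, rule pdiff_matrix_inv[OF open_ball pdiff_subset[OF Fent order_refl sr]])
      (use det in \<open>auto intro: pdiff_const\<close>)
  have Tinv: "T x (F x *v w) = w" "F x *v (T x w) = w" if "x \<in> ball 0 s" for x w
    using det[OF that] by (simp_all add: T_def matrix_vector_mul_assoc invertible_matrix_inv invertible_det_nz)
  have Tlin: "linear (T x)" for x unfolding T_def by (rule matrix_vector_mul_linear)
  define B where "B = (\<lambda>x u w. frechet_derivative (\<lambda>x. T x w) (at x) u)"
  have Bd: "((\<lambda>x. T x w) has_derivative (\<lambda>u. B x u w)) (at x)" if "x \<in> ball 0 s" for x w
    unfolding B_def using smooth_on_differentiable[OF T that] .
  have Blin1: "linear (\<lambda>u. B x u w)" if "x \<in> ball 0 s" for x w using Bd[OF that] by (rule has_derivative_linear)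
  have Texp: "T x w = (\<Sum>l\<in>UNIV. w $ l *\<^sub>R T x (axis l 1))" for x w
    by (rule linear_cart_expand[OF Tlin])
  have Tprod: "((\<lambda>x. T x (W x)) has_derivative (\<lambda>u. T x (W' u) + B x u (W x))) (at x)"
    if x: "x \<in> ball 0 s" and W: "(W has_derivative W') (at x)" for x W W'
  proof -
    have "((\<lambda>x. \<Sum>l\<in>UNIV. W x $ l *\<^sub>R T x (axis l 1)) has_derivative
        (\<lambda>u. \<Sum>l\<in>UNIV. W x $ l *\<^sub>R B x u (axis l 1) + W' u $ l *\<^sub>R T x (axis l 1))) (at x)"
      by (intro has_derivative_sum has_derivative_scaleR Bd[OF x]
          bounded_linear.has_derivative[OF bounded_linear_vec_nth W])
    moreover have "(\<Sum>l\<in>UNIV. W x $ l *\<^sub>R B x u (axis l 1)) = B x u (W x)" for u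
    proof -
      have "((\<lambda>y. \<Sum>l\<in>UNIV. W x $ l *\<^sub>R T y (axis l 1)) has_derivative
          (\<lambda>u. \<Sum>l\<in>UNIV. W x $ l *\<^sub>R B x u (axis l 1))) (at x)"
        by (intro has_derivative_sum has_derivative_scaleR_right Bd[OF x])
      then have "((\<lambda>y. T y (W x)) has_derivative (\<lambda>u. \<Sum>l\<in>UNIV. W x $ l *\<^sub>R B x u (axis l 1))) (at x)"
        by (simp flip: Texp)
      from frechet_derivative_eq[OF this] show ?thesis by (simp add: B_def)
    qed
    ultimately show ?thesis by (simp add: sum.distrib add.commute flip: Texp)
  qed
  \<comment> \<open>Differentiating \<open>T x (R c j x) = axis j 1\<close> expresses
    \<open>B\<close> by the derivative of \<open>R c j\<close>. Symmetry of \<open>B\<close> on the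
    fibres, which is closedness of the coframe there, then amounts to the vanishing of the
    brackets.\<close>
  have Bsym0: "B x (R c k x) (R c j x) = B x (R c j x) (R c k x)" if x: "x \<in> ball 0 s" and jk: "j \<in> K" "k \<in> K" for x j k
  proof -
    have eq: "B x u (R c j x) = - T x (frechet_derivative (R c j) (at x) u)" if j: "j \<in> K" for j u
    proof -
      have xr: "x \<in> ball 0 r" using x sr by blast
      have 1: "((\<lambda>x. T x (R c j x)) has_derivative (\<lambda>u. T x (frechet_derivative (R c j) (at x) u) + B x u (R c j x))) (at x)"
        by (rule Tprod[OF x R_derivative[OF c xr]])
      have 2: "((\<lambda>x. T x (R c j x)) has_derivative (\<lambda>u. 0)) (at x)"
      proof (rule has_derivative_transform_within_open[OF _ open_ball x])
        show "((\<lambda>x. axis j 1) has_derivative (\<lambda>u. 0)) (at x)" by simp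
        fix y :: "real ^ 'n" assume y: "y \<in> ball 0 s"
        have "F y *v axis j 1 = R c j y"
          using j by (simp add: Fcol axis_def if_distrib[of "\<lambda>t. t *\<^sub>R _"] \<eta>_simps cong: if_cong)
            (simp add: \<rho>_def \<eta>_def vec_eq_iff)
        then show "axis j 1 = T y (R c j y)" using Tinv(1)[OF y, of "axis j 1"] by simp
      qed
      have "T x (frechet_derivative (R c j) (at x) u) + B x u (R c j x) = 0"
        using fun_cong[OF has_derivative_unique[OF 1 2], of u] .
      then show ?thesis by (simp add: eq_neg_iff_add_eq_0 add.commute)
    qed
    have "x \<in> ball 0 r" using x sr by blast
    from R_commute[OF c this, of j k] show ?thesis by (simp add: eq jk)
  qed
  have rangeQ: "w = (\<Sum>j\<in>K. T x w $ j *\<^sub>R R c j x)" "\<rho> (T x w) = 0" if x: "x \<in> ball 0 s" and w: "\<rho> w = 0" for x w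
  proof -
    have e: "w = (\<Sum>j\<in>K. T x w $ j *\<^sub>R R c j x) + \<eta> (\<rho> (T x w))" using Tinv(2)[OF x, of w] by (simp add: Fcol)
    have "\<rho> w = \<rho> (T x w)"
      using arg_cong[OF e, of \<rho>] K x sr by (simp add: \<rho>_simps subset_eq)
    with w show "\<rho> (T x w) = 0" by simp
    with e show "w = (\<Sum>j\<in>K. T x w $ j *\<^sub>R R c j x)" by (simp add: \<eta>_simps)
  qed
  have Blin2: "linear (B x u)" if x: "x \<in> ball 0 s" for x u
  proof (rule linearI)
    fix w w' :: "real ^ 'n" and a :: real
    have "((\<lambda>y. T y w + T y w') has_derivative (\<lambda>u. B x u w + B x u w')) (at x)"
      by (intro has_derivative_add Bd[OF x])
    then have "((\<lambda>y. T y (w + w')) has_derivative (\<lambda>u. B x u w + B x u w')) (at x)"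
      by (simp add: linear_add[OF Tlin])
    from frechet_derivative_eq[OF this] show "B x u (w + w') = B x u w + B x u w'" by (simp add: B_def)
    have "((\<lambda>y. a *\<^sub>R T y w) has_derivative (\<lambda>u. a *\<^sub>R B x u w)) (at x)"
      by (intro has_derivative_scaleR_right Bd[OF x])
    then have "((\<lambda>y. T y (a *\<^sub>R w)) has_derivative (\<lambda>u. a *\<^sub>R B x u w)) (at x)"
      by (simp add: linear_cmul[OF Tlin])
    from frechet_derivative_eq[OF this] show "B x u (a *\<^sub>R w) = a *\<^sub>R B x u w" by (simp add: B_def)
  qed
  have Bsym: "B x u w = B x w u" if x: "x \<in> ball 0 s" and u: "\<rho> u = 0" and w: "\<rho> w = 0" for x u w
  proof -
    let ?a = "\<lambda>j. T x u $ j" and ?b = "\<lambda>j. T x w $ j"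
    have lin: "B x (\<Sum>j\<in>K. a j *\<^sub>R R c j x) (\<Sum>k\<in>K. b k *\<^sub>R R c k x) =
        (\<Sum>j\<in>K. \<Sum>k\<in>K. a j *\<^sub>R b k *\<^sub>R B x (R c j x) (R c k x))" for a b
      by (simp add: linear_sum[OF Blin1[OF x]] linear_cmul[OF Blin1[OF x]] linear_sum[OF Blin2[OF x]]
          linear_cmul[OF Blin2[OF x]] scaleR_sum_right)
        (subst sum.swap, simp add: mult.commute)
    have "B x u w = (\<Sum>j\<in>K. \<Sum>k\<in>K. ?a j *\<^sub>R ?b k *\<^sub>R B x (R c j x) (R c k x))"
      using lin[of ?a ?b] by (simp flip: rangeQ(1)[OF x u] rangeQ(1)[OF x w])
    also have "\<dots> = (\<Sum>j\<in>K. \<Sum>k\<in>K. ?b j *\<^sub>R ?a k *\<^sub>R B x (R c j x) (R c k x))"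
      by (subst sum.swap) (intro sum.cong refl, simp add: Bsym0[OF x] mult.commute)
    also have "\<dots> = B x w u"
      using lin[of ?b ?a] by (simp flip: rangeQ(1)[OF x u] rangeQ(1)[OF x w])
    finally show ?thesis .
  qed
  \<comment> \<open>Moves in the fibre of \<open>x\<close>, from its transverse representative at
    \<open>t = 0\<close> to \<open>x\<close> itself at \<open>t = 1\<close>.\<close>
  define \<chi>t where "\<chi>t = (\<lambda>(t::real) x. \<eta> (\<rho> x) + t *\<^sub>R Q x)"
  have \<chi>lin: "bounded_linear (\<chi>t t)" for t
    unfolding \<chi>t_def
    by (intro bounded_linear_add bounded_linear_compose[OF bounded_linear_split(2,1)] bounded_linear_const_scaleR bounded_linear_split)
  have \<chi>ball: "\<chi>t t x \<in> ball 0 q" if "x \<in> ball 0 q" "t \<in> {0..1}" for t x q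
    unfolding \<chi>t_def using fibre_in_ball[OF that] .
  define h where "h = (\<lambda>(z :: real \<times> real) x. T (\<chi>t (snd z) x) (Q x))"
  have hp: "pdiff k ({0} \<times> {0..1}) (ball 0 s) h" for k
  proof -
    have \<chi>p: "pdiff k ({0} \<times> {0..1}) (ball 0 s) (\<lambda>(z :: real \<times> real) x. \<chi>t (snd z) x)"
      unfolding \<chi>t_def
      by (intro pdiff_add open_ball pdiff_scaleR pdiff_linear pdiff_const continuous_intros
          bounded_linear_compose[OF bounded_linear_split(2,1)] bounded_linear_split)
    have "pdiff k ({0} \<times> {0..1}) (ball 0 s) (\<lambda>(z :: real \<times> real) x. T (\<chi>t (snd z) x) e)" for e
      by (rule pdiff_compose[OF open_ball open_ball smooth_on_pdiff[OF T] \<chi>p]) (use \<chi>ball in auto)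
    then have "pdiff k ({0} \<times> {0..1}) (ball 0 s) (\<lambda>(z :: real \<times> real) x. \<Sum>l\<in>UNIV. Q x $ l *\<^sub>R T (\<chi>t (snd z) x) (axis l 1))"
      by (intro pdiff_sum open_ball pdiff_scaleR pdiff_linear bounded_linear_compose[OF bounded_linear_vec_nth bounded_linear_split(3)])
    then show ?thesis by (simp add: h_def flip: Texp)
  qed
  \<comment> \<open>The primitive of the Poincare lemma, carried out in each fibre: the coframe
    integrated along the segment ending at \<open>x\<close>.\<close>
  define J where "J = (\<lambda>x. integral {0..1} (\<lambda>t. h (0, t) x))"
  have Js: "smooth_on (ball 0 s) J"
    unfolding J_def by (rule smooth_onI, rule pdiff_cong[OF open_ball pdiff_integral[OF open_ball hp]]) simp
  have JQ: "frechet_derivative J (at x) u = T x u" if x: "x \<in> ball 0 s" and u: "\<rho> u = 0" for x u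
  proof -
    have Qu: "Q u = u" using split_sum[of u] u by (simp add: \<eta>_simps)
    have inb: "\<chi>t t x \<in> ball 0 s" if "t \<in> {0..1}" for t by (rule \<chi>ball[OF x that])
    have "(J has_derivative (\<lambda>u. integral {0..1} (\<lambda>t. frechet_derivative (h (0, t)) (at x) u))) (at x)"
      unfolding J_def by (rule has_derivative_param_integral[OF open_ball hp _ x]) simp
    then have "frechet_derivative J (at x) u = integral {0..1} (\<lambda>t. frechet_derivative (h (0, t)) (at x) u)"
      by (rule frechet_derivative_eq)
    also have "\<dots> = integral {0..1} (\<lambda>t. T (\<chi>t t x) u + t *\<^sub>R B (\<chi>t t x) (Q x) u)"
    proof (rule integral_cong)
      fix t :: real assume t: "t \<in> {0..1}"
      have "((\<lambda>(y, w). T y w) has_derivative (\<lambda>(a, b). T (\<chi>t t x) b + B (\<chi>t t x) a (Q x))) (at (\<chi>t t x, Q x))"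
      proof -
        have "((\<lambda>z. \<Sum>l\<in>UNIV. snd z $ l *\<^sub>R T (fst z) (axis l 1)) has_derivative
            (\<lambda>z. \<Sum>l\<in>UNIV. Q x $ l *\<^sub>R B (\<chi>t t x) (fst z) (axis l 1) + snd z $ l *\<^sub>R T (\<chi>t t x) (axis l 1))) (at (\<chi>t t x, Q x))"
        proof (intro has_derivative_sum)
          fix l
          have "((\<lambda>z :: (real ^ 'n) \<times> (real ^ 'n). T (fst z) (axis l 1)) has_derivative (\<lambda>z. B (\<chi>t t x) (fst z) (axis l 1))) (at (\<chi>t t x, Q x))"
            by (rule has_derivative_compose[where f = fst and g = "\<lambda>y. T y (axis l 1)"])
              (auto intro!: bounded_linear_imp_has_derivative bounded_linear_fst Bd[OF inb[OF t]])
          moreover have "((\<lambda>z :: (real ^ 'n) \<times> (real ^ 'n). snd z $ l) has_derivative (\<lambda>z. snd z $ l)) (at (\<chi>t t x, Q x))"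
            by (intro bounded_linear_imp_has_derivative bounded_linear_compose[OF bounded_linear_vec_nth bounded_linear_snd])
          ultimately show "((\<lambda>z. snd z $ l *\<^sub>R T (fst z) (axis l 1)) has_derivative
            (\<lambda>z. Q x $ l *\<^sub>R B (\<chi>t t x) (fst z) (axis l 1) + snd z $ l *\<^sub>R T (\<chi>t t x) (axis l 1))) (at (\<chi>t t x, Q x))"
            using has_derivative_scaleR by fastforce
        qed
        moreover have "(\<Sum>l\<in>UNIV. Q x $ l *\<^sub>R B (\<chi>t t x) a (axis l 1)) = B (\<chi>t t x) a (Q x)" for a
          by (rule linear_cart_expand[OF Blin2[OF inb[OF t]], symmetric])
        ultimately show ?thesis by (simp add: case_prod_unfold sum.distrib add.commute flip: Texp)
      qed
      from has_derivative_compose[OF has_derivative_Pair[OF bounded_linear_imp_has_derivative[OF \<chi>lin[of t]]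
            bounded_linear_imp_has_derivative[OF bounded_linear_split(3)]] this]
      have "(h (0, t) has_derivative (\<lambda>u. T (\<chi>t t x) (Q u) + B (\<chi>t t x) (\<chi>t t u) (Q x))) (at x)"
        by (simp add: h_def case_prod_unfold)
      from frechet_derivative_eq[OF this, of u]
      have "frechet_derivative (h (0, t)) (at x) u = T (\<chi>t t x) u + B (\<chi>t t x) (t *\<^sub>R u) (Q x)"
        by (simp add: \<chi>t_def u Qu \<eta>_simps)
      also have "B (\<chi>t t x) (t *\<^sub>R u) (Q x) = t *\<^sub>R B (\<chi>t t x) (Q x) u"
        using Bsym[OF inb[OF t], of u "Q x"] u by (simp add: linear_cmul[OF Blin1[OF inb[OF t]]])
      finally show "frechet_derivative (h (0, t)) (at x) u = T (\<chi>t t x) u + t *\<^sub>R B (\<chi>t t x) (Q x) u" .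
    qed
    \<comment> \<open>By the symmetry of \<open>B\<close> the integrand has become the derivative of
      \<open>t *\<^sub>R T (\<chi>t t x) u\<close> in \<open>t\<close>.\<close>
    also have "\<dots> = 1 *\<^sub>R T (\<chi>t 1 x) u - 0 *\<^sub>R T (\<chi>t 0 x) u"
    proof (rule integral_unique, rule fundamental_theorem_of_calculus)
      fix t :: real assume t: "t \<in> {0..1}"
      have "((\<lambda>t. \<chi>t t x) has_derivative (\<lambda>h. h *\<^sub>R Q x)) (at t within {0..1})"
        unfolding \<chi>t_def by (auto intro!: derivative_eq_intros)
      from has_derivative_compose[OF this Bd[OF inb[OF t]], of u]
      have "((\<lambda>t. T (\<chi>t t x) u) has_vector_derivative B (\<chi>t t x) (Q x) u) (at t within {0..1})"
        by (simp add: has_vector_derivative_def linear_cmul[OF Blin1[OF inb[OF t]]])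
      then show "((\<lambda>t. t *\<^sub>R T (\<chi>t t x) u) has_vector_derivative T (\<chi>t t x) u + t *\<^sub>R B (\<chi>t t x) (Q x) u) (at t within {0..1})"
        by (auto intro!: derivative_eq_intros simp: add.commute)
    qed simp
    also have "\<chi>t 1 x = x" by (simp add: \<chi>t_def split_sum)
    finally show ?thesis by simp
  qed
  define f where "f = (\<lambda>x. \<eta> (\<rho> x) + Q (J x))"
  have fs: "smooth_on (ball 0 s') f"
    unfolding f_def
    by (intro smooth_on_add open_ball smooth_on_bounded_linear bounded_linear_compose[OF bounded_linear_split(2,1)]
        smooth_on_bounded_linear_compose[OF bounded_linear_split(3)] smooth_on_subset[OF Js s's])
  have fd: "frechet_derivative f (at x) u = \<eta> (\<rho> u) + Q (frechet_derivative J (at x) u)" if "x \<in> ball 0 s'" for x u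
  proof (rule frechet_derivative_eq)
    have "x \<in> ball 0 s" using that s's by blast
    from smooth_on_differentiable[OF Js this]
    show "(f has_derivative (\<lambda>u. \<eta> (\<rho> u) + Q (frechet_derivative J (at x) u))) (at x)"
      unfolding f_def
      by (intro has_derivative_add bounded_linear.has_derivative[OF bounded_linear_split(3)]
          bounded_linear_imp_has_derivative bounded_linear_compose[OF bounded_linear_split(2,1)])
  qed
  have fK: "frechet_derivative f (at x) u = Q (T x u)" if x: "x \<in> ball 0 s'" and u: "\<rho> u = 0" for x u
    using JQ[OF _ u, of x] x s's by (simp add: fd[OF x] u \<eta>_simps subset_eq)
  have in0': "0 \<in> ball (0 :: real ^ 'n) s'" "0 \<in> ball (0 :: real ^ 'n) s" using s' s by auto
  have T0: "T 0 u = u" for u using Tinv(1)[OF in0'(2), of u] by (simp add: F0)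
  have "linear (frechet_derivative f (at 0))"
    using smooth_on_differentiable[OF fs in0'(1)] by (rule has_derivative_linear)
  then have inj: "inj (frechet_derivative f (at 0))"
    unfolding linear_injective_0[OF \<open>linear (frechet_derivative f (at 0))\<close>]
  proof (intro allI impI)
    fix u assume z: "frechet_derivative f (at 0) u = 0"
    from arg_cong[OF z, of \<rho>] have u: "\<rho> u = 0" by (simp add: fd[OF in0'(1)] \<rho>_simps)
    with z have "Q u = 0" by (simp add: fK[OF in0'(1)] T0)
    with u show "u = 0" using split_sum[of u] by (simp add: \<eta>_simps)
  qed
  have f0: "f 0 = 0"
    by (simp add: f_def J_def h_def \<rho>_simps \<eta>_simps Q_simps linear_0[OF Tlin])
  obtain d r' g where d: "centered d r'" "chart_dom d \<subseteq> chart_dom c" "smooth_on (ball 0 r') g" "g 0 = 0"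
    "\<And>y. y \<in> ball 0 r' \<Longrightarrow> g y \<in> ball 0 s'" "\<And>y. y \<in> ball 0 r' \<Longrightarrow> f (g y) = y"
    "\<And>y i. y \<in> ball 0 r' \<Longrightarrow> R d i y = frechet_derivative f (at (g y)) (R c i (g y))"
    using change_chart[OF c s' fs f0 inj] by blast
  have gs: "g y \<in> ball 0 s" "g y \<in> ball 0 r" if "y \<in> ball 0 r'" for y using d(5)[OF that] s's sr by blast+
  show thesis
  proof (rule that[OF d(1), of g])
    fix x :: "real ^ 'n" and j assume x: "x \<in> ball 0 r'" and j: "j \<in> K"
    have "F (g x) *v axis j 1 = R c j (g x)"
      using j by (simp add: Fcol axis_def if_distrib[of "\<lambda>t. t *\<^sub>R _"] \<eta>_simps cong: if_cong)
        (simp add: \<rho>_def \<eta>_def vec_eq_iff)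
    then have "T (g x) (R c j (g x)) = axis j 1" using Tinv(1)[OF gs(1)[OF x], of "axis j 1"] by simp
    then show "R d j x = axis j 1"
      by (simp add: d(7)[OF x] fK[OF d(5)[OF x] K[OF gs(2)[OF x] j]] j)
  next
    fix x :: "real ^ 'n" assume x: "x \<in> ball 0 r'"
    show "g x \<in> ball 0 r" by (rule gs(2)[OF x])
    show "\<rho> (g x) = \<rho> x" using arg_cong[OF d(6)[OF x], of \<rho>] by (simp add: f_def \<rho>_simps)
    show "\<rho> (R d i x) = \<rho> (R c i (g x))" for i by (simp add: d(7)[OF x] fd[OF d(5)[OF x]] \<rho>_simps)
  qed
qed

text \<open>The bracket with a constant field is a directional derivative. Commuting with the
  straightened fields therefore kills all derivatives along the fibres.\<close>

lemma R_derivative_K: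
  assumes c: "centered c r" and K: "\<And>x j. x \<in> ball 0 r \<Longrightarrow> j \<in> K \<Longrightarrow> R c j x = axis j 1" and x: "x \<in> ball 0 r"
  shows "\<rho> u = 0 \<Longrightarrow> frechet_derivative (R c i) (at x) u = 0"
proof -
  have lin: "linear (frechet_derivative (R c i) (at x))" using R_derivative[OF c x] by (rule has_derivative_linear)
  have ax: "frechet_derivative (R c i) (at x) (axis j 1) = 0" if j: "j \<in> K" for j
  proof -
    have "(R c j has_derivative (\<lambda>u. 0)) (at x)"
    proof (rule has_derivative_transform_within_open[OF _ open_ball x])
      show "((\<lambda>x. axis j 1) has_derivative (\<lambda>u. 0)) (at x)" by simp
    qed (use K[OF _ j] in simp)
    then have "frechet_derivative (R c j) (at x) (R c i x) = 0" by (rule frechet_derivative_eq)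
    with R_commute[OF c x, of i j] K[OF x j] show ?thesis by simp
  qed
  assume "\<rho> u = 0"
  then have "u = (\<Sum>j\<in>K. u $ j *\<^sub>R axis j 1)" using split_sum[of u] by (simp add: \<eta>_simps Q_expand)
  then have "frechet_derivative (R c i) (at x) u = frechet_derivative (R c i) (at x) (\<Sum>j\<in>K. u $ j *\<^sub>R axis j 1)"
    by (rule arg_cong)
  also have "\<dots> = 0" by (simp add: linear_sum[OF lin] linear_cmul[OF lin] ax)
  finally show ?thesis .
qed

lemma R_independent_K:
  assumes c: "centered c r" and K: "\<And>x j. x \<in> ball 0 r \<Longrightarrow> j \<in> K \<Longrightarrow> R c j x = axis j 1" and x: "x \<in> ball 0 r"
  shows "R c i x = R c i (\<eta> (\<rho> x))"
proof -
  let ?\<gamma> = "\<lambda>t::real. \<eta> (\<rho> x) + t *\<^sub>R Q x"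
  have vd: "((\<lambda>t. R c i (?\<gamma> t)) has_vector_derivative 0) (at t)" if t: "t \<in> {0..1}" for t
  proof -
    have b: "?\<gamma> t \<in> ball 0 r" by (rule fibre_in_ball[OF x t])
    have "(?\<gamma> has_derivative (\<lambda>h. h *\<^sub>R Q x)) (at t)" by (auto intro!: derivative_eq_intros)
    from has_derivative_compose[OF this R_derivative[OF c b]] show ?thesis
      using R_derivative_K[OF c K b, where u = "_ *\<^sub>R Q x"] by (simp add: has_vector_derivative_def \<rho>_simps)
  qed
  have "R c i (?\<gamma> 1) = R c i (?\<gamma> 0)"
  proof (rule constant_of_zero_interior_derivative)
    show "continuous_on {0..1} (\<lambda>t. R c i (?\<gamma> t))"
      unfolding continuous_on_eq_continuous_within
      using vd has_vector_derivative_continuous continuous_at_imp_continuous_at_within by blast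
  qed (use vd in auto)
  then show ?thesis by (simp add: split_sum)
qed

text \<open>Shifts the \<open>K\<close>-coordinates by the solution \<open>g\<close> of the cohomological equation
  \<open>Dg(x) x = \<beta> x\<close>, so that the Euler field loses its \<open>K\<close>-components up to a constant.\<close>

lemma euler_shift:
  assumes c: "centered c r" and K: "\<And>x j. x \<in> ball 0 r \<Longrightarrow> j \<in> K \<Longrightarrow> R c j x = axis j 1"
    and W: "\<And>x. x \<in> ball 0 r \<Longrightarrow> \<rho> (\<Sum>a\<in>UNIV. v a *\<^sub>R R c (\<sigma> a) x) = \<rho> x"
  obtains c' r' b0 g where "centered c' r'" "\<And>x j. x \<in> ball 0 r' \<Longrightarrow> j \<in> K \<Longrightarrow> R c' j x = axis j 1"
    "\<And>x. x \<in> ball 0 r' \<Longrightarrow> g x \<in> ball 0 r" "\<And>x. x \<in> ball 0 r' \<Longrightarrow> \<rho> (g x) = \<rho> x"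
    "\<And>x i. x \<in> ball 0 r' \<Longrightarrow> \<rho> (R c' i x) = \<rho> (R c i (g x))"
    "\<And>x. x \<in> ball 0 r' \<Longrightarrow> (\<Sum>a\<in>UNIV. v a *\<^sub>R R c' (\<sigma> a) x) - Q b0 = \<eta> (\<rho> x)"
proof -
  have r: "r > 0" using c by (simp add: centered_def)
  define W where "W = (\<lambda>x. \<Sum>a\<in>UNIV. v a *\<^sub>R R c (\<sigma> a) x)"
  have Ws: "smooth_on (ball 0 r) W"
    unfolding W_def by (intro smooth_on_sum smooth_on_scaleR smooth_on_const R_smooth[OF c] open_ball)
  have Wi: "W x = W (\<eta> (\<rho> x))" if "x \<in> ball 0 r" for x
    unfolding W_def by (intro sum.cong refl) (simp only: R_independent_K[OF c K that])
  have W\<rho>: "\<rho> (W x) = \<rho> x" if "x \<in> ball 0 r" for x using W[OF that] by (simp add: W_def)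
  \<comment> \<open>The part of \<open>W\<close> along \<open>K\<close>, minus its value at the
    origin: \<open>Dg(x) x\<close> is zero at \<open>x = 0\<close>, so this constant cannot be
    removed and survives as \<open>Q b0\<close>.\<close>
  define \<beta> where "\<beta> = (\<lambda>x. Q (W (\<eta> (\<rho> x))) - Q (W 0))"
  have blP: "bounded_linear (\<lambda>x. \<eta> (\<rho> x))" by (rule bounded_linear_compose[OF bounded_linear_split(2,1)])
  have \<beta>s: "smooth_on (ball 0 r) \<beta>"
    unfolding \<beta>_def
  proof (rule smooth_on_diff[OF open_ball smooth_on_bounded_linear_compose[OF bounded_linear_split(3) open_ball] smooth_on_const])
    show "smooth_on (ball 0 r) (\<lambda>x. W (\<eta> (\<rho> x)))"
      by (rule smooth_on_compose[OF open_ball open_ball Ws smooth_on_bounded_linear[OF blP]])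
        (intro ball_split)
  qed
  have \<beta>0: "\<beta> 0 = 0" by (simp add: \<beta>_def \<rho>_simps \<eta>_simps)
  have \<beta>\<rho>: "\<beta> x = \<beta> y" if "\<rho> x = \<rho> y" for x y by (simp add: \<beta>_def that)
  \<comment> \<open>The integral of \<open>\<beta> (t x) / t\<close> over the unit interval, regular
    since \<open>\<beta> 0 = 0\<close>. At \<open>\<tau> x\<close> it equals the integral of the
    same integrand up to \<open>\<tau>\<close>, so that its derivative along the ray at
    \<open>\<tau> = 1\<close> is \<open>\<beta> x\<close>.\<close>
  define g0 where "g0 = (\<lambda>x. integral {0..1} (\<lambda>t. hadamard \<beta> t x))"
  have hp: "pdiff k ({0} \<times> {0..1}) (ball 0 r) (\<lambda>z :: real \<times> real. hadamard \<beta> (snd z))" for k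
    by (rule pdiff_reparam[OF _ _ pdiff_hadamard[OF \<beta>s]]) (auto intro!: continuous_intros)
  have g0s: "smooth_on (ball 0 r) g0"
    unfolding g0_def by (rule smooth_onI, rule pdiff_cong[OF open_ball pdiff_integral[OF open_ball hp]]) simp
  have g0d: "(g0 has_derivative frechet_derivative g0 (at x)) (at x)" if "x \<in> ball 0 r" for x
    by (rule smooth_on_differentiable[OF g0s that])
  have hc: "continuous_on {0..1} (\<lambda>t. hadamard \<beta> t x)" if "x \<in> ball 0 r" for x
  proof -
    have "continuous_on {0..1} (\<lambda>t. (t, x))" by (intro continuous_intros)
    from continuous_on_compose2[OF pdiff_continuous[OF pdiff_hadamard[OF \<beta>s]] this] that
    show ?thesis by (auto simp: image_subset_iff)
  qed
  have g0x: "frechet_derivative g0 (at x) x = \<beta> x" if x: "x \<in> ball 0 r" for x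
  proof -
    have ray: "g0 (\<tau> *\<^sub>R x) = integral {0..\<tau>} (\<lambda>t. hadamard \<beta> t x)" if \<tau>: "\<tau> \<in> {0..1}" for \<tau>
    proof -
      have "g0 (\<tau> *\<^sub>R x) = integral {0..1} (\<lambda>t. \<tau> *\<^sub>R hadamard \<beta> (\<tau> * t) x)"
        unfolding g0_def
        by (rule integral_cong) (simp add: hadamard_scaleR[OF \<beta>s x _ \<tau>] mult.commute)
      also have "\<dots> = \<tau> *\<^sub>R integral {0..1} (\<lambda>t. hadamard \<beta> (\<tau> * t) x)" by simp
      also have "\<dots> = integral {0..\<tau>} (\<lambda>t. hadamard \<beta> t x)"
        using \<tau> by (intro integral_rescale[symmetric]) simp
      finally show ?thesis .
    qed
    have a: "((\<lambda>\<tau>. g0 (\<tau> *\<^sub>R x)) has_vector_derivative frechet_derivative g0 (at (1 *\<^sub>R x)) x) (at 1 within {0..1})"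
      by (rule smooth_on_ray[OF g0s x]) simp
    have "((\<lambda>\<tau>. integral {0..\<tau>} (\<lambda>t. hadamard \<beta> t x)) has_vector_derivative hadamard \<beta> 1 x) (at 1 within {0..1})"
      by (rule integral_has_vector_derivative[OF hc[OF x]]) simp
    then have b: "((\<lambda>\<tau>. g0 (\<tau> *\<^sub>R x)) has_vector_derivative hadamard \<beta> 1 x) (at 1 within {0..1})"
      by (rule has_vector_derivative_transform[rotated 2]) (use ray in auto)
    have "frechet_derivative g0 (at (1 *\<^sub>R x)) x = hadamard \<beta> 1 x"
      by (rule vector_derivative_unique_within_closed_interval[of 0 1 1, unfolded cbox_interval, OF _ _ a b]) auto
    then show ?thesis using hadamard_eq[OF \<beta>s \<beta>0 x, of 1] by simp
  qed
  have g0\<rho>: "g0 x = g0 (\<eta> (\<rho> x))" if x: "x \<in> ball 0 r" for x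
  proof -
    have y: "\<eta> (\<rho> x) \<in> ball 0 r" by (intro ball_split x)
    \<comment> \<open>Both quotients come from the same values of \<open>\<beta>\<close>, but the
      factor \<open>t\<close> can be cancelled only for nonzero \<open>t\<close>; the exceptional
      point does not affect the integral.\<close>
    show ?thesis
      unfolding g0_def
    proof (rule integral_spike[of "{0}"])
      fix t :: real assume t: "t \<in> {0..1} - {0}"
      have "t *\<^sub>R hadamard \<beta> t (\<eta> (\<rho> x)) = t *\<^sub>R hadamard \<beta> t x"
        using hadamard_eq[OF \<beta>s \<beta>0 x, of t] hadamard_eq[OF \<beta>s \<beta>0 y, of t] t
          \<beta>\<rho>[of "t *\<^sub>R x" "t *\<^sub>R \<eta> (\<rho> x)"] by (simp add: \<rho>_simps)
      then show "hadamard \<beta> t (\<eta> (\<rho> x)) = hadamard \<beta> t x" using t by simp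
    qed simp
  qed
  have g0Q: "frechet_derivative g0 (at x) u = 0" if x: "x \<in> ball 0 r" and u: "\<rho> u = 0" for x u
  proof -
    have y: "\<eta> (\<rho> x) \<in> ball 0 r" by (intro ball_split x)
    have "((\<lambda>x. g0 (\<eta> (\<rho> x))) has_derivative (\<lambda>u. frechet_derivative g0 (at (\<eta> (\<rho> x))) (\<eta> (\<rho> u)))) (at x)"
      by (rule has_derivative_compose[OF bounded_linear_imp_has_derivative[OF blP] g0d[OF y]])
    then have "(g0 has_derivative (\<lambda>u. frechet_derivative g0 (at (\<eta> (\<rho> x))) (\<eta> (\<rho> u)))) (at x)"
      by (rule has_derivative_transform_within_open[OF _ open_ball x]) (simp only: g0\<rho>[symmetric])
    from frechet_derivative_eq[OF this, of u] show ?thesis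
      using has_derivative_linear[OF g0d[OF y]] by (simp add: u \<eta>_simps linear_0)
  qed
  define f where "f = (\<lambda>x. x - Q (g0 x))"
  have fs: "smooth_on (ball 0 r) f"
    unfolding f_def
    by (rule smooth_on_diff[OF open_ball smooth_on_bounded_linear[OF bounded_linear_ident]
          smooth_on_bounded_linear_compose[OF bounded_linear_split(3) open_ball g0s]])
  have fd: "frechet_derivative f (at x) u = u - Q (frechet_derivative g0 (at x) u)" if "x \<in> ball 0 r" for x u
  proof (rule frechet_derivative_eq)
    show "(f has_derivative (\<lambda>u. u - Q (frechet_derivative g0 (at x) u))) (at x)"
      unfolding f_def
      by (intro has_derivative_diff has_derivative_ident bounded_linear.has_derivative[OF bounded_linear_split(3) g0d[OF that]])
  qed
  have in0: "0 \<in> ball (0 :: real ^ 'n) r" using r by simp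
  have lin0: "linear (frechet_derivative f (at 0))"
    using smooth_on_differentiable[OF fs in0] by (rule has_derivative_linear)
  have inj: "inj (frechet_derivative f (at 0))"
    unfolding linear_injective_0[OF lin0]
  proof (intro allI impI)
    fix u assume z: "frechet_derivative f (at 0) u = 0"
    from arg_cong[OF z, of \<rho>] have u: "\<rho> u = 0" by (simp add: fd[OF in0] \<rho>_simps)
    with z show "u = 0" by (simp add: fd[OF in0] g0Q[OF in0 u] Q_simps)
  qed
  have f0: "f 0 = 0"
  proof -
    have "hadamard \<beta> t 0 = 0" if "t \<in> {0..1}" for t
      using hadamard_scaleR[OF \<beta>s in0 that, of 0] by simp
    then have "g0 0 = integral {0..1::real} (\<lambda>t. 0)"
      unfolding g0_def by (rule integral_cong)
    then show ?thesis by (simp add: f_def Q_simps)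
  qed
  obtain d r' g where d: "centered d r'" "chart_dom d \<subseteq> chart_dom c" "smooth_on (ball 0 r') g" "g 0 = 0"
    "\<And>y. y \<in> ball 0 r' \<Longrightarrow> g y \<in> ball 0 r" "\<And>y. y \<in> ball 0 r' \<Longrightarrow> f (g y) = y"
    "\<And>y i. y \<in> ball 0 r' \<Longrightarrow> R d i y = frechet_derivative f (at (g y)) (R c i (g y))"
    using change_chart[OF c r order_refl fs f0 inj] by blast
  show thesis
  proof (rule that[OF d(1), of g "W 0"])
    fix x :: "real ^ 'n" and j assume x: "x \<in> ball 0 r'" and j: "j \<in> K"
    show "R d j x = axis j 1"
      by (simp add: d(7)[OF x] K[OF d(5)[OF x] j] fd[OF d(5)[OF x]] g0Q[OF d(5)[OF x]] j Q_simps)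
  next
    fix x :: "real ^ 'n" assume x: "x \<in> ball 0 r'"
    have gx: "g x \<in> ball 0 r" by (rule d(5)[OF x])
    show "g x \<in> ball 0 r" by (rule gx)
    show \<rho>g: "\<rho> (g x) = \<rho> x" using arg_cong[OF d(6)[OF x], of \<rho>] by (simp add: f_def \<rho>_simps)
    show "\<rho> (R d i x) = \<rho> (R c i (g x))" for i by (simp add: d(7)[OF x] fd[OF gx] \<rho>_simps)
    have lin: "linear (frechet_derivative g0 (at (g x)))" using g0d[OF gx] by (rule has_derivative_linear)
    have linf: "linear (frechet_derivative f (at (g x)))"
      using smooth_on_differentiable[OF fs gx] by (rule has_derivative_linear)
    have "(\<Sum>a\<in>UNIV. v a *\<^sub>R R d (\<sigma> a) x) = frechet_derivative f (at (g x)) (W (g x))"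
      by (simp add: d(7)[OF x] W_def linear_sum[OF linf] linear_cmul[OF linf])
    also have "\<dots> = W (g x) - Q (frechet_derivative g0 (at (g x)) (W (g x)))" by (rule fd[OF gx])
    also have "frechet_derivative g0 (at (g x)) (W (g x)) = \<beta> (g x)"
    proof -
      have "frechet_derivative g0 (at (g x)) (W (g x) - g x) = 0"
        by (rule g0Q[OF gx]) (simp add: \<rho>_simps W\<rho>[OF gx])
      then show ?thesis using g0x[OF gx] by (simp add: linear_diff[OF lin])
    qed
    also have "Q (\<beta> (g x)) = Q (W (g x)) - Q (W 0)" by (simp add: \<beta>_def Q_simps flip: Wi[OF gx])
    finally have "(\<Sum>a\<in>UNIV. v a *\<^sub>R R d (\<sigma> a) x) - Q (W 0) = W (g x) - Q (W (g x))" by simp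
    also have "\<dots> = \<eta> (\<rho> (W (g x)))" using split_sum[of "W (g x)"] by (simp add: algebra_simps)
    finally show "(\<Sum>a\<in>UNIV. v a *\<^sub>R R d (\<sigma> a) x) - Q (W 0) = \<eta> (\<rho> x)" by (simp add: W\<rho>[OF gx] \<rho>g)
  qed
qed

text \<open>A smooth field commuting with the Euler field is homogeneous of degree one in the transverse
  directions, hence linear there, and of degree zero in the \<open>K\<close>-directions, hence constant there.\<close>

lemma linear_of_commuting_euler:
  assumes c: "centered c r" and K: "\<And>x j. x \<in> ball 0 r \<Longrightarrow> j \<in> K \<Longrightarrow> R c j x = axis j 1"
    and Y: "\<And>x. x \<in> ball 0 r \<Longrightarrow> \<rho> (R c i x) = Y (\<rho> x)" and Yd: "(Y has_derivative L) (at 0)"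
    and E: "\<And>x. x \<in> ball 0 r \<Longrightarrow> (\<Sum>a\<in>UNIV. v a *\<^sub>R R c (\<sigma> a) x) - Q b0 = \<eta> (\<rho> x)"
    and x: "x \<in> ball 0 r"
  shows "R c i x = \<eta> (L (\<rho> x)) + Q (R c i 0)"
proof -
  have r: "r > 0" using c by (simp add: centered_def)
  have in0: "0 \<in> ball (0 :: real ^ 'n) r" using r by simp
  let ?D = "\<lambda>x. frechet_derivative (R c i) (at x)"
  have blP: "bounded_linear (\<lambda>x. \<eta> (\<rho> x))" by (rule bounded_linear_compose[OF bounded_linear_split(2,1)])
  \<comment> \<open>The bracket with the Euler field: the derivative of \<open>R c i\<close> along
    it on the left, its constant derivative applied to \<open>R c i\<close> on the right. The shift
    \<open>Q b0\<close> contributes to neither, since \<open>R c i\<close> does not vary along the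
    fibres.\<close>
  have comm: "?D x (\<eta> (\<rho> x)) = \<eta> (\<rho> (R c i x))" if x: "x \<in> ball 0 r" for x
  proof -
    have lin: "linear (?D x)" using R_derivative[OF c x] by (rule has_derivative_linear)
    have Qb: "?D x (Q b0) = 0" by (rule R_derivative_K[OF c K x]) simp_all
    have "?D x (\<eta> (\<rho> x)) = (\<Sum>a\<in>UNIV. v a *\<^sub>R ?D x (R c (\<sigma> a) x))"
      by (simp add: linear_diff[OF lin] linear_sum[OF lin] linear_cmul[OF lin] Qb flip: E[OF x])
    also have "\<dots> = (\<Sum>a\<in>UNIV. v a *\<^sub>R frechet_derivative (R c (\<sigma> a)) (at x) (R c i x))"
      by (simp add: R_commute[OF c x, of i])
    also have "\<dots> = \<eta> (\<rho> (R c i x))"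
    proof -
      have "((\<lambda>x. (\<Sum>a\<in>UNIV. v a *\<^sub>R R c (\<sigma> a) x) - Q b0) has_derivative
          (\<lambda>u. (\<Sum>a\<in>UNIV. v a *\<^sub>R frechet_derivative (R c (\<sigma> a)) (at x) u) - 0)) (at x)"
        by (intro has_derivative_diff has_derivative_const has_derivative_sum has_derivative_scaleR_right R_derivative[OF c x])
      moreover have "((\<lambda>x. (\<Sum>a\<in>UNIV. v a *\<^sub>R R c (\<sigma> a) x) - Q b0) has_derivative (\<lambda>u. \<eta> (\<rho> u))) (at x)"
        by (rule has_derivative_transform_within_open[OF bounded_linear_imp_has_derivative[OF blP] open_ball x])
          (simp add: E)
      ultimately have "(\<lambda>u. (\<Sum>a\<in>UNIV. v a *\<^sub>R frechet_derivative (R c (\<sigma> a)) (at x) u) - 0) = (\<lambda>u. \<eta> (\<rho> u))"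
        by (rule has_derivative_unique)
      from fun_cong[OF this, of "R c i x"] show ?thesis by simp
    qed
    finally show ?thesis .
  qed
  define y where "y = \<eta> (\<rho> x)"
  have y: "y \<in> ball 0 r" "\<rho> y = \<rho> x" "\<eta> (\<rho> y) = y"
    unfolding y_def using ball_split(2)[OF ball_split(1)[OF x]] by simp_all
  have ty: "t *\<^sub>R y \<in> ball 0 r" if "t \<in> {0..1}" for t
    by (rule scaleR_in_ball[OF _ y(1)]) (use that in auto)
  have commt: "t *\<^sub>R ?D (t *\<^sub>R y) y = \<eta> (\<rho> (R c i (t *\<^sub>R y)))" if t: "t \<in> {0..1}" for t
    using comm[OF ty[OF t]] has_derivative_linear[OF R_derivative[OF c ty[OF t], of i]]
    by (simp add: \<rho>_simps \<eta>_simps y(3) linear_cmul)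
  \<comment> \<open>Euler's identity of degree zero: the components in \<open>K\<close> do not
    change along the ray.\<close>
  have DQ: "Q (?D (t *\<^sub>R y) y) = 0" if t: "0 < t" "t < 1" for t
    using arg_cong[OF commt[of t], of Q] t by (simp add: Q_simps)
  have ray: "((\<lambda>t. R c i (t *\<^sub>R y)) has_vector_derivative ?D (t *\<^sub>R y) y) (at t within T)" if "t \<in> {0..1}" for t T
    by (rule smooth_on_ray[OF R_smooth[OF c] y(1) that])
  have contR: "continuous_on {0..1} (\<lambda>t. R c i (t *\<^sub>R y))"
    unfolding continuous_on_eq_continuous_within using has_vector_derivative_continuous[OF ray] by blast
  have "Q (R c i (1 *\<^sub>R y)) = Q (R c i (0 *\<^sub>R y))"
  proof (rule constant_of_zero_interior_derivative)
    show "continuous_on {0..1} (\<lambda>t. Q (R c i (t *\<^sub>R y)))"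
      by (rule bounded_linear.continuous_on[OF bounded_linear_split(3) contR])
    fix t :: real assume t: "0 < t" "t < 1"
    then have "t \<in> {0..1}" by simp
    from bounded_linear.has_vector_derivative[OF bounded_linear_split(3) ray[OF this, of UNIV]]
    show "((\<lambda>t. Q (R c i (t *\<^sub>R y))) has_vector_derivative 0) (at t)" by (simp add: DQ[OF t])
  qed
  then have Qpart: "Q (R c i y) = Q (R c i 0)" by simp
  \<comment> \<open>For the transverse components Euler's identity has degree one. Differentiated
    along the ray, it shows that the transverse part of \<open>G\<close> is constant there, so the
    field at \<open>y\<close> equals its linear part at the origin applied to
    \<open>y\<close>.\<close>
  define G where "G = (\<lambda>z. ?D z y)"
  have Gs: "smooth_on (ball 0 r) G" unfolding G_def by (rule smooth_on_derivative[OF R_smooth[OF c]])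
  have Gray: "((\<lambda>t. G (t *\<^sub>R y)) has_vector_derivative frechet_derivative G (at (t *\<^sub>R y)) y) (at t within T)" if "t \<in> {0..1}" for t T
    by (rule smooth_on_ray[OF Gs y(1) that])
  have contG: "continuous_on {0..1} (\<lambda>t. G (t *\<^sub>R y))"
    unfolding continuous_on_eq_continuous_within using has_vector_derivative_continuous[OF Gray] by blast
  have "\<rho> (G (1 *\<^sub>R y)) = \<rho> (G (0 *\<^sub>R y))"
  proof (rule constant_of_zero_interior_derivative)
    show "continuous_on {0..1} (\<lambda>t. \<rho> (G (t *\<^sub>R y)))"
      by (rule bounded_linear.continuous_on[OF bounded_linear_split(1) contG])
    fix t :: real assume t: "0 < t" "t < 1"
    then have t': "t \<in> {0..1}" by simp
    have 1: "((\<lambda>t. \<rho> (G (t *\<^sub>R y))) has_vector_derivative \<rho> (frechet_derivative G (at (t *\<^sub>R y)) y)) (at t)"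
      using bounded_linear.has_vector_derivative[OF bounded_linear_split(1) Gray[OF t', of UNIV]] .
    have 2: "((\<lambda>t. \<rho> (R c i (t *\<^sub>R y))) has_vector_derivative \<rho> (G (t *\<^sub>R y))) (at t)"
      using bounded_linear.has_vector_derivative[OF bounded_linear_split(1) ray[OF t', of UNIV]] by (simp add: G_def)
    have 3: "((\<lambda>t. t *\<^sub>R \<rho> (G (t *\<^sub>R y))) has_vector_derivative
        t *\<^sub>R \<rho> (frechet_derivative G (at (t *\<^sub>R y)) y) + 1 *\<^sub>R \<rho> (G (t *\<^sub>R y))) (at t)"
      by (rule has_vector_derivative_scaleR[OF DERIV_ident 1])
    have "((\<lambda>t. t *\<^sub>R \<rho> (G (t *\<^sub>R y))) has_vector_derivative \<rho> (G (t *\<^sub>R y))) (at t)"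
    proof (rule has_vector_derivative_transform_within_open[OF 2, of "{0<..<1}"])
      fix q :: real assume "q \<in> {0<..<1}"
      then have "q \<in> {0..1}" by simp
      from arg_cong[OF commt[OF this], of \<rho>] show "\<rho> (R c i (q *\<^sub>R y)) = q *\<^sub>R \<rho> (G (q *\<^sub>R y))"
        by (simp add: \<rho>_simps G_def)
    qed (use t in auto)
    from vector_derivative_unique_at[OF this 3] have "t *\<^sub>R \<rho> (frechet_derivative G (at (t *\<^sub>R y)) y) = 0" by simp
    with t 1 show "((\<lambda>t. \<rho> (G (t *\<^sub>R y))) has_vector_derivative 0) (at t)" by simp
  qed
  moreover have "\<rho> (G (1 *\<^sub>R y)) = \<rho> (R c i y)"
    using arg_cong[OF commt[of 1], of \<rho>] by (simp add: G_def)
  moreover have "\<rho> (G (0 *\<^sub>R y)) = L (\<rho> x)"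
  proof -
    have "((\<lambda>x. \<rho> (R c i x)) has_derivative (\<lambda>u. \<rho> (?D 0 u))) (at 0)" by (rule frechet_\<rho>_R[OF c in0])
    moreover have "((\<lambda>x. Y (\<rho> x)) has_derivative (\<lambda>u. L (\<rho> u))) (at 0)"
      by (rule has_derivative_compose[OF bounded_linear_imp_has_derivative[OF bounded_linear_split(1)]])
        (simp add: \<rho>_simps Yd)
    then have "((\<lambda>x. \<rho> (R c i x)) has_derivative (\<lambda>u. L (\<rho> u))) (at 0)"
      by (rule has_derivative_transform_within_open[OF _ open_ball in0]) (simp only: Y)
    ultimately have "(\<lambda>u. \<rho> (?D 0 u)) = (\<lambda>u. L (\<rho> u))" by (rule has_derivative_unique)
    from fun_cong[OF this, of y] show ?thesis by (simp add: G_def y(2))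
  qed
  ultimately have "\<rho> (R c i y) = L (\<rho> x)" by simp
  moreover have "R c i x = R c i y" unfolding y_def by (rule R_independent_K[OF c K x])
  ultimately show ?thesis using split_sum[of "R c i y"] Qpart by simp
qed

end

section \<open>Existence of the normal form\<close>

text \<open>The vectors \<open>L b *v x0\<close> span, so \<open>x0\<close> is a combination of
  them. By commutativity the same combination of the matrices fixes each \<open>L b *v x0\<close>,
  hence everything. This is the \<open>W\<close> of the overview at the level of linear
  parts.\<close>

lemma identity_combination:
  fixes L :: "'m::finite \<Rightarrow> real ^ 'm ^ 'm"
  assumes comm: "\<And>a b. L a ** L b = L b ** L a" and W: "wedge (\<lambda>a. L a *v x0) \<noteq> 0"
  obtains v where "\<And>u. (\<Sum>a\<in>UNIV. v a *\<^sub>R (L a *v u)) = u"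
proof -
  have span: "\<exists>z. x = (\<Sum>b\<in>UNIV. z b *\<^sub>R (L b *v x0))" for x
  proof -
    let ?W = "\<chi> i j. (L j *v x0) $ i"
    have "invertible ?W" using W by (simp add: wedge_def invertible_det_nz)
    then obtain W' where "?W ** W' = mat 1" unfolding invertible_def by blast
    then have "?W *v (W' *v x) = x" by (simp add: matrix_vector_mul_assoc)
    then obtain y where "?W *v y = x" by blast
    then have "x = (\<Sum>b\<in>UNIV. y $ b *\<^sub>R (L b *v x0))"
      by (auto simp: vec_eq_iff matrix_vector_mult_def[of ?W] mult.commute)
    then show ?thesis by blast
  qed
  obtain v where v: "x0 = (\<Sum>b\<in>UNIV. v b *\<^sub>R (L b *v x0))" using span by blast
  show thesis
  proof (rule that[of v])
    fix u
    obtain z where u: "u = (\<Sum>b\<in>UNIV. z b *\<^sub>R (L b *v x0))" using span by blast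
    have swap: "L a *v (L b *v x0) = L b *v (L a *v x0)" for a b
      by (simp only: matrix_vector_mul_assoc comm[of a b])
    have "(\<Sum>a\<in>UNIV. v a *\<^sub>R (L a *v u)) = (\<Sum>a\<in>UNIV. \<Sum>b\<in>UNIV. z b *\<^sub>R v a *\<^sub>R (L b *v (L a *v x0)))"
      by (simp add: u mult.commute matrix_vector_right_distrib linear_sum[OF matrix_vector_mul_linear]
          linear_cmul[OF matrix_vector_mul_linear] scaleR_sum_right swap[of _ _])
    also have "\<dots> = (\<Sum>b\<in>UNIV. z b *\<^sub>R (L b *v (\<Sum>a\<in>UNIV. v a *\<^sub>R (L a *v x0))))"
      by (subst sum.swap) (simp add: linear_sum[OF matrix_vector_mul_linear]
          linear_cmul[OF matrix_vector_mul_linear] scaleR_sum_right)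
    finally show "(\<Sum>a\<in>UNIV. v a *\<^sub>R (L a *v u)) = u" by (simp flip: v u)
  qed
qed

lemma basis_of_RnI:
  fixes v :: "nat \<Rightarrow> real ^ 'n::finite"
  assumes v: "\<And>c. (\<Sum>i\<in>{1..CARD('n)}. c i *\<^sub>R v i) = 0 \<Longrightarrow> \<forall>i\<in>{1..CARD('n)}. c i = 0"
  shows "basis_of_Rn v"
proof -
  let ?I = "{1..CARD('n)}"
  have inj: "inj_on v ?I"
  proof (rule inj_onI, rule ccontr)
    fix i j assume ij: "i \<in> ?I" "j \<in> ?I" "v i = v j" "i \<noteq> j"
    have "(\<Sum>k\<in>?I. ((if k = i then 1 else 0) - (if k = j then 1 else 0)) *\<^sub>R v k) = v i - v j"
      using ij(1,2) by (simp add: scaleR_diff_left sum_subtractf if_distrib[of "\<lambda>x. x *\<^sub>R _"] cong: if_cong)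
    then have "(\<Sum>k\<in>?I. ((if k = i then 1 else 0) - (if k = j then 1 else 0)) *\<^sub>R v k) = 0"
      by (simp only: ij(3) diff_self)
    from bspec[OF v[OF this] ij(1)] ij(4) show False by simp
  qed
  have ind: "independent (v ` ?I)"
    unfolding independent_explicit
  proof (intro conjI allI impI ballI)
    fix c w assume "(\<Sum>w\<in>v ` ?I. c w *\<^sub>R w) = 0" and w: "w \<in> v ` ?I"
    then have "(\<Sum>i\<in>?I. c (v i) *\<^sub>R v i) = 0" by (simp only: sum.reindex[OF inj] o_def)
    from v[OF this] w show "c w = 0" by blast
  qed simp
  have "card (v ` ?I) = CARD('n)" by (simp only: card_image[OF inj] card_atLeastAtMost diff_Suc_1)
  then have "UNIV \<subseteq> span (v ` ?I)"
    by (intro card_ge_dim_independent ind) (simp_all add: dim_UNIV)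
  with inj ind show ?thesis by (auto simp: basis_of_Rn_def)
qed

context local_system
begin

text \<open>The linear parts are read off once, in the first chart. Every later change of chart is
  tangent to the identity on the reduced system or leaves it unchanged, so the same matrices
  \<open>L\<close> describe the fields in the last chart.\<close>

lemma linear_chart:
  fixes \<pi> :: "'p \<Rightarrow> real ^ 'm"
  assumes p: "p \<in> topspace M" and V: "p \<in> V" and quot: "local_quotient M A X K V \<pi>"
    and proj: "\<And>a. projects_to A V \<pi> (X (\<sigma> a)) (Z a)"
    and nondeg: "nondegenerate_fixed_point Z (\<pi> p)"
  obtains c r L x0 where "centered c r" "\<And>a b. L a ** L b = L b ** L a"
    "\<And>a. diagonalizable_over_C (L a)" "wedge (\<lambda>a. L a *v x0) \<noteq> 0"
    "\<And>x j. x \<in> ball 0 r \<Longrightarrow> j \<in> K \<Longrightarrow> R c j x = axis j 1"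
    "\<And>x a. x \<in> ball 0 r \<Longrightarrow> R c (\<sigma> a) x = \<eta> (L a *v \<rho> x) + Q (R c (\<sigma> a) 0)"
proof -
  obtain c r where c: "centered c r" "\<And>j. j \<in> K \<Longrightarrow> R c j 0 = axis j 1"
    "\<And>x j. x \<in> ball 0 r \<Longrightarrow> j \<in> K \<Longrightarrow> \<rho> (R c j x) = 0"
    "\<And>x a. x \<in> ball 0 r \<Longrightarrow> \<rho> (R c (\<sigma> a) x) = Z a (\<pi> p + \<rho> x)"
    using first_chart[OF p V quot proj] by blast
  have r: "r > 0" using c(1) by (simp add: centered_def)
  \<comment> \<open>\<open>Z a\<close> is specified on the image of \<open>V\<close> only. Read
    through a chart and the section \<open>\<eta>\<close>, the reduced field is visibly smooth near
    \<open>\<pi> p\<close>.\<close>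
  define Z' where "Z' a z = \<rho> (R c (\<sigma> a) (\<eta> z))" for a z
  have Z'_eq: "Z' a z = Z a (\<pi> p + z)" if "z \<in> ball 0 r" for a z
    using c(4)[OF ball_split(2)[OF that]] by (simp add: Z'_def)
  have Z': "\<rho> (R c (\<sigma> a) x) = Z' a (\<rho> x)" if "x \<in> ball 0 r" for a x
    using c(4)[OF that] Z'_eq[OF ball_split(1)[OF that]] by simp
  have sm: "smooth_on (ball 0 r) (Z' a)" for a
    unfolding Z'_def
    by (rule smooth_on_bounded_linear_compose[OF bounded_linear_split(1) open_ball
          smooth_on_compose[OF open_ball open_ball R_smooth[OF c(1)]
            smooth_on_bounded_linear[OF bounded_linear_split(2)] ball_split(2)]])
  have D: "(Z' a has_derivative frechet_derivative (Z' a) (at z)) (at z)" if "z \<in> ball 0 r" for a z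
    by (rule smooth_on_differentiable[OF sm that])
  have in0: "0 \<in> ball (0 :: real ^ 'm) r" using r by simp
  define L where "L a = linear_part (Z a) (\<pi> p)" for a
  have L: "frechet_derivative (Z' a) (at 0) = (*v) (L a)" for a
  proof -
    have "((\<lambda>y. Z' a (y - \<pi> p)) has_derivative frechet_derivative (Z' a) (at 0)) (at (\<pi> p))"
    proof (rule has_derivative_compose[of "\<lambda>y. y - \<pi> p" "\<lambda>u. u", where g = "Z' a"])
      show "((\<lambda>y. y - \<pi> p) has_derivative (\<lambda>u. u)) (at (\<pi> p))"
        by (auto intro!: derivative_eq_intros)
    qed (use D[OF in0] in simp)
    then have "(Z a has_derivative frechet_derivative (Z' a) (at 0)) (at (\<pi> p))"
      by (rule has_derivative_transform_within_open[of _ _ _ _ "ball (\<pi> p) r"])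
        (use r Z'_eq in \<open>auto simp: dist_norm norm_minus_commute\<close>)
    then have eq: "frechet_derivative (Z a) (at (\<pi> p)) = frechet_derivative (Z' a) (at 0)"
      by (rule frechet_derivative_at[symmetric])
    have "linear (frechet_derivative (Z' a) (at 0))" using D[OF in0] by (rule has_derivative_linear)
    then show ?thesis unfolding L_def linear_part_def eq by (simp add: fun_eq_iff matrix_works)
  qed
  have L': "(Z' a has_derivative (*v) (L a)) (at 0)" for a using D[OF in0, of a] by (simp only: L)
  have Z0: "Z' a 0 = 0" for a using Z'_eq[OF in0] nondeg by (simp add: nondegenerate_fixed_point_def)
  \<comment> \<open>\<open>\<rho>\<close> carries each transverse field to its reduced field, hence
    brackets to brackets, and the reduced fields commute too.\<close>
  have Z_commute: "frechet_derivative (Z' b) (at z) (Z' a z) = frechet_derivative (Z' a) (at z) (Z' b z)"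
    if z: "z \<in> ball 0 r" for a b z
  proof -
    have *: "frechet_derivative (Z' b) (at z) (Z' a z) =
        \<rho> (frechet_derivative (R c (\<sigma> b)) (at (\<eta> z)) (R c (\<sigma> a) (\<eta> z)))" for a b
    proof -
      have d: "(Z' b has_derivative frechet_derivative (Z' b) (at z)) (at (\<rho> (\<eta> z)))"
        using D[OF z] by simp
      have "((\<lambda>x. Z' b (\<rho> x)) has_derivative (\<lambda>u. frechet_derivative (Z' b) (at z) (\<rho> u))) (at (\<eta> z))"
        by (rule has_derivative_compose[OF bounded_linear.has_derivative[OF bounded_linear_split(1) has_derivative_ident] d])
      then have "((\<lambda>x. \<rho> (R c (\<sigma> b) x)) has_derivative (\<lambda>u. frechet_derivative (Z' b) (at z) (\<rho> u))) (at (\<eta> z))"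
        by (rule has_derivative_transform_within_open[OF _ open_ball ball_split(2)[OF z]]) (rule Z'[symmetric])
      from has_derivative_unique[OF this frechet_\<rho>_R[OF c(1) ball_split(2)[OF z]]]
      have "frechet_derivative (Z' b) (at z) (\<rho> (R c (\<sigma> a) (\<eta> z))) =
          \<rho> (frechet_derivative (R c (\<sigma> b)) (at (\<eta> z)) (R c (\<sigma> a) (\<eta> z)))"
        by (rule fun_cong)
      then show ?thesis by (simp add: Z'_def)
    qed
    show ?thesis
      unfolding * using R_commute[OF c(1) ball_split(2)[OF z]] by (rule arg_cong)
  qed
  \<comment> \<open>The identity \<open>Z_commute\<close> is differentiated at the origin. Both
    fields vanish there, so no second derivatives remain, only the products of the linear
    parts.\<close>
  have comm: "L a ** L b = L b ** L a" for a b
  proof -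
    have d: "((\<lambda>z. frechet_derivative (Z' b) (at z) (Z' a z)) has_derivative (\<lambda>u. L b *v (L a *v u))) (at 0)" for a b
      using has_derivative_apply_at_zero[OF open_ball in0 sm L' Z0, of b a] by (simp only: L)
    have "((\<lambda>z. frechet_derivative (Z' b) (at z) (Z' a z)) has_derivative (\<lambda>u. L a *v (L b *v u))) (at 0)"
      by (rule has_derivative_transform_within_open[OF d open_ball in0]) (rule Z_commute)
    from has_derivative_unique[OF d this] have "L b *v (L a *v u) = L a *v (L b *v u)" for u
      by (rule fun_cong)
    then show ?thesis by (simp add: matrix_eq matrix_vector_mul_assoc)
  qed
  have diag: "diagonalizable_over_C (L a)" for a
    using nondeg by (simp add: nondegenerate_fixed_point_def L_def)
  have "\<exists>x0. wedge (\<lambda>a. L a *v x0) \<noteq> 0"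
  proof (rule ccontr)
    assume "\<not> ?thesis"
    then have "negligible (UNIV :: (real ^ 'm) set)"
      using nondeg by (simp add: nondegenerate_fixed_point_def L_def)
    then show False by simp
  qed
  then obtain x0 where x0: "wedge (\<lambda>a. L a *v x0) \<noteq> 0" by blast
  obtain v where v: "\<And>u. (\<Sum>a\<in>UNIV. v a *\<^sub>R (L a *v u)) = u"
    using identity_combination[OF comm x0] by blast
  obtain c1 r1 Y where c1: "centered c1 r1" "\<And>j. j \<in> K \<Longrightarrow> R c1 j 0 = axis j 1"
    "\<And>x j. x \<in> ball 0 r1 \<Longrightarrow> j \<in> K \<Longrightarrow> \<rho> (R c1 j x) = 0"
    "\<And>x a. x \<in> ball 0 r1 \<Longrightarrow> \<rho> (R c1 (\<sigma> a) x) = Y a (\<rho> x)"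
    "\<And>a. (Y a has_derivative (*v) (L a)) (at 0)"
    "\<And>x. x \<in> ball 0 r1 \<Longrightarrow> (\<Sum>a\<in>UNIV. v a *\<^sub>R Y a (\<rho> x)) = \<rho> x"
    using euler_chart[OF c(1-3) Z' Z0 L' v] by blast
  obtain c2 r2 g2 where c2: "centered c2 r2" "\<And>x j. x \<in> ball 0 r2 \<Longrightarrow> j \<in> K \<Longrightarrow> R c2 j x = axis j 1"
    "\<And>x. x \<in> ball 0 r2 \<Longrightarrow> g2 x \<in> ball 0 r1" "\<And>x. x \<in> ball 0 r2 \<Longrightarrow> \<rho> (g2 x) = \<rho> x"
    "\<And>x i. x \<in> ball 0 r2 \<Longrightarrow> \<rho> (R c2 i x) = \<rho> (R c1 i (g2 x))"
    using straighten[OF c1(1-3)] by blast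
  have Y2: "\<rho> (R c2 (\<sigma> a) x) = Y a (\<rho> x)" if "x \<in> ball 0 r2" for a x
    by (simp only: c2(5)[OF that] c1(4)[OF c2(3)[OF that]] c2(4)[OF that])
  have "\<rho> (\<Sum>a\<in>UNIV. v a *\<^sub>R R c2 (\<sigma> a) x) = \<rho> x" if "x \<in> ball 0 r2" for x
    using c1(6)[OF c2(3)[OF that]] by (simp add: \<rho>_simps Y2[OF that] c2(4)[OF that])
  note c2_euler = this
  obtain c3 r3 b0 g3 where c3: "centered c3 r3" "\<And>x j. x \<in> ball 0 r3 \<Longrightarrow> j \<in> K \<Longrightarrow> R c3 j x = axis j 1"
    "\<And>x. x \<in> ball 0 r3 \<Longrightarrow> g3 x \<in> ball 0 r2" "\<And>x. x \<in> ball 0 r3 \<Longrightarrow> \<rho> (g3 x) = \<rho> x"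
    "\<And>x i. x \<in> ball 0 r3 \<Longrightarrow> \<rho> (R c3 i x) = \<rho> (R c2 i (g3 x))"
    "\<And>x. x \<in> ball 0 r3 \<Longrightarrow> (\<Sum>a\<in>UNIV. v a *\<^sub>R R c3 (\<sigma> a) x) - Q b0 = \<eta> (\<rho> x)"
  proof (rule euler_shift[OF c2(1), where v = v], goal_cases)
    case 3
    show ?case by (rule 3(1)[OF 3(2-)])
  qed (auto intro: c2(2) c2_euler)
  have Y3: "\<rho> (R c3 (\<sigma> a) x) = Y a (\<rho> x)" if "x \<in> ball 0 r3" for a x
    by (simp only: c3(5)[OF that] Y2[OF c3(3)[OF that]] c3(4)[OF that])
  show thesis
    by (rule that[OF c3(1) comm diag x0 c3(2)
          linear_of_commuting_euler[OF c3(1,2) Y3 c1(5) c3(6)]])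
qed

lemma card_split: "CARD('m) \<le> CARD('n)" "card K = CARD('n) - CARD('m)"
proof -
  have "CARD('m) = card (- K)" using bij_betw_same_card[OF \<sigma>] .
  then have "CARD('m) = CARD('n) - card K" by (simp add: Compl_eq_Diff_UNIV card_Diff_subset)
  moreover have "card K \<le> CARD('n)" by (rule card_mono) auto
  ultimately show "CARD('m) \<le> CARD('n)" "card K = CARD('n) - CARD('m)" by auto
qed

lemma normal_form_exists:
  fixes L :: "'m \<Rightarrow> real ^ 'm ^ 'm"
  assumes c: "centered c r" and comm: "\<And>a b. L a ** L b = L b ** L a"
    and diag: "\<And>a. diagonalizable_over_C (L a)" and W: "wedge (\<lambda>a. L a *v x0) \<noteq> 0"
    and K: "\<And>x j. x \<in> ball 0 r \<Longrightarrow> j \<in> K \<Longrightarrow> R c j x = axis j 1"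
    and L: "\<And>x a. x \<in> ball 0 r \<Longrightarrow> R c (\<sigma> a) x = \<eta> (L a *v \<rho> x) + Q (R c (\<sigma> a) 0)"
    and \<iota>: "bij_betw \<iota> {1..CARD('n)} UNIV"
  obtains h e d v where "h + 2 * e = CARD('m)" "d \<in> A" "p \<in> chart_dom d" "basis_of_Rn v"
    "normal_form \<iota> X d v h e"
proof -
  let ?m = "CARD('m)" and ?n = "CARD('n)"
  note mn = card_split
  obtain h e \<Theta> u where he: "h + 2 * e = ?m" and \<Theta>_lin: "\<And>k. linear (\<Theta> k :: real ^ 'm \<Rightarrow> real)"
    and \<Theta>_inj: "\<And>y. (\<And>k. k \<in> {1..?m} \<Longrightarrow> \<Theta> k y = 0) \<Longrightarrow> y = 0"
    and \<Theta>1: "\<And>i k y. i \<in> {1..h} \<Longrightarrow> k \<in> {1..?m} \<Longrightarrow>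
      \<Theta> k (\<Sum>a\<in>UNIV. u i $ a *\<^sub>R (L a *v y)) = (if k = i then \<Theta> i y else 0)"
    and \<Theta>2: "\<And>j k y. j \<in> {1..e} \<Longrightarrow> k \<in> {1..?m} \<Longrightarrow>
      \<Theta> k (\<Sum>a\<in>UNIV. u (h + 2 * j - 1) $ a *\<^sub>R (L a *v y)) =
      (if k = h + 2 * j - 1 \<or> k = h + 2 * j then \<Theta> k y else 0)"
    and \<Theta>3: "\<And>j k y. j \<in> {1..e} \<Longrightarrow> k \<in> {1..?m} \<Longrightarrow>
      \<Theta> k (\<Sum>a\<in>UNIV. u (h + 2 * j) $ a *\<^sub>R (L a *v y)) =
      (if k = h + 2 * j - 1 then - \<Theta> (h + 2 * j) y
       else if k = h + 2 * j then \<Theta> (h + 2 * j - 1) y else 0)"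
    and u: "\<And>c. (\<Sum>i\<in>{1..?m}. c i *\<^sub>R u i) = (0 :: real ^ 'm) \<Longrightarrow> \<forall>i\<in>{1..?m}. c i = 0"
    using simultaneous_normal_form[OF comm diag W] by blast
  have "card {?m + 1..?n} = card K" using mn by simp
  then obtain \<kappa> where \<kappa>: "bij_betw \<kappa> {?m + 1..?n} K"
    using finite_same_card_bij[OF finite_atLeastAtMost finite] by blast
  have \<kappa>K: "\<kappa> k \<in> K" if "k \<in> {?m + 1..?n}" for k using \<kappa> that by (auto simp: bij_betw_def)
  have \<kappa>_eq: "\<kappa> k = \<kappa> l \<longleftrightarrow> k = l" if "k \<in> {?m + 1..?n}" "l \<in> {?m + 1..?n}" for k l
    using inj_on_eq_iff[OF bij_betw_imp_inj_on[OF \<kappa>] that] .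
  have \<iota>_eq: "\<iota> k = \<iota> l \<longleftrightarrow> k = l" if "k \<in> {1..?n}" "l \<in> {1..?n}" for k l
    using inj_on_eq_iff[OF bij_betw_imp_inj_on[OF \<iota>] that] .
  have \<iota>_ext: "x = y" if "\<And>k. k \<in> {1..?n} \<Longrightarrow> x $ \<iota> k = y $ \<iota> k" for x y :: "real ^ 'n"
    unfolding vec_eq_iff
  proof
    fix i
    have "i \<in> \<iota> ` {1..?n}" using \<iota> by (simp add: bij_betw_def)
    then show "x $ i = y $ i" using that by blast
  qed
  \<comment> \<open>The first \<open>CARD('m)\<close> coordinates are the normalising forms on the
    transverse space, the remaining ones are the coordinates in \<open>K\<close> in some order;
    \<open>\<iota>\<close> translates between numbers and coordinate indices.\<close>
  define f :: "real ^ 'n \<Rightarrow> real ^ 'n" where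
    "f x = (\<chi> i. let k = inv_into {1..?n} \<iota> i in if k \<le> ?m then \<Theta> k (\<rho> x) else x $ \<kappa> k)" for x
  have f: "f x $ \<iota> k = (if k \<le> ?m then \<Theta> k (\<rho> x) else x $ \<kappa> k)" if "k \<in> {1..?n}" for x k
    using inv_into_f_f[OF bij_betw_imp_inj_on[OF \<iota>] that] by (simp add: f_def)
  have f_lin: "linear f"
    by (rule linearI; rule \<iota>_ext)
      (simp_all add: f \<rho>_simps linear_add[OF \<Theta>_lin] linear_cmul[OF \<Theta>_lin])
  have f_bl: "bounded_linear f" using f_lin linear_conv_bounded_linear by blast
  have f_inj: "inj f"
    unfolding linear_injective_0[OF f_lin]
  proof (intro allI impI)
    fix x assume x: "f x = 0"
    have "\<rho> x = 0"
    proof (rule \<Theta>_inj)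
      fix k assume "k \<in> {1..?m}"
      with f[of k x] mn x show "\<Theta> k (\<rho> x) = 0" by simp
    qed
    moreover have "x $ j = 0" if "j \<in> K" for j
    proof -
      obtain k where "k \<in> {?m + 1..?n}" "j = \<kappa> k" using \<kappa> \<open>j \<in> K\<close> unfolding bij_betw_def by blast
      with f[of k x] x show ?thesis by simp
    qed
    then have "Q x = 0" by (simp add: Q_expand)
    ultimately show "x = 0" using split_sum[of x] by (simp add: \<eta>_simps)
  qed
  have f_frechet: "frechet_derivative f (at x) = f" for x
    using frechet_derivative_eq[OF bounded_linear.has_derivative[OF f_bl has_derivative_ident]] by blast
  have r: "r > 0" using c by (simp add: centered_def)
  obtain d r' g where d: "centered d r'" "\<And>y. y \<in> ball 0 r' \<Longrightarrow> g y \<in> ball 0 r"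
    "\<And>y. y \<in> ball 0 r' \<Longrightarrow> f (g y) = y" "\<And>y i. y \<in> ball 0 r' \<Longrightarrow> R d i y = f (R c i (g y))"
    using change_chart[OF c r order_refl smooth_on_bounded_linear[OF f_bl] linear_0[OF f_lin], unfolded f_frechet, OF f_inj]
    by metis
  have d': "d \<in> A" "p \<in> chart_dom d" "coord d ` chart_dom d = ball 0 r'" using d(1) by (auto simp: centered_def)
  \<comment> \<open>A transverse field may still carry a constant part along \<open>K\<close>. The
    subtracted combination of the free fields, which are constant in this chart, cancels it.\<close>
  define v where "v k = (if k \<le> ?m then \<eta> (u k) - (\<Sum>a\<in>UNIV. u k $ a *\<^sub>R Q (R c (\<sigma> a) 0)) else axis (\<kappa> k) 1)" for k
  have G: "(\<Sum>i\<in>UNIV. w $ i *\<^sub>R R c i x) =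
      \<eta> (\<Sum>a\<in>UNIV. \<rho> w $ a *\<^sub>R (L a *v \<rho> x)) + ((\<Sum>a\<in>UNIV. \<rho> w $ a *\<^sub>R Q (R c (\<sigma> a) 0)) + Q w)"
    if x: "x \<in> ball 0 r" for w x
  proof -
    have "(\<Sum>i\<in>UNIV. w $ i *\<^sub>R R c i x) = (\<Sum>i\<in>-K. w $ i *\<^sub>R R c i x) + (\<Sum>i\<in>K. w $ i *\<^sub>R R c i x)"
      using sum.subset_diff[of K UNIV] by (simp add: Compl_eq_Diff_UNIV)
    also have "(\<Sum>i\<in>K. w $ i *\<^sub>R R c i x) = Q w" by (simp add: Q_expand K[OF x])
    also have "(\<Sum>i\<in>-K. w $ i *\<^sub>R R c i x) = (\<Sum>a\<in>UNIV. w $ \<sigma> a *\<^sub>R R c (\<sigma> a) x)"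
      by (rule sum.reindex_bij_betw[OF \<sigma>, symmetric])
    also have "\<dots> = (\<Sum>a\<in>UNIV. \<rho> w $ a *\<^sub>R (\<eta> (L a *v \<rho> x) + Q (R c (\<sigma> a) 0)))"
      using L[OF x] by (simp add: \<rho>_def)
    finally show ?thesis by (simp add: scaleR_add_right sum.distrib \<eta>_simps)
  qed
  have gen: "generator X w d q $ \<iota> k = (if k \<le> ?m then \<Theta> k (\<Sum>a\<in>UNIV. \<rho> w $ a *\<^sub>R (L a *v \<rho> (g (coord d q))))
      else ((\<Sum>a\<in>UNIV. \<rho> w $ a *\<^sub>R Q (R c (\<sigma> a) 0)) + Q w) $ \<kappa> k)"
    if q: "q \<in> chart_dom d" and k: "k \<in> {1..?n}" for w q k
  proof -
    have y: "coord d q \<in> ball 0 r'" using d'(3) q by blast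
    have "generator X w d q = (\<Sum>i\<in>UNIV. w $ i *\<^sub>R R d i (coord d q))"
      by (simp add: generator_def R_coord[OF d'(1) q])
    also have "\<dots> = f (\<Sum>i\<in>UNIV. w $ i *\<^sub>R R c i (g (coord d q)))"
      by (simp add: d(4)[OF y] linear_sum[OF f_lin] linear_cmul[OF f_lin])
    finally have *: "generator X w d q = f (\<Sum>i\<in>UNIV. w $ i *\<^sub>R R c i (g (coord d q)))" .
    have "\<eta> z $ \<kappa> k = 0" if "\<not> k \<le> ?m" for z using \<kappa>K[of k] that k by (simp add: \<eta>_def)
    then show ?thesis unfolding * f[OF k] G[OF d(2)[OF y]]
      by (simp add: \<rho>_simps)
  qed
  have coord: "coord d q $ \<iota> k = \<Theta> k (\<rho> (g (coord d q)))" if "q \<in> chart_dom d" "k \<in> {1..?m}" for q k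
  proof -
    have y: "coord d q \<in> ball 0 r'" using d'(3) that by blast
    show ?thesis using f[of k "g (coord d q)"] that mn by (simp add: d(3)[OF y])
  qed
  have \<rho>v: "\<rho> (v k) = u k" if "k \<le> ?m" for k using that by (simp add: v_def \<rho>_simps)
  have Qv: "Q (v k) = - (\<Sum>a\<in>UNIV. u k $ a *\<^sub>R Q (R c (\<sigma> a) 0))" if "k \<le> ?m" for k
    using that by (simp add: v_def Q_simps)
  have v': "\<rho> (v k) = 0" "Q (v k) = axis (\<kappa> k) 1" if "k \<in> {?m + 1..?n}" for k
    using that \<kappa>K[OF that] by (simp_all add: v_def)
  have gen1: "generator X (v i) d q $ \<iota> k = (if k \<le> ?m then \<Theta> k (\<Sum>a\<in>UNIV. u i $ a *\<^sub>R (L a *v \<rho> (g (coord d q)))) else 0)"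
    if "q \<in> chart_dom d" "i \<le> ?m" "k \<in> {1..?n}" for i k q
    using that by (simp add: gen \<rho>v Qv)
  have gen2: "generator X (v i) d q = axis (\<iota> i) 1" if q: "q \<in> chart_dom d" and i: "i \<in> {?m + 1..?n}" for i q
  proof (rule \<iota>_ext)
    fix k assume k: "k \<in> {1..?n}"
    have "i \<in> {1..?n}" using i by simp
    note eq = \<iota>_eq[OF k this]
    show "generator X (v i) d q $ \<iota> k = axis (\<iota> i) 1 $ \<iota> k"
    proof (cases "k \<le> ?m")
      case True
      then show ?thesis using i by (simp add: gen[OF q k] v' axis_def eq linear_0[OF \<Theta>_lin])
    next
      case False
      then have "k \<in> {?m + 1..?n}" using k by simp
      from \<kappa>_eq[OF this i] show ?thesis using False i by (simp add: gen[OF q k] v' axis_def eq)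
    qed
  qed
  have nf: "normal_form \<iota> X d v h e"
    unfolding normal_form_def Let_def
  proof (intro ballI conjI)
    fix q i assume q: "q \<in> chart_dom d" and i: "i \<in> {1..h}"
    have i': "i \<in> {1..?m}" "i \<in> {1..?n}" using i he mn by auto
    show "generator X (v i) d q = coord d q $ \<iota> i *\<^sub>R axis (\<iota> i) 1"
    proof (rule \<iota>_ext)
      fix k assume k: "k \<in> {1..?n}"
      show "generator X (v i) d q $ \<iota> k = (coord d q $ \<iota> i *\<^sub>R axis (\<iota> i) 1) $ \<iota> k"
        using k i' i by (auto simp: gen1[OF q _ k] \<Theta>1 coord[OF q] axis_def \<iota>_eq)
    qed
  next
    fix q j assume q: "q \<in> chart_dom d" and j: "j \<in> {1..e}"
    define a b where ab: "a = h + 2 * j - 1" "b = h + 2 * j"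
    have ab': "a \<in> {1..?m}" "a \<in> {1..?n}" "b \<in> {1..?m}" "b \<in> {1..?n}" "a \<noteq> b" using j he mn unfolding ab by auto
    note \<Theta>' = \<Theta>2[OF j, folded ab] \<Theta>3[OF j, folded ab]
    have "generator X (v a) d q = coord d q $ \<iota> a *\<^sub>R axis (\<iota> a) 1 + coord d q $ \<iota> b *\<^sub>R axis (\<iota> b) 1"
    proof (rule \<iota>_ext)
      fix k assume k: "k \<in> {1..?n}"
      show "generator X (v a) d q $ \<iota> k = (coord d q $ \<iota> a *\<^sub>R axis (\<iota> a) 1 + coord d q $ \<iota> b *\<^sub>R axis (\<iota> b) 1) $ \<iota> k"
        using k ab' by (auto simp: gen1[OF q _ k] \<Theta>' coord[OF q] axis_def \<iota>_eq)
    qed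
    then show "generator X (v (h + 2 * j - 1)) d q = coord d q $ \<iota> (h + 2 * j - 1) *\<^sub>R axis (\<iota> (h + 2 * j - 1)) 1 +
        coord d q $ \<iota> (h + 2 * j) *\<^sub>R axis (\<iota> (h + 2 * j)) 1"
      unfolding ab .
    have "generator X (v b) d q = coord d q $ \<iota> a *\<^sub>R axis (\<iota> b) 1 - coord d q $ \<iota> b *\<^sub>R axis (\<iota> a) 1"
    proof (rule \<iota>_ext)
      fix k assume k: "k \<in> {1..?n}"
      show "generator X (v b) d q $ \<iota> k = (coord d q $ \<iota> a *\<^sub>R axis (\<iota> b) 1 - coord d q $ \<iota> b *\<^sub>R axis (\<iota> a) 1) $ \<iota> k"
        using k ab' by (auto simp: gen1[OF q _ k] \<Theta>' coord[OF q] axis_def \<iota>_eq)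
    qed
    then show "generator X (v (h + 2 * j)) d q = coord d q $ \<iota> (h + 2 * j - 1) *\<^sub>R axis (\<iota> (h + 2 * j)) 1 -
        coord d q $ \<iota> (h + 2 * j) *\<^sub>R axis (\<iota> (h + 2 * j - 1)) 1"
      unfolding ab .
  next
    fix q k assume "q \<in> chart_dom d" and "k \<in> {h + 2 * e + 1..?n}"
    then show "generator X (v k) d q = axis (\<iota> k) 1" unfolding he by (rule gen2)
  qed
  have "basis_of_Rn v"
  proof (rule basis_of_RnI)
    fix c assume s: "(\<Sum>i\<in>{1..?n}. c i *\<^sub>R v i) = 0"
    have split: "{1..?n} = {1..?m} \<union> {?m + 1..?n}" using mn by auto
    \<comment> \<open>The basis is block triangular: \<open>\<rho>\<close> annihilates the second
      group and sends the first to the independent \<open>u i\<close>; afterwards \<open>Q\<close>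
      distinguishes the members of the second.\<close>
    have s': "(\<Sum>i\<in>{1..?m}. c i *\<^sub>R v i) + (\<Sum>i\<in>{?m + 1..?n}. c i *\<^sub>R v i) = 0"
      using s unfolding split by (subst (asm) sum.union_disjoint) auto
    from arg_cong[OF this, of \<rho>] have "(\<Sum>i\<in>{1..?m}. c i *\<^sub>R u i) = 0"
      by (simp add: \<rho>_simps \<rho>v v')
    then have c1: "\<forall>i\<in>{1..?m}. c i = 0" by (rule u)
    have c2: "c k = 0" if k: "k \<in> {?m + 1..?n}" for k
    proof -
      have "(\<Sum>i\<in>{?m + 1..?n}. c i *\<^sub>R v i) = 0" using s' c1 by simp
      from arg_cong[OF this, of "\<lambda>x. Q x $ \<kappa> k"] have "(\<Sum>i\<in>{?m + 1..?n}. c i * (if i = k then 1 else 0)) = 0"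
        using \<kappa>_eq[OF _ k] by (simp add: Q_simps v' axis_def eq_commute[of "\<kappa> k"])
      then show ?thesis using k by (simp add: if_distrib[of "\<lambda>x. _ * x"] cong: if_cong)
    qed
    show "\<forall>i\<in>{1..?n}. c i = 0" unfolding split using c1 c2 by blast
  qed
  then show thesis using that[OF he d'(1,2) _ nf] by blast
qed

end

section \<open>Uniqueness of the type\<close>

lemma transition_derivative:
  fixes M :: "'p topology" and A :: "('p, 'n::finite) chart set"
  assumes man: "smooth_manifold M A" and c: "c \<in> A" "p \<in> chart_dom c" and d: "d \<in> A" "p \<in> chart_dom d"
  shows "(in_coords c (coord d) has_derivative frechet_derivative (in_coords c (coord d)) (at (coord c p))) (at (coord c p))"
    "frechet_derivative (in_coords d (coord c)) (at (coord d p))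
      (frechet_derivative (in_coords c (coord d)) (at (coord c p)) u) = u"
proof -
  have der: "(in_coords c (coord d) has_derivative frechet_derivative (in_coords c (coord d)) (at (coord c p))) (at (coord c p))"
    if "c \<in> A" "d \<in> A" "p \<in> chart_dom c" "p \<in> chart_dom d" for c d
    using smooth_on_differentiable[OF manifold_compatible[OF man that(1,2)], of "coord c p"] that by blast
  show D: "(in_coords c (coord d) has_derivative frechet_derivative (in_coords c (coord d)) (at (coord c p))) (at (coord c p))"
    using der c d by blast
  note ch = manifold_chart[OF man c(1)] manifold_chart[OF man d(1)]
  have dp: "in_coords c (coord d) (coord c p) = coord d p" by (rule in_coords_coord[OF ch(1) c(2)])
  have o: "open (coord c ` (chart_dom c \<inter> chart_dom d))"
    by (rule chart_open_image[OF ch(1)]) (use ch(2) in \<open>simp add: is_chart_def\<close>)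
  have "((\<lambda>x. in_coords d (coord c) (in_coords c (coord d) x)) has_derivative
      (\<lambda>u. frechet_derivative (in_coords d (coord c)) (at (coord d p))
        (frechet_derivative (in_coords c (coord d)) (at (coord c p)) u))) (at (coord c p))"
    by (rule has_derivative_compose[OF D]) (use der[OF d(1) c(1) d(2) c(2)] in \<open>simp add: dp\<close>)
  then have "((\<lambda>x. x) has_derivative (\<lambda>u. frechet_derivative (in_coords d (coord c)) (at (coord d p))
        (frechet_derivative (in_coords c (coord d)) (at (coord c p)) u))) (at (coord c p))"
    by (rule has_derivative_transform_within_open[OF _ o])
      (use c d in \<open>auto simp: in_coords_coord[OF ch(1)] in_coords_coord[OF ch(2)]\<close>)
  from has_derivative_unique[OF this has_derivative_ident]
  show "frechet_derivative (in_coords d (coord c)) (at (coord d p))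
      (frechet_derivative (in_coords c (coord d)) (at (coord c p)) u) = u"
    by (rule fun_cong)
qed

lemma smooth_vector_field_generator:
  fixes M :: "'p topology" and A :: "('p, 'n::finite) chart set"
  assumes man: "smooth_manifold M A" and X: "\<And>i. smooth_vector_field A (X i)"
  shows "smooth_vector_field A (generator X w)"
  unfolding smooth_vector_field_def
proof (intro conjI ballI)
  fix c d q assume *: "c \<in> A" "d \<in> A" "q \<in> chart_dom c \<inter> chart_dom d"
  have "linear (frechet_derivative (in_coords c (coord d)) (at (coord c q)))"
    using transition_derivative(1)[OF man, of c q d] * by (intro has_derivative_linear) auto
  moreover have "X i d q = frechet_derivative (in_coords c (coord d)) (at (coord c q)) (X i c q)" for i
    using X[of i] * unfolding smooth_vector_field_def by blast
  ultimately show "generator X w d q = frechet_derivative (in_coords c (coord d)) (at (coord c q)) (generator X w c q)"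
    by (simp add: generator_def linear_sum linear_cmul)
next
  fix c assume c: "c \<in> A"
  have o: "open (coord c ` chart_dom c)" using manifold_chart[OF man c] by (simp add: is_chart_def)
  have "smooth_on (coord c ` chart_dom c) (\<lambda>x. \<Sum>i\<in>UNIV. w $ i *\<^sub>R in_coords c (X i c) x)"
    using X c o by (intro smooth_on_sum smooth_on_scaleR smooth_on_const) (auto simp: smooth_vector_field_def)
  then show "smooth_on (coord c ` chart_dom c) (in_coords c (generator X w c))"
    by (simp add: in_coords_def generator_def o_def)
qed

text \<open>Each Jacobian maps one family of vectors onto the other, so neither dimension exceeds
  the other, whatever chart the choice in \<open>rank_at\<close> picks.\<close>

lemma rank_at_eq_dim:
  fixes M :: "'p topology" and A :: "('p, 'n::finite) chart set"
  assumes man: "smooth_manifold M A" and X: "\<And>i. smooth_vector_field A (X i)" and c: "c \<in> A" "p \<in> chart_dom c"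
  shows "rank_at A X p = dim (range (\<lambda>i. X i c p))"
proof -
  define d where "d = (SOME c. c \<in> A \<and> p \<in> chart_dom c)"
  have d: "d \<in> A" "p \<in> chart_dom d" using someI[of "\<lambda>c. c \<in> A \<and> p \<in> chart_dom c" c] c by (simp_all add: d_def)
  have le: "dim (range (\<lambda>i. X i d p)) \<le> dim (range (\<lambda>i. X i c p))"
    if "c \<in> A" "p \<in> chart_dom c" "d \<in> A" "p \<in> chart_dom d" for c d
  proof -
    let ?J = "frechet_derivative (in_coords c (coord d)) (at (coord c p))"
    have "X i d p = ?J (X i c p)" for i using X[of i] that unfolding smooth_vector_field_def by blast
    then have "range (\<lambda>i. X i d p) = ?J ` range (\<lambda>i. X i c p)" by (simp add: image_image)
    moreover have "linear ?J" using transition_derivative(1)[OF man that] by (rule has_derivative_linear)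
    ultimately show ?thesis by (simp add: dim_image_le)
  qed
  have "rank_at A X p = dim (range (\<lambda>i. X i d p))" by (simp add: rank_at_def d_def Let_def dim_span)
  with le[OF c d] le[OF d c] show ?thesis by simp
qed

text \<open>The derivative at a zero is an endomorphism of the tangent space, so its spectrum does not
  depend on the chart; the last condition excludes the eigenvalues \<open>\<alpha> \<plusminus> \<i>\<beta>\<close>.\<close>

definition real_zero :: "('p, 'n::finite) vfield \<Rightarrow> ('p, 'n) chart \<Rightarrow> 'p \<Rightarrow> bool" where
  "real_zero Y c p \<longleftrightarrow> Y c p = 0 \<and>
     (let D = frechet_derivative (in_coords c (Y c)) (at (coord c p)) in
      \<forall>\<alpha> \<beta> u. \<beta> \<noteq> 0 \<longrightarrow> D (D u) - (2 * \<alpha>) *\<^sub>R D u + (\<alpha>\<^sup>2 + \<beta>\<^sup>2) *\<^sub>R u = 0 \<longrightarrow> u = 0)"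

lemma real_zero_chart_change:
  fixes M :: "'p topology" and A :: "('p, 'n::finite) chart set"
  assumes man: "smooth_manifold M A" and Y: "smooth_vector_field A Y"
    and c: "c \<in> A" "p \<in> chart_dom c" and d: "d \<in> A" "p \<in> chart_dom d"
    and rz: "real_zero Y c p"
  shows "real_zero Y d p"
proof -
  define f where "f = in_coords c (coord d)"
  define J where "J = frechet_derivative f (at (coord c p))"
  define J' where "J' = frechet_derivative (in_coords d (coord c)) (at (coord d p))"
  define C where "C = frechet_derivative (in_coords c (Y c)) (at (coord c p))"
  define D where "D = frechet_derivative (in_coords d (Y d)) (at (coord d p))"
  note ch = manifold_chart[OF man c(1)] manifold_chart[OF man d(1)]
  let ?S = "coord c ` (chart_dom c \<inter> chart_dom d)"
  have o: "open ?S" "coord c p \<in> ?S"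
    using chart_open_image[OF ch(1), of "chart_dom d"] ch(2) c d by (auto simp: is_chart_def)
  have J: "(f has_derivative J) (at (coord c p))" and J'J: "J' (J u) = u" and JJ': "J (J' u) = u" for u
    using transition_derivative[OF man c d] transition_derivative(2)[OF man d c] by (simp_all add: J_def J'_def f_def)
  have Jlin: "linear J" using J by (rule has_derivative_linear)
  have Yd: "Y d q = frechet_derivative f (at (coord c q)) (Y c q)" if "q \<in> chart_dom c \<inter> chart_dom d" for q
    using Y c d that unfolding smooth_vector_field_def f_def by blast
  have Yc0: "Y c p = 0" using rz by (simp add: real_zero_def)
  then have Yd0: "Y d p = 0" using Yd[of p] c d linear_0[OF Jlin] by (simp add: J_def)
  have in_dom: "coord c p \<in> coord c ` chart_dom c" "coord d p \<in> coord d ` chart_dom d" using c d by auto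
  have C: "(in_coords c (Y c) has_derivative C) (at (coord c p))"
    unfolding C_def using Y c in_dom by (intro smooth_on_differentiable) (auto simp: smooth_vector_field_def)
  have D: "(in_coords d (Y d) has_derivative D) (at (coord d p))"
    unfolding D_def using Y d in_dom by (intro smooth_on_differentiable) (auto simp: smooth_vector_field_def)
  have f: "smooth_on ?S f" unfolding f_def by (rule manifold_compatible[OF man c(1) d(1)])
  have fp: "f (coord c p) = coord d p" unfolding f_def by (rule in_coords_coord[OF ch(1) c(2)])
  have "in_coords c (Y c) (coord c p) = 0" by (simp add: Yc0 in_coords_coord[OF ch(1) c(2)])
  \<comment> \<open>Because \<open>Y\<close> vanishes at \<open>p\<close>, its linear parts in the
    two charts are conjugate by the Jacobian \<open>J\<close>.\<close>
  from has_derivative_apply_at_zero[OF o f C this]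
  have "((\<lambda>x. frechet_derivative f (at x) (in_coords c (Y c) x)) has_derivative (\<lambda>u. J (C u))) (at (coord c p))"
    by (simp add: J_def)
  then have "((\<lambda>x. in_coords d (Y d) (f x)) has_derivative (\<lambda>u. J (C u))) (at (coord c p))"
    by (rule has_derivative_transform_within_open[OF _ o])
      (auto simp: Yd in_coords_coord[OF ch(1)] in_coords_coord[OF ch(2)] f_def)
  moreover have "((\<lambda>x. in_coords d (Y d) (f x)) has_derivative (\<lambda>u. D (J u))) (at (coord c p))"
    by (rule has_derivative_compose[OF J]) (simp add: fp D)
  ultimately have "(\<lambda>u. J (C u)) = (\<lambda>u. D (J u))" by (rule has_derivative_unique)
  then have DJ: "D (J u) = J (C u)" for u by (rule fun_cong[symmetric])
  have Creal: "u = 0" if "\<beta> \<noteq> 0" "C (C u) - (2 * \<alpha>) *\<^sub>R C u + (\<alpha>\<^sup>2 + \<beta>\<^sup>2) *\<^sub>R u = 0" for \<alpha> \<beta> :: real and u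
    using rz that unfolding real_zero_def C_def Let_def by blast
  have "u = 0" if \<beta>: "\<beta> \<noteq> 0" and u: "D (D u) - (2 * \<alpha>) *\<^sub>R D u + (\<alpha>\<^sup>2 + \<beta>\<^sup>2) *\<^sub>R u = 0" for \<alpha> \<beta> :: real and u
  proof -
    define w where "w = J' u"
    have w: "u = J w" by (simp add: w_def JJ')
    have "J (C (C w) - (2 * \<alpha>) *\<^sub>R C w + (\<alpha>\<^sup>2 + \<beta>\<^sup>2) *\<^sub>R w) = 0"
      using u by (simp add: w DJ linear_add[OF Jlin] linear_diff[OF Jlin] linear_cmul[OF Jlin])
    then have "C (C w) - (2 * \<alpha>) *\<^sub>R C w + (\<alpha>\<^sup>2 + \<beta>\<^sup>2) *\<^sub>R w = 0"
      using J'J linear_0[OF Jlin] by metis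
    then have "w = 0" by (rule Creal[OF \<beta>])
    then show ?thesis by (simp add: w linear_0[OF Jlin])
  qed
  with Yd0 show ?thesis unfolding real_zero_def Let_def D_def by blast
qed

section \<open>Generators in a normal form chart\<close>

lemma block_cases [consumes 1]:
  fixes k h e n :: nat
  assumes "k \<in> {1..n}"
  obtains "k \<in> {1..h}" | j where "j \<in> {1..e}" "k = h + 2 * j - 1" | j where "j \<in> {1..e}" "k = h + 2 * j"
    | "k \<in> {h + 2 * e + 1..n}"
proof -
  have "k \<in> {1..h} \<or> k \<in> {h + 2 * e + 1..n} \<or> (h < k \<and> k \<le> h + 2 * e)" using assms by auto
  moreover have "(k = h + 2 * ((k - h + 1) div 2) - 1 \<or> k = h + 2 * ((k - h + 1) div 2)) \<and> (k - h + 1) div 2 \<in> {1..e}"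
    if "h < k" "k \<le> h + 2 * e" using that by simp presburger
  ultimately show thesis using that by blast
qed

text \<open>Positivity keeps the subtraction from truncating: for \<open>h = i = 0\<close> the index
  \<open>h + 2 * i - 1\<close> would be 0 as well.\<close>

lemma pair_index:
  fixes i j h :: nat
  assumes "1 \<le> i" "1 \<le> j"
  shows "h + 2 * i - 1 = h + 2 * j - 1 \<longleftrightarrow> i = j" "h + 2 * i - 1 \<noteq> h + 2 * j" "h + 2 * i \<noteq> h + 2 * j - 1"
  using assms by presburger+

text \<open>An arbitrary normal form of the given size, since uniqueness has to hold against every
  competitor. The chart need not send \<open>p\<close> to the origin; it is the assumption
  \<open>corank\<close> that makes the first \<open>h + 2 * e\<close> coordinates of
  \<open>p\<close> vanish.\<close>

locale normal_form_chart =
  fixes M :: "'p topology" and A :: "('p, 'n::finite) chart set" and X :: "'n \<Rightarrow> ('p, 'n) vfield"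
    and \<iota> :: "nat \<Rightarrow> 'n" and c :: "('p, 'n) chart" and p :: 'p and v :: "nat \<Rightarrow> real ^ 'n" and h e :: nat
  assumes man: "smooth_manifold M A" and field: "\<And>i. smooth_vector_field A (X i)"
    and \<iota>: "bij_betw \<iota> {1..CARD('n)} UNIV" and c: "c \<in> A" "p \<in> chart_dom c"
    and basis: "basis_of_Rn v" and nf: "normal_form \<iota> X c v h e"
    and corank: "h + 2 * e = CARD('n) - rank_at A X p"
begin

lemma corank_le: "h + 2 * e \<le> CARD('n)" using corank by simp

lemma \<iota>_eq: "k \<in> {1..CARD('n)} \<Longrightarrow> l \<in> {1..CARD('n)} \<Longrightarrow> \<iota> k = \<iota> l \<longleftrightarrow> k = l"
  using inj_on_eq_iff[OF bij_betw_imp_inj_on[OF \<iota>]] .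

lemma coords_eqI:
  fixes x y :: "real ^ 'n"
  assumes "\<And>k. k \<in> {1..CARD('n)} \<Longrightarrow> x $ \<iota> k = y $ \<iota> k"
  shows "x = y"
  unfolding vec_eq_iff
proof
  fix i
  have "i \<in> \<iota> ` {1..CARD('n)}" using \<iota> by (simp add: bij_betw_def)
  then show "x $ i = y $ i" using assms by blast
qed

lemma generator_basis:
  assumes q: "q \<in> chart_dom c" and k: "k \<in> {1..CARD('n)}"
  shows "i \<in> {1..h} \<Longrightarrow> generator X (v i) c q $ \<iota> k = (if k = i then coord c q $ \<iota> i else 0)"
    "j \<in> {1..e} \<Longrightarrow> generator X (v (h + 2 * j - 1)) c q $ \<iota> k =
      (if k = h + 2 * j - 1 \<or> k = h + 2 * j then coord c q $ \<iota> k else 0)"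
    "j \<in> {1..e} \<Longrightarrow> generator X (v (h + 2 * j)) c q $ \<iota> k =
      (if k = h + 2 * j - 1 then - (coord c q $ \<iota> (h + 2 * j))
       else if k = h + 2 * j then coord c q $ \<iota> (h + 2 * j - 1) else 0)"
    "i \<in> {h + 2 * e + 1..CARD('n)} \<Longrightarrow> generator X (v i) c q $ \<iota> k = (if k = i then 1 else 0)"
proof -
  note nf' = bspec[OF nf[unfolded normal_form_def Let_def] q]
  have 1: "generator X (v i) c q = coord c q $ \<iota> i *\<^sub>R axis (\<iota> i) 1" if "i \<in> {1..h}" for i
    using nf' that by blast
  have 2: "generator X (v (h + 2 * j - 1)) c q = coord c q $ \<iota> (h + 2 * j - 1) *\<^sub>R axis (\<iota> (h + 2 * j - 1)) 1 +
      coord c q $ \<iota> (h + 2 * j) *\<^sub>R axis (\<iota> (h + 2 * j)) 1" if "j \<in> {1..e}" for j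
    using nf' that by blast
  have 3: "generator X (v (h + 2 * j)) c q = coord c q $ \<iota> (h + 2 * j - 1) *\<^sub>R axis (\<iota> (h + 2 * j)) 1 -
      coord c q $ \<iota> (h + 2 * j) *\<^sub>R axis (\<iota> (h + 2 * j - 1)) 1" if "j \<in> {1..e}" for j
    using nf' that by blast
  have 4: "generator X (v i) c q = axis (\<iota> i) 1" if "i \<in> {h + 2 * e + 1..CARD('n)}" for i
    using nf' that by blast
  have ax: "axis (\<iota> l) (1::real) $ \<iota> k = (if k = l then 1 else 0)" if "l \<in> {1..CARD('n)}" for l
    using \<iota>_eq[OF k that] by (simp add: axis_def eq_commute[of "\<iota> l"])
  show "generator X (v i) c q $ \<iota> k = (if k = i then coord c q $ \<iota> i else 0)" if i: "i \<in> {1..h}"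
    using 1[OF i] ax[of i] i corank_le by auto
  show "generator X (v i) c q $ \<iota> k = (if k = i then 1 else 0)" if i: "i \<in> {h + 2 * e + 1..CARD('n)}"
    using 4[OF i] ax[of i] i by auto
  fix j assume j: "j \<in> {1..e}"
  have in_n: "h + 2 * j - 1 \<in> {1..CARD('n)}" "h + 2 * j \<in> {1..CARD('n)}" and ne: "h + 2 * j - 1 \<noteq> h + 2 * j"
    using j corank_le by auto
  show "generator X (v (h + 2 * j - 1)) c q $ \<iota> k =
      (if k = h + 2 * j - 1 \<or> k = h + 2 * j then coord c q $ \<iota> k else 0)"
    using ne by (simp only: 2[OF j] vector_add_component vector_scaleR_component ax[OF in_n(1)] ax[OF in_n(2)]) auto
  show "generator X (v (h + 2 * j)) c q $ \<iota> k =
      (if k = h + 2 * j - 1 then - (coord c q $ \<iota> (h + 2 * j))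
       else if k = h + 2 * j then coord c q $ \<iota> (h + 2 * j - 1) else 0)"
    using ne by (simp only: 3[OF j] vector_minus_component vector_scaleR_component ax[OF in_n(1)] ax[OF in_n(2)]) auto
qed

lemma generator_sum: "generator X (\<Sum>k\<in>I. t k *\<^sub>R w k) c q = (\<Sum>k\<in>I. t k *\<^sub>R generator X (w k) c q)"
  by (simp add: generator_def scaleR_sum_left scaleR_sum_right sum.swap[of _ UNIV])

lemma generator_components:
  assumes q: "q \<in> chart_dom c"
  defines "w t \<equiv> \<Sum>k\<in>{1..CARD('n)}. t k *\<^sub>R v k"
  shows "i \<in> {1..h} \<Longrightarrow> generator X (w t) c q $ \<iota> i = t i * coord c q $ \<iota> i"
    "j \<in> {1..e} \<Longrightarrow> generator X (w t) c q $ \<iota> (h + 2 * j - 1) =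
      t (h + 2 * j - 1) * coord c q $ \<iota> (h + 2 * j - 1) - t (h + 2 * j) * coord c q $ \<iota> (h + 2 * j)"
    "j \<in> {1..e} \<Longrightarrow> generator X (w t) c q $ \<iota> (h + 2 * j) =
      t (h + 2 * j - 1) * coord c q $ \<iota> (h + 2 * j) + t (h + 2 * j) * coord c q $ \<iota> (h + 2 * j - 1)"
    "i \<in> {h + 2 * e + 1..CARD('n)} \<Longrightarrow> generator X (w t) c q $ \<iota> i = t i"
proof -
  have *: "generator X (w t) c q $ \<iota> k = (\<Sum>l\<in>T. t l * generator X (v l) c q $ \<iota> k)"
    if "T \<subseteq> {1..CARD('n)}" "\<And>l. l \<in> {1..CARD('n)} - T \<Longrightarrow> generator X (v l) c q $ \<iota> k = 0" for k T
    unfolding w_def generator_sum sum_component vector_scaleR_component real_scaleR_def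
    by (rule sum.mono_neutral_right) (use that in auto)
  show "generator X (w t) c q $ \<iota> i = t i * coord c q $ \<iota> i" if i: "i \<in> {1..h}"
  proof -
    have i': "i \<in> {1..CARD('n)}" using i corank_le by simp
    have "generator X (v l) c q $ \<iota> i = 0" if l: "l \<in> {1..CARD('n)} - {i}" for l
    proof -
      have "l \<in> {1..CARD('n)}" "l \<noteq> i" using l by auto
      then show ?thesis
        by (cases rule: block_cases[where h = h and e = e]) (use i generator_basis[OF q i'] in auto)
    qed
    from *[of "{i}", OF _ this] show ?thesis using i' generator_basis(1)[OF q i' i] by simp
  qed
  show "generator X (w t) c q $ \<iota> i = t i" if i: "i \<in> {h + 2 * e + 1..CARD('n)}"
  proof -
    have i': "i \<in> {1..CARD('n)}" using i by simp
    have "generator X (v l) c q $ \<iota> i = 0" if l: "l \<in> {1..CARD('n)} - {i}" for l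
    proof -
      have "l \<in> {1..CARD('n)}" "l \<noteq> i" using l by auto
      then show ?thesis
        by (cases rule: block_cases[where h = h and e = e]) (use i generator_basis[OF q i'] in auto)
    qed
    from *[of "{i}", OF _ this] show ?thesis using i' generator_basis(4)[OF q i' i] by simp
  qed
  fix j assume j: "j \<in> {1..e}"
  define a b where ab: "a = h + 2 * j - 1" "b = h + 2 * j"
  have in_n: "a \<in> {1..CARD('n)}" "b \<in> {1..CARD('n)}" and ne: "a \<noteq> b" using j corank_le by (auto simp: ab)
  have zero: "generator X (v l) c q $ \<iota> k = 0" if l: "l \<in> {1..CARD('n)} - {a, b}" and k: "k \<in> {a, b}" for l k
  proof -
    have l': "l \<in> {1..CARD('n)}" "l \<noteq> a" "l \<noteq> b" using l by auto
    have k': "k \<in> {1..CARD('n)}" using k in_n by auto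
    from l'(1) show ?thesis
    proof (cases rule: block_cases[where h = h and e = e])
      case 1
      then show ?thesis using generator_basis(1)[OF q k', of l] k j by (auto simp: ab)
    next
      case (2 i)
      then have "i \<noteq> j" using l' by (auto simp: ab)
      then have "k \<noteq> h + 2 * i - 1 \<and> k \<noteq> h + 2 * i"
        using k pair_index[of i j h] pair_index[of j i h] j 2(1) unfolding ab insert_iff empty_iff atLeastAtMost_iff
        by (metis add_left_cancel mult_left_cancel zero_neq_numeral)
      then show ?thesis using generator_basis(2)[OF q k', of i] 2 by simp
    next
      case (3 i)
      then have "i \<noteq> j" using l' by (auto simp: ab)
      then have "k \<noteq> h + 2 * i - 1 \<and> k \<noteq> h + 2 * i"
        using k pair_index[of i j h] pair_index[of j i h] j 3(1) unfolding ab insert_iff empty_iff atLeastAtMost_iff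
        by (metis add_left_cancel mult_left_cancel zero_neq_numeral)
      then show ?thesis using generator_basis(3)[OF q k', of i] 3 by simp
    next
      case 4
      then show ?thesis using generator_basis(4)[OF q k', of l] k j by (auto simp: ab)
    qed
  qed
  have gb: "generator X (v a) c q $ \<iota> a = coord c q $ \<iota> a" "generator X (v a) c q $ \<iota> b = coord c q $ \<iota> b"
    "generator X (v b) c q $ \<iota> a = - coord c q $ \<iota> b" "generator X (v b) c q $ \<iota> b = coord c q $ \<iota> a"
    using generator_basis(2,3)[OF q in_n(1) j, folded ab(1), folded ab(2)]
      generator_basis(2,3)[OF q in_n(2) j, folded ab(1), folded ab(2)] ne by auto
  have sub: "{a, b} \<subseteq> {1..CARD('n)}" using in_n by simp
  have "generator X (w t) c q $ \<iota> a = t a * coord c q $ \<iota> a - t b * coord c q $ \<iota> b"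
    using *[OF sub zero, of a] ne by (simp add: gb)
  then show "generator X (w t) c q $ \<iota> (h + 2 * j - 1) =
      t (h + 2 * j - 1) * coord c q $ \<iota> (h + 2 * j - 1) - t (h + 2 * j) * coord c q $ \<iota> (h + 2 * j)"
    unfolding ab .
  have "generator X (w t) c q $ \<iota> b = t a * coord c q $ \<iota> b + t b * coord c q $ \<iota> a"
    using *[OF sub zero, of b] ne by (simp add: gb)
  then show "generator X (w t) c q $ \<iota> (h + 2 * j) =
      t (h + 2 * j - 1) * coord c q $ \<iota> (h + 2 * j) + t (h + 2 * j) * coord c q $ \<iota> (h + 2 * j - 1)"
    unfolding ab .
qed

text \<open>At \<open>p\<close> the constant fields alone fill the rank, so every generator there is
  a combination of them and has no component among the first \<open>h + 2 * e\<close>. For the real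
  fields and the dilations these components are the coordinates of \<open>p\<close>.\<close>

lemma coord_zero:
  assumes k: "k \<in> {1..h + 2 * e}"
  shows "coord c p $ \<iota> k = 0"
proof -
  let ?T = "range (\<lambda>i. X i c p)" and ?I = "{h + 2 * e + 1..CARD('n)}"
  define B where "B = (\<lambda>k. axis (\<iota> k) (1::real)) ` ?I"
  have gen_span: "generator X w c p \<in> span ?T" for w
    unfolding generator_def by (intro span_sum span_scale span_base) auto
  have "axis (\<iota> k) 1 = generator X (v k) c p" if "k \<in> ?I" for k
    using nf c that unfolding normal_form_def Let_def by force
  then have sub: "B \<subseteq> span ?T" using gen_span by (force simp: B_def)
  have "B \<subseteq> Basis" by (auto simp: B_def)
  then have ind: "independent B" using independent_Basis independent_mono by blast
  have "inj_on (\<lambda>k. axis (\<iota> k) (1::real)) ?I"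
    by (rule inj_onI) (auto simp: axis_eq_axis \<iota>_eq)
  then have "card B = CARD('n) - (h + 2 * e)" unfolding B_def by (simp add: card_image)
  moreover have "rank_at A X p \<le> CARD('n)"
    using dim_subset_UNIV[of ?T] by (simp add: rank_at_eq_dim[OF man field c])
  ultimately have "dim (span ?T) \<le> card B"
    using corank by (simp add: dim_span flip: rank_at_eq_dim[OF man field c])
  from card_ge_dim_independent[OF sub ind this] have "span ?T \<subseteq> span B" .
  also have "span B \<subseteq> {y. y $ \<iota> l = 0}" if l: "l \<in> {1..h + 2 * e}" for l
  proof (rule span_minimal)
    show "B \<subseteq> {y. y $ \<iota> l = 0}" using l corank_le by (auto simp: B_def axis_def \<iota>_eq)
  qed (simp add: subspace_def)
  finally have zero: "generator X w c p $ \<iota> l = 0" if "l \<in> {1..h + 2 * e}" for w l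
    using that gen_span[of w] by blast
  have k': "k \<in> {1..CARD('n)}" using k corank_le by simp
  from k show ?thesis
  proof (cases rule: block_cases[where h = h and e = e])
    case 1
    then show ?thesis using generator_basis(1)[OF c(2) k' 1] zero[OF k, of "v k"] by simp
  next
    case (2 j)
    then show ?thesis using generator_basis(2)[OF c(2) k' 2(1)] zero[OF k, of "v (h + 2 * j - 1)"] by simp
  next
    case (3 j)
    then show ?thesis using generator_basis(2)[OF c(2) k' 3(1)] zero[OF k, of "v (h + 2 * j - 1)"] by simp
  qed simp
qed

text \<open>Vanishing at \<open>p\<close> excludes the constant fields. What remains is linear, with
  eigenvalues \<open>t i\<close> on the lines and
  \<open>t (h + 2 * j - 1) \<plusminus> \<i> t (h + 2 * j)\<close> on the planes, so they are all
  real exactly if the rotations are absent.\<close>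

lemma real_zero_iff:
  defines "w t \<equiv> \<Sum>k\<in>{1..CARD('n)}. t k *\<^sub>R v k"
  shows "real_zero (generator X (w t)) c p \<longleftrightarrow> (\<forall>j\<in>{1..e}. t (h + 2 * j) = 0) \<and> (\<forall>k\<in>{h + 2 * e + 1..CARD('n)}. t k = 0)"
proof -
  note comp = generator_components[of _ _ t, folded w_def]
  have zero: "generator X (w t) c p = 0 \<longleftrightarrow> (\<forall>k\<in>{h + 2 * e + 1..CARD('n)}. t k = 0)"
  proof
    assume 0: "generator X (w t) c p = 0"
    show "\<forall>k\<in>{h + 2 * e + 1..CARD('n)}. t k = 0" using comp(4)[OF c(2)] by (simp add: 0)
  next
    assume t: "\<forall>k\<in>{h + 2 * e + 1..CARD('n)}. t k = 0"
    show "generator X (w t) c p = 0"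
    proof (rule coords_eqI)
      fix k assume k: "k \<in> {1..CARD('n)}"
      then show "generator X (w t) c p $ \<iota> k = 0 $ \<iota> k"
      proof (cases rule: block_cases[where h = h and e = e])
        case 1
        then show ?thesis by (simp add: comp(1)[OF c(2)] coord_zero)
      next
        case (2 j)
        have "h + 2 * j - 1 \<in> {1..h + 2 * e}" "h + 2 * j \<in> {1..h + 2 * e}" using 2(1) by auto
        from coord_zero[OF this(1)] coord_zero[OF this(2)] show ?thesis by (simp only: 2(2) comp(2)[OF c(2) 2(1)]) simp
      next
        case (3 j)
        have "h + 2 * j - 1 \<in> {1..h + 2 * e}" "h + 2 * j \<in> {1..h + 2 * e}" using 3(1) by auto
        from coord_zero[OF this(1)] coord_zero[OF this(2)] show ?thesis by (simp only: 3(2) comp(3)[OF c(2) 3(1)]) simp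
      next
        case 4
        then show ?thesis using t by (simp add: comp(4)[OF c(2)])
      qed
    qed
  qed
  show ?thesis
  proof (cases "\<forall>k\<in>{h + 2 * e + 1..CARD('n)}. t k = 0")
    case False
    then show ?thesis using zero by (auto simp: real_zero_def)
  next
    case True
    \<comment> \<open>An odd offset \<open>k - h\<close> marks the first member of a pair, with
      partner \<open>k + 1\<close>, and an even one the second, with partner
      \<open>k - 1\<close>.\<close>
    define B :: "real ^ 'n \<Rightarrow> real ^ 'n" where "B y = (\<chi> i. let k = inv_into {1..CARD('n)} \<iota> i in
      if k \<le> h then t k * y $ \<iota> k else if h + 2 * e < k then 0
      else if odd (k - h) then t k * y $ \<iota> k - t (k + 1) * y $ \<iota> (k + 1)
      else t (k - 1) * y $ \<iota> k + t k * y $ \<iota> (k - 1))" for y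
    have inv: "inv_into {1..CARD('n)} \<iota> (\<iota> k) = k" if "k \<in> {1..CARD('n)}" for k
      using inv_into_f_f[OF bij_betw_imp_inj_on[OF \<iota>] that] .
    have B1: "B y $ \<iota> i = t i * y $ \<iota> i" if "i \<in> {1..h}" for y i
    proof -
      have "i \<in> {1..CARD('n)}" "i \<le> h" using that corank_le by auto
      then show ?thesis unfolding B_def by (simp only: vec_lambda_beta inv Let_def if_True)
    qed
    have B4: "B y $ \<iota> i = 0" if "i \<in> {h + 2 * e + 1..CARD('n)}" for y i
    proof -
      have "i \<in> {1..CARD('n)}" "\<not> i \<le> h" "h + 2 * e < i" using that by auto
      then show ?thesis unfolding B_def by (simp only: vec_lambda_beta inv Let_def if_False if_True)
    qed
    have B2: "B y $ \<iota> (h + 2 * j - 1) =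
      t (h + 2 * j - 1) * y $ \<iota> (h + 2 * j - 1) - t (h + 2 * j) * y $ \<iota> (h + 2 * j)" if "j \<in> {1..e}" for y j
    proof -
      have "h + 2 * j - 1 \<in> {1..CARD('n)}" "\<not> h + 2 * j - 1 \<le> h" "\<not> h + 2 * e < h + 2 * j - 1"
        "odd (h + 2 * j - 1 - h)" "h + 2 * j - 1 + 1 = h + 2 * j" using that corank_le by auto
      then show ?thesis unfolding B_def by (simp only: vec_lambda_beta inv Let_def if_False if_True simp_thms)
    qed
    have B3: "B y $ \<iota> (h + 2 * j) =
      t (h + 2 * j - 1) * y $ \<iota> (h + 2 * j) + t (h + 2 * j) * y $ \<iota> (h + 2 * j - 1)" if "j \<in> {1..e}" for y j
    proof -
      have "h + 2 * j \<in> {1..CARD('n)}" "\<not> h + 2 * j \<le> h" "\<not> h + 2 * e < h + 2 * j"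
        "\<not> odd (h + 2 * j - h)" using that corank_le by auto
      then show ?thesis unfolding B_def by (simp only: vec_lambda_beta inv Let_def if_False if_True simp_thms)
    qed
    have Blin: "linear B"
      by (rule linearI; simp add: B_def vec_eq_iff Let_def algebra_simps)
    then have Bbl: "bounded_linear B" using linear_conv_bounded_linear by blast
    have gen: "generator X (w t) c q = B (coord c q)" if "q \<in> chart_dom c" for q
    proof (rule coords_eqI)
      fix k assume "k \<in> {1..CARD('n)}"
      then show "generator X (w t) c q $ \<iota> k = B (coord c q) $ \<iota> k"
        by (cases rule: block_cases[where h = h and e = e]) (use True in \<open>simp_all only: comp[OF that] B1 B2 B3 B4\<close>)
    qed
    have ch: "is_chart M c" by (rule manifold_chart[OF man c(1)])
    then have o: "open (coord c ` chart_dom c)" by (simp add: is_chart_def)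
    have "(B has_derivative B) (at (coord c p))"
      by (rule bounded_linear.has_derivative[OF Bbl has_derivative_ident])
    then have "(in_coords c (generator X (w t) c) has_derivative B) (at (coord c p))"
      by (rule has_derivative_transform_within_open[OF _ o imageI[OF c(2)]])
        (auto simp: in_coords_coord[OF ch] gen)
    then have D: "frechet_derivative (in_coords c (generator X (w t) c)) (at (coord c p)) = B"
      by (rule frechet_derivative_at[symmetric])
    have rz: "real_zero (generator X (w t)) c p \<longleftrightarrow>
        (\<forall>\<alpha> \<beta> u. \<beta> \<noteq> 0 \<longrightarrow> B (B u) - (2 * \<alpha>) *\<^sub>R B u + (\<alpha>\<^sup>2 + \<beta>\<^sup>2) *\<^sub>R u = 0 \<longrightarrow> u = 0)"
      using zero True by (simp add: real_zero_def D Let_def)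
    show ?thesis
    proof
      assume R: "real_zero (generator X (w t)) c p"
      have "t (h + 2 * j) = 0" if j: "j \<in> {1..e}" for j
      proof (rule ccontr)
        assume nz: "t (h + 2 * j) \<noteq> 0"
        define a b where ab: "a = h + 2 * j - 1" "b = h + 2 * j"
        have in_n: "a \<in> {1..CARD('n)}" "b \<in> {1..CARD('n)}" using j corank_le by (auto simp: ab)
        \<comment> \<open>On the plane of the pair \<open>(a, b)\<close> the map \<open>B\<close>
          satisfies its characteristic equation with \<open>\<alpha> = t a\<close> and
          \<open>\<beta> = t b\<close>; so any nonzero vector of this plane refutes the
          realness.\<close>
        define u :: "real ^ 'n" where "u = axis (\<iota> a) 1"
        have u: "u $ \<iota> k = (if k = a then 1 else 0)" if "k \<in> {1..CARD('n)}" for k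
          using \<iota>_eq[OF that in_n(1)] by (simp add: u_def axis_def eq_commute[of "\<iota> a"])
        define z where "z = B (B u) - (2 * t a) *\<^sub>R B u + ((t a)\<^sup>2 + (t b)\<^sup>2) *\<^sub>R u"
        have z: "z $ \<iota> k = B (B u) $ \<iota> k - 2 * t a * B u $ \<iota> k + ((t a)\<^sup>2 + (t b)\<^sup>2) * u $ \<iota> k" for k
          by (simp add: z_def)
        have pair: "z $ \<iota> (h + 2 * i - 1) = 0 \<and> z $ \<iota> (h + 2 * i) = 0" if i: "i \<in> {1..e}" for i
        proof -
          define a' b' where ab': "a' = h + 2 * i - 1" "b' = h + 2 * i"
          note B' = B2[OF i, folded ab'(1), folded ab'(2)] B3[OF i, folded ab'(1), folded ab'(2)]
          have i': "a' \<in> {1..CARD('n)}" "b' \<in> {1..CARD('n)}" using i corank_le by (auto simp: ab')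
          have "a' = a \<longleftrightarrow> i = j" "b' \<noteq> a"
            using pair_index[of i j h] i j unfolding ab ab' by auto
          then have u': "u $ \<iota> a' = (if i = j then 1 else 0)" "u $ \<iota> b' = 0"
            using u[OF i'(1)] u[OF i'(2)] by auto
          have "i = j \<Longrightarrow> t a = t a' \<and> t b = t b'" by (simp add: ab ab')
          then have "z $ \<iota> a' = 0 \<and> z $ \<iota> b' = 0"
            by (cases "i = j") (simp_all add: z B' u' power2_eq_square algebra_simps)
          then show ?thesis unfolding ab' .
        qed
        have "z = 0"
        proof (rule coords_eqI)
          fix k assume k: "k \<in> {1..CARD('n)}"
          then show "z $ \<iota> k = 0 $ \<iota> k"
          proof (cases rule: block_cases[where h = h and e = e])
            case 1
            then have "k \<noteq> a" using j by (auto simp: ab)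
            then show ?thesis using B1[OF 1] u[OF k] by (simp add: z)
          next
            case (2 i)
            then show ?thesis using pair[OF 2(1)] by simp
          next
            case (3 i)
            then show ?thesis using pair[OF 3(1)] by simp
          next
            case 4
            then have "k \<noteq> a" using j by (auto simp: ab)
            then show ?thesis using B4[OF 4] u[OF k] by (simp add: z)
          qed
        qed
        then have "B (B u) - (2 * t a) *\<^sub>R B u + ((t a)\<^sup>2 + (t b)\<^sup>2) *\<^sub>R u = 0" by (simp only: z_def)
        moreover have "t b \<noteq> 0" using nz by (simp add: ab)
        ultimately have "u = 0" using R unfolding rz by blast
        with u[OF in_n(1)] show False by simp
      qed
      with True show "(\<forall>j\<in>{1..e}. t (h + 2 * j) = 0) \<and> (\<forall>k\<in>{h + 2 * e + 1..CARD('n)}. t k = 0)" by blast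
    next
      assume t: "(\<forall>j\<in>{1..e}. t (h + 2 * j) = 0) \<and> (\<forall>k\<in>{h + 2 * e + 1..CARD('n)}. t k = 0)"
      have diag: "\<exists>\<tau>. \<forall>y. B y $ \<iota> k = \<tau> * y $ \<iota> k" if "k \<in> {1..CARD('n)}" for k
        using that
      proof (cases rule: block_cases[where h = h and e = e])
        case 1 then show ?thesis using B1 by blast
      next
        case (2 j) then show ?thesis using B2[OF 2(1)] t by auto
      next
        case (3 j) then show ?thesis using B3[OF 3(1)] t by auto
      next
        case 4 then show ?thesis using B4[OF 4] by (auto intro!: exI[of _ 0])
      qed
      show "real_zero (generator X (w t)) c p"
        unfolding rz
      proof (intro allI impI)
        fix \<alpha> \<beta> :: real and u
        assume \<beta>: "\<beta> \<noteq> 0" and u: "B (B u) - (2 * \<alpha>) *\<^sub>R B u + (\<alpha>\<^sup>2 + \<beta>\<^sup>2) *\<^sub>R u = 0"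
        show "u = 0"
        proof (rule coords_eqI)
          fix k assume k: "k \<in> {1..CARD('n)}"
          obtain \<tau> where \<tau>: "\<And>y. B y $ \<iota> k = \<tau> * y $ \<iota> k" using diag[OF k] by blast
          \<comment> \<open>Without rotations \<open>B\<close> is diagonal; in each coordinate the
            quadratic condition is a sum of two squares times the component, and
            \<open>\<beta>\<close> is nonzero.\<close>
          have "((\<tau> - \<alpha>)\<^sup>2 + \<beta>\<^sup>2) * u $ \<iota> k = 0"
            using arg_cong[OF u, of "\<lambda>y. y $ \<iota> k"] by (simp add: \<tau> power2_eq_square algebra_simps)
          moreover have "(\<tau> - \<alpha>)\<^sup>2 + \<beta>\<^sup>2 \<noteq> 0" using \<beta> by (simp add: sum_power2_eq_zero_iff)
          ultimately show "u $ \<iota> k = 0 $ \<iota> k" unfolding zero_index by (metis mult_eq_0_iff)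
        qed
      qed
    qed
  qed
qed

text \<open>The coefficients of the \<open>h\<close> real fields and of the \<open>e\<close>
  dilations remain free, those of the rotations and of the constant fields must vanish.\<close>

lemma dim_real_zero: "dim {w. real_zero (generator X w) c p} = h + e"
proof -
  let ?O = "(\<lambda>j. h + 2 * j - 1) ` {1..e}"
  define I where "I = {1..h} \<union> ?O"
  have I: "I \<subseteq> {1..CARD('n)}" using corank_le by (auto simp: I_def)
  have notI: "k \<notin> I \<longleftrightarrow> (\<exists>j\<in>{1..e}. k = h + 2 * j) \<or> k \<in> {h + 2 * e + 1..CARD('n)}" if k: "k \<in> {1..CARD('n)}" for k
  proof
    assume "k \<notin> I"
    with k show "(\<exists>j\<in>{1..e}. k = h + 2 * j) \<or> k \<in> {h + 2 * e + 1..CARD('n)}"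
      by (cases rule: block_cases[where h = h and e = e]) (auto simp: I_def)
  next
    assume "(\<exists>j\<in>{1..e}. k = h + 2 * j) \<or> k \<in> {h + 2 * e + 1..CARD('n)}"
    then show "k \<notin> I" unfolding I_def by auto presburger+
  qed
  have real: "real_zero (generator X (\<Sum>k\<in>{1..CARD('n)}. t k *\<^sub>R v k)) c p \<longleftrightarrow> (\<forall>k\<in>{1..CARD('n)} - I. t k = 0)" for t
  proof -
    have "{1..CARD('n)} - I = {k \<in> {1..CARD('n)}. k \<notin> I}" by blast
    also have "\<dots> = {k \<in> {1..CARD('n)}. (\<exists>j\<in>{1..e}. k = h + 2 * j) \<or> k \<in> {h + 2 * e + 1..CARD('n)}}" using notI by blast
    also have "\<dots> = (\<lambda>j. h + 2 * j) ` {1..e} \<union> {h + 2 * e + 1..CARD('n)}" using corank_le by auto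
    finally have "{1..CARD('n)} - I = (\<lambda>j. h + 2 * j) ` {1..e} \<union> {h + 2 * e + 1..CARD('n)}" .
    then show ?thesis unfolding real_zero_iff by (simp only: ball_Un ball_simps)
  qed
  have inj: "inj_on v {1..CARD('n)}" and ind: "independent (v ` {1..CARD('n)})" and sp: "span (v ` {1..CARD('n)}) = UNIV"
    using basis by (auto simp: basis_of_Rn_def)
  have sums: "w \<in> span (v ` T) \<longleftrightarrow> (\<exists>t. w = (\<Sum>k\<in>T. t k *\<^sub>R v k))" if T: "T \<subseteq> {1..CARD('n)}" for w T
  proof
    have fin: "finite T" using T finite_subset by blast
    assume "w \<in> span (v ` T)"
    then obtain u where "w = (\<Sum>x\<in>v ` T. u x *\<^sub>R x)" using fin by (auto simp: span_finite)
    then show "\<exists>t. w = (\<Sum>k\<in>T. t k *\<^sub>R v k)"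
      by (auto simp: sum.reindex[OF inj_on_subset[OF inj T]])
  qed (clarify, intro span_sum span_scale span_base imageI)
  have "{w. real_zero (generator X w) c p} = span (v ` I)"
  proof (intro set_eqI iffI)
    fix w assume w: "w \<in> {w. real_zero (generator X w) c p}"
    obtain t where t: "w = (\<Sum>k\<in>{1..CARD('n)}. t k *\<^sub>R v k)" using sums[of "{1..CARD('n)}" w] sp by auto
    have "\<forall>k\<in>{1..CARD('n)} - I. t k = 0" using w real unfolding t by blast
    then have "w = (\<Sum>k\<in>I. t k *\<^sub>R v k)"
      unfolding t by (intro sum.mono_neutral_right) (use I in auto)
    then show "w \<in> span (v ` I)" using sums[OF I] by blast
  next
    fix w assume "w \<in> span (v ` I)"
    then obtain t where t: "w = (\<Sum>k\<in>I. t k *\<^sub>R v k)" using sums[OF I] by blast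
    have "w = (\<Sum>k\<in>{1..CARD('n)}. (if k \<in> I then t k else 0) *\<^sub>R v k)"
      unfolding t by (rule sum.mono_neutral_cong_left) (use I in auto)
    then show "w \<in> {w. real_zero (generator X w) c p}" using real[of "\<lambda>k. if k \<in> I then t k else 0"] by simp
  qed
  moreover have "independent (v ` I)" using ind I independent_mono by (metis image_mono)
  then have "dim (span (v ` I)) = card I"
    by (simp add: dim_span dim_eq_card_independent card_image[OF inj_on_subset[OF inj I]])
  moreover have "card I = h + e"
  proof -
    have "{1..h} \<inter> ?O = {}" by auto
    moreover have "inj_on (\<lambda>j. h + 2 * j - 1) {1..e}" by (rule inj_onI) auto
    ultimately show ?thesis by (simp add: I_def card_Un_disjoint card_image)
  qed
  ultimately show ?thesis by simp
qed

end

theorem theorem6p2: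
  fixes M :: "'p topology"
    and A :: "('p, 'n::finite) chart set"
    and X :: "'n \<Rightarrow> ('p, 'n) vfield"
    and \<iota> :: "nat \<Rightarrow> 'n"
    and p :: 'p
    and m :: nat
  assumes "smooth_manifold M A"
    and "integrable_system A X"
    and "nondegenerate_singular_point TYPE('m::finite) M A X p"
    and "m = CARD('n) - rank_at A X p"
    and "bij_betw \<iota> {1..CARD('n)} UNIV"
  shows "\<exists>h e. h + 2 * e = m \<and>
           (\<exists>c\<in>A. p \<in> chart_dom c \<and> (\<exists>v. basis_of_Rn v \<and> normal_form \<iota> X c v h e)) \<and>
           (\<forall>h' e'. h' + 2 * e' = m \<and>
              (\<exists>c\<in>A. p \<in> chart_dom c \<and> (\<exists>v. basis_of_Rn v \<and> normal_form \<iota> X c v h' e')) \<longrightarrow>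
              h' = h \<and> e' = e)"
proof -
  note man = assms(1) and sys = assms(2) and \<iota> = assms(5)
  have field: "smooth_vector_field A (X i)" for i using sys by (simp add: integrable_system_def)
  obtain K and \<sigma> :: "'m \<Rightarrow> 'n" and V and \<pi> :: "'p \<Rightarrow> real ^ 'm" and Z where
    K: "card K = rank_at A X p" and \<sigma>: "bij_betw \<sigma> UNIV (- K)" and V: "p \<in> V" "local_quotient M A X K V \<pi>"
    and Z: "\<And>a. projects_to A V \<pi> (X (\<sigma> a)) (Z a)" "nondegenerate_fixed_point Z (\<pi> p)"
    and p: "p \<in> topspace M"
    using assms(3) unfolding nondegenerate_singular_point_def singular_point_def by blast
  interpret local_system K \<sigma> M A X p by standard (rule \<sigma> man sys)+
  have m: "CARD('m) = m" using card_split K assms(4) by simp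
  obtain c r L x0 where c: "centered c r" "\<And>a b. L a ** L b = L b ** L a"
    "\<And>a. diagonalizable_over_C (L a)" "wedge (\<lambda>a. L a *v x0) \<noteq> 0"
    "\<And>x j. x \<in> ball 0 r \<Longrightarrow> j \<in> K \<Longrightarrow> R c j x = axis j 1"
    "\<And>x a. x \<in> ball 0 r \<Longrightarrow> R c (\<sigma> a) x = \<eta> (L a *v \<rho> x) + Q (R c (\<sigma> a) 0)"
    using linear_chart[OF p V Z] by metis
  obtain h e d v where he: "h + 2 * e = m" and d: "d \<in> A" "p \<in> chart_dom d" "basis_of_Rn v" "normal_form \<iota> X d v h e"
    using normal_form_exists[OF c \<iota>] m by metis
  have "h' = h \<and> e' = e" if he': "h' + 2 * e' = m"
    and d': "d' \<in> A" "p \<in> chart_dom d'" "basis_of_Rn v'" "normal_form \<iota> X d' v' h' e'" for h' e' d' v'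
  proof -
    interpret N: normal_form_chart M A X \<iota> d p v h e
      by standard (use man field \<iota> d he assms(4) in simp_all)
    interpret N': normal_form_chart M A X \<iota> d' p v' h' e'
      by standard (use man field \<iota> d' he' assms(4) in simp_all)
    \<comment> \<open>Whether a generator is a real zero does not refer to a normal form, so both
      charts compute the dimension of one and the same subspace.\<close>
    have "real_zero (generator X w) d p \<longleftrightarrow> real_zero (generator X w) d' p" for w
      using real_zero_chart_change[OF man smooth_vector_field_generator[OF man, of X, OF field]] d d' by blast
    then have "h + e = h' + e'" using N.dim_real_zero N'.dim_real_zero by simp
    with he he' show ?thesis by simp
  qed
  with he d show ?thesis by blast
qed

end
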